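(* Let $X$ be a surface with punctures, with a free action of a finite group $G$, such that $X/G$ is a sphere with (at least one) punctures. Then for each fixed $a\ge0$, the function $$i\mapsto\dim H^i(\mathrm{Conf}^G_n(X);\mathbb{Q})^{W_{n-a}}$$ is bounded by a polynomial in $i$ and uniformly bounded in $n$; that is, there is a polynomial $p_a$ such that $\dim H^i(\mathrm{Conf}^G_n(X);\mathbb{Q})^{W_{n-a}}\le p_a(i)$ for all $i\ge0$ and all $n\ge a$.
   Context: Here $X=\mathcal S-\{p_1,\dots,p_b\}$ is a closed surface $\mathcal S$ with finitely many points removed, and $X/G\cong S^2-\{q_0,\dots,q_c\}$ with $c\ge0$. $\mathrm{Conf}^G_n(X)=\{(x_1,\dots,x_n)\in X^n: x_i\ne gx_j\text{ for all }i\ne j,\ g\in G\}$, with the action of $W_n=G^n\rtimes S_n$ ($G^n$ coordinatewise, $S_n$ permuting coordinates). For $a\le n$, $W_{n-a}=G^{n-a}\rtimes S_{n-a}\subset W_n$ is the subgroup acting on $n-a$ of the coordinates and fixing the other $a$ coordinates; the superscript denotes invariants. *)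

theory Defs
  imports
    "HOL-Analysis.Abstract_Topological_Spaces"
    "HOL-Homology.Homology"
    "HOL-Algebra.Group_Action"
    "HOL-Algebra.Sym_Groups"
    "HOL-Algebra.Product_Groups"
    "HOL-Computational_Algebra.Polynomial"
    "Jordan_Normal_Form.VS_Connect"
begin

section \<open>Surfaces and orbit spaces\<close>

text \<open>A compact two-dimensional topological manifold without boundary. Connectedness is not
  part of the definition.\<close>

definition closed_surface :: "'a topology \<Rightarrow> bool" where
  "closed_surface S \<longleftrightarrow> compact_space S \<and> Hausdorff_space S \<and> second_countable S \<and>
     (\<forall>x\<in>topspace S. \<exists>U. openin S U \<and> x \<in> U \<and>
        subtopology S U homeomorphic_space Euclidean_space 2)"

definition free_topological_action ::
    "('g, 'm) monoid_scheme \<Rightarrow> 'a topology \<Rightarrow> ('g \<Rightarrow> 'a \<Rightarrow> 'a) \<Rightarrow> bool" where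
  "free_topological_action G X \<phi> \<longleftrightarrow> group_action G (topspace X) \<phi> \<and>
     (\<forall>g\<in>carrier G. continuous_map X X (\<phi> g)) \<and>
     (\<forall>x\<in>topspace X. stabilizer G \<phi> x = {\<one>\<^bsub>G\<^esub>})"

definition orbit_space ::
    "('g, 'm) monoid_scheme \<Rightarrow> 'a topology \<Rightarrow> ('g \<Rightarrow> 'a \<Rightarrow> 'a) \<Rightarrow> 'a set topology" where
  "orbit_space G X \<phi> = topology (\<lambda>U. U \<subseteq> orbits G (topspace X) \<phi> \<and>
     openin X {x \<in> topspace X. orbit G \<phi> x \<in> U})"

lemma openin_orbit_space:
  "openin (orbit_space G X \<phi>) U \<longleftrightarrow>
     U \<subseteq> orbits G (topspace X) \<phi> \<and> openin X {x \<in> topspace X. orbit G \<phi> x \<in> U}"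
proof -
  let ?op = "\<lambda>U. U \<subseteq> orbits G (topspace X) \<phi> \<and> openin X {x \<in> topspace X. orbit G \<phi> x \<in> U}"
  have "?op (U \<inter> V)" if "?op U" "?op V" for U V
  proof -
    have "{x \<in> topspace X. orbit G \<phi> x \<in> U \<inter> V} =
        {x \<in> topspace X. orbit G \<phi> x \<in> U} \<inter> {x \<in> topspace X. orbit G \<phi> x \<in> V}"
      by auto
    with that show ?thesis by auto
  qed
  moreover have "?op (\<Union>\<K>)" if "\<forall>K\<in>\<K>. ?op K" for \<K>
  proof -
    have "{x \<in> topspace X. orbit G \<phi> x \<in> \<Union>\<K>} = (\<Union>K\<in>\<K>. {x \<in> topspace X. orbit G \<phi> x \<in> K})"
      by auto
    moreover have "openin X (\<Union>K\<in>\<K>. {x \<in> topspace X. orbit G \<phi> x \<in> K})"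
      using that by blast
    ultimately have "openin X {x \<in> topspace X. orbit G \<phi> x \<in> \<Union>\<K>}" by simp
    with that show ?thesis by blast
  qed
  ultimately have "istopology ?op"
    unfolding istopology_def by blast
  then show ?thesis
    unfolding orbit_space_def by (simp add: topology_inverse')
qed

lemma topspace_orbit_space: "topspace (orbit_space G X \<phi>) = orbits G (topspace X) \<phi>"
proof
  show "topspace (orbit_space G X \<phi>) \<subseteq> orbits G (topspace X) \<phi>"
    using openin_orbit_space[of G X \<phi> "topspace (orbit_space G X \<phi>)"] by auto
  have "{x \<in> topspace X. orbit G \<phi> x \<in> orbits G (topspace X) \<phi>} = topspace X"
    by (auto simp: orbits_def)
  then have "openin (orbit_space G X \<phi>) (orbits G (topspace X) \<phi>)"
    by (simp add: openin_orbit_space)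
  then show "orbits G (topspace X) \<phi> \<subseteq> topspace (orbit_space G X \<phi>)"
    by (rule openin_subset)
qed

lemma quotient_map_orbit_space: "quotient_map X (orbit_space G X \<phi>) (orbit G \<phi>)"
  by (auto simp: quotient_map_def topspace_orbit_space openin_orbit_space orbits_def)


section \<open>Orbit configuration spaces\<close>

text \<open>Coordinates are indexed by \<open>{1..n}\<close>, and tuples are extensional functions, as in the
  library's product topology.\<close>

definition orbit_conf ::
    "('g, 'm) monoid_scheme \<Rightarrow> 'a topology \<Rightarrow> ('g \<Rightarrow> 'a \<Rightarrow> 'a) \<Rightarrow> nat \<Rightarrow> (nat \<Rightarrow> 'a) topology" where
  "orbit_conf G X \<phi> n = subtopology (product_topology (\<lambda>_. X) {1..n})
     {x. \<forall>i\<in>{1..n}. \<forall>j\<in>{1..n}. i \<noteq> j \<longrightarrow> (\<forall>g\<in>carrier G. x i \<noteq> \<phi> g (x j))}"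

text \<open>The group \<open>W\<^sub>n = G\<^sup>n \<rtimes> S\<^sub>n\<close>, where \<open>\<sigma>\<close> moves the \<open>i\<close>-th coordinate to
  position \<open>\<sigma> i\<close>.\<close>

definition wreath_group :: "('g, 'm) monoid_scheme \<Rightarrow> nat \<Rightarrow> ((nat \<Rightarrow> 'g) \<times> (nat \<Rightarrow> nat)) monoid" where
  "wreath_group G n =
     \<lparr>carrier = carrier (product_group {1..n} (\<lambda>_. G)) \<times> carrier (sym_group n),
      monoid.mult = (\<lambda>(g, \<sigma>) (h, \<tau>).
        (\<lambda>i\<in>{1..n}. g i \<otimes>\<^bsub>G\<^esub> h (Hilbert_Choice.inv \<sigma> i), \<sigma> \<circ> \<tau>)),
      one = (\<lambda>i\<in>{1..n}. \<one>\<^bsub>G\<^esub>, id)\<rparr>"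

definition wreath_action ::
    "('g \<Rightarrow> 'a \<Rightarrow> 'a) \<Rightarrow> nat \<Rightarrow> (nat \<Rightarrow> 'g) \<times> (nat \<Rightarrow> nat) \<Rightarrow> (nat \<Rightarrow> 'a) \<Rightarrow> nat \<Rightarrow> 'a" where
  "wreath_action \<phi> n = (\<lambda>(g, \<sigma>) x. \<lambda>i\<in>{1..n}. \<phi> (g i) (x (Hilbert_Choice.inv \<sigma> i)))"

text \<open>The subgroup \<open>W\<^bsub>n-a\<^esub>\<close> of \<open>W\<^sub>n\<close>, acting on the last \<open>n - a\<close> coordinates and fixing the
  first \<open>a\<close> ones.\<close>

definition wreath_subgroup ::
    "('g, 'm) monoid_scheme \<Rightarrow> nat \<Rightarrow> nat \<Rightarrow> ((nat \<Rightarrow> 'g) \<times> (nat \<Rightarrow> nat)) set" where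
  "wreath_subgroup G n a = {(g, \<sigma>) \<in> carrier (wreath_group G n).
     \<forall>i\<in>{1..n}. i \<le> a \<longrightarrow> g i = \<one>\<^bsub>G\<^esub> \<and> \<sigma> i = i}"


lemma sym_group_inv:
  assumes "\<sigma> \<in> carrier (sym_group n)"
  shows "Hilbert_Choice.inv \<sigma> i \<in> {1..n} \<longleftrightarrow> i \<in> {1..n}"
    "\<sigma> i \<in> {1..n} \<longleftrightarrow> i \<in> {1..n}" "Hilbert_Choice.inv \<sigma> (\<sigma> i) = i" "\<sigma> (Hilbert_Choice.inv \<sigma> i) = i"
proof -
  have p: "\<sigma> permutes {1..n}" using assms by (simp add: sym_group_def)
  show "\<sigma> i \<in> {1..n} \<longleftrightarrow> i \<in> {1..n}" using p by (rule permutes_in_image)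
  show "Hilbert_Choice.inv \<sigma> i \<in> {1..n} \<longleftrightarrow> i \<in> {1..n}"
    using permutes_inv[OF p] by (rule permutes_in_image)
  show "Hilbert_Choice.inv \<sigma> (\<sigma> i) = i" "\<sigma> (Hilbert_Choice.inv \<sigma> i) = i"
    using permutes_inverses[OF p] by auto
qed

lemma sym_group_comp_inv:
  assumes "\<sigma> \<in> carrier (sym_group n)" "\<tau> \<in> carrier (sym_group n)"
  shows "\<sigma> \<circ> \<tau> \<in> carrier (sym_group n)" "Hilbert_Choice.inv (\<sigma> \<circ> \<tau>) i = Hilbert_Choice.inv \<tau> (Hilbert_Choice.inv \<sigma> i)"
   "Hilbert_Choice.inv \<sigma> \<in> carrier (sym_group n)" "id \<in> carrier (sym_group n)" "Hilbert_Choice.inv (Hilbert_Choice.inv \<sigma>) = \<sigma>"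
proof -
  have p: "\<sigma> permutes {1..n}" "\<tau> permutes {1..n}" using assms by (simp_all add: sym_group_def)
  show "\<sigma> \<circ> \<tau> \<in> carrier (sym_group n)" "Hilbert_Choice.inv \<sigma> \<in> carrier (sym_group n)" "id \<in> carrier (sym_group n)"
    unfolding sym_group_def using permutes_compose[OF p(2,1)] permutes_inv[OF p(1)] permutes_id by simp_all
  show "Hilbert_Choice.inv (Hilbert_Choice.inv \<sigma>) = \<sigma>" using p(1) by (rule permutes_inv_inv)
  show "Hilbert_Choice.inv (\<sigma> \<circ> \<tau>) i = Hilbert_Choice.inv \<tau> (Hilbert_Choice.inv \<sigma> i)"
    unfolding o_inv_distrib[OF permutes_bij[OF p(1)] permutes_bij[OF p(2)]] by (rule comp_apply)
qed

lemma wreath_group_group: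
  assumes "group G" shows "group (wreath_group G n)"
proof -
  interpret G: group G by fact
  show ?thesis
  proof (rule groupI)
    fix x assume "x \<in> carrier (wreath_group G n)"
    then obtain g \<sigma> where x: "x = (g,\<sigma>)" "g \<in> {1..n} \<rightarrow>\<^sub>E carrier G" "\<sigma> \<in> carrier (sym_group n)"
      by (auto simp: wreath_group_def)
    show "\<exists>y\<in>carrier (wreath_group G n). y \<otimes>\<^bsub>wreath_group G n\<^esub> x = \<one>\<^bsub>wreath_group G n\<^esub>"
    proof (rule bexI)
      show "(\<lambda>i\<in>{1..n}. inv\<^bsub>G\<^esub> (g (\<sigma> i)), Hilbert_Choice.inv \<sigma>) \<otimes>\<^bsub>wreath_group G n\<^esub> x = \<one>\<^bsub>wreath_group G n\<^esub>"
        using x sym_group_inv(2)[OF x(3)] sym_group_comp_inv[OF x(3) x(3)] sym_group_inv(3)[OF x(3)]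
        by (auto simp: wreath_group_def fun_eq_iff PiE_iff  intro!: G.l_inv)
      show "(\<lambda>i\<in>{1..n}. inv\<^bsub>G\<^esub> (g (\<sigma> i)), Hilbert_Choice.inv \<sigma>) \<in> carrier (wreath_group G n)"
        using x sym_group_inv(2)[OF x(3)] sym_group_comp_inv[OF x(3) x(3)]
        by (auto simp: wreath_group_def PiE_iff)
    qed
  next
    fix x y z assume "x \<in> carrier (wreath_group G n)" "y \<in> carrier (wreath_group G n)" "z \<in> carrier (wreath_group G n)"
    then obtain g \<sigma> h \<tau> k \<upsilon> where x: "x = (g,\<sigma>)" "g \<in> {1..n} \<rightarrow>\<^sub>E carrier G" "\<sigma> \<in> carrier (sym_group n)"
       "y = (h,\<tau>)" "h \<in> {1..n} \<rightarrow>\<^sub>E carrier G" "\<tau> \<in> carrier (sym_group n)"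
       "z = (k,\<upsilon>)" "k \<in> {1..n} \<rightarrow>\<^sub>E carrier G" "\<upsilon> \<in> carrier (sym_group n)"
      by (auto simp: wreath_group_def)
    show "x \<otimes>\<^bsub>wreath_group G n\<^esub> y \<otimes>\<^bsub>wreath_group G n\<^esub> z =
       x \<otimes>\<^bsub>wreath_group G n\<^esub> (y \<otimes>\<^bsub>wreath_group G n\<^esub> z)"
      using x sym_group_inv(1)[OF x(3)] sym_group_inv(1)[OF x(6)] sym_group_comp_inv[OF x(3,6)] sym_group_comp_inv[OF x(6,9)]
      by (auto simp: wreath_group_def fun_eq_iff PiE_iff intro!: G.m_assoc simp del: atLeastAtMost_iff)
  next
    fix x y assume "x \<in> carrier (wreath_group G n)" "y \<in> carrier (wreath_group G n)"
    then obtain g \<sigma> h \<tau> where x: "x = (g,\<sigma>)" "g \<in> {1..n} \<rightarrow>\<^sub>E carrier G" "\<sigma> \<in> carrier (sym_group n)"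
       "y = (h,\<tau>)" "h \<in> {1..n} \<rightarrow>\<^sub>E carrier G" "\<tau> \<in> carrier (sym_group n)"
      by (auto simp: wreath_group_def)
    then show "x \<otimes>\<^bsub>wreath_group G n\<^esub> y \<in> carrier (wreath_group G n)"
      using sym_group_inv(1)[OF x(3)] sym_group_comp_inv[OF x(3,6)]
      by (auto simp: wreath_group_def PiE_iff)
  next
    fix x assume "x \<in> carrier (wreath_group G n)"
    then show "\<one>\<^bsub>wreath_group G n\<^esub> \<otimes>\<^bsub>wreath_group G n\<^esub> x = x"
      by (auto simp: wreath_group_def fun_eq_iff PiE_iff extensional_def)
  next
    show "\<one>\<^bsub>wreath_group G n\<^esub> \<in> carrier (wreath_group G n)"
      by (auto simp: wreath_group_def sym_group_def permutes_id)
  qed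
qed

lemma wreath_action_conf:
  assumes act: "free_topological_action G X \<phi>" and w: "w \<in> carrier (wreath_group G n)"
  shows "continuous_map (orbit_conf G X \<phi> n) (orbit_conf G X \<phi> n) (wreath_action \<phi> n w)"
proof -
  interpret A: group_action G "topspace X" \<phi> using act by (simp add: free_topological_action_def)
  interpret G: group G using A.group_hom by (simp add: group_hom_def)
  from w obtain g \<sigma> where x: "w = (g,\<sigma>)" "g \<in> {1..n} \<rightarrow>\<^sub>E carrier G" "\<sigma> \<in> carrier (sym_group n)"
      by (auto simp: wreath_group_def)
  note s = sym_group_inv(1)[OF x(3)]
  have gi: "g i \<in> carrier G" if "i \<in> {1..n}" for i using that x by auto
  have c: "continuous_map X X (\<phi> (g i))" if "i \<in> {1..n}" for i
    using act gi[OF that] by (simp add: free_topological_action_def)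
  have "continuous_map (product_topology (\<lambda>_. X) {1..n}) (product_topology (\<lambda>_. X) {1..n}) (wreath_action \<phi> n w)"
    unfolding continuous_map_componentwise
  proof (intro conjI ballI)
    fix k assume k: "k \<in> {1..n}"
    have "continuous_map (product_topology (\<lambda>_. X) {1..n}) X (\<phi> (g k) \<circ> (\<lambda>x. x (Hilbert_Choice.inv \<sigma> k)))"
      using k s c by (intro continuous_map_compose[OF continuous_map_product_projection[of _ _ "\<lambda>_. X"]]) auto
    then show "continuous_map (product_topology (\<lambda>_. X) {1..n}) X (\<lambda>x. wreath_action \<phi> n w x k)"
      using k by (simp add: wreath_action_def x comp_def)
  qed (auto simp: wreath_action_def x)
  moreover have "wreath_action \<phi> n w x i \<noteq> \<phi> k (wreath_action \<phi> n w x j)"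
    if xx: "x \<in> topspace (product_topology (\<lambda>_. X) {1..n})"
      "\<forall>i\<in>{1..n}. \<forall>j\<in>{1..n}. i \<noteq> j \<longrightarrow> (\<forall>g\<in>carrier G. x i \<noteq> \<phi> g (x j))"
      "i \<in> {1..n}" "j \<in> {1..n}" "i \<noteq> j" "k \<in> carrier G" for x i j k
  proof
    let ?i = "Hilbert_Choice.inv \<sigma> i" let ?j = "Hilbert_Choice.inv \<sigma> j"
    assume "wreath_action \<phi> n w x i = \<phi> k (wreath_action \<phi> n w x j)"
    then have e: "\<phi> (g i) (x ?i) = \<phi> k (\<phi> (g j) (x ?j))"
      using that by (simp add: wreath_action_def x)
    have ij: "?i \<in> {1..n}" "?j \<in> {1..n}" using s that by auto
    have X: "x ?i \<in> topspace X" "x ?j \<in> topspace X" using that ij by (auto simp: PiE_iff)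
    have "\<phi> (g i) (x ?i) = \<phi> (k \<otimes>\<^bsub>G\<^esub> g j) (x ?j)"
      using e X gi that by (simp add: A.composition_rule)
    then have "x ?i = \<phi> (inv\<^bsub>G\<^esub> (g i) \<otimes>\<^bsub>G\<^esub> (k \<otimes>\<^bsub>G\<^esub> g j)) (x ?j)"
      using A.orbit_sym_aux[OF gi[OF that(3)] X(1), of "\<phi> (k \<otimes>\<^bsub>G\<^esub> g j) (x ?j)"]
        A.composition_rule[OF X(2), of "inv\<^bsub>G\<^esub> (g i)" "k \<otimes>\<^bsub>G\<^esub> g j"] gi[OF that(3)] gi[OF that(4)] that(6)
      by simp
    moreover have "?i \<noteq> ?j" using that(5) sym_group_inv(4)[OF x(3)] by metis
    ultimately show False using xx(2) ij gi[OF that(3)] gi[OF that(4)] that(6) by blast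
  qed
  ultimately show ?thesis
    unfolding orbit_conf_def
    by (auto simp: continuous_map_in_subtopology continuous_map_from_subtopology)
qed

lemma wreath_action_mult:
  assumes act: "free_topological_action G X \<phi>" and w: "v \<in> carrier (wreath_group G n)" "w \<in> carrier (wreath_group G n)"
   and x: "x \<in> topspace (orbit_conf G X \<phi> n)"
  shows "wreath_action \<phi> n (v \<otimes>\<^bsub>wreath_group G n\<^esub> w) x = wreath_action \<phi> n v (wreath_action \<phi> n w x)"
    "wreath_action \<phi> n \<one>\<^bsub>wreath_group G n\<^esub> x = x"
proof -
  interpret A: group_action G "topspace X" \<phi> using act by (simp add: free_topological_action_def)
  interpret G: group G using A.group_hom by (simp add: group_hom_def)
  from w obtain g \<sigma> h \<tau> where v: "v = (g,\<sigma>)" "g \<in> {1..n} \<rightarrow>\<^sub>E carrier G" "\<sigma> \<in> carrier (sym_group n)"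
     "w = (h,\<tau>)" "h \<in> {1..n} \<rightarrow>\<^sub>E carrier G" "\<tau> \<in> carrier (sym_group n)"
    by (auto simp: wreath_group_def)
  have "x \<in> topspace (product_topology (\<lambda>_. X) {1..n})"
    using x unfolding orbit_conf_def topspace_subtopology by blast
  then have X: "x \<in> {1..n} \<rightarrow>\<^sub>E topspace X" by simp
  show "wreath_action \<phi> n (v \<otimes>\<^bsub>wreath_group G n\<^esub> w) x = wreath_action \<phi> n v (wreath_action \<phi> n w x)"
  proof
    fix i
    show "wreath_action \<phi> n (v \<otimes>\<^bsub>wreath_group G n\<^esub> w) x i = wreath_action \<phi> n v (wreath_action \<phi> n w x) i"
    proof (cases "i \<in> {1..n}")
      case True
      let ?i = "Hilbert_Choice.inv \<sigma> i"
      have i: "?i \<in> {1..n}" using sym_group_inv(1)[OF v(3)] True by blast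
      have j: "Hilbert_Choice.inv \<tau> ?i \<in> {1..n}" using sym_group_inv(1)[OF v(6)] i by blast
      have "x (Hilbert_Choice.inv \<tau> ?i) \<in> topspace X" by (rule PiE_mem[OF X j])
      moreover have "g i \<in> carrier G" by (rule PiE_mem[OF v(2) True])
      moreover have "h ?i \<in> carrier G" by (rule PiE_mem[OF v(5) i])
      ultimately have "\<phi> (g i \<otimes>\<^bsub>G\<^esub> h ?i) (x (Hilbert_Choice.inv \<tau> ?i)) = \<phi> (g i) (\<phi> (h ?i) (x (Hilbert_Choice.inv \<tau> ?i)))"
        by (rule A.composition_rule)
      then show ?thesis using True i
        by (simp add: v(1,4) wreath_action_def wreath_group_def sym_group_comp_inv(2)[OF v(3,6)] del: atLeastAtMost_iff)
    qed (simp add: v(1,4) wreath_action_def wreath_group_def del: atLeastAtMost_iff)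
  qed
  show "wreath_action \<phi> n \<one>\<^bsub>wreath_group G n\<^esub> x = x"
  proof
    fix i
    show "wreath_action \<phi> n \<one>\<^bsub>wreath_group G n\<^esub> x i = x i"
    proof (cases "i \<in> {1..n}")
      case True
      have "\<phi> \<one>\<^bsub>G\<^esub> (x i) = x i"
        using PiE_mem[OF X True] fun_cong[OF A.id_eq_one, of "x i"] by simp
      then show ?thesis using True by (simp add: wreath_action_def wreath_group_def del: atLeastAtMost_iff)
    next
      case False
      then show ?thesis using PiE_arb[OF X False]
        by (simp add: wreath_action_def wreath_group_def del: atLeastAtMost_iff)
    qed
  qed
qed

lemma wreath_subgroup_subgroup:
  assumes "group G"
  shows "subgroup (wreath_subgroup G n a) (wreath_group G n)"
proof -
  interpret G: group G by fact
  interpret W: group "wreath_group G n" by (rule wreath_group_group[OF assms])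
  have car: "g \<in> {1..n} \<rightarrow>\<^sub>E carrier G" "\<sigma> \<in> carrier (sym_group n)"
    if "(g, \<sigma>) \<in> carrier (wreath_group G n)" for g \<sigma>
    using that unfolding wreath_group_def by simp_all
  have inv_fix: "Hilbert_Choice.inv \<sigma> i = i" if "\<sigma> \<in> carrier (sym_group n)" "\<sigma> i = i" for \<sigma> i
    using sym_group_inv(3)[OF that(1), of i] that(2) by simp
  have mult: "(g, \<sigma>) \<otimes>\<^bsub>wreath_group G n\<^esub> (h, \<tau>) =
      (\<lambda>i\<in>{1..n}. g i \<otimes>\<^bsub>G\<^esub> h (Hilbert_Choice.inv \<sigma> i), \<sigma> \<circ> \<tau>)" for g \<sigma> h \<tau>
    by (simp add: wreath_group_def)
  show ?thesis
  proof (rule W.subgroupI)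
    show "wreath_subgroup G n a \<subseteq> carrier (wreath_group G n)"
      unfolding wreath_subgroup_def by blast
    have "\<one>\<^bsub>wreath_group G n\<^esub> = (\<lambda>i\<in>{1..n}. \<one>\<^bsub>G\<^esub>, id)" by (simp add: wreath_group_def)
    then have "\<one>\<^bsub>wreath_group G n\<^esub> \<in> wreath_subgroup G n a"
      using W.one_closed unfolding wreath_subgroup_def by simp
    then show "wreath_subgroup G n a \<noteq> {}" by blast
  next
    fix x y assume xy: "x \<in> wreath_subgroup G n a" "y \<in> wreath_subgroup G n a"
    obtain g \<sigma> h \<tau> where eq: "x = (g, \<sigma>)" "y = (h, \<tau>)" by (cases x, cases y)
    have c: "(g, \<sigma>) \<in> carrier (wreath_group G n)" "(h, \<tau>) \<in> carrier (wreath_group G n)"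
      and f: "\<And>i. i \<in> {1..n} \<Longrightarrow> i \<le> a \<Longrightarrow> g i = \<one>\<^bsub>G\<^esub>" "\<And>i. i \<in> {1..n} \<Longrightarrow> i \<le> a \<Longrightarrow> \<sigma> i = i"
        "\<And>i. i \<in> {1..n} \<Longrightarrow> i \<le> a \<Longrightarrow> h i = \<one>\<^bsub>G\<^esub>" "\<And>i. i \<in> {1..n} \<Longrightarrow> i \<le> a \<Longrightarrow> \<tau> i = i"
      using xy unfolding eq wreath_subgroup_def by blast+
    have "g i \<otimes>\<^bsub>G\<^esub> h (Hilbert_Choice.inv \<sigma> i) = \<one>\<^bsub>G\<^esub> \<and> (\<sigma> \<circ> \<tau>) i = i"
      if "i \<in> {1..n}" "i \<le> a" for i
      using f(1)[OF that] f(2)[OF that] f(3)[OF that] f(4)[OF that] inv_fix[OF car(2)[OF c(1)] f(2)[OF that]]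
      by simp
    then show "x \<otimes>\<^bsub>wreath_group G n\<^esub> y \<in> wreath_subgroup G n a"
      using W.m_closed[OF c] unfolding eq mult wreath_subgroup_def by simp
  next
    fix x assume x: "x \<in> wreath_subgroup G n a"
    obtain g \<sigma> where eq: "x = (g, \<sigma>)" by (cases x)
    have c: "(g, \<sigma>) \<in> carrier (wreath_group G n)"
      and f: "\<And>i. i \<in> {1..n} \<Longrightarrow> i \<le> a \<Longrightarrow> g i = \<one>\<^bsub>G\<^esub>" "\<And>i. i \<in> {1..n} \<Longrightarrow> i \<le> a \<Longrightarrow> \<sigma> i = i"
      using x unfolding eq wreath_subgroup_def by blast+
    obtain h \<tau> where y: "inv\<^bsub>wreath_group G n\<^esub> x = (h, \<tau>)" by (cases "inv\<^bsub>wreath_group G n\<^esub> x")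
    have d: "(h, \<tau>) \<in> carrier (wreath_group G n)"
      using W.inv_closed[OF c] y eq by simp
    have "(h, \<tau>) \<otimes>\<^bsub>wreath_group G n\<^esub> (g, \<sigma>) = (\<lambda>i\<in>{1..n}. \<one>\<^bsub>G\<^esub>, id)"
      using W.l_inv[OF c] y eq by (simp add: wreath_group_def)
    then have e: "(\<lambda>i\<in>{1..n}. h i \<otimes>\<^bsub>G\<^esub> g (Hilbert_Choice.inv \<tau> i)) = (\<lambda>i\<in>{1..n}. \<one>\<^bsub>G\<^esub>)" "\<tau> \<circ> \<sigma> = id"
      unfolding mult by simp_all
    have "h i = \<one>\<^bsub>G\<^esub> \<and> \<tau> i = i" if i: "i \<in> {1..n}" "i \<le> a" for i
    proof
      show t: "\<tau> i = i" using fun_cong[OF e(2), of i] f(2)[OF i] by simp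
      have "h i \<in> carrier G" using car(1)[OF d] i by blast
      then show "h i = \<one>\<^bsub>G\<^esub>"
        using fun_cong[OF e(1), of i] i inv_fix[OF car(2)[OF d] t] f(1)[OF i] by simp
    qed
    then show "inv\<^bsub>wreath_group G n\<^esub> x \<in> wreath_subgroup G n a"
      using d unfolding y wreath_subgroup_def by simp
  qed
qed


section \<open>Singular cohomology with rational coefficients\<close>

abbreviation rat_field :: "rat ring" where
  "rat_field \<equiv> class_ring"

text \<open>Cochains are the homomorphisms from the integral singular chain group to the additive
  group of the rationals; extensionality makes equality of cochains equality of functions.\<close>

definition cochains :: "nat \<Rightarrow> 'a topology \<Rightarrow> ('a chain \<Rightarrow> rat) set" where
  "cochains p X = hom (chain_group p X) (add_monoid rat_field) \<inter> extensional (singular_chain_set p X)"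

definition cochain_module :: "nat \<Rightarrow> 'a topology \<Rightarrow> (rat, 'a chain \<Rightarrow> rat) module" where
  "cochain_module p X =
     \<lparr>carrier = cochains p X, monoid.mult = undefined, one = undefined,
      zero = (\<lambda>c\<in>singular_chain_set p X. 0),
      add = (\<lambda>u v. \<lambda>c\<in>singular_chain_set p X. u c + v c),
      smult = (\<lambda>r u. \<lambda>c\<in>singular_chain_set p X. r * u c)\<rparr>"

definition coboundary_map :: "nat \<Rightarrow> 'a topology \<Rightarrow> ('a chain \<Rightarrow> rat) \<Rightarrow> 'a chain \<Rightarrow> rat" where
  "coboundary_map p X u = (\<lambda>c\<in>singular_chain_set (Suc p) X. u (chain_boundary (Suc p) c))"

definition cocycles :: "nat \<Rightarrow> 'a topology \<Rightarrow> ('a chain \<Rightarrow> rat) set" where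
  "cocycles p X = {u \<in> cochains p X. coboundary_map p X u = \<zero>\<^bsub>cochain_module (Suc p) X\<^esub>}"

definition coboundaries :: "nat \<Rightarrow> 'a topology \<Rightarrow> ('a chain \<Rightarrow> rat) set" where
  "coboundaries p X = (case p of 0 \<Rightarrow> {\<zero>\<^bsub>cochain_module 0 X\<^esub>}
     | Suc q \<Rightarrow> coboundary_map q X ` cochains q X)"

definition quotient_module :: "('r, 'v, 'x) module_scheme \<Rightarrow> 'v set \<Rightarrow> ('r, 'v set) module" where
  "quotient_module M N =
     \<lparr>carrier = a_rcosets\<^bsub>M\<^esub> N, monoid.mult = undefined, one = undefined,
      zero = N, add = set_add M,
      smult = (\<lambda>r A. \<Union>v\<in>A. N +>\<^bsub>M\<^esub> (r \<odot>\<^bsub>M\<^esub> v))\<rparr>"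

definition cohomology :: "nat \<Rightarrow> 'a topology \<Rightarrow> (rat, ('a chain \<Rightarrow> rat) set) module" where
  "cohomology p X = quotient_module ((cochain_module p X)\<lparr>carrier := cocycles p X\<rparr>) (coboundaries p X)"

definition cochain_map :: "nat \<Rightarrow> 'a topology \<Rightarrow> ('a \<Rightarrow> 'b) \<Rightarrow> ('b chain \<Rightarrow> rat) \<Rightarrow> 'a chain \<Rightarrow> rat" where
  "cochain_map p X f u = (\<lambda>c\<in>singular_chain_set p X. u (chain_map p f c))"

text \<open>The map \<open>f\<^sup>*\<close> into the cohomology of \<open>X\<close> induced by a continuous map \<open>f\<close> out of \<open>X\<close>: it
  sends the class of a cocycle \<open>u\<close> to the class of its pullback.\<close>

definition cohomology_map ::
    "nat \<Rightarrow> 'a topology \<Rightarrow> ('a \<Rightarrow> 'b) \<Rightarrow> ('b chain \<Rightarrow> rat) set \<Rightarrow> ('a chain \<Rightarrow> rat) set" where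
  "cohomology_map p X f A = (\<Union>u\<in>A. coboundaries p X +>\<^bsub>cochain_module p X\<^esub> cochain_map p X f u)"

definition invariant_cohomology ::
    "nat \<Rightarrow> 'a topology \<Rightarrow> ('a \<Rightarrow> 'a) set \<Rightarrow> (rat, ('a chain \<Rightarrow> rat) set) module" where
  "invariant_cohomology p X F = (cohomology p X)
     \<lparr>carrier := {A \<in> carrier (cohomology p X). \<forall>f\<in>F. cohomology_map p X f A = A}\<rparr>"


lemma submodule_subgroup:
  assumes "submodule K N M"
  shows "subgroup N (add_monoid M)"
proof -
  interpret N: submodule K N M by fact
  interpret module K M by (rule N.module)
  have "\<ominus>\<^bsub>M\<^esub> n \<in> N" if "n \<in> N" for n
  proof -
    have "n \<in> carrier M" using that N.subset by auto
    then have "\<ominus>\<^bsub>M\<^esub> n = (\<ominus>\<^bsub>K\<^esub> \<one>\<^bsub>K\<^esub>) \<odot>\<^bsub>M\<^esub> n" by (simp add: smult_l_minus)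
    then show ?thesis using that by simp
  qed
  then show ?thesis
    using N.subset N.zero_closed
    by (intro M.add.subgroupI) (auto simp: a_inv_def simp del: N.zero_closed)
qed


lemma quotient_vectorspace:
  assumes V: "vectorspace K M" and N: "submodule K N M"
  shows "vectorspace K (quotient_module M N)"
    and "\<And>v r. v \<in> carrier M \<Longrightarrow> r \<in> carrier K \<Longrightarrow>
      r \<odot>\<^bsub>quotient_module M N\<^esub> (N +>\<^bsub>M\<^esub> v) = N +>\<^bsub>M\<^esub> (r \<odot>\<^bsub>M\<^esub> v)"
    and "\<And>v w. v \<in> carrier M \<Longrightarrow> w \<in> carrier M \<Longrightarrow>
      (N +>\<^bsub>M\<^esub> v) \<oplus>\<^bsub>quotient_module M N\<^esub> (N +>\<^bsub>M\<^esub> w) = N +>\<^bsub>M\<^esub> (v \<oplus>\<^bsub>M\<^esub> w)"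
proof -
  interpret vectorspace K M by fact
  interpret N: submodule K N M by fact
  have "subgroup N (add_monoid M)" by (rule submodule_subgroup[OF N])
  then have as: "additive_subgroup N M" by (simp add: additive_subgroup_def)
  interpret N: abelian_subgroup N M
    by (rule abelian_subgroupI3[OF as]) unfold_locales
  let ?Q = "quotient_module M N"
  note [simp] = N.a_subset
  have car: "carrier ?Q = (\<lambda>v. N +>\<^bsub>M\<^esub> v) ` carrier M"
    by (auto simp: quotient_module_def A_RCOSETS_def RCOSETS_def a_r_coset_def)
  have add: "(N +>\<^bsub>M\<^esub> v) \<oplus>\<^bsub>?Q\<^esub> (N +>\<^bsub>M\<^esub> w) = N +>\<^bsub>M\<^esub> (v \<oplus>\<^bsub>M\<^esub> w)"
    if "v \<in> carrier M" "w \<in> carrier M" for v w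
    using that by (simp add: quotient_module_def N.a_rcos_sum)
  have eqI: "N +>\<^bsub>M\<^esub> w = N +>\<^bsub>M\<^esub> v" if "v \<in> carrier M" "w \<in> N +>\<^bsub>M\<^esub> v" for v w
    using that by (metis N.a_repr_independence')
  have sm: "r \<odot>\<^bsub>?Q\<^esub> (N +>\<^bsub>M\<^esub> v) = N +>\<^bsub>M\<^esub> (r \<odot>\<^bsub>M\<^esub> v)"
    if v: "v \<in> carrier M" and r: "r \<in> carrier K" for v r
  proof -
    have "N +>\<^bsub>M\<^esub> (r \<odot>\<^bsub>M\<^esub> w) = N +>\<^bsub>M\<^esub> (r \<odot>\<^bsub>M\<^esub> v)" if w: "w \<in> N +>\<^bsub>M\<^esub> v" for w
    proof (rule eqI)
      show "r \<odot>\<^bsub>M\<^esub> v \<in> carrier M" using v r by simp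
      from w obtain n where n: "n \<in> N" "w = n \<oplus>\<^bsub>M\<^esub> v"
        by (auto simp: a_r_coset_def r_coset_def)
      moreover from n have "n \<in> carrier M" by (meson N.a_subset subsetD)
      ultimately show "r \<odot>\<^bsub>M\<^esub> w \<in> N +>\<^bsub>M\<^esub> (r \<odot>\<^bsub>M\<^esub> v)"
        using v r N.smult_closed[of r n]
        by (auto simp: a_r_coset_def r_coset_def smult_r_distr)
    qed
    moreover have "v \<in> N +>\<^bsub>M\<^esub> v" using v by (rule N.a_rcos_self)
    ultimately have "(\<Union>w\<in>N +>\<^bsub>M\<^esub> v. N +>\<^bsub>M\<^esub> (r \<odot>\<^bsub>M\<^esub> w)) = N +>\<^bsub>M\<^esub> (r \<odot>\<^bsub>M\<^esub> v)"
      by blast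
    then show ?thesis by (simp add: quotient_module_def)
  qed
  have zero: "\<zero>\<^bsub>?Q\<^esub> = N +>\<^bsub>M\<^esub> \<zero>\<^bsub>M\<^esub>"
    by (simp add: quotient_module_def)
  show "vectorspace K ?Q"
  proof (rule vs_criteria)
    show "field K" ..
    show "\<zero>\<^bsub>?Q\<^esub> \<in> carrier ?Q" unfolding zero car by blast
    show "\<forall>v\<in>carrier ?Q. v \<oplus>\<^bsub>?Q\<^esub> \<zero>\<^bsub>?Q\<^esub> = v"
    proof
      fix A assume "A \<in> carrier ?Q"
      then obtain v where v: "v \<in> carrier M" "A = N +>\<^bsub>M\<^esub> v" by (auto simp: car)
      then show "A \<oplus>\<^bsub>?Q\<^esub> \<zero>\<^bsub>?Q\<^esub> = A"
        unfolding zero v(2) add[OF v(1) M.zero_closed] by simp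
    qed
    show "\<forall>v\<in>carrier ?Q. \<exists>neg_v\<in>carrier ?Q. v \<oplus>\<^bsub>?Q\<^esub> neg_v = \<zero>\<^bsub>?Q\<^esub>"
    proof
      fix A assume "A \<in> carrier ?Q"
      then obtain v where v: "v \<in> carrier M" "A = N +>\<^bsub>M\<^esub> v" by (auto simp: car)
      then have "A \<oplus>\<^bsub>?Q\<^esub> (N +>\<^bsub>M\<^esub> (\<ominus>\<^bsub>M\<^esub> v)) = \<zero>\<^bsub>?Q\<^esub>"
        unfolding zero by (simp add: add M.r_neg)
      moreover have "N +>\<^bsub>M\<^esub> (\<ominus>\<^bsub>M\<^esub> v) \<in> carrier ?Q" using v by (auto simp: car)
      ultimately show "\<exists>neg_v\<in>carrier ?Q. A \<oplus>\<^bsub>?Q\<^esub> neg_v = \<zero>\<^bsub>?Q\<^esub>" by blast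
    qed
  qed (auto simp: car add sm zero M.a_ac smult_assoc1 smult_l_distr smult_r_distr)
  show "\<And>v r. v \<in> carrier M \<Longrightarrow> r \<in> carrier K \<Longrightarrow>
      r \<odot>\<^bsub>quotient_module M N\<^esub> (N +>\<^bsub>M\<^esub> v) = N +>\<^bsub>M\<^esub> (r \<odot>\<^bsub>M\<^esub> v)" by (rule sm)
  show "\<And>v w. v \<in> carrier M \<Longrightarrow> w \<in> carrier M \<Longrightarrow>
      (N +>\<^bsub>M\<^esub> v) \<oplus>\<^bsub>quotient_module M N\<^esub> (N +>\<^bsub>M\<^esub> w) = N +>\<^bsub>M\<^esub> (v \<oplus>\<^bsub>M\<^esub> w)" by (rule add)
qed

lemma cochains_iff:
  "u \<in> cochains p X \<longleftrightarrow> u \<in> extensional (singular_chain_set p X) \<and>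
     (\<forall>c d. singular_chain p X c \<longrightarrow> singular_chain p X d \<longrightarrow> u (c + d) = u c + u d)"
  by (auto simp: cochains_def hom_def class_ring_simps)

lemma vectorspace_cochain_module: "vectorspace rat_field (cochain_module p X)"
proof (rule vs_criteria)
  show "field rat_field" by (rule class_field)
  let ?M = "cochain_module p X"
  show "\<forall>v\<in>carrier ?M. \<exists>neg_v\<in>carrier ?M. v \<oplus>\<^bsub>?M\<^esub> neg_v = \<zero>\<^bsub>?M\<^esub>"
  proof
    fix v assume "v \<in> carrier ?M"
    then show "\<exists>neg_v\<in>carrier ?M. v \<oplus>\<^bsub>?M\<^esub> neg_v = \<zero>\<^bsub>?M\<^esub>"
      by (intro bexI[of _ "\<lambda>c\<in>singular_chain_set p X. - v c"])
        (auto simp: cochain_module_def cochains_iff singular_chain_add intro!: ext)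
  qed
qed (auto simp: cochain_module_def cochains_iff singular_chain_add class_ring_simps algebra_simps
       extensional_def restrict_def intro!: ext)


lemma coboundary_map_closed: "u \<in> cochains p X \<Longrightarrow> coboundary_map p X u \<in> cochains (Suc p) X"
  by (auto simp: cochains_iff coboundary_map_def singular_chain_add chain_boundary_add
      singular_chain_boundary_alt)

lemma cochain_zero: "u \<in> cochains p X \<Longrightarrow> u 0 = 0"
  using singular_chain_0 unfolding cochains_iff by (metis add_cancel_right_left)

lemma coboundaries_subset: "coboundaries p X \<subseteq> cocycles p X"
proof (cases p)
  case 0
  then show ?thesis
    by (auto simp: coboundaries_def cocycles_def cochain_module_def cochains_iff coboundary_map_def
        singular_chain_add singular_chain_boundary_alt)
next
  case (Suc q)
  have "coboundary_map (Suc q) X (coboundary_map q X v) = (\<lambda>c\<in>singular_chain_set (Suc (Suc q)) X. 0)"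
    if "v \<in> cochains q X" for v
    using cochain_zero[OF that]
    by (auto simp: coboundary_map_def singular_chain_boundary_alt chain_boundary_boundary_alt)
  then show ?thesis
    by (auto simp: Suc coboundaries_def cocycles_def cochain_module_def coboundary_map_closed)
qed

lemma submodule_cocycles: "submodule rat_field (cocycles p X) (cochain_module p X)"
proof -
  have "module rat_field (cochain_module p X)"
    using vectorspace_cochain_module[of p X] by (simp add: vectorspace_def)
  then show ?thesis
    unfolding LinearCombinations.submodule_def
    apply (simp only: simp_thms)
    by (auto simp: cocycles_def cochain_module_def cochains_iff coboundary_map_def
        singular_chain_add singular_chain_boundary_alt class_ring_simps algebra_simps
        fun_eq_iff restrict_def extensional_def)
qed

lemma vectorspace_cocycles:
  "vectorspace rat_field ((cochain_module p X)\<lparr>carrier := cocycles p X\<rparr>)"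
  by (simp add: subspace_def submodule_cocycles vectorspace.subspace_is_vs vectorspace_cochain_module)

lemma submodule_coboundaries:
  "submodule rat_field (coboundaries p X) ((cochain_module p X)\<lparr>carrier := cocycles p X\<rparr>)"
proof -
  have "module rat_field ((cochain_module p X)\<lparr>carrier := cocycles p X\<rparr>)"
    using vectorspace_cocycles[of p X] by (simp add: vectorspace_def)
  moreover have "(\<lambda>c\<in>singular_chain_set p X. v c + w c) \<in> coboundaries p X"
    if "v \<in> coboundaries p X" "w \<in> coboundaries p X" for v w
  proof (cases p)
    case 0
    with that show ?thesis by (auto simp: coboundaries_def cochain_module_def fun_eq_iff restrict_def)
  next
    case (Suc q)
    with that obtain v' w' where "v' \<in> cochains q X" "w' \<in> cochains q X"
      "v = coboundary_map q X v'" "w = coboundary_map q X w'" by (auto simp: coboundaries_def)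
    then show ?thesis unfolding Suc coboundaries_def
      by (auto intro!: image_eqI[of _ _ "\<lambda>c\<in>singular_chain_set q X. v' c + w' c"]
          simp: cochains_iff coboundary_map_def singular_chain_boundary_alt singular_chain_add)
  qed
  moreover have "(\<lambda>c\<in>singular_chain_set p X. r * v c) \<in> coboundaries p X"
    if "v \<in> coboundaries p X" for v r
  proof (cases p)
    case 0
    with that show ?thesis by (auto simp: coboundaries_def cochain_module_def fun_eq_iff restrict_def)
  next
    case (Suc q)
    with that obtain v' where "v' \<in> cochains q X"
      "v = coboundary_map q X v'" by (auto simp: coboundaries_def)
    then show ?thesis unfolding Suc coboundaries_def
      by (auto intro!: image_eqI[of _ _ "\<lambda>c\<in>singular_chain_set q X. r * v' c"]
          simp: cochains_iff coboundary_map_def singular_chain_boundary_alt singular_chain_add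
            algebra_simps)
  qed
  moreover have "(\<lambda>c\<in>singular_chain_set p X. 0) \<in> coboundaries p X"
  proof (cases p)
    case 0
    then show ?thesis by (auto simp: coboundaries_def cochain_module_def)
  next
    case (Suc q)
    then show ?thesis unfolding Suc coboundaries_def
      by (auto intro!: image_eqI[of _ _ "\<lambda>c\<in>singular_chain_set q X. 0"]
          simp: cochains_iff coboundary_map_def singular_chain_boundary_alt singular_chain_add)
  qed
  ultimately show ?thesis
    using coboundaries_subset[of p X] unfolding LinearCombinations.submodule_def
    by (auto simp: cochain_module_def)
qed

lemma vectorspace_cohomology: "vectorspace rat_field (cohomology p X)"
  unfolding cohomology_def
  by (rule quotient_vectorspace[OF vectorspace_cocycles submodule_coboundaries])

abbreviation cohom_class where "cohom_class p X u \<equiv> coboundaries p X +>\<^bsub>cochain_module p X\<^esub> u"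

lemma coset_carrier: "N +>\<^bsub>M\<lparr>carrier := C\<rparr>\<^esub> u = N +>\<^bsub>M\<^esub> u"
  by (simp add: a_r_coset_def r_coset_def)

lemma carrier_cohomology: "carrier (cohomology p X) = cohom_class p X ` cocycles p X"
  by (auto simp: cohomology_def quotient_module_def A_RCOSETS_def RCOSETS_def a_r_coset_def r_coset_def)

lemma cohom_class_eqI:
  assumes "u \<in> cocycles p X" "b \<in> coboundaries p X"
  shows "cohom_class p X (b \<oplus>\<^bsub>cochain_module p X\<^esub> u) = cohom_class p X u"
proof -
  let ?Z = "(cochain_module p X)\<lparr>carrier := cocycles p X\<rparr>"
  interpret Z: vectorspace rat_field ?Z by (rule vectorspace_cocycles)
  interpret N: submodule rat_field "coboundaries p X" ?Z by (rule submodule_coboundaries)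
  have sg: "subgroup (coboundaries p X) (add_monoid ?Z)"
    by (rule submodule_subgroup[OF submodule_coboundaries])
  have "b \<oplus>\<^bsub>?Z\<^esub> u \<in> coboundaries p X +>\<^bsub>?Z\<^esub> u"
    using assms by (auto simp: a_r_coset_def r_coset_def)
  from Z.M.a_repr_independence[OF this _ sg] assms show ?thesis
    by (simp add: coset_carrier)
qed

lemma cochain_map_cocycle:
  assumes "continuous_map X Y f" "u \<in> cocycles p Y"
  shows "cochain_map p X f u \<in> cocycles p X"
proof -
  have u: "u (chain_boundary (Suc p) c) = 0" if "singular_chain (Suc p) Y c" for c
    using assms(2) that
    by (auto simp: cocycles_def coboundary_map_def cochain_module_def fun_eq_iff) 
      (metis mem_Collect_eq restrict_apply')
  note [simp] = singular_chain_chain_map[OF _ assms(1)]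
  have "cochain_map p X f u \<in> cochains p X"
    using assms(2) by (auto simp: cocycles_def cochains_iff cochain_map_def singular_chain_add chain_map_add)
  moreover have "u (chain_map p f (chain_boundary (Suc p) c)) = 0" if c: "singular_chain (Suc p) X c" for c
    using u[OF singular_chain_chain_map[OF c assms(1)]] chain_boundary_chain_map[OF c, of f] by simp
  then have "coboundary_map p X (cochain_map p X f u) = \<zero>\<^bsub>cochain_module (Suc p) X\<^esub>"
    by (auto simp: cochain_map_def coboundary_map_def cochain_module_def singular_chain_boundary_alt fun_eq_iff)
  ultimately show ?thesis by (simp add: cocycles_def)
qed

lemma cochain_map_coboundary:
  assumes "continuous_map X Y f" "u \<in> coboundaries p Y"
  shows "cochain_map p X f u \<in> coboundaries p X"
proof (cases p)
  case 0
  with assms show ?thesis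
    by (auto simp: coboundaries_def cochain_module_def cochain_map_def fun_eq_iff restrict_def
        singular_chain_chain_map[OF _ assms(1)])
next
  case (Suc q)
  with assms obtain v where v: "v \<in> cochains q Y" "u = coboundary_map q Y v"
    by (auto simp: coboundaries_def)
  then have "cochain_map p X f u = coboundary_map q X (cochain_map q X f v)"
    by (auto simp: Suc fun_eq_iff cochain_map_def coboundary_map_def restrict_def
        singular_chain_chain_map[OF _ assms(1)] singular_chain_boundary_alt chain_boundary_chain_map)
  moreover have "cochain_map q X f v \<in> cochains q X"
    using v by (auto simp: cochains_iff cochain_map_def
        singular_chain_add chain_map_add singular_chain_chain_map[OF _ assms(1)])
  ultimately show ?thesis by (auto simp: Suc coboundaries_def)
qed

lemma cohomology_map_class:
  assumes f: "continuous_map X Y f" and u: "u \<in> cocycles p Y"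
  shows "cohomology_map p X f (cohom_class p Y u) = cohom_class p X (cochain_map p X f u)"
proof -
  have *: "cohom_class p X (cochain_map p X f (b \<oplus>\<^bsub>cochain_module p Y\<^esub> u))
     = cohom_class p X (cochain_map p X f u)" if "b \<in> coboundaries p Y" for b
  proof -
    have "cochain_map p X f (b \<oplus>\<^bsub>cochain_module p Y\<^esub> u)
      = cochain_map p X f b \<oplus>\<^bsub>cochain_module p X\<^esub> cochain_map p X f u"
      by (auto simp: cochain_map_def cochain_module_def fun_eq_iff singular_chain_chain_map[OF _ f])
    then show ?thesis
      using cohom_class_eqI cochain_map_cocycle[OF f u] cochain_map_coboundary[OF f that] by metis
  qed
  have "\<exists>b. b \<in> coboundaries p Y"
    using submodule_coboundaries[of p Y] by (auto dest: LinearCombinations.submodule.zero_closed)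
  with * show ?thesis
    by (auto simp: cohomology_map_def a_r_coset_def r_coset_def)
qed

lemma vectorspace_invariant_cohomology:
  assumes F: "\<And>f. f \<in> F \<Longrightarrow> continuous_map X X f"
  shows "vectorspace rat_field (invariant_cohomology p X F)"
proof -
  interpret H: vectorspace rat_field "cohomology p X" by (rule vectorspace_cohomology)
  let ?I = "{A \<in> carrier (cohomology p X). \<forall>f\<in>F. cohomology_map p X f A = A}"
  let ?M = "cochain_module p X"
  note qv = quotient_vectorspace[OF vectorspace_cocycles[of p X] submodule_coboundaries[of p X],
    folded cohomology_def, unfolded coset_carrier, simplified]
  have map_add: "cochain_map p X f (u \<oplus>\<^bsub>?M\<^esub> v) = cochain_map p X f u \<oplus>\<^bsub>?M\<^esub> cochain_map p X f v"
    and map_smult: "cochain_map p X f (r \<odot>\<^bsub>?M\<^esub> v) = r \<odot>\<^bsub>?M\<^esub> cochain_map p X f v"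
    if "f \<in> F" for f u v r
    by (auto simp: cochain_map_def cochain_module_def fun_eq_iff singular_chain_chain_map[OF _ F[OF that]])
  interpret Z: submodule rat_field "cocycles p X" ?M by (rule submodule_cocycles)
  note qa = qv(3) and qs = qv(2)
  have 1: "A \<oplus>\<^bsub>cohomology p X\<^esub> B \<in> ?I" if "A \<in> ?I" "B \<in> ?I" for A B
  proof -
    from that obtain u v where uv: "u \<in> cocycles p X" "v \<in> cocycles p X"
      "A = cohom_class p X u" "B = cohom_class p X v" by (auto simp: carrier_cohomology)
    have "cohomology_map p X f (A \<oplus>\<^bsub>cohomology p X\<^esub> B) = A \<oplus>\<^bsub>cohomology p X\<^esub> B" if f: "f \<in> F" for f
    proof -
      have "cohomology_map p X f (A \<oplus>\<^bsub>cohomology p X\<^esub> B)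
         = cohomology_map p X f A \<oplus>\<^bsub>cohomology p X\<^esub> cohomology_map p X f B"
        using uv cochain_map_cocycle[OF F[OF f]] Z.m_closed[of u v]
        by (simp add: qa cohomology_map_class[OF F[OF f]] map_add[OF f])
      then show ?thesis using that \<open>A \<in> ?I\<close> \<open>B \<in> ?I\<close> by simp
    qed
    then show ?thesis using that by simp
  qed
  have 2: "r \<odot>\<^bsub>cohomology p X\<^esub> A \<in> ?I" if "A \<in> ?I" for A r
  proof -
    from that obtain u where u: "u \<in> cocycles p X" "A = cohom_class p X u"
      by (auto simp: carrier_cohomology)
    have "cohomology_map p X f (r \<odot>\<^bsub>cohomology p X\<^esub> A) = r \<odot>\<^bsub>cohomology p X\<^esub> A" if f: "f \<in> F" for f
    proof -
      have "cohomology_map p X f (r \<odot>\<^bsub>cohomology p X\<^esub> A)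
         = r \<odot>\<^bsub>cohomology p X\<^esub> cohomology_map p X f A"
        using u cochain_map_cocycle[OF F[OF f]] Z.smult_closed[of r u]
        by (simp add: qs cohomology_map_class[OF F[OF f]] map_smult[OF f])
      then show ?thesis using \<open>A \<in> ?I\<close> f by simp
    qed
    then show ?thesis using that H.smult_closed[of r A] by simp
  qed
  have 3: "\<zero>\<^bsub>cohomology p X\<^esub> \<in> ?I"
  proof -
    let ?z = "\<zero>\<^bsub>?M\<^esub>"
    have z: "?z \<in> cocycles p X" by (rule Z.zero_closed)
    interpret C: vectorspace rat_field ?M by (rule vectorspace_cochain_module)
    have "coboundaries p X \<subseteq> carrier ?M"
      using coboundaries_subset Z.subset by blast
    then have eq: "\<zero>\<^bsub>cohomology p X\<^esub> = cohom_class p X ?z"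
      by (simp add: cohomology_def quotient_module_def)
    have "cochain_map p X f ?z = ?z" if "f \<in> F" for f
      by (auto simp: cochain_map_def cochain_module_def fun_eq_iff singular_chain_chain_map[OF _ F[OF that]])
    then show ?thesis unfolding eq using z
      by (auto simp: carrier_cohomology cohomology_map_class[OF F])
  qed
  have "submodule rat_field ?I (cohomology p X)"
    unfolding LinearCombinations.submodule_def using 1 2 3 H.module_axioms by auto
  then show ?thesis
    unfolding invariant_cohomology_def
    by (simp add: subspace_def H.subspace_is_vs vectorspace_cohomology)
qed

text \<open>Hence the library's \<^const>\<open>vectorspace.fin_dim\<close> and \<^const>\<open>vectorspace.dim\<close> have their
  intended meaning on the invariants of \<open>W\<^bsub>n-a\<^esub>\<close>.\<close>

lemma vectorspace_wreath_invariants: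
  assumes "free_topological_action G X \<phi>"
  shows "vectorspace rat_field (invariant_cohomology i (orbit_conf G X \<phi> n)
           (wreath_action \<phi> n ` wreath_subgroup G n a))"
proof (rule vectorspace_invariant_cohomology)
  fix f assume "f \<in> wreath_action \<phi> n ` wreath_subgroup G n a"
  then obtain w where "f = wreath_action \<phi> n w" "w \<in> carrier (wreath_group G n)"
    unfolding wreath_subgroup_def by blast
  then show "continuous_map (orbit_conf G X \<phi> n) (orbit_conf G X \<phi> n) f"
    using wreath_action_conf[OF assms] by simp
qed

end

theory Submission
  imports Defs
begin

text \<open>
  The quotient of \<open>X\<close> by \<open>G\<close> is the plane minus a finite set \<open>P\<close>. Dividing the last \<open>n - a\<close> points of an
  orbit configuration by \<open>G\<close> turns it into a configuration of \<open>n - a\<close> points of the plane over the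
  base \<open>B = Conf\<^sup>G\<^sub>a(X)\<close>, avoiding \<open>a + |P|\<close> holes that move with the base point; by averaging and
  lifting simplices, invariant cocycles descend to symmetric functionals on the homology of this space.
  Such functionals are bounded by residues. If the residues of a functional along the collisions
  with one hole vanish, then it extends over that hole; this trades one hole, or one point and one degree, at a time,
  and produces the factor \<open>(i + 1)\<^sup>h\<close> for \<open>h\<close> holes. Without holes a symmetric functional has a single residue
  up to symmetry, and the residues of this residue vanish: for three points by the Jacobi identity, for two disjoint pairs
  by antisymmetry. Hence it factors through the base, and the bound does not depend on \<open>n\<close>. Finally the homology of \<open>B\<close>
  is bounded in all degrees, because \<open>B\<close> is covered by finitely many open sets
  which, together with their intersections, contract onto finite fibres.
\<close>

section \<open>Rational functionals on commutative groups\<close>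

text \<open>Integral homology with rational functionals is used instead of cohomology because a
  functional that vanishes on the kernel of a homomorphism factors through it, the rationals being
  injective; every extension statement thus becomes the computation of a kernel. Kernels of filling
  in a collision are computed by excision and exactness from one fact: a class of the circle times
  \<open>V\<close> that dies in \<open>V\<close> is a cross product with the circle. The obstacle is
  uniformity in \<open>n\<close>: an induction that removes free points would make the bound grow
  with their number. The way out is that free points are permuted doubly transitively, so the
  residue at one collision decides about the residues at all. The decisive vanishing statements are
  proved after applying a functional: the geometry gives a multiple 2 x = 0 or 3 x = 0, and rational
  values do not see torsion. Unconstrained coordinates stay in the space as free complex numbers.
  Forgetting a point is therefore an inclusion, and most homotopies of configurations are straight
  lines. The exponent of the bound is \<open>a\<close> plus the number of punctures of the
  plane.\<close>

text \<open>Functionals are \<open>0\<close> outside the carrier, so that they form a rational vector space of functions.\<close>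

definition rhom :: "('g, 'm) monoid_scheme \<Rightarrow> ('g \<Rightarrow> rat) set" where
  "rhom G = {l. (\<forall>x\<in>carrier G. \<forall>y\<in>carrier G. l (x \<otimes>\<^bsub>G\<^esub> y) = l x + l y) \<and> (\<forall>x. x \<notin> carrier G \<longrightarrow> l x = 0)}"

definition rpull :: "('g, 'm) monoid_scheme \<Rightarrow> ('g \<Rightarrow> 'h) \<Rightarrow> ('h \<Rightarrow> rat) \<Rightarrow> 'g \<Rightarrow> rat" where
  "rpull G g l = (\<lambda>x. if x \<in> carrier G then l (g x) else 0)"

lemma rhom_mult: "\<lbrakk>l \<in> rhom G; x \<in> carrier G; y \<in> carrier G\<rbrakk> \<Longrightarrow> l (x \<otimes>\<^bsub>G\<^esub> y) = l x + l y"
  by (simp add: rhom_def)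

lemma rhom_outside: "\<lbrakk>l \<in> rhom G; x \<notin> carrier G\<rbrakk> \<Longrightarrow> l x = 0"
  by (simp add: rhom_def)

lemma rhom_one:
  assumes "group G" "l \<in> rhom G" shows "l \<one>\<^bsub>G\<^esub> = 0"
proof -
  interpret group G by fact
  have "l (\<one>\<^bsub>G\<^esub> \<otimes>\<^bsub>G\<^esub> \<one>\<^bsub>G\<^esub>) = l \<one>\<^bsub>G\<^esub> + l \<one>\<^bsub>G\<^esub>" using rhom_mult[OF assms(2)] by blast
  then show ?thesis by simp
qed

lemma rhom_inv:
  assumes "group G" "l \<in> rhom G" "x \<in> carrier G" shows "l (inv\<^bsub>G\<^esub> x) = - l x"
proof -
  interpret group G by fact
  have "l (inv\<^bsub>G\<^esub> x \<otimes>\<^bsub>G\<^esub> x) = l (inv\<^bsub>G\<^esub> x) + l x" using rhom_mult[OF assms(2)] assms(3) by blast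
  then show ?thesis using assms rhom_one[OF assms(1,2)] by simp
qed

lemma rpull_rhom: "\<lbrakk>g \<in> hom G H; l \<in> rhom H; group G\<rbrakk> \<Longrightarrow> rpull G g l \<in> rhom G"
  by (auto simp: rpull_def rhom_def hom_def Pi_iff group.is_monoid monoid.m_closed)

lemma rhom_lincomb: "\<lbrakk>l \<in> rhom G; m \<in> rhom G\<rbrakk> \<Longrightarrow> (\<lambda>x. l x - c * m x) \<in> rhom G"
  by (simp add: rhom_def algebra_simps)

text \<open>The rationals are an injective abelian group: a functional is extended along \<open>g\<close> by taking a
  maximal single-valued subgroup of \<open>H \<times> \<rat>\<close> containing \<open>{(g x, l x)}\<close>.\<close>

lemma rhom_factor:
  assumes G: "comm_group G" and H: "comm_group H" and g: "g \<in> hom G H" and l: "l \<in> rhom G"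
    and ker: "\<And>x. x \<in> carrier G \<Longrightarrow> g x = \<one>\<^bsub>H\<^esub> \<Longrightarrow> l x = 0"
  shows "\<exists>m\<in>rhom H. \<forall>x\<in>carrier G. l x = m (g x)"
proof -
  interpret G: comm_group G by fact
  interpret H: comm_group H by fact
  interpret gh: group_hom G H g by (simp add: group_hom_def group_hom_axioms_def g G.is_group H.is_group)
  define R0 where "R0 = (\<lambda>x. (g x, l x)) ` carrier G"
  \<comment> \<open>A \<open>good\<close> relation is a subgroup of \<open>H\<close> times the
    rationals, expressed by closure under differences, that contains the prescribed graph; the last
    clause makes it single-valued.\<close>
  define good where "good R \<longleftrightarrow> R \<subseteq> carrier H \<times> UNIV \<and> R0 \<subseteq> R \<and>
    (\<forall>x r y s. (x,r) \<in> R \<longrightarrow> (y,s) \<in> R \<longrightarrow> (x \<otimes>\<^bsub>H\<^esub> inv\<^bsub>H\<^esub> y, r - s) \<in> R) \<and> (\<forall>r. (\<one>\<^bsub>H\<^esub>, r) \<in> R \<longrightarrow> r = 0)"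
    for R :: "('c \<times> rat) set"
  have good1: "R0 \<subseteq> R" and good2: "R \<subseteq> carrier H \<times> UNIV"
    and good3: "(x,r) \<in> R \<Longrightarrow> (y,s) \<in> R \<Longrightarrow> (x \<otimes>\<^bsub>H\<^esub> inv\<^bsub>H\<^esub> y, r - s) \<in> R"
    and good4: "(\<one>\<^bsub>H\<^esub>, r) \<in> R \<Longrightarrow> r = 0" if "good R" for R x r y s
    using that by (simp_all add: good_def)
  have good0: "good R0"
    unfolding good_def
  proof (intro conjI allI impI)
    show "R0 \<subseteq> carrier H \<times> UNIV" by (auto simp: R0_def)
    fix x r y s assume "(x,r) \<in> R0" "(y,s) \<in> R0"
    then obtain a b where ab: "a \<in> carrier G" "b \<in> carrier G" "x = g a" "y = g b" "r = l a" "s = l b"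
      by (auto simp: R0_def)
    have "l (a \<otimes>\<^bsub>G\<^esub> inv\<^bsub>G\<^esub> b) = l a - l b"
      using ab rhom_mult[OF l] rhom_inv[OF G.is_group l] by simp
    then show "(x \<otimes>\<^bsub>H\<^esub> inv\<^bsub>H\<^esub> y, r - s) \<in> R0"
      unfolding R0_def using ab by (intro image_eqI[of _ _ "a \<otimes>\<^bsub>G\<^esub> inv\<^bsub>G\<^esub> b"]) auto
  next
    fix r assume "(\<one>\<^bsub>H\<^esub>, r) \<in> R0" then show "r = 0" using ker by (auto simp: R0_def)
  qed auto
  have "\<exists>M\<in>Collect good. \<forall>X\<in>Collect good. M \<subseteq> X \<longrightarrow> X = M"
  proof (rule subset_Zorn_nonempty)
    show "Collect good \<noteq> {}" using good0 by blast
    fix C assume C: "C \<noteq> {}" "subset.chain (Collect good) C"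
    have gC: "good R" if "R \<in> C" for R using C(2) that by (auto simp: subset.chain_def)
    have "good (\<Union>C)"
      unfolding good_def
    proof (intro conjI allI impI)
      show "\<Union>C \<subseteq> carrier H \<times> UNIV" using good2[OF gC] by (meson Union_least)
      obtain A where "A \<in> C" using C(1) by blast
      moreover from this have "R0 \<subseteq> A" using good1[OF gC] by blast
      ultimately show "R0 \<subseteq> \<Union>C" by blast
      fix x r y s assume "(x,r) \<in> \<Union>C" "(y,s) \<in> \<Union>C"
      then obtain A B where AB: "A \<in> C" "B \<in> C" "(x,r) \<in> A" "(y,s) \<in> B" by blast
      then obtain D where "D \<in> C" "(x,r) \<in> D" "(y,s) \<in> D"
        using C(2) unfolding subset.chain_def by blast
      then show "(x \<otimes>\<^bsub>H\<^esub> inv\<^bsub>H\<^esub> y, r - s) \<in> \<Union>C" using good3[OF gC] by blast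
    next
      fix r assume "(\<one>\<^bsub>H\<^esub>, r) \<in> \<Union>C" then show "r = 0" using good4[OF gC] by blast
    qed
    then show "\<Union>C \<in> Collect good" by simp
  qed
  then obtain R where R: "good R" and max: "\<And>X. good X \<Longrightarrow> R \<subseteq> X \<Longrightarrow> X = R" by blast
  have RH: "(x,r) \<in> R \<Longrightarrow> x \<in> carrier H" for x r using good2[OF R] by blast
  have Rd: "(x,r) \<in> R \<Longrightarrow> (y,s) \<in> R \<Longrightarrow> (x \<otimes>\<^bsub>H\<^esub> inv\<^bsub>H\<^esub> y, r - s) \<in> R" for x r y s
    using good3[OF R] by blast
  have R1: "(\<one>\<^bsub>H\<^esub>, r) \<in> R \<Longrightarrow> r = 0" for r using good4[OF R] by blast
  have "(\<one>\<^bsub>H\<^esub>, 0) \<in> R0" using rhom_one[OF G.is_group l] by (force simp: R0_def)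
  then have Rone: "(\<one>\<^bsub>H\<^esub>, 0) \<in> R" using good1[OF R] by blast
  have Ri: "(inv\<^bsub>H\<^esub> y, - s) \<in> R" if "(y,s) \<in> R" for y s
    using Rd[OF Rone that] RH[OF that] by simp
  have Rm: "(x \<otimes>\<^bsub>H\<^esub> y, r + s) \<in> R" if "(x,r) \<in> R" "(y,s) \<in> R" for x r y s
    using Rd[OF that(1) Ri[OF that(2)]] RH[OF that(2)] by simp
  have Rn: "(y [^]\<^bsub>H\<^esub> (n::nat), of_nat n * s) \<in> R" if "(y,s) \<in> R" for y s n
  proof (induction n)
    case (Suc n) show ?case using Rm[OF Suc that] by (simp add: algebra_simps)
  qed (simp add: Rone)
  have Rp: "(y [^]\<^bsub>H\<^esub> (k::int), of_int k * s) \<in> R" if "(y,s) \<in> R" for y s k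
  proof (cases "0 \<le> k")
    case True
    then obtain n where "k = int n" using zero_le_imp_eq_int by blast
    then show ?thesis using Rn[OF that, of n] by (simp add: int_pow_int)
  next
    case False
    then obtain n where "k = - int n" by (metis linear add.inverse_inverse neg_0_le_iff_le zero_le_imp_eq_int)
    then show ?thesis using Ri[OF Rn[OF that, of n]] RH[OF that] by (simp add: H.int_pow_neg int_pow_int)
  qed
  have tot: "\<exists>r. (x,r) \<in> R" if x: "x \<in> carrier H" for x
  proof -
    \<comment> \<open>The value at \<open>x\<close> is forced as soon as some nonzero power of
      \<open>x\<close> lies in the domain, namely by division; otherwise every value is possible and
      0 is taken. Divisibility of the rationals enters here.\<close>
    define q where "q = (if \<exists>k r. k \<noteq> 0 \<and> (x [^]\<^bsub>H\<^esub> (k::int), r) \<in> R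
      then (SOME q. \<exists>k r. k \<noteq> 0 \<and> (x [^]\<^bsub>H\<^esub> (k::int), r) \<in> R \<and> q = r / of_int k) else 0)"
    have q: "r = of_int k * q" if kr: "(x [^]\<^bsub>H\<^esub> k, r) \<in> R" for k r
    proof (cases "k = 0")
      case True then show ?thesis using kr R1 by simp
    next
      case False
      then have ex: "\<exists>k r. k \<noteq> 0 \<and> (x [^]\<^bsub>H\<^esub> (k::int), r) \<in> R" using kr by blast
      then have "\<exists>q k r. k \<noteq> 0 \<and> (x [^]\<^bsub>H\<^esub> (k::int), r) \<in> R \<and> q = r / of_int k" by blast
      from someI_ex[OF this] obtain k0 r0 where k0: "k0 \<noteq> 0" "(x [^]\<^bsub>H\<^esub> k0, r0) \<in> R" "q = r0 / of_int k0"
        using ex unfolding q_def by auto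
      have "((x [^]\<^bsub>H\<^esub> k) [^]\<^bsub>H\<^esub> k0 \<otimes>\<^bsub>H\<^esub> inv\<^bsub>H\<^esub> ((x [^]\<^bsub>H\<^esub> k0) [^]\<^bsub>H\<^esub> k), of_int k0 * r - of_int k * r0) \<in> R"
        by (intro Rd Rp kr k0)
      moreover have "(x [^]\<^bsub>H\<^esub> k) [^]\<^bsub>H\<^esub> k0 = (x [^]\<^bsub>H\<^esub> k0) [^]\<^bsub>H\<^esub> k"
        using x by (simp add: H.int_pow_pow mult.commute)
      ultimately have "(\<one>\<^bsub>H\<^esub>, of_int k0 * r - of_int k * r0) \<in> R" using x by simp
      then have "of_int k0 * r = of_int k * r0" using R1 by fastforce
      moreover have "r0 = q * of_int k0" using k0 by simp
      ultimately have "of_int k0 * r = of_int k0 * (of_int k * q)" by (simp add: ac_simps)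
      then show ?thesis using k0(1) by simp
    qed
    \<comment> \<open>The subgroup generated by \<open>R\<close> and \<open>(x, q)\<close>;
      maximality of \<open>R\<close> then puts \<open>x\<close> into its domain.\<close>
    define R' where "R' = {(y \<otimes>\<^bsub>H\<^esub> x [^]\<^bsub>H\<^esub> k, r + of_int k * q) | y r k. (y,r) \<in> R}"
    have sub: "R \<subseteq> R'"
    proof
      fix z assume "z \<in> R"
      then show "z \<in> R'" unfolding R'_def using RH
        by (cases z) (force intro: exI[of _ "0::int"])
    qed
    have "good R'"
      unfolding good_def
    proof (intro conjI allI impI)
      show "R' \<subseteq> carrier H \<times> UNIV" using x RH by (auto simp: R'_def)
      show "R0 \<subseteq> R'" using sub good1[OF R] by blast
      fix a s b t assume "(a,s) \<in> R'" "(b,t) \<in> R'"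
      then obtain y r z u and k j :: int where *: "a = y \<otimes>\<^bsub>H\<^esub> x [^]\<^bsub>H\<^esub> k" "s = r + of_int k * q" "(y,r) \<in> R"
        "b = z \<otimes>\<^bsub>H\<^esub> x [^]\<^bsub>H\<^esub> j" "t = u + of_int j * q" "(z,u) \<in> R"
        unfolding R'_def by blast
      have c: "y \<in> carrier H" "z \<in> carrier H" using * RH by auto
      have "a \<otimes>\<^bsub>H\<^esub> inv\<^bsub>H\<^esub> b = (y \<otimes>\<^bsub>H\<^esub> inv\<^bsub>H\<^esub> z) \<otimes>\<^bsub>H\<^esub> x [^]\<^bsub>H\<^esub> (k - j)"
        using c x *(1,4) by (simp add: H.inv_mult H.int_pow_diff H.m_ac)
      moreover have "s - t = (r - u) + of_int (k - j) * q" using * by (simp add: algebra_simps)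
      moreover have "(y \<otimes>\<^bsub>H\<^esub> inv\<^bsub>H\<^esub> z, r - u) \<in> R" using * Rd by blast
      ultimately show "(a \<otimes>\<^bsub>H\<^esub> inv\<^bsub>H\<^esub> b, s - t) \<in> R'" unfolding R'_def by blast
    next
      fix s assume "(\<one>\<^bsub>H\<^esub>, s) \<in> R'"
      then obtain y r and k :: int where *: "\<one>\<^bsub>H\<^esub> = y \<otimes>\<^bsub>H\<^esub> x [^]\<^bsub>H\<^esub> k" "s = r + of_int k * q" "(y,r) \<in> R"
        unfolding R'_def by blast
      have "y = inv\<^bsub>H\<^esub> (x [^]\<^bsub>H\<^esub> k)"
        using *(1) RH[OF *(3)] x by (metis H.inv_equality H.inv_inv H.int_pow_closed)
      then have "(x [^]\<^bsub>H\<^esub> k, - r) \<in> R" using Ri[OF *(3)] x by simp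
      then show "s = 0" using q *(2) by fastforce
    qed
    then have "R' = R" using max sub by blast
    moreover have "(\<one>\<^bsub>H\<^esub> \<otimes>\<^bsub>H\<^esub> x [^]\<^bsub>H\<^esub> (1::int), 0 + of_int 1 * q) \<in> R'"
      unfolding R'_def using Rone by blast
    ultimately show ?thesis using x by (auto simp: H.int_pow_1)
  qed
  have uni: "r = s" if "(x,r) \<in> R" "(x,s) \<in> R" for x r s
    using R1[of "r - s"] Rd[OF that] RH[OF that(1)] by simp
  define m where "m x = (if x \<in> carrier H then (THE r. (x,r) \<in> R) else 0)" for x
  have m: "m x = r" if "(x,r) \<in> R" for x r
    using that RH[OF that] uni unfolding m_def by auto
  have "m \<in> rhom H"
    unfolding rhom_def
  proof (intro CollectI conjI ballI allI impI)
    fix x y assume "x \<in> carrier H" "y \<in> carrier H"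
    then obtain r s where "(x,r) \<in> R" "(y,s) \<in> R" using tot by blast
    then show "m (x \<otimes>\<^bsub>H\<^esub> y) = m x + m y" using m Rm by metis
  qed (simp add: m_def)
  moreover have "l x = m (g x)" if "x \<in> carrier G" for x
    using m[of "g x" "l x"] good1[OF R] that by (auto simp: R0_def)
  ultimately show ?thesis by blast
qed

text \<open>For a linear space \<open>V\<close> of functions this is dimension at most
  \<open>n\<close>: that many evaluations already separate its elements. The form needs no basis,
  and a bound moves along a homomorphism by moving the test points.\<close>

definition sep :: "('s \<Rightarrow> rat) set \<Rightarrow> nat \<Rightarrow> bool" where
  "sep V n \<longleftrightarrow> (\<exists>S. finite S \<and> card S \<le> n \<and> (\<forall>v\<in>V. (\<forall>s\<in>S. v s = 0) \<longrightarrow> v = (\<lambda>x. 0)))"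

lemma sep_mono: "\<lbrakk>sep V n; W \<subseteq> V; n \<le> m\<rbrakk> \<Longrightarrow> sep W m"
  unfolding sep_def by (meson le_trans subsetD)

lemma sep_zero: "(\<And>v. v \<in> V \<Longrightarrow> v = (\<lambda>x. 0)) \<Longrightarrow> sep V n"
  unfolding sep_def by (intro exI[of _ "{}"]) auto

text \<open>Rank plus nullity: the restriction of \<open>v\<close> along \<open>g\<close> is tested
  at the images of the points for \<open>W\<close>, and what restricts to zero is tested at the
  points for the kernel.\<close>

lemma sep_extend:
  assumes V: "sep W n" and k: "sep {v \<in> V. \<forall>x. v (g x) = 0 \<or> x \<notin> A} m"
    and W: "\<And>v. v \<in> V \<Longrightarrow> (\<lambda>x. if x \<in> A then v (g x) else 0) \<in> W"
  shows "sep V (n + m)"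
proof -
  from V obtain S where S: "finite S" "card S \<le> n" "\<And>v. v \<in> W \<Longrightarrow> (\<forall>s\<in>S. v s = 0) \<Longrightarrow> v = (\<lambda>x. 0)"
    unfolding sep_def by auto
  from k obtain T where T: "finite T" "card T \<le> m"
    "\<And>v. v \<in> V \<Longrightarrow> (\<forall>x. v (g x) = 0 \<or> x \<notin> A) \<Longrightarrow> (\<forall>s\<in>T. v s = 0) \<Longrightarrow> v = (\<lambda>x. 0)"
    unfolding sep_def by auto
  show ?thesis
    unfolding sep_def
  proof (intro exI conjI ballI impI)
    show "finite (g ` S \<union> T)" using S T by simp
    show "card (g ` S \<union> T) \<le> n + m"
      using card_Un_le[of "g ` S" T] card_image_le[OF S(1), of g] S T by linarith
    fix v assume v: "v \<in> V" "\<forall>s\<in>g ` S \<union> T. v s = 0"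
    have "(\<lambda>x. if x \<in> A then v (g x) else 0) = (\<lambda>x. 0)"
      using v by (intro S(3) W) auto
    then have "\<forall>x. v (g x) = 0 \<or> x \<notin> A" by metis
    then show "v = (\<lambda>x. 0)" using T(3) v by auto
  qed
qed

text \<open>Test points for \<open>W\<close> need not lie in the image of \<open>g\<close>, so they
  cannot be pulled back. Instead they are removed one by one; each removal costs at most one
  dimension, hence at most one new test point.\<close>

lemma sep_image:
  assumes "sep W n" and "\<And>l m c. l \<in> W \<Longrightarrow> m \<in> W \<Longrightarrow> (\<lambda>x. l x - c * m x) \<in> W"
  shows "sep ((\<lambda>l x. if x \<in> A then l (g x) else 0) ` W) n"
proof -
  let ?p = "\<lambda>l x. if x \<in> A then l (g x) else (0::rat)"
  have "sep (?p ` W) (card S)" if "finite S" "\<And>v. v \<in> W \<Longrightarrow> (\<forall>s\<in>S. v s = 0) \<Longrightarrow> v = (\<lambda>x. 0)"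
    "\<And>l m c. l \<in> W \<Longrightarrow> m \<in> W \<Longrightarrow> (\<lambda>x. l x - c * m x) \<in> W" for S W
    using that
  proof (induction S arbitrary: W rule: finite_induct)
    case empty
    then show ?case by (intro sep_zero) force
  next
    case (insert s S)
    define W0 where "W0 = {l \<in> W. l s = 0}"
    have "sep (?p ` W0) (card S)"
      by (rule insert.IH) (use insert.prems in \<open>auto simp: W0_def\<close>)
    then obtain T where T: "finite T" "card T \<le> card S"
      "\<And>l. l \<in> W0 \<Longrightarrow> (\<forall>t\<in>T. ?p l t = 0) \<Longrightarrow> ?p l = (\<lambda>x. 0)" unfolding sep_def by auto
    show ?case
    proof (cases "\<forall>l\<in>W. (\<forall>t\<in>T. ?p l t = 0) \<longrightarrow> ?p l = (\<lambda>x. 0)")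
      case True
      then show ?thesis unfolding sep_def using T insert.hyps
        by (intro exI[of _ T]) auto
    next
      case False
      then obtain k where k: "k \<in> W" "\<forall>t\<in>T. ?p k t = 0" "?p k \<noteq> (\<lambda>x. 0)" by blast
      then obtain r where r: "?p k r \<noteq> 0" by blast
      have ks: "k s \<noteq> 0" using T(3)[of k] k by (auto simp: W0_def)
      have "?p l = (\<lambda>x. 0)" if l: "l \<in> W" "\<forall>t\<in>insert r T. ?p l t = 0" for l
      proof -
        \<comment> \<open>Subtracting the multiple of \<open>k\<close> that agrees with
          \<open>l\<close> at \<open>s\<close> brings \<open>l\<close> into \<open>W0\<close>, where
          \<open>T\<close> suffices; the factor is then read off at \<open>r\<close>.\<close>
        define l' where "l' = (\<lambda>x. l x - l s / k s * k x)"
        have "l' \<in> W" unfolding l'_def by (rule insert.prems(2)[OF l(1) k(1)])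
        then have "l' \<in> W0" using ks by (simp add: W0_def l'_def)
        moreover have "\<forall>t\<in>T. ?p l' t = 0"
        proof
          fix t assume "t \<in> T"
          then have lt: "?p l t = 0" and kt: "?p k t = 0" using l(2) k(2) by blast+
          have "?p l' t = ?p l t - l s / k s * ?p k t" by (simp add: l'_def)
          then show "?p l' t = 0" unfolding lt kt by simp
        qed
        ultimately have 0: "?p l' = (\<lambda>x. 0)" by (rule T(3))
        have eq: "?p l x = l s / k s * ?p k x" for x
        proof -
          have "?p l x - l s / k s * ?p k x = ?p l' x" by (simp add: l'_def)
          then show ?thesis using fun_cong[OF 0, of x] by linarith
        qed
        have "?p l r = 0" using l(2) by blast
        then have "l s / k s * ?p k r = 0" using eq[of r] by argo
        then have "l s / k s = 0" using r by (metis mult_eq_0_iff)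
        then show ?thesis using eq by (metis mult_zero_left)
      qed
      then show ?thesis unfolding sep_def using T insert.hyps
        by (intro exI[of _ "insert r T"]) (auto simp: card_insert_if)
    qed
  qed
  note key = this
  from assms(1) obtain S where S: "finite S" "card S \<le> n" "\<And>v. v \<in> W \<Longrightarrow> (\<forall>s\<in>S. v s = 0) \<Longrightarrow> v = (\<lambda>x. 0)"
    unfolding sep_def by auto
  show ?thesis by (rule sep_mono[OF key[OF S(1) S(3) assms(2)] subset_refl S(2)])
qed

lemma sep_rhom_extend:
  assumes "sep W n" "g \<in> hom G H" "group G" "\<And>v. v \<in> V \<Longrightarrow> rpull G g v \<in> W"
    "sep {v \<in> V. \<forall>x\<in>carrier G. v (g x) = 0} m"
  shows "sep V (n + m)"
  using assms(1) _ assms(4)[unfolded rpull_def]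
proof (rule sep_extend[where g = g and A = "carrier G"])
  show "sep {v \<in> V. \<forall>x. v (g x) = 0 \<or> x \<notin> carrier G} m"
    using assms(5) by (rule sep_mono) auto
qed auto

lemma sep_rpull:
  assumes "sep (rhom H) n"
  shows "sep {rpull G g l |l. l \<in> rhom H} n"
  using sep_image[OF assms rhom_lincomb, of "carrier G" g]
  unfolding rpull_def image_def by (rule sep_mono) auto

section \<open>The cross product with the circle\<close>

abbreviation push :: "int \<Rightarrow> 'a topology \<Rightarrow> 'b topology \<Rightarrow> ('a \<Rightarrow> 'b) \<Rightarrow> 'a chain set \<Rightarrow> 'b chain set" where
  "push p X Y f \<equiv> hom_induced p X {} Y {} f"

abbreviation hcl :: "nat \<Rightarrow> 'a topology \<Rightarrow> 'a chain \<Rightarrow> 'a chain set" where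
  "hcl p X c \<equiv> homologous_rel_set p X {} c"

abbreviation hfun :: "int \<Rightarrow> 'a topology \<Rightarrow> ('a chain set \<Rightarrow> rat) set" where
  "hfun p X \<equiv> rhom (homology_group p X)"

section \<open>Continuity rules for expressions with Euclidean values on abstract topological
  spaces\<close>

lemma continuous_map_tendsto:
  "continuous_map X euclidean f \<longleftrightarrow> (\<forall>x\<in>topspace X. (f \<longlongrightarrow> f x) (atin X x))"
  by (simp add: continuous_map_atin)

named_theorems cmi

lemma cmi_basic [cmi]:
  fixes f g :: "'a \<Rightarrow> 'b::real_normed_algebra_1"
  assumes "continuous_map X euclidean f" "continuous_map X euclidean g"
  shows "continuous_map X euclidean (\<lambda>x. f x + g x)" "continuous_map X euclidean (\<lambda>x. f x - g x)"
    "continuous_map X euclidean (\<lambda>x. f x * g x)"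
  using assms by (auto simp: continuous_map_tendsto intro!: tendsto_intros)

lemma cmi_unary [cmi]:
  fixes f :: "'a \<Rightarrow> 'b::real_normed_algebra_1"
  assumes "continuous_map X euclidean f"
  shows "continuous_map X euclidean (\<lambda>x. - f x)" "continuous_map X euclidean (\<lambda>x. norm (f x))"
    "continuous_map X euclidean (\<lambda>x. f x ^ n)"
  using assms by (auto simp: continuous_map_tendsto intro!: tendsto_intros)

lemma cmi_complex [cmi]:
  fixes f :: "'a \<Rightarrow> complex" and r s :: "'a \<Rightarrow> real"
  shows "continuous_map X euclidean f \<Longrightarrow> continuous_map X euclidean (\<lambda>x. cnj (f x))"
    "continuous_map X euclidean f \<Longrightarrow> continuous_map X euclidean (\<lambda>x. Re (f x))"
    "continuous_map X euclidean f \<Longrightarrow> continuous_map X euclidean (\<lambda>x. Im (f x))"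
    "continuous_map X euclidean r \<Longrightarrow> continuous_map X euclidean (\<lambda>x. of_real (r x) :: complex)"
    "continuous_map X euclidean r \<Longrightarrow> continuous_map X euclidean (\<lambda>x. cis (r x))"
    "continuous_map X euclidean r \<Longrightarrow> continuous_map X euclidean s \<Longrightarrow> continuous_map X euclidean (\<lambda>x. min (r x) (s x))"
    "continuous_map X euclidean r \<Longrightarrow> continuous_map X euclidean (\<lambda>x. \<bar>r x\<bar>)"
  unfolding cis_conv_exp
  by (auto simp: continuous_map_tendsto intro!: tendsto_intros)

lemma cmi_divide [cmi]:
  fixes f g :: "'a \<Rightarrow> 'b::real_normed_field"
  shows "continuous_map X euclidean f \<Longrightarrow> continuous_map X euclidean g \<Longrightarrow> (\<And>x. x \<in> topspace X \<Longrightarrow> g x \<noteq> 0) \<Longrightarrow>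
     continuous_map X euclidean (\<lambda>x. f x / g x)"
  by (auto simp: continuous_map_tendsto intro!: tendsto_intros)

lemma cmi_sgn [cmi]:
  fixes f :: "'a \<Rightarrow> complex"
  assumes "continuous_map X euclidean f" "\<And>x. x \<in> topspace X \<Longrightarrow> f x \<noteq> 0"
  shows "continuous_map X euclidean (\<lambda>x. sgn (f x))"
  using assms by (auto simp: continuous_map_tendsto intro!: tendsto_sgn)

lemma cmi_sum [cmi]:
  fixes f :: "'i \<Rightarrow> 'a \<Rightarrow> 'b::real_normed_algebra_1"
  shows "(\<And>i. i \<in> I \<Longrightarrow> continuous_map X euclidean (f i)) \<Longrightarrow> continuous_map X euclidean (\<lambda>x. \<Sum>i\<in>I. f i x)"
  by (auto simp: continuous_map_tendsto intro!: tendsto_intros)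

lemma cmi_misc [cmi]:
  "continuous_map X euclidean (\<lambda>x. c)"
  "continuous_map (prod_topology (top_of_set T) X) euclidean fst"
  "continuous_map (prod_topology euclidean X) euclidean fst"
  "continuous_map (prod_topology Y X) X snd"
  by (auto intro: continuous_map_into_fulltopology[OF continuous_map_fst] continuous_map_fst continuous_map_snd)

lemma continuous_map_top_of_set:
  "continuous_map X (top_of_set T) f \<longleftrightarrow> continuous_map X euclidean f \<and> (\<forall>x\<in>topspace X. f x \<in> T)"
  by (auto simp: continuous_map_in_subtopology)

abbreviation IX :: "'v topology \<Rightarrow> (real \<times> 'v) topology" where
  "IX V \<equiv> prod_topology (top_of_set {0..1}) V"

abbreviation SX :: "'v topology \<Rightarrow> (complex \<times> 'v) topology" where
  "SX V \<equiv> prod_topology (top_of_set (sphere 0 1)) V"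

lemma continuous_map_SX:
  "continuous_map X (SX V) f \<longleftrightarrow> continuous_map X euclidean (\<lambda>x. fst (f x)) \<and>
     (\<forall>x\<in>topspace X. norm (fst (f x)) = 1) \<and> continuous_map X V (\<lambda>x. snd (f x))"
  by (auto simp: continuous_map_pairwise comp_def continuous_map_top_of_set)

lemma continuous_map_IX:
  "continuous_map X (IX V) f \<longleftrightarrow> continuous_map X euclidean (\<lambda>x. fst (f x)) \<and>
     (\<forall>x\<in>topspace X. 0 \<le> fst (f x) \<and> fst (f x) \<le> 1) \<and> continuous_map X V (\<lambda>x. snd (f x))"
  by (auto simp: continuous_map_pairwise comp_def continuous_map_top_of_set)

lemma push_homotopic:
  assumes "continuous_map (IX X) Y h" "\<And>x. x \<in> topspace X \<Longrightarrow> h (0,x) = f x" "\<And>x. x \<in> topspace X \<Longrightarrow> h (1,x) = g x"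
  shows "push p X Y f = push p X Y g"
proof -
  have "homotopic_with (\<lambda>h. True) X Y f g"
    using assms by (subst homotopic_with) auto
  then show ?thesis by (rule homology_homotopy_empty)
qed

lemma push_compose:
  "\<lbrakk>continuous_map X Y f; continuous_map Y Z g\<rbrakk> \<Longrightarrow> push p Y Z g (push p X Y f x) = push p X Z (\<lambda>x. g (f x)) x"
  by (simp add: hom_induced_compose' comp_def)

lemma push_cong: "(\<And>x. x \<in> topspace X \<Longrightarrow> f x = g x) \<Longrightarrow> push p X Y f = push p X Y g"
  by (rule hom_induced_eq)

lemma push_id: "\<lbrakk>x \<in> carrier (homology_group p X); \<And>y. y \<in> topspace X \<Longrightarrow> f y = y; continuous_map X X f\<rbrakk> \<Longrightarrow> push p X X f x = x"
  by (rule hom_induced_id_gen)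

lemma push_hcl:
  "\<lbrakk>continuous_map X Y f; singular_relcycle p X {} c\<rbrakk> \<Longrightarrow> push (int p) X Y f (hcl p X c) = hcl p Y (chain_map p f c)"
  by (simp add: hom_induced_chain_map)

lemma hcl_carrier: "singular_relcycle p X {} c \<Longrightarrow> hcl p X c \<in> carrier (homology_group (int p) X)"
  by (auto simp: carrier_relative_homology_group)

lemma hcl_cases:
  assumes "x \<in> carrier (homology_group (int p) X)"
  obtains c where "singular_relcycle p X {} c" "x = hcl p X c"
  using assms by (auto simp: carrier_relative_homology_group)

lemma hcl_eq: "hcl p X a = hcl p X b \<longleftrightarrow> singular_relboundary p X {} (a - b)"
  unfolding homologous_rel_set_eq by (simp add: homologous_rel_def)

lemma hcl_one: "hcl p X a = \<one>\<^bsub>homology_group (int p) X\<^esub> \<longleftrightarrow> singular_relboundary p X {} a"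
  by (simp add: homologous_rel_set_eq_relboundary)

lemma hcl_add:
  assumes "singular_relcycle p X {} a" "singular_relcycle p X {} b"
  shows "hcl p X a \<otimes>\<^bsub>homology_group (int p) X\<^esub> hcl p X b = hcl p X (a + b)"
proof -
  let ?A = "hcl p X a" and ?B = "hcl p X b" and ?C = "hcl p X (a + b)"
  have "(\<Union>r\<in>?A. \<Union>s\<in>?B. {r + s}) = ?C"
  proof (intro equalityI subsetI)
    fix z assume "z \<in> (\<Union>r\<in>?A. \<Union>s\<in>?B. {r + s})"
    then obtain x y where "homologous_rel p X {} a x" "homologous_rel p X {} b y" "z = x + y" by auto
    then show "z \<in> ?C" using homologous_rel_add by simp
  next
    fix z assume "z \<in> ?C"
    then have "z - a \<in> ?B" by (simp add: homologous_rel_def algebra_simps)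
    moreover have "a \<in> ?A" "z = a + (z - a)" by simp_all
    ultimately show "z \<in> (\<Union>r\<in>?A. \<Union>s\<in>?B. {r + s})" by blast
  qed
  then show ?thesis by (simp only: mult_relative_homology_group)
qed

text \<open>A cylinder on a cycle \<open>z\<close>: a chain in \<open>[0,1] \<times> V\<close> joining the two ends and
  null-homologous in \<open>V\<close>, which makes it unique up to homology.\<close>

definition cyl :: "nat \<Rightarrow> 'v topology \<Rightarrow> 'v chain \<Rightarrow> (real \<times> 'v) chain \<Rightarrow> bool" where
  "cyl p V z c \<longleftrightarrow> singular_chain (Suc p) (IX V) c \<and>
     chain_boundary (Suc p) c = chain_map p (Pair 1) z - chain_map p (Pair 0) z \<and>
     singular_relboundary (Suc p) V {} (chain_map (Suc p) snd c)"

lemma cm_Pair_IX: "0 \<le> t \<Longrightarrow> t \<le> 1 \<Longrightarrow> continuous_map V (IX V) (Pair t)"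
  by (auto simp: continuous_map_IX)

lemma cm_snd_IX: "continuous_map (IX V) V snd"
  by (rule continuous_map_snd)

lemma chain_map_comp: "chain_map p h (chain_map p g c) = chain_map p (\<lambda>x. h (g x)) c"
  using fun_cong[OF chain_map_compose[of p h g], of c] by (simp add: comp_def)

text \<open>Any chain that fills the homotopy between the two end inclusions works after a
  correction: its projection to \<open>V\<close> is a cycle, because both ends project to the same
  chain, and a copy of it in the slice at 0 is subtracted.\<close>

lemma cyl_exists:
  assumes z: "singular_relcycle p V {} z" shows "\<exists>c. cyl p V z c"
proof -
  have "homotopic_with (\<lambda>h. True) V (IX V) (Pair 1) (Pair 0)"
    unfolding homotopic_with_def
    by (intro exI[of _ "\<lambda>(t,x). (1 - t, x)"]) (auto simp: continuous_map_IX case_prod_unfold intro!: cmi)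
  then have "homologous_rel p (IX V) {} (chain_map p (Pair 1) z) (chain_map p (Pair 0) z)"
    using z by (intro homotopic_imp_homologous_rel_chain_maps[where T = "{}" and S = V]) auto
  then obtain c where c: "singular_chain (Suc p) (IX V) c"
    "chain_boundary (Suc p) c = chain_map p (Pair 1) z - chain_map p (Pair 0) z"
    unfolding homologous_rel_def singular_boundary by blast
  let ?s = "chain_map (Suc p) snd c"
  have s: "singular_chain (Suc p) V ?s" by (rule singular_chain_chain_map[OF c(1) cm_snd_IX])
  have bs: "chain_boundary (Suc p) ?s = 0"
    using chain_boundary_chain_map[OF c(1), of snd] by (simp add: c(2) chain_map_diff chain_map_comp)
  let ?c = "c - chain_map (Suc p) (Pair 0) ?s"
  have "cyl p V z ?c"
    unfolding cyl_def
  proof (intro conjI)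
    show "singular_chain (Suc p) (IX V) ?c"
      by (intro singular_chain_diff c singular_chain_chain_map[OF s] cm_Pair_IX) auto
    show "chain_boundary (Suc p) ?c = chain_map p (Pair 1) z - chain_map p (Pair 0) z"
      using chain_boundary_chain_map[OF s, of "Pair 0"] by (simp add: chain_boundary_diff c(2) bs)
    have "chain_map (Suc p) snd ?c = chain_map (Suc p) snd c - chain_map (Suc p) (\<lambda>x. x) ?s"
      by (simp add: chain_map_diff chain_map_comp)
    also have "chain_map (Suc p) (\<lambda>x. x) ?s = ?s" by (rule chain_map_id_gen[OF s]) simp
    finally show "singular_relboundary (Suc p) V {} (chain_map (Suc p) snd ?c)" by simp
  qed
  then show ?thesis ..
qed

lemma cyl_cycle:
  assumes c: "cyl p V z c" and z: "singular_relcycle p V {} z" and F: "continuous_map (IX V) M F"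
    and e: "\<And>v. v \<in> topspace V \<Longrightarrow> F (0,v) = F (1,v)"
  shows "singular_relcycle (Suc p) M {} (chain_map (Suc p) F c)"
proof -
  have "chain_map p (\<lambda>v. F (1,v)) z = chain_map p (\<lambda>v. F (0,v)) z"
    using z by (intro chain_map_eq[where X = V]) (auto simp: singular_cycle e)
  then show ?thesis
    using c chain_boundary_chain_map[of "Suc p" "IX V" c F]
    by (auto simp: singular_cycle cyl_def chain_map_diff chain_map_comp intro: singular_chain_chain_map[OF _ F])
qed

text \<open>Up to the two end copies of a chain \<open>d\<close> joining their bases, two cylinders
  differ by a cycle of \<open>IX V\<close>. That space retracts to \<open>V\<close>, where both
  cylinders are null-homologous, so the cycle bounds; the end copies cancel under \<open>F\<close>
  because \<open>F\<close> agrees at both ends.\<close>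

lemma cyl_unique:
  assumes c: "cyl p V z c" "cyl p V z' c'" and zz: "singular_relboundary p V {} (z - z')"
    and F: "continuous_map (IX V) M F"
    and e: "\<And>v. v \<in> topspace V \<Longrightarrow> F (0,v) = F (1,v)"
  shows "hcl (Suc p) M (chain_map (Suc p) F c) = hcl (Suc p) M (chain_map (Suc p) F c')"
proof -
  obtain d where d: "singular_chain (Suc p) V d" "chain_boundary (Suc p) d = z - z'"
    using zz by (auto simp: singular_boundary)
  let ?P = "\<lambda>t. chain_map (Suc p) (Pair (t::real)) d"
  define x where "x = c - c' - (?P 1 - ?P 0)"
  have P: "singular_chain (Suc p) (IX V) (?P t)" "chain_boundary (Suc p) (?P t) = chain_map p (Pair t) z - chain_map p (Pair t) z'"
    if "0 \<le> t" "t \<le> 1" for t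
    using singular_chain_chain_map[OF d(1) cm_Pair_IX[OF that]] chain_boundary_chain_map[OF d(1), of "Pair t"]
    by (auto simp: d(2) chain_map_diff)
  have xc: "singular_relcycle (Suc p) (IX V) {} x"
    unfolding singular_cycle x_def using c
    by (auto simp: cyl_def chain_boundary_diff P intro!: singular_chain_diff P)
  have "singular_relboundary (Suc p) V {} (chain_map (Suc p) snd c - chain_map (Suc p) snd c')"
    using c by (intro singular_relboundary_diff) (auto simp: cyl_def)
  moreover have "chain_map (Suc p) snd x = chain_map (Suc p) snd c - chain_map (Suc p) snd c'"
    by (simp add: x_def chain_map_diff chain_map_comp)
  ultimately have "singular_relboundary (Suc p) V {} (chain_map (Suc p) snd x)" by simp
  then have "singular_relboundary (Suc p) (IX V) {} (chain_map (Suc p) (Pair 0) (chain_map (Suc p) snd x))"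
    by (rule singular_relboundary_chain_map[OF _ cm_Pair_IX]) auto
  then have 1: "singular_relboundary (Suc p) (IX V) {} (chain_map (Suc p) (\<lambda>x. (0, snd x)) x)"
    by (simp add: chain_map_comp)
  have "homotopic_with (\<lambda>h. True) (IX V) (IX V) (\<lambda>x. x) (\<lambda>x. (0, snd x))"
    unfolding homotopic_with_def
    by (intro exI[of _ "\<lambda>(t,x). ((1 - t) * fst x, snd x)"])
       (auto simp: continuous_map_IX case_prod_unfold mult_le_one
          intro!: cmi continuous_map_compose[OF continuous_map_snd, unfolded comp_def])
  then have "homologous_rel (Suc p) (IX V) {} (chain_map (Suc p) (\<lambda>x. x) x) (chain_map (Suc p) (\<lambda>x. (0, snd x)) x)"
    using xc by (intro homotopic_imp_homologous_rel_chain_maps[where T = "{}" and S = "IX V"]) auto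
  moreover have "chain_map (Suc p) (\<lambda>x. x) x = x"
    using xc by (intro chain_map_id_gen[where X = "IX V"]) (auto simp: singular_cycle)
  ultimately have "singular_relboundary (Suc p) (IX V) {} (x - chain_map (Suc p) (\<lambda>x. (0, snd x)) x)"
    by (simp add: homologous_rel_def)
  from singular_relboundary_add[OF this 1] have "singular_relboundary (Suc p) (IX V) {} x" by simp
  then have "singular_relboundary (Suc p) M {} (chain_map (Suc p) F x)"
    by (rule singular_relboundary_chain_map[OF _ F]) auto
  moreover have "chain_map (Suc p) (\<lambda>v. F (1,v)) d = chain_map (Suc p) (\<lambda>v. F (0,v)) d"
    using d by (intro chain_map_eq[where X = V]) (auto simp: e)
  ultimately show ?thesis
    unfolding hcl_eq x_def by (simp add: chain_map_diff chain_map_comp)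
qed

lemma cyl_natural:
  assumes c: "cyl p V z c" and z: "singular_relcycle p V {} z" and f: "continuous_map V W f"
  shows "cyl p W (chain_map p f z) (chain_map (Suc p) (\<lambda>(t,v). (t, f v)) c)"
proof -
  have F: "continuous_map (IX V) (IX W) (\<lambda>(t,v). (t, f v))"
    using continuous_map_compose[OF continuous_map_snd f, of "top_of_set {0..1::real}"]
    by (auto simp: continuous_map_IX case_prod_unfold comp_def intro!: cmi)
  have cc: "singular_chain (Suc p) (IX V) c" using c by (simp add: cyl_def)
  have "singular_relboundary (Suc p) W {} (chain_map (Suc p) f (chain_map (Suc p) snd c))"
    using c by (intro singular_relboundary_chain_map[OF _ f]) (auto simp: cyl_def)
  then show ?thesis
    using c chain_boundary_chain_map[OF cc, of "\<lambda>(t,v). (t, f v)"] singular_chain_chain_map[OF cc F]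
    by (auto simp: cyl_def chain_map_diff chain_map_comp case_prod_unfold)
qed

lemma cyl_add: "\<lbrakk>cyl p V z c; cyl p V z' c'\<rbrakk> \<Longrightarrow> cyl p V (z + z') (c + c')"
  unfolding cyl_def
  by (simp add: chain_boundary_add chain_map_add singular_chain_add singular_relboundary_add)

definition ee :: "real \<times> 'v \<Rightarrow> complex \<times> 'v" where
  "ee = (\<lambda>(t,v). (cis (2 * pi * t), v))"

lemma cm_ee: "continuous_map (IX V) (SX V) ee"
  by (auto simp: continuous_map_SX ee_def case_prod_unfold intro!: cmi)

lemma ee_ends: "ee (0,v) = ee (1,v)"
  by (simp add: ee_def)

text \<open>The cross product with the fundamental class of the circle. In negative degrees the homology
  groups are trivial and the value is the unit.\<close>

definition tau :: "int \<Rightarrow> 'v topology \<Rightarrow> 'v chain set \<Rightarrow> (complex \<times> 'v) chain set" where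
  "tau p V A = (if p < 0 then \<one>\<^bsub>homology_group (p + 1) (SX V)\<^esub> else
     hcl (Suc (nat p)) (SX V) (chain_map (Suc (nat p)) ee
       (SOME c. \<exists>z\<in>A. singular_relcycle (nat p) V {} z \<and> cyl (nat p) V z c)))"

text \<open>Independence of both choices, the representative and the cylinder, is
  \<open>cyl_unique\<close>.\<close>

lemma tau_hcl:
  assumes z: "singular_relcycle p V {} z" and c: "cyl p V z c"
  shows "tau (int p) V (hcl p V z) = hcl (Suc p) (SX V) (chain_map (Suc p) ee c)"
proof -
  let ?P = "\<lambda>c. \<exists>z'\<in>hcl p V z. singular_relcycle p V {} z' \<and> cyl p V z' c"
  have "?P c" using z c by (intro bexI[of _ z]) simp_all
  then have "?P (Eps ?P)" by (rule someI)
  then obtain z' where z': "z' \<in> hcl p V z" "singular_relcycle p V {} z'" "cyl p V z' (Eps ?P)" by blast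
  then have "hcl (Suc p) (SX V) (chain_map (Suc p) ee c) = hcl (Suc p) (SX V) (chain_map (Suc p) ee (Eps ?P))"
    by (intro cyl_unique[OF c _ _ cm_ee]) (auto simp: ee_ends homologous_rel_def)
  then show ?thesis by (simp add: tau_def)
qed

lemma neg_carrier: "p < 0 \<Longrightarrow> x \<in> carrier (homology_group p X) \<longleftrightarrow> x = \<one>\<^bsub>homology_group p X\<^esub>"
  by (simp add: relative_homology_group_def singleton_group_def)

lemma int_Suc: "int p + 1 = int (Suc p)" by simp

lemma tau_hom: "tau p V \<in> hom (homology_group p V) (homology_group (p + 1) (SX V))"
proof (cases "p < 0")
  case True
  then show ?thesis
    by (auto simp: hom_def tau_def group.is_monoid monoid.l_one)
next
  case False
  then obtain n where n: "p = int n" by (metis int_nat_eq not_less)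
  show ?thesis
    unfolding n int_Suc
  proof (rule homI)
    fix x assume "x \<in> carrier (homology_group (int n) V)"
    then obtain z where z: "singular_relcycle n V {} z" "x = hcl n V z" by (rule hcl_cases)
    obtain c where c: "cyl n V z c" using cyl_exists[OF z(1)] ..
    show "tau (int n) V x \<in> carrier (homology_group (int (Suc n)) (SX V))"
      unfolding z(2) tau_hcl[OF z(1) c]
      by (rule hcl_carrier[OF cyl_cycle[OF c z(1) cm_ee ee_ends]])
    fix y assume "y \<in> carrier (homology_group (int n) V)"
    then obtain z' where z': "singular_relcycle n V {} z'" "y = hcl n V z'" by (rule hcl_cases)
    obtain c' where c': "cyl n V z' c'" using cyl_exists[OF z'(1)] ..
    show "tau (int n) V (x \<otimes>\<^bsub>homology_group (int n) V\<^esub> y) =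
      tau (int n) V x \<otimes>\<^bsub>homology_group (int (Suc n)) (SX V)\<^esub> tau (int n) V y"
      unfolding z(2) z'(2) hcl_add[OF z(1) z'(1)] tau_hcl[OF z(1) c] tau_hcl[OF z'(1) c']
        tau_hcl[OF singular_relcycle_add[OF z(1) z'(1)] cyl_add[OF c c']]
        hcl_add[OF cyl_cycle[OF c z(1) cm_ee ee_ends] cyl_cycle[OF c' z'(1) cm_ee ee_ends]]
      by (simp add: chain_map_add)
  qed
qed

lemma tau_closed: "x \<in> carrier (homology_group p V) \<Longrightarrow> tau p V x \<in> carrier (homology_group (p + 1) (SX V))"
  using tau_hom by (auto simp: hom_def)

lemma push_closed: "push p X Y f x \<in> carrier (homology_group p Y)"
  by (rule hom_induced_carrier)

lemma push_one: "push p X Y f \<one>\<^bsub>homology_group p X\<^esub> = \<one>\<^bsub>homology_group p Y\<^esub>"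
  by (rule hom_one[OF hom_induced_hom]) auto

lemma push_mult:
  "\<lbrakk>x \<in> carrier (homology_group p X); y \<in> carrier (homology_group p X)\<rbrakk> \<Longrightarrow>
   push p X Y f (x \<otimes>\<^bsub>homology_group p X\<^esub> y) = push p X Y f x \<otimes>\<^bsub>homology_group p Y\<^esub> push p X Y f y"
  by (rule hom_mult[OF hom_induced_hom])

lemma push_tau:
  assumes "singular_relcycle p V {} z" "cyl p V z c" "continuous_map (SX V) M F"
  shows "push (int p + 1) (SX V) M F (tau (int p) V (hcl p V z)) = hcl (Suc p) M (chain_map (Suc p) (\<lambda>w. F (ee w)) c)"
  unfolding int_Suc
  by (simp only: tau_hcl[OF assms(1,2)] push_hcl[OF assms(3) cyl_cycle[OF assms(2,1) cm_ee ee_ends]] chain_map_comp)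

lemma cyl_cases:
  assumes "x \<in> carrier (homology_group (int p) V)"
  obtains z c where "singular_relcycle p V {} z" "x = hcl p V z" "cyl p V z c"
proof -
  obtain z where z: "singular_relcycle p V {} z" "x = hcl p V z" using assms by (rule hcl_cases)
  obtain c where "cyl p V z c" using cyl_exists[OF z(1)] ..
  with z show thesis by (rule that)
qed

lemma cm_SX_map: "continuous_map V W f \<Longrightarrow> continuous_map (SX V) (SX W) (\<lambda>(\<theta>,v). (\<theta>, f v))"
  using continuous_map_compose[OF continuous_map_snd, of V W f "top_of_set (sphere 0 1)"]
  by (auto simp: continuous_map_SX case_prod_unfold comp_def intro!: cmi)

lemma tau_natural:
  assumes f: "continuous_map V W f" and x: "x \<in> carrier (homology_group p V)"
  shows "push (p + 1) (SX V) (SX W) (\<lambda>(\<theta>,v). (\<theta>, f v)) (tau p V x) = tau p W (push p V W f x)"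
proof (cases "p < 0")
  case True
  then show ?thesis by (simp add: tau_def push_one)
next
  case False
  then obtain n where n: "p = int n" by (metis int_nat_eq not_less)
  obtain z c where zc: "singular_relcycle n V {} z" "x = hcl n V z" "cyl n V z c"
    using cyl_cases[OF x[unfolded n]] .
  have "tau (int n) W (push (int n) V W f x) = hcl (Suc n) (SX W) (chain_map (Suc n) ee (chain_map (Suc n) (\<lambda>(t,v). (t, f v)) c))"
    unfolding zc(2) push_hcl[OF f zc(1)]
    using zc(1) f by (intro tau_hcl[OF _ cyl_natural[OF zc(3,1) f]] singular_relcycle_chain_map) auto
  then show ?thesis
    unfolding n zc(2) push_tau[OF zc(1,3) cm_SX_map[OF f]] by (simp add: chain_map_comp ee_def case_prod_unfold)
qed

text \<open>Holds by the last clause of \<open>cyl\<close>, which normalizes away any component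
  coming from \<open>V\<close> itself.\<close>

lemma push_snd_tau:
  assumes x: "x \<in> carrier (homology_group p V)"
  shows "push (p + 1) (SX V) V snd (tau p V x) = \<one>\<^bsub>homology_group (p + 1) V\<^esub>"
proof (cases "p < 0")
  case True
  then show ?thesis by (simp add: tau_def push_one)
next
  case False
  then obtain n where n: "p = int n" by (metis int_nat_eq not_less)
  obtain z c where zc: "singular_relcycle n V {} z" "x = hcl n V z" "cyl n V z c"
    using cyl_cases[OF x[unfolded n]] .
  have "(\<lambda>w::real \<times> 'a. snd (ee w)) = snd" by (auto simp: ee_def)
  then show ?thesis
    unfolding n zc(2) push_tau[OF zc(1,3) continuous_map_snd] unfolding int_Suc hcl_one
    using zc(3) by (simp add: cyl_def)
qed

lemma cyl_concat:
  assumes c: "cyl p V z c" and z: "singular_relcycle p V {} z"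
  shows "cyl p V z (chain_map (Suc p) (\<lambda>(t,v). (t / 2, v)) c + chain_map (Suc p) (\<lambda>(t,v). ((t + 1) / 2, v)) c)"
proof -
  have F: "continuous_map (IX V) (IX V) (\<lambda>(t,v). (t / 2, v))" "continuous_map (IX V) (IX V) (\<lambda>(t,v). ((t + 1) / 2, v))"
    by (auto simp: continuous_map_IX case_prod_unfold intro!: cmi)
  have cc: "singular_chain (Suc p) (IX V) c" using c by (simp add: cyl_def)
  show ?thesis
    using c
    by (auto simp: cyl_def chain_boundary_add chain_boundary_chain_map[OF cc] chain_map_diff chain_map_add chain_map_comp
        case_prod_unfold intro!: singular_chain_add singular_chain_chain_map[OF cc] F[unfolded case_prod_unfold] singular_relboundary_add)
qed

text \<open>Addition of loops. Squaring maps each closed half circle once around the circle, so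
  \<open>F\<close> runs through \<open>F1\<close> and then through \<open>F2\<close>; on chains this
  is the subdivision of the cylinder at 1/2.\<close>

lemma tau_concat:
  assumes x: "x \<in> carrier (homology_group p V)"
    and F: "continuous_map (SX V) M F" "continuous_map (SX V) M F1" "continuous_map (SX V) M F2"
    and F1: "\<And>\<theta> v. norm \<theta> = 1 \<Longrightarrow> 0 \<le> Im \<theta> \<Longrightarrow> v \<in> topspace V \<Longrightarrow> F (\<theta>,v) = F1 (\<theta>\<^sup>2,v)"
    and F2: "\<And>\<theta> v. norm \<theta> = 1 \<Longrightarrow> Im \<theta> \<le> 0 \<Longrightarrow> v \<in> topspace V \<Longrightarrow> F (\<theta>,v) = F2 (\<theta>\<^sup>2,v)"
  shows "push (p+1) (SX V) M F (tau p V x) =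
    push (p+1) (SX V) M F1 (tau p V x) \<otimes>\<^bsub>homology_group (p+1) M\<^esub> push (p+1) (SX V) M F2 (tau p V x)"
proof (cases "p < 0")
  case True
  then show ?thesis by (simp add: tau_def push_one group.is_monoid monoid.l_one)
next
  case False
  then obtain n where n: "p = int n" by (metis int_nat_eq not_less)
  obtain z c where zc: "singular_relcycle n V {} z" "x = hcl n V z" "cyl n V z c"
    using cyl_cases[OF x[unfolded n]] .
  let ?d = "chain_map (Suc n) (\<lambda>(t,v). (t / 2, v)) c + chain_map (Suc n) (\<lambda>(t,v). ((t + 1) / 2, v)) c"
  have cc: "singular_chain (Suc n) (IX V) c" using zc by (simp add: cyl_def)
  have m: "continuous_map (IX V) M (\<lambda>w. G (ee w))" if "continuous_map (SX V) M G" for G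
    using continuous_map_compose[OF cm_ee that] by (simp add: comp_def)
  have cy: "singular_relcycle (Suc n) M {} (chain_map (Suc n) (\<lambda>w. G (ee w)) c)" if "continuous_map (SX V) M G" for G
    by (rule cyl_cycle[OF zc(3,1) m[OF that]]) (simp add: ee_ends)
  have "hcl (Suc n) M (chain_map (Suc n) (\<lambda>w. F (ee w)) c) = hcl (Suc n) M (chain_map (Suc n) (\<lambda>w. F (ee w)) ?d)"
    by (rule cyl_unique[OF zc(3) cyl_concat[OF zc(3,1)] _ m[OF F(1)]]) (auto simp: ee_ends)
  also have "chain_map (Suc n) (\<lambda>w. F (ee w)) ?d =
    chain_map (Suc n) (\<lambda>w. F1 (ee w)) c + chain_map (Suc n) (\<lambda>w. F2 (ee w)) c"
    unfolding chain_map_add chain_map_comp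
  proof (intro arg_cong2[where f = "(+)"] chain_map_eq[OF cc])
    fix w assume "w \<in> topspace (IX V)"
    then obtain t v where w: "w = (t,v)" "0 \<le> t" "t \<le> 1" "v \<in> topspace V" by auto
    have "0 \<le> sin (pi * t)" using w by (intro sin_ge_zero) (auto simp: mult_left_le)
    then have "F (cis (pi * t), v) = F1 ((cis (pi * t))\<^sup>2, v)" using w by (intro F1) auto
    then show "F (ee (case w of (t,v) \<Rightarrow> (t / 2, v))) = F1 (ee w)"
      unfolding w(1) by (simp add: ee_def Complex.DeMoivre mult.assoc)
    have "cis (pi * (t + 1)) = - cis (pi * t)" by (simp add: distrib_left flip: cis_mult)
    then have "F (cis (pi * (t + 1)), v) = F2 ((cis (pi * (t + 1)))\<^sup>2, v)"
      using w \<open>0 \<le> sin (pi * t)\<close> by (intro F2) auto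
    also have "(cis (pi * (t + 1)))\<^sup>2 = (cis (pi * t))\<^sup>2" unfolding \<open>cis (pi * (t + 1)) = - cis (pi * t)\<close> by simp
    finally show "F (ee (case w of (t,v) \<Rightarrow> ((t + 1) / 2, v))) = F2 (ee w)"
      unfolding w(1) by (simp add: ee_def Complex.DeMoivre mult.assoc)
  qed
  finally show ?thesis
    unfolding n zc(2) push_tau[OF zc(1,3) F(1)] push_tau[OF zc(1,3) F(2)] push_tau[OF zc(1,3) F(3)] unfolding int_Suc
    using hcl_add[OF cy[OF F(2)] cy[OF F(3)]] by simp
qed

section \<open>Exact sequences\<close>

abbreviation rel :: "int \<Rightarrow> 'a topology \<Rightarrow> 'a set \<Rightarrow> 'a chain set \<Rightarrow> 'a chain set" where
  "rel p X S \<equiv> hom_induced p X {} X S id"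

lemma homology_exact_1:
  "rel p X S ` carrier (homology_group p X) =
     kernel (relative_homology_group p X S) (homology_group (p-1) (subtopology X S)) (hom_boundary p X S)"
  using homology_exactness_axiom_1[of p X S] by simp

lemma homology_exact_2:
  "hom_boundary p X S ` carrier (relative_homology_group p X S) =
     kernel (homology_group (p-1) (subtopology X S)) (homology_group (p-1) X) (push (p-1) (subtopology X S) X id)"
  using homology_exactness_axiom_2[of p X S] by simp

lemma homology_exact_3:
  "push p (subtopology X S) X id ` carrier (homology_group p (subtopology X S)) =
     kernel (homology_group p X) (relative_homology_group p X S) (rel p X S)"
  using homology_exactness_axiom_3[of p X S] by simp

lemma hom_boundary_one: "hom_boundary p X S \<one>\<^bsub>relative_homology_group p X S\<^esub> = \<one>\<^bsub>homology_group (p-1) (subtopology X S)\<^esub>"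
  by (rule hom_one[OF hom_boundary_hom]) auto

text \<open>The set to be excised is the complement of \<open>U\<close>, which is closed and
  contained in the open set \<open>M\<close>.\<close>

lemma excision_open:
  assumes M: "openin X M" and U: "openin X U" and MU: "M \<union> U = topspace X"
  shows "hom_induced p (subtopology X U) (U \<inter> M) X M id
    \<in> iso (relative_homology_group p (subtopology X U) (U \<inter> M)) (relative_homology_group p X M)"
proof -
  have sub: "M \<subseteq> topspace X" "U \<subseteq> topspace X" using M U by (auto dest: openin_subset)
  have "X closure_of (topspace X - U) \<subseteq> X interior_of M"
    using U M MU by (simp add: closure_of_closedin interior_of_openin openin_closedin_eq) auto
  from homology_excision_axiom[OF this sub(1), of p]
  have "hom_induced p (subtopology X U) (M - (topspace X - U)) (subtopology X (topspace X)) M id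
    \<in> iso (relative_homology_group p (subtopology X U) (M - (topspace X - U)))
       (relative_homology_group p (subtopology X (topspace X)) M)"
    using sub by (simp add: double_diff)
  moreover have "M - (topspace X - U) = U \<inter> M" using sub by auto
  ultimately show ?thesis by simp
qed

lemma two_opens_generate:
  assumes "openin X S" "openin X T" "disjnt S T" "S \<union> T = topspace X" "x \<in> carrier (homology_group p X)"
  obtains u v where "u \<in> carrier (homology_group p (subtopology X S))" "v \<in> carrier (homology_group p (subtopology X T))"
    "x = push p (subtopology X S) X id u \<otimes>\<^bsub>homology_group p X\<^esub> push p (subtopology X T) X id v"
proof -
  have "x \<in> (\<lambda>(a,b). push p (subtopology X S) X id a \<otimes>\<^bsub>homology_group p X\<^esub> push p (subtopology X T) X id b) `
     carrier (DirProd (homology_group p (subtopology X S)) (homology_group p (subtopology X T)))"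
    using homology_additivity_explicit[OF assms(1-4), of p] assms(5) by (simp add: iso_def bij_betw_def)
  then show thesis by (auto intro: that)
qed

section \<open>Arcs of the circle times a space\<close>

definition DX :: "complex set \<Rightarrow> 'v topology \<Rightarrow> (complex \<times> 'v) topology" where
  "DX D V = subtopology (SX V) {w. fst w \<in> D}"

lemma topspace_DX [simp]: "topspace (DX D V) = {w. norm (fst w) = 1 \<and> fst w \<in> D \<and> snd w \<in> topspace V}"
  by (auto simp: DX_def)

lemma cm_subtopology: "continuous_map X Y f \<Longrightarrow> continuous_map (subtopology X S) Y f"
  by (rule continuous_map_from_subtopology)

lemma continuous_map_DX:
  "continuous_map X (DX D V) f \<longleftrightarrow> continuous_map X euclidean (\<lambda>x. fst (f x)) \<and>
     (\<forall>x\<in>topspace X. norm (fst (f x)) = 1 \<and> fst (f x) \<in> D) \<and> continuous_map X V (\<lambda>x. snd (f x))"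
  unfolding DX_def continuous_map_in_subtopology continuous_map_SX by auto

lemma cmi_fst_snd [cmi]:
  "continuous_map (IX (SX V)) euclidean (\<lambda>x. fst (snd x))"
  "continuous_map (IX (DX D V)) euclidean (\<lambda>x. fst (snd x))"
  "continuous_map (DX D V) euclidean fst"
  "continuous_map (IX (DX D V)) V (\<lambda>x. snd (snd x))"
  "continuous_map (IX (SX V)) V (\<lambda>x. snd (snd x))"
  "continuous_map (DX D V) V snd"
proof -
  have a: "continuous_map (DX D V) euclidean fst" "continuous_map (SX V) euclidean fst"
    "continuous_map (DX D V) V snd" "continuous_map (SX V) V snd"
    unfolding DX_def by (auto intro!: cmi cm_subtopology)
  then show "continuous_map (DX D V) euclidean fst" "continuous_map (DX D V) V snd" by auto
  show "continuous_map (IX (SX V)) euclidean (\<lambda>x. fst (snd x))"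
    "continuous_map (IX (DX D V)) euclidean (\<lambda>x. fst (snd x))"
    "continuous_map (IX (DX D V)) V (\<lambda>x. snd (snd x))"
    "continuous_map (IX (SX V)) V (\<lambda>x. snd (snd x))"
    using a[THEN continuous_map_compose[OF continuous_map_snd]] by (auto simp: comp_def)
qed

text \<open>Segments to \<open>c\<close> that avoid 0 can be normalized back to the circle, so the
  arc contracts to \<open>c\<close> and every class comes from the slice at
  \<open>c\<close>.\<close>

lemma arc_contract:
  assumes c: "norm c = 1" "c \<in> D"
    and D: "\<And>\<theta> t. \<theta> \<in> D \<Longrightarrow> norm \<theta> = 1 \<Longrightarrow> 0 \<le> t \<Longrightarrow> t \<le> 1 \<Longrightarrow>
      (1 - of_real t) * \<theta> + of_real t * c \<noteq> 0 \<and> sgn ((1 - of_real t) * \<theta> + of_real t * c) \<in> D"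
    and x: "x \<in> carrier (homology_group p (DX D V))"
  shows "x = push p V (DX D V) (Pair c) (push p (DX D V) V snd x)"
proof -
  have "push p (DX D V) (DX D V) (\<lambda>w. w) = push p (DX D V) (DX D V) (\<lambda>w. (c, snd w))"
    by (rule push_homotopic[where h = "\<lambda>(t,w). (sgn ((1 - of_real t) * fst w + of_real t * c), snd w)"])
      (use D in \<open>auto simp: continuous_map_DX case_prod_unfold norm_sgn c intro!: cmi\<close>, auto simp: sgn_eq c)
  moreover have "push p (DX D V) (DX D V) (\<lambda>w. w) x = x"
    using x by (rule push_id) auto
  moreover have "push p V (DX D V) (Pair c) (push p (DX D V) V snd x) = push p (DX D V) (DX D V) (\<lambda>w. (c, snd w)) x"
    by (rule push_compose) (use c in \<open>auto simp: continuous_map_DX intro!: cmi\<close>)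
  ultimately show ?thesis by simp
qed

text \<open>The two open half circles will carry the two ends of a boundary, the two once-punctured
  circles form the excisive cover. All are star-shaped about their midpoints after
  normalization.\<close>

lemma arcs:
  shows "\<theta> \<in> {\<theta>. Re \<theta> > 0} \<Longrightarrow> norm \<theta> = 1 \<Longrightarrow> 0 \<le> t \<Longrightarrow> t \<le> 1 \<Longrightarrow>
      (1 - of_real t) * \<theta> + of_real t * 1 \<noteq> 0 \<and> sgn ((1 - of_real t) * \<theta> + of_real t * 1) \<in> {\<theta>. Re \<theta> > 0}"
    "\<theta> \<in> {\<theta>. Re \<theta> < 0} \<Longrightarrow> norm \<theta> = 1 \<Longrightarrow> 0 \<le> t \<Longrightarrow> t \<le> 1 \<Longrightarrow>
      (1 - of_real t) * \<theta> + of_real t * (-1) \<noteq> 0 \<and> sgn ((1 - of_real t) * \<theta> + of_real t * (-1)) \<in> {\<theta>. Re \<theta> < 0}"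
    "\<theta> \<in> - {-\<i>} \<Longrightarrow> norm \<theta> = 1 \<Longrightarrow> 0 \<le> t \<Longrightarrow> t \<le> 1 \<Longrightarrow>
      (1 - of_real t) * \<theta> + of_real t * \<i> \<noteq> 0 \<and> sgn ((1 - of_real t) * \<theta> + of_real t * \<i>) \<in> - {-\<i>}"
    "\<theta> \<in> - {\<i>} \<Longrightarrow> norm \<theta> = 1 \<Longrightarrow> 0 \<le> t \<Longrightarrow> t \<le> 1 \<Longrightarrow>
      (1 - of_real t) * \<theta> + of_real t * (-\<i>) \<noteq> 0 \<and> sgn ((1 - of_real t) * \<theta> + of_real t * (-\<i>)) \<in> - {\<i>}"
proof -
  have pos: "0 < (1 - t) * a + t" if "0 < a" "0 \<le> t" "t \<le> 1" for a t :: real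
  proof (cases "t = 1")
    case False then show ?thesis using that by (intro add_pos_nonneg mult_pos_pos) auto
  qed simp
  show "(1 - of_real t) * \<theta> + of_real t * 1 \<noteq> 0 \<and> sgn ((1 - of_real t) * \<theta> + of_real t * 1) \<in> {\<theta>. Re \<theta> > 0}"
    if "\<theta> \<in> {\<theta>. Re \<theta> > 0}" "0 \<le> t" "t \<le> 1"
  proof -
    let ?z = "(1 - of_real t) * \<theta> + of_real t * 1"
    have "Re ?z > 0" using pos[of "Re \<theta>" t] that by simp
    moreover from this have "?z \<noteq> 0" by (metis less_irrefl zero_complex.sel(1))
    ultimately show ?thesis by (simp add: sgn_eq zero_less_divide_iff)
  qed
  show "(1 - of_real t) * \<theta> + of_real t * (-1) \<noteq> 0 \<and> sgn ((1 - of_real t) * \<theta> + of_real t * (-1)) \<in> {\<theta>. Re \<theta> < 0}"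
    if "\<theta> \<in> {\<theta>. Re \<theta> < 0}" "0 \<le> t" "t \<le> 1"
  proof -
    let ?z = "(1 - of_real t) * \<theta> + of_real t * (-1)"
    have "Re ?z < 0" using pos[of "- Re \<theta>" t] that by (simp add: algebra_simps)
    moreover from this have "?z \<noteq> 0" by (metis less_irrefl zero_complex.sel(1))
    ultimately show ?thesis by (simp add: sgn_eq divide_less_0_iff)
  qed
  \<comment> \<open>Both punctured circles at once: a segment can meet the imaginary axis only on
    the side of \<open>c\<close>, which is expressed by the sign of the product with
    \<open>Im c\<close>.\<close>
  have key: "(1 - of_real t) * \<theta> + of_real t * c \<noteq> 0 \<and> sgn ((1 - of_real t) * \<theta> + of_real t * c) \<noteq> - c"
    if c: "c = \<i> \<or> c = -\<i>" and th: "\<theta> \<noteq> - c" "norm \<theta> = 1" "0 \<le> t" "t \<le> 1" for c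
  proof -
    let ?z = "(1 - of_real t) * \<theta> + of_real t * c"
    have sq: "(Re \<theta>)\<^sup>2 + (Im \<theta>)\<^sup>2 = 1" using th(2) by (metis cmod_power2 one_power2)
    have "Re ?z \<noteq> 0 \<or> 0 < Im ?z * Im c"
    proof (cases "Re \<theta> = 0 \<or> t = 1")
      case False then show ?thesis using c by auto
    next
      case True
      then consider "t = 1" | "Re \<theta> = 0" by blast
      then show ?thesis
      proof cases
        case 1 then show ?thesis using c by auto
      next
        case 2
        then have "Im \<theta> = 1 \<or> Im \<theta> = -1" using sq by (auto simp: power2_eq_1_iff)
        then have "\<theta> = c" using 2 th(1) c by (auto simp: complex_eq_iff)
        then show ?thesis using c by (auto simp: algebra_simps)
      qed
    qed
    moreover have "Re c = 0" "Im c * Im c = 1" using c by auto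
    moreover have "?z = of_real (norm ?z) * sgn ?z" by (simp add: sgn_eq)
    ultimately show ?thesis
    proof (intro conjI notI)
      assume *: "Re ?z \<noteq> 0 \<or> 0 < Im ?z * Im c" "?z = 0"
      show False using *(1) unfolding *(2) by simp
    next
      assume *: "Re ?z \<noteq> 0 \<or> 0 < Im ?z * Im c" "Re c = 0" "Im c * Im c = 1"
        "?z = of_real (norm ?z) * sgn ?z" "sgn ?z = - c"
      define r where "r = norm ?z"
      have z: "?z = - of_real r * c" using *(4,5) unfolding r_def by simp
      have "Re ?z = 0" "Im ?z * Im c = - r * (Im c * Im c)" unfolding z using *(2) by simp_all
      moreover have "0 \<le> r" by (simp add: r_def)
      ultimately show False using *(1,3) by auto
    qed
  qed
  show "(1 - of_real t) * \<theta> + of_real t * \<i> \<noteq> 0 \<and> sgn ((1 - of_real t) * \<theta> + of_real t * \<i>) \<in> - {-\<i>}"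
    if "\<theta> \<in> - {-\<i>}" "norm \<theta> = 1" "0 \<le> t" "t \<le> 1" using key[of \<i>] that by auto
  show "(1 - of_real t) * \<theta> + of_real t * (-\<i>) \<noteq> 0 \<and> sgn ((1 - of_real t) * \<theta> + of_real t * (-\<i>)) \<in> - {\<i>}"
    if "\<theta> \<in> - {\<i>}" "norm \<theta> = 1" "0 \<le> t" "t \<le> 1" using key[of "-\<i>"] that by auto
qed

lemma openin_DX: "open D \<Longrightarrow> openin (SX V) {w \<in> topspace (SX V). fst w \<in> D}"
  by (rule openin_continuous_map_preimage[where Y = euclidean]) (auto intro!: cmi)

lemma subtopology_SX_eq: "subtopology (SX V) {w \<in> topspace (SX V). fst w \<in> D} = DX D V"
proof -
  have "{w \<in> topspace (SX V). fst w \<in> D} = topspace (SX V) \<inter> {w. fst w \<in> D}" by blast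
  then show ?thesis unfolding DX_def by (simp only: subtopology_restrict)
qed

text \<open>The part of the boundary of \<open>\<tau> y\<close> relative to the complement of \<open>\<i>\<close> is carried by the upper
  half circle.\<close>

lemma tau_relative:
  assumes y: "y \<in> carrier (homology_group p V)"
  defines "A \<equiv> {w \<in> topspace (SX V). fst w \<in> - {\<i>}}" and "J \<equiv> {w \<in> topspace (SX V). fst w \<in> - {-\<i>}}"
  obtains \<xi> where "\<xi> \<in> carrier (relative_homology_group (p+1) (subtopology (SX V) J) (J \<inter> A))"
    "rel (p+1) (SX V) A (tau p V y) = hom_induced (p+1) (subtopology (SX V) J) (J \<inter> A) (SX V) A id \<xi>"
    "hom_boundary (p+1) (subtopology (SX V) J) (J \<inter> A) \<xi> =
       push p V (subtopology (subtopology (SX V) J) (J \<inter> A)) (Pair (-1)) y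
       \<otimes>\<^bsub>homology_group p (subtopology (subtopology (SX V) J) (J \<inter> A))\<^esub>
       inv\<^bsub>homology_group p (subtopology (subtopology (SX V) J) (J \<inter> A))\<^esub>
         push p V (subtopology (subtopology (SX V) J) (J \<inter> A)) (Pair 1) y"
proof (cases "p < 0")
  case True
  show thesis
  proof (rule that)
    show "\<one>\<^bsub>relative_homology_group (p+1) (subtopology (SX V) J) (J \<inter> A)\<^esub>
      \<in> carrier (relative_homology_group (p+1) (subtopology (SX V) J) (J \<inter> A))"
      by (simp add: group.is_monoid)
    show "rel (p+1) (SX V) A (tau p V y) = hom_induced (p+1) (subtopology (SX V) J) (J \<inter> A) (SX V) A id
      \<one>\<^bsub>relative_homology_group (p+1) (subtopology (SX V) J) (J \<inter> A)\<^esub>"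
      using True by (simp add: tau_def hom_one[OF hom_induced_hom])
    show "hom_boundary (p+1) (subtopology (SX V) J) (J \<inter> A) \<one>\<^bsub>relative_homology_group (p+1) (subtopology (SX V) J) (J \<inter> A)\<^esub> =
       push p V (subtopology (subtopology (SX V) J) (J \<inter> A)) (Pair (-1)) y
       \<otimes>\<^bsub>homology_group p (subtopology (subtopology (SX V) J) (J \<inter> A))\<^esub>
       inv\<^bsub>homology_group p (subtopology (subtopology (SX V) J) (J \<inter> A))\<^esub>
         push p V (subtopology (subtopology (SX V) J) (J \<inter> A)) (Pair 1) y"
      using y True hom_boundary_one[of "p+1" "subtopology (SX V) J" "J \<inter> A"]
      by (simp add: neg_carrier push_one group.r_inv[OF group_relative_homology_group] group.is_monoid)
  qed
next
  case False
  then obtain n where n: "p = int n" by (metis int_nat_eq not_less)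
  obtain z c where zc: "singular_relcycle n V {} z" "y = hcl n V z" "cyl n V z c"
    using cyl_cases[OF y[unfolded n]] .
  let ?J = "subtopology (SX V) J" and ?K = "subtopology (subtopology (SX V) J) (J \<inter> A)"
  have cc: "singular_chain (Suc n) (IX V) c" "chain_boundary (Suc n) c = chain_map n (Pair 1) z - chain_map n (Pair 0) z"
    using zc by (simp_all add: cyl_def)
  \<comment> \<open>The upper and the lower half of the circle at half speed. The upper half avoids
    -\<i>; the lower half avoids \<i> and is therefore invisible relative to
    \<open>A\<close>.\<close>
  let ?E1 = "\<lambda>(t,v). (cis (pi * t), v)" and ?E2 = "\<lambda>(t,v). (cis (pi * (t+1)), v)"
  have sinpos: "0 \<le> sin (pi * t)" if "0 \<le> t" "t \<le> 1" for t
    using that by (intro sin_ge_zero) (auto simp: mult_left_le)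
  have E1: "continuous_map (IX V) ?J ?E1"
    unfolding J_def subtopology_SX_eq continuous_map_DX
    using sinpos by (auto simp: case_prod_unfold complex_eq_iff intro!: cmi) force
  have E2: "continuous_map (IX V) (subtopology (SX V) A) ?E2"
    unfolding A_def subtopology_SX_eq continuous_map_DX
    using sinpos by (auto simp: case_prod_unfold complex_eq_iff distrib_left intro!: cmi) force
  have K: "?K = DX (- {\<i>,-\<i>}) V"
  proof -
    have "J \<inter> (J \<inter> A) = topspace (SX V) \<inter> {w. fst w \<in> - {\<i>,-\<i>}}" by (auto simp: A_def J_def)
    then show ?thesis unfolding DX_def by (simp only: subtopology_subtopology subtopology_restrict)
  qed
  have P: "continuous_map V ?K (Pair 1)" "continuous_map V ?K (Pair (-1))"
    unfolding K continuous_map_DX by (auto simp: complex_eq_iff)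
  let ?c1 = "chain_map (Suc n) ?E1 c" and ?c2 = "chain_map (Suc n) ?E2 c"
  have c1: "singular_chain (Suc n) ?J ?c1" "singular_chain (Suc n) (subtopology (SX V) A) ?c2"
    by (auto intro: singular_chain_chain_map[OF cc(1)] E1 E2)
  have b1: "chain_boundary (Suc n) ?c1 = chain_map n (Pair (-1)) z - chain_map n (Pair 1) z"
    using chain_boundary_chain_map[OF cc(1), of ?E1]
    by (simp add: cc(2) chain_map_diff chain_map_comp)
  have zK: "singular_relcycle n ?K {} (chain_map n (Pair t) z)" if "t = 1 \<or> t = -1" for t
    using that P by (intro singular_relcycle_chain_map[OF zc(1)]) auto
  have rc: "singular_relcycle (Suc n) ?J (J \<inter> A) ?c1"
    unfolding singular_relcycle using c1(1) zK[of 1] zK[of "-1"]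
    by (simp add: b1 singular_cycle singular_chain_diff)
  show thesis
  proof (rule that)
    let ?\<xi> = "homologous_rel_set (Suc n) ?J (J \<inter> A) ?c1"
    show "?\<xi> \<in> carrier (relative_homology_group (p+1) ?J (J \<inter> A))"
      unfolding n int_Suc carrier_relative_homology_group using rc by blast
    have "tau p V y = hcl (Suc n) (SX V) (?c1 + ?c2)"
      unfolding n zc(2) tau_hcl[OF zc(1) cyl_concat[OF zc(3,1)]] chain_map_add chain_map_comp
      by (simp add: ee_def case_prod_unfold mult.assoc)
    moreover have cy: "singular_relcycle (Suc n) (SX V) {} (?c1 + ?c2)"
      using cyl_cycle[OF cyl_concat[OF zc(3,1)] zc(1) cm_ee ee_ends]
      unfolding chain_map_add chain_map_comp by (simp add: ee_def case_prod_unfold mult.assoc)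
    moreover have "homologous_rel_set (Suc n) (SX V) A (?c1 + ?c2) = homologous_rel_set (Suc n) (SX V) A ?c1"
      using singular_chain_imp_relboundary[OF c1(2)]
      by (simp only: homologous_rel_set_eq) (simp add: homologous_rel_def)
    moreover have "chain_map (Suc n) id (?c1 + ?c2) = ?c1 + ?c2"
      using cy by (intro chain_map_ident[where X = "SX V"]) (simp add: singular_cycle)
    moreover have "chain_map (Suc n) id ?c1 = ?c1"
      using c1 by (intro chain_map_ident[where X = ?J])
    ultimately show "rel (p+1) (SX V) A (tau p V y) = hom_induced (p+1) ?J (J \<inter> A) (SX V) A id ?\<xi>"
      unfolding n int_Suc using rc
      by (simp add: hom_induced_chain_map continuous_map_from_subtopology del: of_nat_Suc)
    let ?a = "chain_map n (Pair (-1)) z" and ?b = "chain_map n (Pair 1) z" and ?H = "homology_group (int n) ?K"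
    have z1: "singular_relcycle n ?K {} ?a" "singular_relcycle n ?K {} ?b" by (rule zK, simp)+
    have mb: "singular_relcycle n ?K {} (- ?b)" using z1(2) by (simp only: singular_relcycle_minus)
    have "hcl n ?K (- ?b) \<otimes>\<^bsub>?H\<^esub> hcl n ?K ?b = \<one>\<^bsub>?H\<^esub>"
      unfolding hcl_add[OF mb z1(2)] hcl_one by simp
    then have inv: "inv\<^bsub>?H\<^esub> (hcl n ?K ?b) = hcl n ?K (- ?b)"
      by (rule group.inv_equality[OF group_relative_homology_group _ hcl_carrier[OF z1(2)] hcl_carrier[OF mb]])
    have "hcl n ?K ?a \<otimes>\<^bsub>?H\<^esub> inv\<^bsub>?H\<^esub> (hcl n ?K ?b) = hcl n ?K (?a - ?b)"
      unfolding inv hcl_add[OF z1(1) mb] by simp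
    moreover have "hom_boundary (int (Suc n)) ?J (J \<inter> A) ?\<xi> = hcl n ?K (?a - ?b)"
    proof -
      have "1 \<le> Suc n" by simp
      note hom_boundary_chain_boundary[OF rc this]
      then show ?thesis by (simp only: b1 diff_Suc_Suc minus_nat.diff_0)
    qed
    moreover have "push (int n) V ?K (Pair 1) y = hcl n ?K ?b" "push (int n) V ?K (Pair (-1)) y = hcl n ?K ?a"
      unfolding zc(2) by (rule push_hcl[OF _ zc(1)], rule P)+
    ultimately show "hom_boundary (p+1) ?J (J \<inter> A) ?\<xi> =
       push p V ?K (Pair (-1)) y \<otimes>\<^bsub>homology_group p ?K\<^esub> inv\<^bsub>homology_group p ?K\<^esub> push p V ?K (Pair 1) y"
      unfolding n int_Suc by (simp only:)
  qed
qed

lemma hom_push: "push p X Y f \<in> hom (homology_group p X) (homology_group p Y)"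
  by (rule hom_induced_hom)

lemma hom_eq_imp_mult_inv:
  assumes "group G" "group H" "f \<in> hom G H" "x \<in> carrier G" "y \<in> carrier G" "f x = f y"
  shows "f (x \<otimes>\<^bsub>G\<^esub> inv\<^bsub>G\<^esub> y) = \<one>\<^bsub>H\<^esub>"
proof -
  interpret group_hom G H f using assms by (simp add: group_hom_def group_hom_axioms_def)
  show ?thesis using assms(4-6) by simp
qed

lemma group_mult_inv_eq:
  assumes "group G" "x \<in> carrier G" "y \<in> carrier G" "x \<otimes>\<^bsub>G\<^esub> inv\<^bsub>G\<^esub> y = \<one>\<^bsub>G\<^esub>"
  shows "x = y"
proof -
  interpret group G by fact
  show ?thesis using assms(2-4) by (metis inv_equality inv_closed inv_inv)
qed

text \<open>By excision \<open>x\<close> is given relative to \<open>A\<close> by a class on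
  \<open>J\<close>, whose boundary lives on two arcs and consists of some \<open>y\<close> at 1 and
  some \<open>y'\<close> at -1. It dies in \<open>J\<close>, so \<open>y\<close> is the inverse of
  \<open>y'\<close>, and the boundary agrees with that of \<open>tau y'\<close>. The remaining
  difference comes from \<open>A\<close>, which contracts to \<open>V\<close>, and is zero there by
  assumption.\<close>

lemma tau_surj:
  assumes x: "x \<in> carrier (homology_group (p+1) (SX V))"
    and sx: "push (p+1) (SX V) V snd x = \<one>\<^bsub>homology_group (p+1) V\<^esub>"
  obtains y where "y \<in> carrier (homology_group p V)" "x = tau p V y"
proof -
  define A where "A = {w \<in> topspace (SX V). fst w \<in> - {\<i>}}"
  define J where "J = {w \<in> topspace (SX V). fst w \<in> - {-\<i>}}"
  let ?T = "SX V" let ?J = "subtopology ?T J" let ?K = "subtopology ?J (J \<inter> A)"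
  have oA: "openin ?T A" and oJ: "openin ?T J"
    unfolding A_def J_def by (rule openin_DX, simp add: open_Compl)+
  have AJ: "A \<union> J = topspace ?T" by (auto simp: A_def J_def complex_eq_iff)
  let ?exc = "hom_induced (p+1) ?J (J \<inter> A) ?T A id"
  have exc: "?exc \<in> iso (relative_homology_group (p+1) ?J (J \<inter> A)) (relative_homology_group (p+1) ?T A)"
    by (rule excision_open[OF oA oJ AJ])
  have K: "?K = DX (- {\<i>,-\<i>}) V"
  proof -
    have "J \<inter> (J \<inter> A) = topspace (SX V) \<inter> {w. fst w \<in> - {\<i>,-\<i>}}" by (auto simp: A_def J_def)
    then show ?thesis unfolding DX_def by (simp only: subtopology_subtopology subtopology_restrict)
  qed
  have J': "?J = DX (- {-\<i>}) V" and A': "subtopology ?T A = DX (- {\<i>}) V"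
    unfolding A_def J_def by (rule subtopology_SX_eq)+
  have KJ: "continuous_map ?K ?J id" by (simp add: continuous_map_from_subtopology)
  have AT: "continuous_map (subtopology ?T A) ?T id" by (simp add: continuous_map_from_subtopology)
  have Jsnd: "continuous_map ?J V snd" unfolding J' by (intro cmi)
  have Asnd: "continuous_map (subtopology ?T A) V snd" unfolding A' by (intro cmi)
  have PK: "continuous_map V ?K (Pair 1)" "continuous_map V ?K (Pair (-1))"
    unfolding K continuous_map_DX by (auto simp: complex_eq_iff)
  have tc: "tau p V y \<in> carrier (homology_group (p+1) ?T)" if "y \<in> carrier (homology_group p V)" for y
    by (rule tau_closed[OF that])
  obtain \<xi> where \<xi>: "\<xi> \<in> carrier (relative_homology_group (p+1) ?J (J \<inter> A))" "?exc \<xi> = rel (p+1) ?T A x"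
  proof -
    have "rel (p+1) ?T A x \<in> ?exc ` carrier (relative_homology_group (p+1) ?J (J \<inter> A))"
      using exc hom_induced_carrier[of "p+1" ?T "{}" ?T A id x] by (simp add: iso_def bij_betw_def)
    then show thesis using that by (auto simp: image_iff)
  qed
  let ?b = "hom_boundary (p+1) ?J (J \<inter> A)"
  have b_hom: "?b \<in> hom (relative_homology_group (p+1) ?J (J \<inter> A)) (homology_group p ?K)"
    using hom_boundary_hom[of "p+1" ?J "J \<inter> A"] by simp
  have b_ker: "?b ` carrier (relative_homology_group (p+1) ?J (J \<inter> A)) = kernel (homology_group p ?K) (homology_group p ?J) (push p ?K ?J id)"
    using homology_exact_2[of "p+1" ?J "J \<inter> A"] by simp
  let ?HK = "homology_group p ?K" and ?HV = "homology_group p V"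
  interpret HK: comm_group ?HK by simp
  interpret HV: comm_group ?HV by simp
  have b\<xi>: "?b \<xi> \<in> carrier ?HK" "push p ?K ?J id (?b \<xi>) = \<one>\<^bsub>homology_group p ?J\<^esub>"
    using b_ker \<xi>(1) by (auto simp: kernel_def)
  obtain y y' where y: "y \<in> carrier ?HV" "y' \<in> carrier ?HV"
    "?b \<xi> = push p V ?K (Pair 1) y \<otimes>\<^bsub>?HK\<^esub> push p V ?K (Pair (-1)) y'"
  proof -
    let ?Kp = "{w \<in> topspace ?K. fst w \<in> {\<theta>. Re \<theta> > 0}}" and ?Km = "{w \<in> topspace ?K. fst w \<in> {\<theta>. Re \<theta> < 0}}"
    have oK: "openin ?K ?Kp" "openin ?K ?Km"
      unfolding K
      by (rule openin_continuous_map_preimage[where Y = euclidean]; auto intro!: cmi open_Collect_less continuous_intros)+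
    have un: "?Kp \<union> ?Km = topspace ?K"
    proof -
      have "0 < Re a \<or> Re a < 0" if "norm a = 1" "a \<noteq> \<i>" "a \<noteq> -\<i>" for a
      proof (rule ccontr)
        assume "\<not> (0 < Re a \<or> Re a < 0)"
        then have "Re a = 0" using that by simp
        moreover from this have "\<bar>Im a\<bar> = 1" using that(1) by (simp add: cmod_eq_Im)
        ultimately show False using that by (auto simp: complex_eq_iff abs_if split: if_splits)
      qed
      then show ?thesis unfolding K by auto
    qed
    have dj: "disjnt ?Kp ?Km" unfolding disjnt_def by fastforce
    obtain u v where uv: "u \<in> carrier (homology_group p (subtopology ?K ?Kp))" "v \<in> carrier (homology_group p (subtopology ?K ?Km))"
      "?b \<xi> = push p (subtopology ?K ?Kp) ?K id u \<otimes>\<^bsub>?HK\<^esub> push p (subtopology ?K ?Km) ?K id v"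
      by (rule two_opens_generate[OF oK dj un b\<xi>(1)])
    have eq: "subtopology ?K {w \<in> topspace ?K. fst w \<in> {\<theta>. Re \<theta> > 0}} = DX {\<theta>. Re \<theta> > 0} V"
      "subtopology ?K {w \<in> topspace ?K. fst w \<in> {\<theta>. Re \<theta> < 0}} = DX {\<theta>. Re \<theta> < 0} V"
    proof -
      have 1: "subtopology ?K {w \<in> topspace ?K. fst w \<in> D} = DX D V" if "\<i> \<notin> D" "- \<i> \<notin> D" for D
      proof -
        have "{w \<in> topspace ?K. fst w \<in> D} = topspace (SX V) \<inter> {w. fst w \<in> D}"
          using that by (auto simp: A_def J_def)
        moreover have "J \<inter> (J \<inter> A) \<inter> (topspace (SX V) \<inter> {w. fst w \<in> D}) = topspace (SX V) \<inter> {w. fst w \<in> D}"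
          using that by (auto simp: A_def J_def)
        ultimately show ?thesis
          unfolding DX_def by (simp only: subtopology_subtopology subtopology_restrict)
      qed
      show "subtopology ?K ?Kp = DX {\<theta>. Re \<theta> > 0} V" "subtopology ?K ?Km = DX {\<theta>. Re \<theta> < 0} V"
        by (rule 1, simp, simp)+
    qed
    have cont: "continuous_map (DX {\<theta>. Re \<theta> > 0} V) ?K id" "continuous_map (DX {\<theta>. Re \<theta> < 0} V) ?K id"
      unfolding K continuous_map_DX by (auto intro!: cmi)
    have "u = push p V (DX {\<theta>. Re \<theta> > 0} V) (Pair 1) (push p (DX {\<theta>. Re \<theta> > 0} V) V snd u)"
      by (rule arc_contract[OF _ _ arcs(1)]) (use uv(1) eq in auto)
    then have u: "push p (DX {\<theta>. Re \<theta> > 0} V) ?K id u = push p V ?K (Pair 1) (push p (DX {\<theta>. Re \<theta> > 0} V) V snd u)"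
      using push_compose[OF _ cont(1), where f = "Pair 1" and p = p and x = "push p (DX {\<theta>. Re \<theta> > 0} V) V snd u" and X = V]
      by (simp add: continuous_map_DX)
    have "v = push p V (DX {\<theta>. Re \<theta> < 0} V) (Pair (-1)) (push p (DX {\<theta>. Re \<theta> < 0} V) V snd v)"
      by (rule arc_contract[OF _ _ arcs(2)]) (use uv(2) eq in auto)
    then have v: "push p (DX {\<theta>. Re \<theta> < 0} V) ?K id v = push p V ?K (Pair (-1)) (push p (DX {\<theta>. Re \<theta> < 0} V) V snd v)"
      using push_compose[OF _ cont(2), where f = "Pair (-1)" and p = p and x = "push p (DX {\<theta>. Re \<theta> < 0} V) V snd v" and X = V]
      by (simp add: continuous_map_DX)
    show thesis
    proof (rule that)
      show "push p (DX {\<theta>. Re \<theta> > 0} V) V snd u \<in> carrier ?HV" "push p (DX {\<theta>. Re \<theta> < 0} V) V snd v \<in> carrier ?HV"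
        by (rule push_closed)+
      show "?b \<xi> = push p V ?K (Pair 1) (push p (DX {\<theta>. Re \<theta> > 0} V) V snd u) \<otimes>\<^bsub>?HK\<^esub>
          push p V ?K (Pair (-1)) (push p (DX {\<theta>. Re \<theta> < 0} V) V snd v)"
        unfolding uv(3) u[symmetric] v[symmetric] by (simp only: eq)
    qed
  qed
  have PJ: "continuous_map V ?J (Pair 1)" "continuous_map V ?J (Pair (-1))"
    using continuous_map_compose[OF PK(1) KJ] continuous_map_compose[OF PK(2) KJ] by auto
  have yy: "y \<otimes>\<^bsub>?HV\<^esub> y' = \<one>\<^bsub>?HV\<^esub>"
  proof -
    have snd1: "push p ?J V snd (push p ?K ?J id (push p V ?K (Pair t) z)) = z" if "t = 1 \<or> t = -1" "z \<in> carrier ?HV" for t z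
    proof -
      have P: "continuous_map V ?K (Pair t)" "continuous_map V ?J (Pair t)" using that PK PJ by auto
      have "push p ?J V snd (push p ?K ?J id (push p V ?K (Pair t) z)) = push p V V (\<lambda>v. snd (id (t, v))) z"
        by (simp only: push_compose[OF P(1) KJ] push_compose[OF _ Jsnd] P(2) id_apply)
      then show ?thesis using push_id[OF that(2), of "\<lambda>v. v"] by simp
    qed
    have "\<one>\<^bsub>?HV\<^esub> = push p ?J V snd (push p ?K ?J id (?b \<xi>))" unfolding b\<xi>(2) push_one ..
    also have "\<dots> = y \<otimes>\<^bsub>?HV\<^esub> y'"
      unfolding y(3) by (simp add: push_mult push_closed snd1 y(1,2))
    finally show ?thesis by simp
  qed
  then have y_inv: "y = inv\<^bsub>?HV\<^esub> y'" using y(1,2) by (metis HV.inv_equality)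
  obtain \<xi>' where \<xi>': "\<xi>' \<in> carrier (relative_homology_group (p+1) ?J (J \<inter> A))"
    "rel (p+1) ?T A (tau p V y') = ?exc \<xi>'"
    "?b \<xi>' = push p V ?K (Pair (-1)) y' \<otimes>\<^bsub>?HK\<^esub> inv\<^bsub>?HK\<^esub> push p V ?K (Pair 1) y'"
    using tau_relative[OF y(2)] unfolding A_def J_def by blast
  have "push p V ?K (Pair 1) y = inv\<^bsub>?HK\<^esub> push p V ?K (Pair 1) y'"
    unfolding y_inv using y(2)
    by (intro group_hom.hom_inv) (auto simp: group_hom_def group_hom_axioms_def hom_push)
  then have bb: "?b \<xi> = ?b \<xi>'"
    unfolding y(3) \<xi>'(3) by (simp add: HK.m_comm push_closed)
  have "\<xi> = \<xi>'"
  proof -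
    let ?R = "relative_homology_group (p+1) ?J (J \<inter> A)"
    have gR: "group ?R" by simp
    let ?d = "\<xi> \<otimes>\<^bsub>?R\<^esub> inv\<^bsub>?R\<^esub> \<xi>'"
    have d: "?d \<in> carrier ?R" using \<xi>(1) \<xi>'(1) by (simp add: group.is_monoid monoid.m_closed)
    have "?b ?d = \<one>\<^bsub>?HK\<^esub>"
      by (rule hom_eq_imp_mult_inv[OF gR _ b_hom \<xi>(1) \<xi>'(1) bb]) simp
    then have "?d \<in> kernel ?R (homology_group (p+1-1) ?K) ?b" using d by (simp add: kernel_def)
    then obtain e where e: "e \<in> carrier (homology_group (p+1) ?J)" "?d = rel (p+1) ?J (J \<inter> A) e"
      unfolding homology_exact_1[symmetric] by blast
    have sinpos: "sin (pi / 2 * (1 - t)) \<noteq> - 1" if "0 \<le> t" "t \<le> 1" for t :: real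
    proof -
      have "pi / 2 * (1 - t) \<le> pi / 2 * 1" using that by (intro mult_left_mono) auto
      then have "0 \<le> sin (pi / 2 * (1 - t))" using that pi_gt_zero by (intro sin_ge_zero) auto
      then show ?thesis by linarith
    qed
    \<comment> \<open>The contraction of \<open>J\<close> ends at \<i>, which is not in
      \<open>?K\<close>. A quarter turn moves the end to 1, so classes of \<open>J\<close> come from
      \<open>?K\<close> and vanish relatively.\<close>
    have "push (p+1) V ?J (Pair \<i>) = push (p+1) V ?J (Pair 1)"
    proof (rule push_homotopic[where h = "\<lambda>(t,v). (cis (pi / 2 * (1 - t)), v)"])
      show "continuous_map (IX V) ?J (\<lambda>(t,v). (cis (pi / 2 * (1 - t)), v))"
        unfolding J' continuous_map_DX case_prod_unfold
        using sinpos by (auto simp: complex_eq_iff intro!: cmi)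
    qed (auto simp: complex_eq_iff)
    moreover have "e = push (p+1) V ?J (Pair \<i>) (push (p+1) ?J V snd e)"
      unfolding J' by (rule arc_contract[OF _ _ arcs(3)]) (use e(1) in \<open>auto simp: J'\<close>)
    ultimately have "e = push (p+1) V ?J (Pair 1) (push (p+1) ?J V snd e)" by simp
    also have "\<dots> = push (p+1) ?K ?J id (push (p+1) V ?K (Pair 1) (push (p+1) ?J V snd e))"
      using push_compose[OF PK(1) KJ] by simp
    finally have "e \<in> kernel (homology_group (p+1) ?J) ?R (rel (p+1) ?J (J \<inter> A))"
      unfolding homology_exact_3[symmetric] using push_closed by blast
    then have "?d = \<one>\<^bsub>?R\<^esub>" using e(2) by (simp add: kernel_def)
    then show ?thesis by (rule group_mult_inv_eq[OF gR \<xi>(1) \<xi>'(1)])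
  qed
  then have "rel (p+1) ?T A x = rel (p+1) ?T A (tau p V y')" using \<xi>(2) \<xi>'(2) by simp
  let ?HT = "homology_group (p+1) ?T"
  let ?d = "x \<otimes>\<^bsub>?HT\<^esub> inv\<^bsub>?HT\<^esub> tau p V y'"
  have gT: "group ?HT" by simp
  have "rel (p+1) ?T A ?d = \<one>\<^bsub>relative_homology_group (p+1) ?T A\<^esub>"
    by (rule hom_eq_imp_mult_inv[OF gT _ hom_induced_hom x tc[OF y(2)]]) (simp, fact)
  moreover have dc: "?d \<in> carrier ?HT" using x tc[OF y(2)] by (simp add: group.is_monoid monoid.m_closed)
  ultimately have "?d \<in> kernel ?HT (relative_homology_group (p+1) ?T A) (rel (p+1) ?T A)" by (simp add: kernel_def)
  then obtain a where a: "a \<in> carrier (homology_group (p+1) (subtopology ?T A))" "?d = push (p+1) (subtopology ?T A) ?T id a"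
    unfolding homology_exact_3[symmetric] by blast
  have "push (p+1) ?T V snd ?d = \<one>\<^bsub>homology_group (p+1) V\<^esub>"
    by (rule hom_eq_imp_mult_inv[OF gT _ hom_push x tc[OF y(2)]]) (simp_all add: sx push_snd_tau[OF y(2)])
  then have "push (p+1) (subtopology ?T A) V snd a = \<one>\<^bsub>homology_group (p+1) V\<^esub>"
    unfolding a(2) push_compose[OF AT continuous_map_snd] by simp
  moreover have "a = push (p+1) V (subtopology ?T A) (Pair (-\<i>)) (push (p+1) (subtopology ?T A) V snd a)"
    unfolding A' by (rule arc_contract[OF _ _ arcs(4)]) (use a(1) in \<open>auto simp: A' complex_eq_iff\<close>)
  ultimately have "a = \<one>\<^bsub>homology_group (p+1) (subtopology ?T A)\<^esub>" by (simp add: push_one)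
  then have "?d = \<one>\<^bsub>?HT\<^esub>" using a(2) by (simp add: push_one)
  then have "x = tau p V y'" by (rule group_mult_inv_eq[OF gT x tc[OF y(2)]])
  then show thesis using that y(2) by blast
qed


section \<open>Loops in tori and the sign rules for cross products\<close>

lemma cm_SX_fst: "continuous_map (SX V) euclidean fst" and cm_SX_snd: "continuous_map (SX V) V snd"
  by (auto intro!: cmi)

lemma cm_SX2:
  "continuous_map (SX (SX V)) euclidean (\<lambda>x. fst (snd x))" "continuous_map (SX (SX V)) V (\<lambda>x. snd (snd x))"
  using continuous_map_compose[OF cm_SX_snd cm_SX_fst] continuous_map_compose[OF cm_SX_snd cm_SX_snd]
  by (auto simp: comp_def)

lemma cm_SX3:
  "continuous_map (SX (SX (SX V))) euclidean (\<lambda>x. fst (snd (snd x)))"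
  "continuous_map (SX (SX (SX V))) V (\<lambda>x. snd (snd (snd x)))"
  using continuous_map_compose[OF cm_SX_snd cm_SX2(1)] continuous_map_compose[OF cm_SX_snd cm_SX2(2)]
  by (auto simp: comp_def)

lemmas cm_SXs = cm_SX_fst cm_SX_snd cm_SX2 cm_SX3

text \<open>The diagonal of a torus is homotopic to running through one factor after the other.
  Folding the circle onto its upper half by \<open>?g\<close> gives a map \<open>?F\<close> that
  does exactly this, and \<open>?g\<close> is null-homotopic, which deforms \<open>?F\<close> to a
  rotated diagonal.\<close>

lemma tau_diag:
  assumes x: "x \<in> carrier (homology_group p V)"
  shows "push (p+1) (SX V) (SX (SX V)) (\<lambda>(\<theta>,v). (\<theta>,(\<theta>,v))) (tau p V x) =
    push (p+1) (SX V) (SX (SX V)) (\<lambda>(\<theta>,v). (\<theta>,(1,v))) (tau p V x)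
    \<otimes>\<^bsub>homology_group (p+1) (SX (SX V))\<^esub> push (p+1) (SX V) (SX (SX V)) (\<lambda>(\<theta>,v). (1,(\<theta>,v))) (tau p V x)"
proof -
  let ?g = "\<lambda>\<theta>. of_real (Re \<theta>) + \<i> * of_real \<bar>Im \<theta>\<bar>"
  let ?h = "\<lambda>t \<theta>. (1 - of_real t) * ?g \<theta> + of_real t * \<i> :: complex"
  \<comment> \<open>The circle coordinates of \<open>?F\<close> are
    \<open>(\<theta>\<^sup>2, 1)\<close> on the upper half and \<open>(1, \<theta>\<^sup>2)\<close>
    on the lower half.\<close>
  let ?F = "\<lambda>(\<theta>,v). (?g \<theta> * \<theta>, (cnj (?g \<theta>) * \<theta>, v))"
  let ?R = "\<lambda>(\<theta>,v). (\<i> * \<theta>, (- \<i> * \<theta>, v))"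
  have norm_g: "norm (?g \<theta>) = norm \<theta>" for \<theta> by (simp add: cmod_def)
  have h0: "?h t \<theta> \<noteq> 0" if "norm \<theta> = 1" "0 \<le> t" "t \<le> 1" for t \<theta>
  proof (cases "t = 0")
    case True then show ?thesis using norm_g[of \<theta>] that(1) by (metis add.right_neutral diff_zero mult_1 mult_zero_left norm_zero of_real_0 zero_neq_one)
  next
    case False
    have "0 \<le> (1 - t) * \<bar>Im \<theta>\<bar>" using that by simp
    moreover have "Im (?h t \<theta>) = (1 - t) * \<bar>Im \<theta>\<bar> + t" by simp
    ultimately have "0 < Im (?h t \<theta>)" using False that by linarith
    then show ?thesis by (metis less_irrefl zero_complex.sel(2))
  qed
  have F: "continuous_map (SX V) (SX (SX V)) ?F"
    using norm_g by (auto simp: continuous_map_SX case_prod_unfold norm_mult intro!: cmi simp del: complex_cnj_add)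
  have "push (p+1) (SX V) (SX (SX V)) ?F = push (p+1) (SX V) (SX (SX V)) ?R"
  proof (rule push_homotopic[where h = "\<lambda>(t,(\<theta>,v)). (sgn (?h t \<theta>) * \<theta>, (cnj (sgn (?h t \<theta>)) * \<theta>, v))"])
    show "continuous_map (IX (SX V)) (SX (SX V)) (\<lambda>(t,(\<theta>,v)). (sgn (?h t \<theta>) * \<theta>, (cnj (sgn (?h t \<theta>)) * \<theta>, v)))"
      unfolding continuous_map_SX case_prod_unfold fst_conv snd_conv
      using h0 by (auto simp: norm_mult norm_sgn simp del: complex_cnj_add complex_cnj_mult intro!: cmi)
    fix w assume "w \<in> topspace (SX V)"
    then obtain \<theta> v where w: "w = (\<theta>,v)" "norm \<theta> = 1" by auto
    have "sgn (?g \<theta>) = ?g \<theta>" using norm_g[of \<theta>] w(2) by (simp add: sgn_eq del: norm_eq_1)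
    then show "(case (0::real,w) of (t,(\<theta>,v)) \<Rightarrow> (sgn (?h t \<theta>) * \<theta>, (cnj (sgn (?h t \<theta>)) * \<theta>, v))) = ?F w"
      unfolding w(1) by simp
    show "(case (1::real,w) of (t,(\<theta>,v)) \<Rightarrow> (sgn (?h t \<theta>) * \<theta>, (cnj (sgn (?h t \<theta>)) * \<theta>, v))) = ?R w"
      unfolding w(1) by (simp add: sgn_eq)
  qed
  also have "\<dots> = push (p+1) (SX V) (SX (SX V)) (\<lambda>(\<theta>,v). (\<theta>,(\<theta>,v)))"
    by (rule push_homotopic[where h = "\<lambda>(t,(\<theta>,v)). (cis (pi / 2 * (1 - t)) * \<theta>, (cnj (cis (pi / 2 * (1 - t))) * \<theta>, v))"])
      (auto simp: continuous_map_SX case_prod_unfold norm_mult simp flip: cis_cnj intro!: cmi)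
  finally have 1: "push (p+1) (SX V) (SX (SX V)) (\<lambda>(\<theta>,v). (\<theta>,(\<theta>,v))) = push (p+1) (SX V) (SX (SX V)) ?F" ..
  have g: "?g \<theta> = (if 0 \<le> Im \<theta> then \<theta> else cnj \<theta>)" "cnj (?g \<theta>) = (if 0 \<le> Im \<theta> then cnj \<theta> else \<theta>)" for \<theta>
    by (auto simp: complex_eq_iff)
  have nn: "cnj \<theta> * \<theta> = 1" if "norm \<theta> = 1" for \<theta>
    using that by (metis complex_norm_square mult.commute of_real_1 one_power2)
  show ?thesis
    unfolding 1
  proof (rule tau_concat[OF x F])
    fix \<theta> v assume t: "norm (\<theta>::complex) = 1" "v \<in> topspace V"
    show "?F (\<theta>, v) = (case (\<theta>\<^sup>2, v) of (\<theta>,v) \<Rightarrow> (\<theta>,(1,v)))" if "0 \<le> Im \<theta>"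
      using that nn[OF t(1)] unfolding case_prod_conv g by (simp add: power2_eq_square)
    show "?F (\<theta>, v) = (case (\<theta>\<^sup>2, v) of (\<theta>,v) \<Rightarrow> (1,(\<theta>,v)))" if "Im \<theta> \<le> 0"
    proof (cases "Im \<theta> = 0")
      case True
      then have "\<theta> = cnj \<theta>" by (simp add: complex_eq_iff)
      then show ?thesis using True nn[OF t(1)] unfolding case_prod_conv g by (metis power2_eq_square order_refl)
    next
      case False
      then show ?thesis using that nn[OF t(1)] unfolding case_prod_conv g by (simp add: power2_eq_square)
    qed
  qed (auto simp: continuous_map_SX case_prod_unfold intro!: cmi)
qed

lemma tau_rotate:
  "push q (SX V) (SX V) (\<lambda>(\<theta>,v). (cis r * \<theta>, v)) = push q (SX V) (SX V) (\<lambda>w. w)"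
  by (rule push_homotopic[where h = "\<lambda>(t,(\<theta>,v)). (cis (r * (1 - t)) * \<theta>, v)"])
    (auto simp: continuous_map_SX case_prod_unfold norm_mult intro!: cmi)

lemma inv_unique_homology:
  assumes "x \<in> carrier (homology_group p X)" "y \<in> carrier (homology_group p X)"
    "x \<otimes>\<^bsub>homology_group p X\<^esub> y = \<one>\<^bsub>homology_group p X\<^esub>"
  shows "y = inv\<^bsub>homology_group p X\<^esub> x"
proof -
  interpret H: comm_group "homology_group p X" by simp
  show ?thesis using assms by (metis H.comm_inv_char)
qed

text \<open>Multiplying the first circle coordinate by the conjugate of the second makes the
  diagonal constant, so its class vanishes, while the two summands of \<open>tau_diag\<close> become
  \<open>tau p V x\<close> and its conjugate.\<close>

lemma tau_cnj:
  assumes x: "x \<in> carrier (homology_group p V)"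
  shows "push (p+1) (SX V) (SX V) (\<lambda>(\<theta>,v). (cnj \<theta>, v)) (tau p V x) = inv\<^bsub>homology_group (p+1) (SX V)\<^esub> (tau p V x)"
proof -
  let ?T = "\<lambda>(\<theta>,(\<eta>,v)). (\<theta> * cnj \<eta>, v)"
  have T: "continuous_map (SX (SX V)) (SX V) ?T"
    by (auto simp: continuous_map_SX case_prod_unfold norm_mult intro!: cmi cm_SXs)
  have c: "continuous_map (SX V) (SX (SX V)) (\<lambda>(\<theta>,v). (\<theta>,(\<theta>,v)))"
    "continuous_map (SX V) (SX (SX V)) (\<lambda>(\<theta>,v). (\<theta>,(1,v)))"
    "continuous_map (SX V) (SX (SX V)) (\<lambda>(\<theta>,v). (1,(\<theta>,v)))"
    by (auto simp: continuous_map_SX case_prod_unfold intro!: cmi)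
  have P1: "continuous_map V (SX V) (Pair 1)" by (auto simp: continuous_map_SX)
  have e: "push (p+1) (SX V) (SX V) (\<lambda>w. ?T (case w of (\<theta>,v) \<Rightarrow> (\<theta>,(\<theta>,v)))) = push (p+1) (SX V) (SX V) (\<lambda>w. (1, snd w))"
    by (rule push_cong) (auto, metis complex_norm_square of_real_1 one_power2)
  have "push (p+1) (SX (SX V)) (SX V) ?T (push (p+1) (SX V) (SX (SX V)) (\<lambda>(\<theta>,v). (\<theta>,(\<theta>,v))) (tau p V x)) = \<one>\<^bsub>homology_group (p+1) (SX V)\<^esub>"
    unfolding push_compose[OF c(1) T] e push_compose[OF cm_SX_snd P1, symmetric] push_snd_tau[OF x] push_one ..
  then have "push (p+1) (SX V) (SX V) (\<lambda>w. ?T (case w of (\<theta>,v) \<Rightarrow> (\<theta>,(1,v)))) (tau p V x) \<otimes>\<^bsub>homology_group (p+1) (SX V)\<^esub>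
     push (p+1) (SX V) (SX V) (\<lambda>w. ?T (case w of (\<theta>,v) \<Rightarrow> (1,(\<theta>,v)))) (tau p V x) = \<one>\<^bsub>homology_group (p+1) (SX V)\<^esub>"
    unfolding tau_diag[OF x] push_mult[OF push_closed push_closed] push_compose[OF c(2) T] push_compose[OF c(3) T] .
  moreover have "push (p+1) (SX V) (SX V) (\<lambda>w. ?T (case w of (\<theta>,v) \<Rightarrow> (\<theta>,(1,v)))) (tau p V x) = tau p V x"
    by (rule push_id[OF tau_closed[OF x]]) (auto simp: case_prod_unfold)
  moreover have "(\<lambda>w. ?T (case w of (\<theta>,v::'a) \<Rightarrow> (1,(\<theta>,v)))) = (\<lambda>(\<theta>,v). (cnj \<theta>, v))"
    by auto
  ultimately show ?thesis by (intro inv_unique_homology tau_closed[OF x] push_closed) simp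
qed

lemma tau_inv:
  assumes "x \<in> carrier (homology_group p V)"
  shows "tau p V (inv\<^bsub>homology_group p V\<^esub> x) = inv\<^bsub>homology_group (p+1) (SX V)\<^esub> (tau p V x)"
  by (rule group_hom.hom_inv) (use assms tau_hom in \<open>auto simp: group_hom_def group_hom_axioms_def\<close>)

lemma tau_mult:
  assumes "x \<in> carrier (homology_group p V)" "y \<in> carrier (homology_group p V)"
  shows "tau p V (x \<otimes>\<^bsub>homology_group p V\<^esub> y) = tau p V x \<otimes>\<^bsub>homology_group (p+1) (SX V)\<^esub> tau p V y"
  by (rule hom_mult[OF tau_hom assms])

lemma push_inv:
  assumes "x \<in> carrier (homology_group p X)"
  shows "push p X Y f (inv\<^bsub>homology_group p X\<^esub> x) = inv\<^bsub>homology_group p Y\<^esub> (push p X Y f x)"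
  by (rule group_hom.hom_inv) (use assms in \<open>auto simp: group_hom_def group_hom_axioms_def hom_push\<close>)

definition tau2 :: "int \<Rightarrow> 'v topology \<Rightarrow> 'v chain set \<Rightarrow> (complex \<times> complex \<times> 'v) chain set" where
  "tau2 p W w = tau (p+1) (SX W) (tau p W w)"

lemma tau2_closed: "w \<in> carrier (homology_group p W) \<Longrightarrow> tau2 p W w \<in> carrier (homology_group (p+1+1) (SX (SX W)))"
  unfolding tau2_def by (intro tau_closed)

text \<open>The square of the rotation operator vanishes: the class lies in the image of \<open>\<tau>\<close>, where complex
  conjugation acts by \<open>-1\<close>, while conjugating both circles acts by \<open>(-1)\<^sup>2\<close>.\<close>

lemma tau2_degenerate:
  assumes w: "w \<in> carrier (homology_group p W)" and k: "k \<in> hfun (p+1+1) M"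
    and f: "continuous_map (SX W) M f"
  shows "k (push (p+1+1) (SX (SX W)) M (\<lambda>(\<zeta>,(\<theta>,v)). f (\<zeta> * \<theta>, v)) (tau2 p W w)) = 0"
proof -
  let ?m = "\<lambda>(\<zeta>,(\<theta>,v)). (\<zeta> * \<theta>, v)"
  let ?c = "\<lambda>(\<theta>,v). (cnj \<theta>, v)"
  let ?Om = "tau2 p W w"
  let ?x = "push (p+1+1) (SX (SX W)) (SX W) ?m ?Om"
  let ?H = "homology_group (p+1+1) (SX W)"
  have m: "continuous_map (SX (SX W)) (SX W) ?m"
    by (auto simp: continuous_map_SX case_prod_unfold norm_mult intro!: cmi cm_SXs)
  have c: "continuous_map (SX V) (SX V) ?c" for V
    by (auto simp: continuous_map_SX case_prod_unfold intro!: cmi)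
  have tw: "tau p W w \<in> carrier (homology_group (p+1) (SX W))" by (rule tau_closed[OF w])
  have "push (p+1+1) (SX W) W snd ?x = push (p+1+1) (SX (SX W)) W (\<lambda>u. snd (snd u)) ?Om"
    unfolding push_compose[OF m cm_SX_snd] by (simp add: case_prod_unfold)
  also have "\<dots> = push (p+1+1) (SX W) W snd (push (p+1+1) (SX (SX W)) (SX W) snd ?Om)"
    by (rule push_compose[OF cm_SX_snd cm_SX_snd, symmetric])
  also have "\<dots> = \<one>\<^bsub>homology_group (p+1+1) W\<^esub>"
    unfolding tau2_def push_snd_tau[OF tw] push_one ..
  finally obtain b where b: "b \<in> carrier (homology_group (p+1) W)" "?x = tau (p+1) W b"
    using tau_surj[OF push_closed] by blast
  have 1: "push (p+1+1) (SX W) (SX W) ?c ?x = inv\<^bsub>?H\<^esub> ?x"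
    unfolding b(2) by (rule tau_cnj[OF b(1)])
  have e1: "push (p+1+1) (SX (SX W)) (SX (SX W)) (\<lambda>(\<zeta>,u). (\<zeta>, ?c u)) ?Om = inv\<^bsub>homology_group (p+1+1) (SX (SX W))\<^esub> ?Om"
    unfolding tau2_def tau_natural[OF c tw] tau_cnj[OF w] by (rule tau_inv[OF tw])
  have e2: "push (p+1+1) (SX (SX W)) (SX (SX W)) ?c ?Om = inv\<^bsub>homology_group (p+1+1) (SX (SX W))\<^esub> ?Om"
    unfolding tau2_def by (rule tau_cnj[OF tw])
  have "push (p+1+1) (SX (SX W)) (SX (SX W)) ?c (push (p+1+1) (SX (SX W)) (SX (SX W)) (\<lambda>(\<zeta>,u). (\<zeta>, ?c u)) ?Om) = ?Om"
    unfolding e1 push_inv[OF tau2_closed[OF w]] e2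
    by (rule group.inv_inv[OF group_relative_homology_group tau2_closed[OF w]])
  then have "?x = push (p+1+1) (SX (SX W)) (SX W) ?m (push (p+1+1) (SX (SX W)) (SX (SX W)) ?c (push (p+1+1) (SX (SX W)) (SX (SX W)) (\<lambda>(\<zeta>,u). (\<zeta>, ?c u)) ?Om))"
    by simp
  also have "\<dots> = push (p+1+1) (SX (SX W)) (SX W) (\<lambda>u. ?c (?m u)) ?Om"
  proof -
    have 2: "continuous_map (SX (SX W)) (SX (SX W)) (\<lambda>u. ?c ((\<lambda>(\<zeta>,u). (\<zeta>, ?c u)) u))"
      using continuous_map_compose[OF cm_SX_map[OF c] c] by (simp add: comp_def)
    show ?thesis
      unfolding push_compose[OF cm_SX_map[OF c] c] push_compose[OF 2 m]
      by (rule fun_cong[OF push_cong]) auto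
  qed
  also have "\<dots> = inv\<^bsub>?H\<^esub> ?x" unfolding 1[symmetric] by (rule push_compose[OF m c, symmetric])
  \<comment> \<open>Hence \<open>?x\<close> is 2-torsion, which a rational functional cannot
    see.\<close>
  finally have inv: "?x = inv\<^bsub>?H\<^esub> ?x" .
  have k': "rpull ?H (push (p+1+1) (SX W) M f) k \<in> rhom ?H"
    by (rule rpull_rhom[OF hom_push k]) simp
  have "k (push (p+1+1) (SX W) M f ?x) = rpull ?H (push (p+1+1) (SX W) M f) k (inv\<^bsub>?H\<^esub> ?x)"
    by (subst inv[symmetric]) (simp add: rpull_def push_closed)
  also have "\<dots> = - rpull ?H (push (p+1+1) (SX W) M f) k ?x"
    by (rule rhom_inv[OF _ k' push_closed]) simp
  finally have "k (push (p+1+1) (SX W) M f ?x) = 0" by (simp add: rpull_def push_closed)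
  moreover have "push (p+1+1) (SX W) M f ?x = push (p+1+1) (SX (SX W)) M (\<lambda>(\<zeta>,(\<theta>,v)). f (\<zeta> * \<theta>, v)) ?Om"
    unfolding push_compose[OF m f] by (simp add: case_prod_unfold)
  ultimately show ?thesis by simp
qed

text \<open>With the next lemma: a functional on maps of the torus is additive in a circle variable
  that is used twice.\<close>

lemma tau2_outer_diag:
  assumes w: "w \<in> carrier (homology_group p W)" and k: "k \<in> hfun (p+1+1) M"
    and K: "continuous_map (SX (SX (SX W))) M K"
  shows "k (push (p+1+1) (SX (SX W)) M (\<lambda>(\<zeta>,u). K (\<zeta>,(\<zeta>,u))) (tau2 p W w)) =
    k (push (p+1+1) (SX (SX W)) M (\<lambda>(\<zeta>,u). K (\<zeta>,(1,u))) (tau2 p W w))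
    + k (push (p+1+1) (SX (SX W)) M (\<lambda>(\<zeta>,u). K (1,(\<zeta>,u))) (tau2 p W w))"
proof -
  have tw: "tau p W w \<in> carrier (homology_group (p+1) (SX W))" by (rule tau_closed[OF w])
  let ?V = "SX W" and ?q = "p+1+1"
  have c: "continuous_map (SX ?V) (SX (SX ?V)) (\<lambda>(\<theta>,v). (\<theta>,(\<theta>,v)))"
    "continuous_map (SX ?V) (SX (SX ?V)) (\<lambda>(\<theta>,v). (\<theta>,(1,v)))"
    "continuous_map (SX ?V) (SX (SX ?V)) (\<lambda>(\<theta>,v). (1,(\<theta>,v)))"
    by (auto simp: continuous_map_SX case_prod_unfold intro!: cmi cm_SXs)
  have "push ?q (SX (SX ?V)) M K (push ?q (SX ?V) (SX (SX ?V)) (\<lambda>(\<theta>,v). (\<theta>,(\<theta>,v))) (tau2 p W w)) =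
    push ?q (SX (SX ?V)) M K (push ?q (SX ?V) (SX (SX ?V)) (\<lambda>(\<theta>,v). (\<theta>,(1,v))) (tau2 p W w))
    \<otimes>\<^bsub>homology_group ?q M\<^esub> push ?q (SX (SX ?V)) M K (push ?q (SX ?V) (SX (SX ?V)) (\<lambda>(\<theta>,v). (1,(\<theta>,v))) (tau2 p W w))"
    unfolding tau2_def tau_diag[OF tw] by (rule push_mult; rule push_closed)
  then show ?thesis
    unfolding push_compose[OF c(1) K] push_compose[OF c(2) K] push_compose[OF c(3) K]
    using rhom_mult[OF k] by (simp add: push_closed case_prod_unfold)
qed

lemma tau2_inner_diag:
  assumes w: "w \<in> carrier (homology_group p W)" and k: "k \<in> hfun (p+1+1) M"
    and K: "continuous_map (SX (SX (SX W))) M K"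
  shows "k (push (p+1+1) (SX (SX W)) M (\<lambda>(\<zeta>,(\<theta>,v)). K (\<zeta>,(\<theta>,(\<theta>,v)))) (tau2 p W w)) =
    k (push (p+1+1) (SX (SX W)) M (\<lambda>(\<zeta>,(\<theta>,v)). K (\<zeta>,(\<theta>,(1,v)))) (tau2 p W w))
    + k (push (p+1+1) (SX (SX W)) M (\<lambda>(\<zeta>,(\<theta>,v)). K (\<zeta>,(1,(\<theta>,v)))) (tau2 p W w))"
proof -
  have tw: "tau p W w \<in> carrier (homology_group (p+1) (SX W))" by (rule tau_closed[OF w])
  let ?q = "p+1+1"
  let ?d = "\<lambda>(\<theta>,v). (\<theta>,(\<theta>,v))" and ?a = "\<lambda>(\<theta>,v). (\<theta>,(1,v))" and ?b = "\<lambda>(\<theta>,v). (1,(\<theta>,v))"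
  have c: "continuous_map (SX W) (SX (SX W)) ?d" "continuous_map (SX W) (SX (SX W)) ?a" "continuous_map (SX W) (SX (SX W)) ?b"
    by (auto simp: continuous_map_SX case_prod_unfold intro!: cmi cm_SXs)
  have "push ?q (SX (SX W)) (SX (SX (SX W))) (\<lambda>(\<zeta>,u). (\<zeta>, ?d u)) (tau2 p W w) =
     push ?q (SX (SX W)) (SX (SX (SX W))) (\<lambda>(\<zeta>,u). (\<zeta>, ?a u)) (tau2 p W w)
     \<otimes>\<^bsub>homology_group ?q (SX (SX (SX W)))\<^esub> push ?q (SX (SX W)) (SX (SX (SX W))) (\<lambda>(\<zeta>,u). (\<zeta>, ?b u)) (tau2 p W w)"
    unfolding tau2_def tau_natural[OF c(1) tw] tau_natural[OF c(2) tw] tau_natural[OF c(3) tw] tau_diag[OF w]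
    by (rule tau_mult; rule push_closed)
  then have "push ?q (SX (SX (SX W))) M K (push ?q (SX (SX W)) (SX (SX (SX W))) (\<lambda>(\<zeta>,u). (\<zeta>, ?d u)) (tau2 p W w)) =
     push ?q (SX (SX (SX W))) M K (push ?q (SX (SX W)) (SX (SX (SX W))) (\<lambda>(\<zeta>,u). (\<zeta>, ?a u)) (tau2 p W w))
     \<otimes>\<^bsub>homology_group ?q M\<^esub> push ?q (SX (SX (SX W))) M K (push ?q (SX (SX W)) (SX (SX (SX W))) (\<lambda>(\<zeta>,u). (\<zeta>, ?b u)) (tau2 p W w))"
    by (simp only:) (rule push_mult; rule push_closed)
  then show ?thesis
    unfolding push_compose[OF cm_SX_map[OF c(1)] K] push_compose[OF cm_SX_map[OF c(2)] K] push_compose[OF cm_SX_map[OF c(3)] K]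
    using rhom_mult[OF k] by (simp add: push_closed case_prod_unfold)
qed

text \<open>Expanding the repeated variable by the two diagonal rules leaves, besides the wanted
  terms, only maps of the product \<zeta> * \<theta>, which vanish by
  \<open>tau2_degenerate\<close>. The outcome is the determinant of an integer matrix acting on the
  torus: 1 for a shear, -1 for the exchange and for its product with a shear.\<close>

lemma tau2_torus:
  assumes w: "w \<in> carrier (homology_group p W)" and k: "k \<in> hfun (p+1+1) M" and f: "continuous_map (SX (SX W)) M f"
  shows "k (push (p+1+1) (SX (SX W)) M (\<lambda>(\<zeta>,(\<theta>,v)). f (\<zeta> * \<theta>,(\<theta>,v))) (tau2 p W w)) = k (push (p+1+1) (SX (SX W)) M f (tau2 p W w))"
    "k (push (p+1+1) (SX (SX W)) M (\<lambda>(\<zeta>,(\<theta>,v)). f (\<theta>,(\<zeta>,v))) (tau2 p W w)) = - k (push (p+1+1) (SX (SX W)) M f (tau2 p W w))"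
    "k (push (p+1+1) (SX (SX W)) M (\<lambda>(\<zeta>,(\<theta>,v)). f (\<theta>,(\<zeta> * \<theta>,v))) (tau2 p W w)) = - k (push (p+1+1) (SX (SX W)) M f (tau2 p W w))"
proof -
  let ?D = "\<lambda>g. k (push (p+1+1) (SX (SX W)) M g (tau2 p W w))"
  have K: "continuous_map (SX (SX (SX W))) M (\<lambda>(\<zeta>,(\<eta>,(\<theta>,v))). f (\<zeta> * \<theta>,(\<eta> * \<theta>,v)))"
    "continuous_map (SX (SX (SX W))) M (\<lambda>(\<zeta>,(\<eta>,(\<theta>,v))). f (\<zeta> * \<eta>,(\<theta>,v)))"
    "continuous_map (SX (SX (SX W))) M (\<lambda>(\<zeta>,(\<eta>,(\<theta>,v))). f (\<eta>,(\<zeta> * \<theta>,v)))"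
    using f by (auto simp: case_prod_unfold continuous_map_SX norm_mult
        intro!: continuous_map_compose[of _ "SX (SX W)" _ _ f, unfolded comp_def] cmi cm_SXs)
  have s: "continuous_map (SX W) M (\<lambda>(u,v). f (u,(u,v)))" "continuous_map (SX W) M (\<lambda>(u,v). f (u,(1,v)))"
    "continuous_map (SX W) M (\<lambda>(u,v). f (1,(u,v)))"
    using f by (auto simp: case_prod_unfold continuous_map_SX
        intro!: continuous_map_compose[of _ "SX (SX W)" _ _ f, unfolded comp_def] cmi cm_SXs)
  have e: "?D (\<lambda>(\<zeta>,(\<theta>,v)). f (\<zeta> * \<theta>,(\<zeta> * \<theta>,v))) = 0" "?D (\<lambda>(\<zeta>,(\<theta>,v)). f (\<zeta> * \<theta>,(1,v))) = 0"
    "?D (\<lambda>(\<zeta>,(\<theta>,v)). f (1,(\<zeta> * \<theta>,v))) = 0"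
    using tau2_degenerate[OF w k s(1)] tau2_degenerate[OF w k s(2)] tau2_degenerate[OF w k s(3)] by simp_all
  have 1: "?D (\<lambda>(\<zeta>,(\<theta>,v)). f (\<zeta> * \<theta>,(\<zeta> * \<theta>,v))) = ?D (\<lambda>(\<zeta>,(\<theta>,v)). f (\<zeta> * \<theta>,(\<theta>,v))) + ?D (\<lambda>(\<zeta>,(\<theta>,v)). f (\<theta>,(\<zeta> * \<theta>,v)))"
    using tau2_outer_diag[OF w k K(1)] by (simp add: case_prod_unfold)
  have 2: "?D (\<lambda>(\<zeta>,(\<theta>,v)). f (\<zeta> * \<theta>,(\<theta>,v))) = ?D (\<lambda>(\<zeta>,(\<theta>,v)). f (\<zeta> * \<theta>,(1,v))) + ?D f"
    using tau2_inner_diag[OF w k K(2)] by (simp add: case_prod_unfold)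
  have 3: "?D (\<lambda>(\<zeta>,(\<theta>,v)). f (\<theta>,(\<zeta> * \<theta>,v))) = ?D (\<lambda>(\<zeta>,(\<theta>,v)). f (\<theta>,(\<zeta>,v))) + ?D (\<lambda>(\<zeta>,(\<theta>,v)). f (1,(\<zeta> * \<theta>,v)))"
    using tau2_inner_diag[OF w k K(3)] by (simp add: case_prod_unfold)
  show "?D (\<lambda>(\<zeta>,(\<theta>,v)). f (\<zeta> * \<theta>,(\<theta>,v))) = ?D f" using 2 e by simp
  show "?D (\<lambda>(\<zeta>,(\<theta>,v)). f (\<theta>,(\<zeta>,v))) = - ?D f" using 1 2 3 e by simp
  show "?D (\<lambda>(\<zeta>,(\<theta>,v)). f (\<theta>,(\<zeta> * \<theta>,v))) = - ?D f" using 1 2 e by simp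
qed

section \<open>Removing a closed subset with a tubular neighbourhood\<close>

text \<open>A class of \<open>M\<close> that dies in \<open>Z\<close> is the boundary of a relative
  class, which excision moves into the tube \<open>U\<close>. Its boundary in the punctured tube
  dies in the tube, so its image in \<open>SX N\<close> projects to zero in \<open>N\<close> and is
  a cross product by \<open>tau_surj\<close>. The homotopy between \<open>F\<close> after
  \<open>R\<close> and the inclusion carries this back to \<open>M\<close>.\<close>

lemma tube_kernel:
  assumes M: "openin Z M" and U: "openin Z U" and MU: "M \<union> U = topspace Z"
    and R: "continuous_map (subtopology Z (U \<inter> M)) (SX N) R"
    and F: "continuous_map (SX N) (subtopology Z M) F"
    and FR: "push q (subtopology Z (U \<inter> M)) (subtopology Z M) (\<lambda>w. F (R w)) = push q (subtopology Z (U \<inter> M)) (subtopology Z M) id"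
    and r: "continuous_map (subtopology Z U) N r" and Rr: "\<And>w. w \<in> U \<inter> M \<Longrightarrow> snd (R w) = r w"
    and x: "x \<in> carrier (homology_group q (subtopology Z M))" "push q (subtopology Z M) Z id x = \<one>\<^bsub>homology_group q Z\<^esub>"
  obtains y where "y \<in> carrier (homology_group (q-1) N)" "x = push q (SX N) (subtopology Z M) F (tau (q-1) N y)"
proof -
  have "x \<in> kernel (homology_group (q+1-1) (subtopology Z M)) (homology_group (q+1-1) Z) (push (q+1-1) (subtopology Z M) Z id)"
    using x by (simp add: kernel_def)
  then obtain \<xi> where \<xi>: "\<xi> \<in> carrier (relative_homology_group (q+1) Z M)" "x = hom_boundary (q+1) Z M \<xi>"
    unfolding homology_exact_2[symmetric] by blast
  let ?exc = "hom_induced (q+1) (subtopology Z U) (U \<inter> M) Z M id"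
  have "\<xi> \<in> ?exc ` carrier (relative_homology_group (q+1) (subtopology Z U) (U \<inter> M))"
    using excision_open[OF M U MU, of "q+1"] \<xi>(1) by (simp add: iso_def bij_betw_def)
  then obtain \<xi>' where \<xi>': "\<xi>' \<in> carrier (relative_homology_group (q+1) (subtopology Z U) (U \<inter> M))" "\<xi> = ?exc \<xi>'"
    by blast
  have UM: "subtopology (subtopology Z U) (U \<inter> M) = subtopology Z (U \<inter> M)"
    by (simp add: subtopology_subtopology Int_absorb1)
  define x' where "x' = hom_boundary (q+1) (subtopology Z U) (U \<inter> M) \<xi>'"
  have x': "x' \<in> carrier (homology_group q (subtopology Z (U \<inter> M)))"
    using hom_boundary_carrier[of "q+1" "subtopology Z U" "U \<inter> M" \<xi>'] by (simp add: x'_def UM)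
  have "continuous_map (subtopology Z U) Z id" by (simp add: continuous_map_from_subtopology)
  from naturality_hom_induced[OF this, of "U \<inter> M" M "q+1"]
  have "hom_boundary (q+1) Z M (?exc \<xi>') = push q (subtopology Z (U \<inter> M)) (subtopology Z M) id x'"
    by (simp add: fun_eq_iff x'_def UM)
  then have xx': "x = push q (SX N) (subtopology Z M) F (push q (subtopology Z (U \<inter> M)) (SX N) R x')"
    unfolding \<xi>(2) \<xi>'(2) push_compose[OF R F] FR .
  have "x' \<in> kernel (homology_group (q+1-1) (subtopology (subtopology Z U) (U \<inter> M))) (homology_group (q+1-1) (subtopology Z U))
      (push (q+1-1) (subtopology (subtopology Z U) (U \<inter> M)) (subtopology Z U) id)"
    unfolding homology_exact_2[symmetric] x'_def using \<xi>'(1) by blast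
  then have z: "push q (subtopology Z (U \<inter> M)) (subtopology Z U) id x' = \<one>\<^bsub>homology_group q (subtopology Z U)\<^esub>"
    by (simp add: kernel_def UM)
  have inc: "continuous_map (subtopology Z (U \<inter> M)) (subtopology Z U) id"
    by (auto simp: continuous_map_in_subtopology continuous_map_from_subtopology)
  have "push q (SX N) N snd (push q (subtopology Z (U \<inter> M)) (SX N) R x') = push q (subtopology Z (U \<inter> M)) N (\<lambda>w. r (id w)) x'"
    unfolding push_compose[OF R cm_SX_snd] by (rule fun_cong[OF push_cong]) (simp add: Rr)
  also have "\<dots> = \<one>\<^bsub>homology_group q N\<^esub>" unfolding push_compose[OF inc r, symmetric] z push_one ..
  finally have "push q (SX N) N snd (push q (subtopology Z (U \<inter> M)) (SX N) R x') = \<one>\<^bsub>homology_group q N\<^esub>" .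
  then obtain y where "y \<in> carrier (homology_group (q-1) N)" "push q (subtopology Z (U \<inter> M)) (SX N) R x' = tau (q-1) N y"
    by (rule tau_surj[where p = "q-1" and V = N, unfolded diff_add_cancel, OF push_closed])
  then show thesis using that xx' by simp
qed

text \<open>A functional that vanishes on the classes of \<open>A\<close> and of \<open>B\<close>
  factors through the connecting homomorphism \<open>g\<close>, the boundary after inverting
  excision; so the three bounds add up.\<close>

lemma sep_Mayer_Vietoris:
  assumes A: "openin T A" and B: "openin T B" and AB: "A \<union> B = topspace T"
    and a: "sep (hfun q (subtopology T A)) a" and b: "sep (hfun q (subtopology T B)) b"
    and c: "sep (hfun (q-1) (subtopology T (A \<inter> B))) c"
  shows "sep (hfun q T) (a + (b + c))"
proof -
  let ?H = "homology_group q T"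
  interpret HT: comm_group ?H by simp
  let ?exc = "hom_induced q (subtopology T B) (B \<inter> A) T A id"
  let ?RB = "relative_homology_group q (subtopology T B) (B \<inter> A)" and ?RT = "relative_homology_group q T A"
  have exc: "?exc \<in> iso ?RB ?RT" by (rule excision_open[OF A B AB])
  then have inj: "inj_on ?exc (carrier ?RB)" and im: "?exc ` carrier ?RB = carrier ?RT" by (auto simp: iso_def bij_betw_def)
  define exi where "exi = inv_into (carrier ?RB) ?exc"
  have exi: "exi \<in> hom ?RT ?RB"
    using group.iso_set_sym[OF _ exc] by (simp add: exi_def iso_def)
  define g where "g x = hom_boundary q (subtopology T B) (B \<inter> A) (exi (rel q T A x))" for x
  have BA: "subtopology (subtopology T B) (B \<inter> A) = subtopology T (A \<inter> B)"
    by (simp add: subtopology_subtopology Int_absorb1 Int_commute)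
  have g: "g \<in> hom ?H (homology_group (q-1) (subtopology T (A \<inter> B)))"
  proof -
    have "(hom_boundary q (subtopology T B) (B \<inter> A)) \<circ> (exi \<circ> rel q T A) \<in> hom ?H (homology_group (q-1) (subtopology T (A \<inter> B)))"
      using hom_boundary_hom[of q "subtopology T B" "B \<inter> A"]
      by (intro hom_compose[OF hom_compose[OF hom_induced_hom exi]]) (simp add: BA)
    then show ?thesis by (simp add: g_def[abs_def] comp_def)
  qed
  have cA: "continuous_map (subtopology T A) T id" and cB: "continuous_map (subtopology T B) T id"
    by (simp_all add: continuous_map_from_subtopology)
  have main: "l \<in> {rpull ?H g m |m. m \<in> hfun (q-1) (subtopology T (A \<inter> B))}"
    if l: "l \<in> hfun q T" "\<forall>x\<in>carrier (homology_group q (subtopology T A)). l (push q (subtopology T A) T id x) = 0"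
      "\<forall>x\<in>carrier (homology_group q (subtopology T B)). l (push q (subtopology T B) T id x) = 0" for l
  proof -
    have "l x = 0" if x: "x \<in> carrier ?H" "g x = \<one>\<^bsub>homology_group (q-1) (subtopology T (A \<inter> B))\<^esub>" for x
    proof -
      have xr: "rel q T A x \<in> carrier ?RT" by (rule hom_induced_carrier)
      have iv: "exi (rel q T A x) \<in> carrier ?RB" using exi xr by (auto simp: hom_def)
      then have "exi (rel q T A x) \<in> kernel ?RB (homology_group (q-1) (subtopology (subtopology T B) (B \<inter> A))) (hom_boundary q (subtopology T B) (B \<inter> A))"
        using x(2) by (simp add: kernel_def g_def BA)
      then obtain e where e: "e \<in> carrier (homology_group q (subtopology T B))" "exi (rel q T A x) = rel q (subtopology T B) (B \<inter> A) e"
        unfolding homology_exact_1[symmetric] by blast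
      have "rel q T A x = ?exc (exi (rel q T A x))" unfolding exi_def using xr im by (simp add: f_inv_into_f)
      also have "\<dots> = rel q T A (push q (subtopology T B) T id e)"
        unfolding e(2) using cB by (simp add: hom_induced_compose' continuous_map_id)
      finally have eq: "rel q T A x = rel q T A (push q (subtopology T B) T id e)" .
      let ?pe = "push q (subtopology T B) T id e"
      have "rel q T A (x \<otimes>\<^bsub>?H\<^esub> inv\<^bsub>?H\<^esub> ?pe) = \<one>\<^bsub>?RT\<^esub>"
        by (rule hom_eq_imp_mult_inv[OF _ _ hom_induced_hom x(1) push_closed eq]) simp_all
      then have "x \<otimes>\<^bsub>?H\<^esub> inv\<^bsub>?H\<^esub> ?pe \<in> kernel ?H ?RT (rel q T A)"
        using HT.m_closed[OF x(1) HT.inv_closed[OF push_closed]] by (simp add: kernel_def)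
      then obtain d where d: "d \<in> carrier (homology_group q (subtopology T A))" "x \<otimes>\<^bsub>?H\<^esub> inv\<^bsub>?H\<^esub> ?pe = push q (subtopology T A) T id d"
        unfolding homology_exact_3[symmetric] by blast
      have "l x - l ?pe = l (x \<otimes>\<^bsub>?H\<^esub> inv\<^bsub>?H\<^esub> ?pe)"
        unfolding rhom_mult[OF l(1) x(1) HT.inv_closed[OF push_closed]] rhom_inv[OF HT.is_group l(1) push_closed] by simp
      then show ?thesis using l(2,3) d e(1) by simp
    qed
    then obtain m where m: "m \<in> hfun (q-1) (subtopology T (A \<inter> B))" "\<forall>x\<in>carrier ?H. l x = m (g x)"
      using rhom_factor[OF _ _ g l(1)] by auto
    then have "l = rpull ?H g m" using rhom_outside[OF l(1)] by (auto simp: rpull_def)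
    then show ?thesis using m(1) by blast
  qed
  show ?thesis
  proof (rule sep_rhom_extend[OF a hom_push])
    show "rpull (homology_group q (subtopology T A)) (push q (subtopology T A) T id) v \<in> hfun q (subtopology T A)"
      if "v \<in> hfun q T" for v by (rule rpull_rhom[OF hom_push that]) simp
    show "sep {v \<in> hfun q T. \<forall>x\<in>carrier (homology_group q (subtopology T A)). v (push q (subtopology T A) T id x) = 0} (b + c)"
    proof (rule sep_rhom_extend[OF b hom_push])
      show "sep {v \<in> {v \<in> hfun q T. \<forall>x\<in>carrier (homology_group q (subtopology T A)). v (push q (subtopology T A) T id x) = 0}.
         \<forall>x\<in>carrier (homology_group q (subtopology T B)). v (push q (subtopology T B) T id x) = 0} c"
        by (rule sep_mono[OF sep_rpull[OF c]]) (use main in auto)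
    qed (auto intro!: rpull_rhom[OF hom_push])
  qed simp
qed

section \<open>Configuration spaces over a base\<close>

abbreviation EB :: "'b topology \<Rightarrow> ('b \<times> (nat \<Rightarrow> complex)) topology" where
  "EB B \<equiv> prod_topology B euclidean"

lemma continuous_map_euclidean_fun:
  "continuous_map X (euclidean :: (nat \<Rightarrow> complex) topology) f \<longleftrightarrow> (\<forall>i. continuous_map X euclidean (\<lambda>x. f x i))"
proof -
  have "(euclidean :: (nat \<Rightarrow> complex) topology) = product_topology (\<lambda>i. euclidean) UNIV"
    by (simp add: euclidean_product_topology)
  then show ?thesis by (simp only: continuous_map_componentwise_UNIV)
qed

lemma SX_cases:
  assumes "x \<in> topspace (SX V)"
  obtains \<theta> w where "x = (\<theta>,w)" "norm \<theta> = 1" "w \<in> topspace V"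
  using assms by (cases x) simp

lemma continuous_map_EB:
  "continuous_map X (EB B) f \<longleftrightarrow> continuous_map X B (\<lambda>x. fst (f x)) \<and> (\<forall>i. continuous_map X euclidean (\<lambda>x. snd (f x) i))"
  by (simp add: continuous_map_pairwise comp_def continuous_map_euclidean_fun)

lemma cmi_prod [cmi]:
  fixes f :: "'i \<Rightarrow> 'a \<Rightarrow> real"
  shows "(\<And>i. i \<in> I \<Longrightarrow> continuous_map X euclidean (f i)) \<Longrightarrow> continuous_map X euclidean (\<lambda>x. \<Prod>i\<in>I. f i x)"
  by (auto simp: continuous_map_tendsto intro!: tendsto_prod)

text \<open>Vertices are natural numbers. Those in \<open>A\<close> label holes, whose positions depend on the base point;
  the position of any other vertex is a free coordinate.\<close>

locale config =
  fixes B :: "'b topology" and p :: "nat \<Rightarrow> 'b \<Rightarrow> complex" and A :: "nat set"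
  assumes hole_cont: "\<And>v. v \<in> A \<Longrightarrow> continuous_map B euclidean (p v)"
    and hole_distinct: "\<And>u v b. \<lbrakk>u \<in> A; v \<in> A; u \<noteq> v; b \<in> topspace B\<rbrakk> \<Longrightarrow> p u b \<noteq> p v b"
begin

definition pos :: "'b \<times> (nat \<Rightarrow> complex) \<Rightarrow> nat \<Rightarrow> complex" where
  "pos w v = (if v \<in> A then p v (fst w) else snd w v)"

text \<open>Arbitrary conditions are allowed since kernels are computed in intermediate spaces where
  only some pairs must stay apart. All coordinates remain present, so dropping a vertex from a
  configuration is an inclusion of spaces.\<close>

definition Sb :: "('b \<times> (nat \<Rightarrow> complex) \<Rightarrow> bool) \<Rightarrow> ('b \<times> (nat \<Rightarrow> complex)) topology" where
  "Sb Q = subtopology (EB B) {w. Q w}"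

abbreviation Cf :: "nat set \<Rightarrow> ('b \<times> (nat \<Rightarrow> complex)) topology" where
  "Cf V \<equiv> Sb (\<lambda>w. inj_on (pos w) V)"

lemma topspace_Sb [simp]: "topspace (Sb Q) = {w. fst w \<in> topspace B \<and> Q w}"
  by (auto simp: Sb_def)

lemma continuous_map_Sb:
  "continuous_map X (Sb Q) f \<longleftrightarrow> continuous_map X B (\<lambda>x. fst (f x)) \<and> (\<forall>i. continuous_map X euclidean (\<lambda>x. snd (f x) i))
    \<and> (\<forall>x\<in>topspace X. Q (f x))"
  by (auto simp: Sb_def continuous_map_in_subtopology continuous_map_EB)

lemma cm_pos: "continuous_map X (Sb Q) f \<Longrightarrow> continuous_map X euclidean (\<lambda>x. pos (f x) v)"
  using continuous_map_compose[OF _ hole_cont[of v], of X "\<lambda>x. fst (f x)"]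
  by (auto simp: pos_def continuous_map_Sb comp_def)

lemma cm_id_Sb: "continuous_map (Sb Q) (Sb Q) (\<lambda>w. w)"
  by simp

lemma cm_Sb_coord: "continuous_map X (Sb Q) f \<Longrightarrow> continuous_map X euclidean (\<lambda>x. snd (f x) v)"
  and cm_Sb_base: "continuous_map X (Sb Q) f \<Longrightarrow> continuous_map X B (\<lambda>x. fst (f x))"
  by (auto simp: continuous_map_Sb)

lemma cm_Sb_mono: "(\<And>w. fst w \<in> topspace B \<Longrightarrow> Q w \<Longrightarrow> Q' w) \<Longrightarrow> continuous_map (Sb Q) (Sb Q') id"
  using cm_Sb_coord[OF cm_id_Sb[of Q]] cm_Sb_base[OF cm_id_Sb[of Q]] unfolding continuous_map_Sb by auto

lemma Sb_cong: "(\<And>w. fst w \<in> topspace B \<Longrightarrow> Q w \<longleftrightarrow> Q' w) \<Longrightarrow> Sb Q = Sb Q'"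
proof -
  assume "\<And>w. fst w \<in> topspace B \<Longrightarrow> Q w \<longleftrightarrow> Q' w"
  then have "topspace (EB B) \<inter> {w. Q w} = topspace (EB B) \<inter> {w. Q' w}" by auto
  then show ?thesis unfolding Sb_def by (metis subtopology_restrict)
qed

lemma subtopology_Sb: "subtopology (Sb Q) {w. Q' w} = Sb (\<lambda>w. Q w \<and> Q' w)"
  unfolding Sb_def subtopology_subtopology by (simp add: Collect_conj_eq)

lemma openin_Sb:
  assumes "\<And>w. fst w \<in> topspace B \<Longrightarrow> Q w \<Longrightarrow> R w \<longleftrightarrow> (f w :: 'c::topological_space) \<in> S"
    "continuous_map (Sb Q) euclidean f" "open S"
  shows "openin (Sb Q) {w \<in> topspace (Sb Q). R w}"
proof -
  have "openin (Sb Q) {w \<in> topspace (Sb Q). f w \<in> S}"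
    by (rule openin_continuous_map_preimage[OF assms(2)]) (use assms(3) in simp)
  moreover have "{w \<in> topspace (Sb Q). f w \<in> S} = {w \<in> topspace (Sb Q). R w}" using assms(1) by auto
  ultimately show ?thesis by simp
qed

text \<open>Segments are taken in the free coordinates over a fixed base point. A homotopy of
  configurations then amounts to checking \<open>Q\<close> along a segment.\<close>

lemma linear_homotopy:
  assumes f: "continuous_map X (Sb Q) f" and g: "continuous_map X (Sb Q) g"
    and fst: "\<And>x. x \<in> topspace X \<Longrightarrow> fst (f x) = fst (g x)"
    and Q: "\<And>x t. x \<in> topspace X \<Longrightarrow> 0 \<le> t \<Longrightarrow> t \<le> 1 \<Longrightarrow>
      Q (fst (f x), \<lambda>i. (1 - of_real t) * snd (f x) i + of_real t * snd (g x) i)"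
  shows "push q X (Sb Q) f = push q X (Sb Q) g"
proof (rule push_homotopic[where h = "\<lambda>(t,x). (fst (f x), \<lambda>i. (1 - of_real t) * snd (f x) i + of_real t * snd (g x) i)"])
  have 1: "continuous_map (IX X) B (\<lambda>u. fst (f (snd u)))"
    "continuous_map (IX X) euclidean (\<lambda>u. snd (f (snd u)) i)" "continuous_map (IX X) euclidean (\<lambda>u. snd (g (snd u)) i)" for i
    using continuous_map_compose[OF continuous_map_snd cm_Sb_base[OF f]] continuous_map_compose[OF continuous_map_snd cm_Sb_coord[OF f]]
      continuous_map_compose[OF continuous_map_snd cm_Sb_coord[OF g]] by (auto simp: comp_def)
  show "continuous_map (IX X) (Sb Q) (\<lambda>(t,x). (fst (f x), \<lambda>i. (1 - of_real t) * snd (f x) i + of_real t * snd (g x) i))"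
    unfolding continuous_map_Sb case_prod_unfold fst_conv snd_conv
    using Q by (auto intro!: cmi 1)
qed (use fst in \<open>auto simp: prod_eq_iff\<close>)

text \<open>A product of capped distances is continuous by the rules above and makes sense for a
  single vertex. Each factor is at most 1, so the value is below every distance from
  \<open>a\<close>; the quarter keeps the circles around two different anchors disjoint.\<close>

definition eps :: "nat set \<Rightarrow> nat \<Rightarrow> 'b \<times> (nat \<Rightarrow> complex) \<Rightarrow> real" where
  "eps V a w = (\<Prod>u\<in>V - {a}. min 1 (cmod (pos w a - pos w u))) / 4"

definition orb :: "nat \<Rightarrow> nat \<Rightarrow> ('b \<times> (nat \<Rightarrow> complex) \<Rightarrow> real) \<Rightarrow> complex \<times> 'b \<times> (nat \<Rightarrow> complex) \<Rightarrow> 'b \<times> (nat \<Rightarrow> complex)" where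
  "orb a v r = (\<lambda>(\<theta>,w). (fst w, (snd w)(v := pos w a + of_real (r w) * \<theta>)))"

definition rad :: "nat set \<Rightarrow> nat \<Rightarrow> ('b \<times> (nat \<Rightarrow> complex) \<Rightarrow> real) \<Rightarrow> bool" where
  "rad V a r \<longleftrightarrow> continuous_map (Cf V) euclidean r \<and>
     (\<forall>w\<in>topspace (Cf V). 0 < r w \<and> (\<forall>u\<in>V - {a}. r w < cmod (pos w a - pos w u)))"

lemma eps_le:
  assumes "finite V" "u \<in> V - {a}" shows "eps V a w \<le> min 1 (cmod (pos w a - pos w u)) / 4"
proof -
  have "(\<Prod>u\<in>V - {a}. min 1 (cmod (pos w a - pos w u))) =
     min 1 (cmod (pos w a - pos w u)) * (\<Prod>u\<in>V - {a} - {u}. min 1 (cmod (pos w a - pos w u)))"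
    using assms by (subst prod.remove[of _ u]) auto
  also have "\<dots> \<le> min 1 (cmod (pos w a - pos w u)) * 1"
    by (intro mult_left_mono prod_le_1) auto
  finally show ?thesis by (simp add: eps_def)
qed

lemma eps_le_quarter: "eps V a w \<le> 1 / 4"
  unfolding eps_def by (simp add: prod_le_1)

lemma eps_nonneg: "0 \<le> eps V a w"
  unfolding eps_def by (simp add: prod_nonneg)

lemma eps_pos: "\<lbrakk>inj_on (pos w) V; a \<in> V\<rbrakk> \<Longrightarrow> 0 < eps V a w"
  unfolding eps_def by (auto intro!: prod_pos simp: inj_on_def)

lemma cm_eps: "continuous_map X (Sb Q) f \<Longrightarrow> continuous_map X euclidean (\<lambda>x. eps V a (f x))"
  unfolding eps_def by (intro cmi cm_pos) auto

lemma rad_eps: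
  assumes "finite V" "a \<in> V" shows "rad V a (eps V a)"
  unfolding rad_def
proof (intro conjI ballI)
  show "continuous_map (Cf V) euclidean (eps V a)" using cm_eps[OF cm_id_Sb] .
  fix w assume w: "w \<in> topspace (Cf V)"
  then show "0 < eps V a w" using eps_pos assms by auto
  fix u assume u: "u \<in> V - {a}"
  have "pos w a \<noteq> pos w u" using w u assms(2) by (auto simp: inj_on_def)
  then have "0 < cmod (pos w a - pos w u)" by simp
  then show "eps V a w < cmod (pos w a - pos w u)" using eps_le[OF assms(1) u, of w] by linarith
qed

lemma pos_orb: "v \<notin> A \<Longrightarrow> pos (orb a v r (\<theta>,w)) u = (if u = v then pos w a + of_real (r w) * \<theta> else pos w u)"
  by (auto simp: pos_def orb_def)

lemma inj_on_orb:
  assumes "v \<notin> A" "a \<in> V - {v}" "inj_on (pos w) (V - {v})" "0 < r" "norm \<theta> = 1" "\<And>u. u \<in> V - {v} - {a} \<Longrightarrow> r < cmod (pos w a - pos w u)"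
  shows "inj_on (\<lambda>u. if u = v then pos w a + of_real r * \<theta> else pos w u) V"
proof -
  have *: "pos w u \<noteq> pos w a + of_real r * \<theta>" if "u \<in> V - {v}" for u
  proof (cases "u = a")
    case True then show ?thesis using assms(4,5) by auto
  next
    case False
    have "cmod (of_real r * \<theta>) = r" using assms(4,5) by (simp add: norm_mult)
    then have "cmod (pos w a - pos w u) \<noteq> cmod (of_real r * \<theta>)" using assms(6)[of u] that False by auto
    then show ?thesis by (metis add_diff_cancel_left' norm_minus_commute)
  qed
  show ?thesis
    using assms(3) * unfolding inj_on_def by (metis DiffI singletonD)
qed

lemma cm_orb:
  assumes "v \<in> V - A" "a \<in> V - {v}" "rad (V - {v}) a r"
  shows "continuous_map (SX (Cf (V - {v}))) (Cf V) (orb a v r)"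
proof -
  have s: "continuous_map (SX (Cf (V - {v}))) (Cf (V - {v})) snd" by (rule cm_SX_snd)
  have r: "continuous_map (SX (Cf (V - {v}))) euclidean (\<lambda>x. r (snd x))"
    using continuous_map_compose[OF s, of euclidean r] assms(3) by (simp add: rad_def comp_def)
  have "continuous_map (SX (Cf (V - {v}))) euclidean (\<lambda>x. snd (orb a v r x) i)" for i
    unfolding orb_def by (cases "i = v") (auto simp: case_prod_unfold intro!: cmi r cm_pos[OF s] cm_Sb_coord[OF s])
  moreover have "continuous_map (SX (Cf (V - {v}))) B (\<lambda>x. fst (orb a v r x))"
    using cm_Sb_base[OF s] by (simp add: orb_def case_prod_unfold)
  moreover have "inj_on (pos (orb a v r x)) V" if xt: "x \<in> topspace (SX (Cf (V - {v})))" for x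
  proof -
    obtain \<theta> w where x: "x = (\<theta>,w)" "norm \<theta> = 1" "w \<in> topspace (Cf (V - {v}))" using xt by (rule SX_cases)
    have rs: "0 < r w" "\<And>u. u \<in> V - {v} - {a} \<Longrightarrow> r w < cmod (pos w a - pos w u)"
      using assms(3) x(3) unfolding rad_def by blast+
    have "inj_on (\<lambda>u. if u = v then pos w a + of_real (r w) * \<theta> else pos w u) V"
      by (rule inj_on_orb) (use x assms rs in auto)
    then show ?thesis using assms(1) unfolding x(1) by (subst inj_on_cong[OF pos_orb]) auto
  qed
  ultimately show ?thesis by (simp add: continuous_map_Sb)
qed

text \<open>The tube map dual to taking residues: \<open>v\<close> runs around \<open>a\<close> on a small circle.\<close>

definition L :: "int \<Rightarrow> nat set \<Rightarrow> nat \<Rightarrow> nat \<Rightarrow> ('b \<times> (nat \<Rightarrow> complex)) chain set \<Rightarrow> ('b \<times> (nat \<Rightarrow> complex)) chain set" where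
  "L q V a v x = push (q+1) (SX (Cf (V - {v}))) (Cf V) (orb a v (eps (V - {v}) a)) (tau q (Cf (V - {v})) x)"

lemma L_closed: "L q V a v x \<in> carrier (homology_group (q+1) (Cf V))"
  unfolding L_def by (rule push_closed)

lemma L_hom: "L q V a v \<in> hom (homology_group q (Cf (V - {v}))) (homology_group (q+1) (Cf V))"
  unfolding L_def[abs_def] using hom_compose[OF tau_hom hom_push] by (simp add: comp_def)

lemma sub_Sb: "subtopology (Sb Q) {w \<in> topspace (Sb Q). R w} = Sb (\<lambda>w. Q w \<and> R w)"
proof -
  have "{w \<in> topspace (Sb Q). R w} = topspace (Sb Q) \<inter> {w. R w}" by blast
  then show ?thesis by (simp only: subtopology_restrict subtopology_Sb)
qed

text \<open>Injectivity on a finite set is positivity of the product of all distances.\<close>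

lemma openin_inj_on:
  assumes "finite V" shows "openin (Sb Q) {w \<in> topspace (Sb Q). inj_on (pos w) V}"
proof (rule openin_Sb)
  let ?f = "\<lambda>w. \<Prod>u\<in>V. \<Prod>v\<in>V - {u}. cmod (pos w u - pos w v)"
  show "continuous_map (Sb Q) euclidean ?f" by (intro cmi cm_pos[OF cm_id_Sb])
  show "open {0::real<..}" by simp
  show "inj_on (pos w) V \<longleftrightarrow> ?f w \<in> {0<..}" for w
  proof
    assume "inj_on (pos w) V"
    then show "?f w \<in> {0<..}" by (auto intro!: prod_pos simp: inj_on_def)
  next
    assume *: "?f w \<in> {0<..}"
    show "inj_on (pos w) V"
    proof (rule inj_onI, rule ccontr)
      fix u v assume uv: "u \<in> V" "v \<in> V" "pos w u = pos w v" "u \<noteq> v"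
      then have "(\<Prod>v\<in>V - {u}. cmod (pos w u - pos w v)) = 0"
        using assms by (intro prod_zero) auto
      then have "?f w = 0" using assms uv(1) by (intro prod_zero) auto
      then show False using * by simp
    qed
  qed
qed

text \<open>The set where \<open>v\<close> meets \<open>a\<close> has the tube of radius
  \<open>eps\<close>, with the direction from \<open>a\<close> to \<open>v\<close> as circle
  coordinate; \<open>Q2\<close> makes the other vertices distinct there. The base of the tube is
  \<open>Cf (V - {v})\<close> itself, because the position of \<open>v\<close> is a free coordinate
  in it.\<close>

lemma drop_kernel:
  assumes V: "finite V" "v \<in> V - A" "a \<in> V - {v}"
    and Q1: "\<And>w. fst w \<in> topspace B \<Longrightarrow> inj_on (pos w) V \<Longrightarrow> Q w"
    and Q2: "\<And>w. fst w \<in> topspace B \<Longrightarrow> Q w \<Longrightarrow> pos w a = pos w v \<Longrightarrow> inj_on (pos w) (V - {v})"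
    and x: "x \<in> carrier (homology_group q (Sb (\<lambda>w. Q w \<and> pos w a \<noteq> pos w v)))"
      "push q (Sb (\<lambda>w. Q w \<and> pos w a \<noteq> pos w v)) (Sb Q) id x = \<one>\<^bsub>homology_group q (Sb Q)\<^esub>"
  obtains y where "y \<in> carrier (homology_group (q-1) (Cf (V - {v})))"
    "x = push q (Cf V) (Sb (\<lambda>w. Q w \<and> pos w a \<noteq> pos w v)) id (L (q-1) V a v y)"
proof -
  let ?Z = "Sb Q" and ?N = "Cf (V - {v})" and ?e = "eps (V - {v}) a"
  let ?QM = "\<lambda>w. Q w \<and> pos w a \<noteq> pos w v"
  define M0 where "M0 = {w \<in> topspace ?Z. pos w a \<noteq> pos w v}"
  define U0 where "U0 = {w \<in> topspace ?Z. inj_on (pos w) (V - {v}) \<and> cmod (pos w v - pos w a) < ?e w}"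
  have M: "subtopology ?Z M0 = Sb ?QM" unfolding M0_def by (rule sub_Sb)
  have U: "subtopology ?Z U0 = Sb (\<lambda>w. Q w \<and> inj_on (pos w) (V - {v}) \<and> cmod (pos w v - pos w a) < ?e w)"
    unfolding U0_def by (rule sub_Sb)
  have UM: "subtopology ?Z (U0 \<inter> M0) =
    Sb (\<lambda>w. Q w \<and> (inj_on (pos w) (V - {v}) \<and> cmod (pos w v - pos w a) < ?e w) \<and> pos w a \<noteq> pos w v)" (is "_ = Sb ?QUM")
  proof -
    have "U0 \<inter> M0 = {w \<in> topspace ?Z. (inj_on (pos w) (V - {v}) \<and> cmod (pos w v - pos w a) < ?e w) \<and> pos w a \<noteq> pos w v}"
      unfolding U0_def M0_def by blast
    then show ?thesis by (simp only: sub_Sb)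
  qed
  have oM: "openin ?Z M0"
    unfolding M0_def by (rule openin_Sb[where f = "\<lambda>w. pos w a - pos w v" and S = "- {0}"]) (auto intro!: cmi cm_pos[OF cm_id_Sb])
  have oU: "openin ?Z U0"
  proof -
    have "openin ?Z {w \<in> topspace ?Z. cmod (pos w v - pos w a) < ?e w}"
      by (rule openin_Sb[where f = "\<lambda>w. ?e w - cmod (pos w v - pos w a)" and S = "{0<..}"]) (auto intro!: cmi cm_pos[OF cm_id_Sb] cm_eps[OF cm_id_Sb])
    moreover have "openin ?Z {w \<in> topspace ?Z. inj_on (pos w) (V - {v})}" by (rule openin_inj_on) (use V in simp)
    ultimately have "openin ?Z ({w \<in> topspace ?Z. inj_on (pos w) (V - {v})} \<inter> {w \<in> topspace ?Z. cmod (pos w v - pos w a) < ?e w})"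
      by (rule openin_Int[rotated])
    moreover have "{w \<in> topspace ?Z. inj_on (pos w) (V - {v})} \<inter> {w \<in> topspace ?Z. cmod (pos w v - pos w a) < ?e w} = U0"
      unfolding U0_def by blast
    ultimately show ?thesis by simp
  qed
  have un: "M0 \<union> U0 = topspace ?Z"
  proof
    show "topspace ?Z \<subseteq> M0 \<union> U0"
    proof
      fix w assume w: "w \<in> topspace ?Z"
      show "w \<in> M0 \<union> U0"
      proof (cases "pos w a = pos w v")
        case True
        then have i: "inj_on (pos w) (V - {v})" using w Q2 by simp
        then have "0 < ?e w" by (rule eps_pos) (use V in simp)
        then show ?thesis using w i True by (simp add: U0_def)
      qed (use w in \<open>simp add: M0_def\<close>)
    qed
  qed (auto simp: M0_def U0_def)
  have rad: "rad (V - {v}) a ?e" by (rule rad_eps) (use V in auto)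
  have F0: "continuous_map (SX ?N) (Cf V) (orb a v ?e)" by (rule cm_orb[OF V(2,3) rad])
  have VM: "continuous_map (Cf V) (Sb ?QM) id"
    by (rule cm_Sb_mono) (use Q1 V in \<open>auto simp: inj_on_def\<close>)
  have F: "continuous_map (SX ?N) (Sb ?QM) (orb a v ?e)"
    using continuous_map_compose[OF F0 VM] by simp
  define R where "R w = (sgn (pos w v - pos w a), w)" for w
  have R: "continuous_map (Sb ?QUM) (SX ?N) R"
    unfolding continuous_map_SX R_def fst_conv snd_conv
  proof (intro conjI ballI)
    show "continuous_map (Sb ?QUM) euclidean (\<lambda>w. sgn (pos w v - pos w a))"
      by (intro cmi cm_pos[OF cm_id_Sb]) auto
    show "continuous_map (Sb ?QUM) ?N (\<lambda>w. w)" using cm_Sb_mono[of ?QUM "\<lambda>w. inj_on (pos w) (V - {v})"] by (simp add: id_def)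
    fix w assume "w \<in> topspace (Sb ?QUM)"
    then have ne: "pos w a \<noteq> pos w v" by simp
    have "pos w v - pos w a \<noteq> 0" using not_sym[OF ne] by simp
    then show "cmod (sgn (pos w v - pos w a)) = 1" by (simp add: norm_sgn)
  qed
  have FR: "push q (Sb ?QUM) (Sb ?QM) (\<lambda>w. orb a v ?e (R w)) = push q (Sb ?QUM) (Sb ?QM) id"
  proof (rule linear_homotopy)
    show "continuous_map (Sb ?QUM) (Sb ?QM) (\<lambda>w. orb a v ?e (R w))"
      using continuous_map_compose[OF R F] by (simp add: comp_def)
    show "continuous_map (Sb ?QUM) (Sb ?QM) id" by (rule cm_Sb_mono) auto
    fix w t assume w: "w \<in> topspace (Sb ?QUM)" and t: "0 \<le> t" "t \<le> (1::real)"
    define d where "d = pos w v - pos w a"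
    \<comment> \<open>The segment between \<open>v\<close> and its radial projection stays on one
      ray from \<open>a\<close>; its radius \<open>s\<close> remains positive and at most
      \<open>eps\<close>.\<close>
    define s where "s = (1 - t) * ?e w + t * cmod d"
    have d: "d \<noteq> 0" "cmod d < ?e w" using w by (auto simp: d_def)
    have wi: "inj_on (pos w) (V - {v})" "fst w \<in> topspace B" using w by auto
    have s0: "0 < s"
    proof (cases "t = 1")
      case False
      then have "0 < (1 - t) * ?e w" using t eps_pos[OF wi(1), of a] V by simp
      then show ?thesis using t by (simp add: s_def add_pos_nonneg)
    qed (use d in \<open>simp add: s_def\<close>)
    have "t * cmod d \<le> t * ?e w" using d t by (intro mult_left_mono) auto
    then have se: "s \<le> ?e w" by (simp add: s_def algebra_simps)
    have dd: "d = of_real (cmod d) * sgn d" by (simp add: sgn_eq)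
    have va: "v \<notin> A" "v \<noteq> a" "snd w v = pos w v" using V by (auto simp: pos_def)
    have eq: "(fst (orb a v ?e (R w)), \<lambda>i. (1 - of_real t) * snd (orb a v ?e (R w)) i + of_real t * snd (id w) i) = orb a v (\<lambda>_. s) (sgn d, w)"
    proof -
      have "(1 - of_real t) * (pos w a + of_real (?e w) * sgn d) + of_real t * pos w v = pos w a + of_real s * sgn d"
      proof -
        have "pos w v = pos w a + of_real (cmod d) * sgn d" using dd by (simp add: d_def)
        then show ?thesis by (simp add: s_def algebra_simps)
      qed
      then show ?thesis using va(3) by (auto simp: orb_def R_def d_def[symmetric] algebra_simps)
    qed
    have "inj_on (\<lambda>u. if u = v then pos w a + of_real s * sgn d else pos w u) V"
    proof (rule inj_on_orb[OF va(1) V(3) wi(1) s0])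
      show "s < cmod (pos w a - pos w u)" if "u \<in> V - {v} - {a}" for u
      proof -
        have "w \<in> topspace ?N" using wi by simp
        then have "?e w < cmod (pos w a - pos w u)" using rad that unfolding rad_def by blast
        then show ?thesis using se by linarith
      qed
    qed (use d in \<open>simp add: norm_sgn\<close>)
    then have i: "inj_on (pos (orb a v (\<lambda>_. s) (sgn d, w))) V" using va(1) by (subst inj_on_cong[OF pos_orb]) auto
    have "fst (orb a v (\<lambda>_. s) (sgn d, w)) \<in> topspace B" using wi by (simp add: orb_def)
    with i have "?QM (orb a v (\<lambda>_. s) (sgn d, w))" using Q1 V by (auto simp: inj_on_def)
    then show "?QM (fst (orb a v ?e (R w)), \<lambda>i. (1 - of_real t) * snd (orb a v ?e (R w)) i + of_real t * snd (id w) i)"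
      unfolding eq .
  qed (auto simp: orb_def R_def)
  have r: "continuous_map (subtopology ?Z U0) ?N (\<lambda>w. w)"
    unfolding U using cm_Sb_mono[of "\<lambda>w. Q w \<and> inj_on (pos w) (V - {v}) \<and> cmod (pos w v - pos w a) < ?e w" "\<lambda>w. inj_on (pos w) (V - {v})"]
    by (simp add: id_def)
  obtain y where y: "y \<in> carrier (homology_group (q-1) ?N)" "x = push q (SX ?N) (subtopology ?Z M0) (orb a v ?e) (tau (q-1) ?N y)"
  proof (rule tube_kernel[OF oM oU un])
    show "continuous_map (subtopology ?Z (U0 \<inter> M0)) (SX ?N) R" unfolding UM by (rule R)
    show "continuous_map (SX ?N) (subtopology ?Z M0) (orb a v ?e)" unfolding M by (rule F)
    show "push q (subtopology ?Z (U0 \<inter> M0)) (subtopology ?Z M0) (\<lambda>w. orb a v ?e (R w)) = push q (subtopology ?Z (U0 \<inter> M0)) (subtopology ?Z M0) id"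
      unfolding UM M by (rule FR)
    show "x \<in> carrier (homology_group q (subtopology ?Z M0))" "push q (subtopology ?Z M0) ?Z id x = \<one>\<^bsub>homology_group q ?Z\<^esub>"
      unfolding M using x by auto
  qed (use r in \<open>auto simp: R_def\<close>)
  have "x = push q (Cf V) (Sb ?QM) id (L (q-1) V a v y)"
    unfolding y(2) M L_def diff_add_cancel push_compose[OF F0 VM] by simp
  with y(1) show thesis by (rule that)
qed

text \<open>\<open>kills q V l a v\<close>: the residue of \<open>l\<close> along the collision of \<open>v\<close> with \<open>a\<close> vanishes.\<close>

definition kills :: "int \<Rightarrow> nat set \<Rightarrow> (('b \<times> (nat \<Rightarrow> complex)) chain set \<Rightarrow> rat) \<Rightarrow> nat \<Rightarrow> nat \<Rightarrow> bool" where
  "kills q V l a v \<longleftrightarrow> (\<forall>y\<in>carrier (homology_group (q-1) (Cf (V - {v}))). l (L (q-1) V a v y) = 0)"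

text \<open>Collisions are allowed one at a time. Modulo a tube around a collision, a class that
  dies once this collision is allowed dies already before, and \<open>l\<close> vanishes on the
  tube.\<close>

lemma star_kernel:
  assumes V: "finite V" and l: "l \<in> hfun q (Cf V)" and X: "finite X"
    and pairs: "\<And>a v. (a,v) \<in> X \<Longrightarrow> v \<in> V - A \<and> a \<in> V - {v} \<and> kills q V l a v"
    and Q: "\<And>w. fst w \<in> topspace B \<Longrightarrow> inj_on (pos w) V \<longleftrightarrow> Q w \<and> (\<forall>(a,v)\<in>X. pos w a \<noteq> pos w v)"
    and Q2: "\<And>w a v. (a,v) \<in> X \<Longrightarrow> fst w \<in> topspace B \<Longrightarrow> Q w \<Longrightarrow> pos w a = pos w v \<Longrightarrow> inj_on (pos w) (V - {v})"
    and x: "x \<in> carrier (homology_group q (Cf V))" "push q (Cf V) (Sb Q) id x = \<one>\<^bsub>homology_group q (Sb Q)\<^esub>"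
  shows "l x = 0"
proof -
  let ?S = "\<lambda>Y. Sb (\<lambda>w. Q w \<and> (\<forall>(a,v)\<in>Y. pos w a \<noteq> pos w v))"
  have inc: "continuous_map (Cf V) (?S Y) id" if "Y \<subseteq> X" for Y
    by (rule cm_Sb_mono) (use Q that in blast)
  have inc2: "continuous_map (?S Y) (?S Y') id" if "Y' \<subseteq> Y" for Y Y'
    by (rule cm_Sb_mono) (use that in blast)
  have "l x = 0" if "D \<subseteq> X" "x \<in> carrier (homology_group q (Cf V))"
      "push q (Cf V) (?S (X - D)) id x = \<one>\<^bsub>homology_group q (?S (X - D))\<^esub>" for D x
    using finite_subset[OF that(1) X] that
  proof (induction D arbitrary: x rule: finite_induct)
    case empty
    have e: "?S (X - {}) = Cf V" by (rule Sb_cong) (use Q in auto)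
    have "push q (Cf V) (Cf V) id x = \<one>\<^bsub>homology_group q (Cf V)\<^esub>" using empty.prems(3) unfolding e .
    moreover have "push q (Cf V) (Cf V) id x = x" by (rule push_id) (use empty in auto)
    ultimately show ?case using rhom_one[OF _ l] by simp
  next
    case (insert e D)
    obtain a v where e: "e = (a,v)" by (cases e)
    let ?Y = "X - insert e D" and ?W = "X - D"
    have YW: "?W = insert (a,v) ?Y" using insert e by auto
    have av: "v \<in> V - A" "a \<in> V - {v}" "kills q V l a v" using pairs[of a v] insert.prems(1) e by auto
    have SW: "?S ?W = Sb (\<lambda>w. (Q w \<and> (\<forall>(a,v)\<in>?Y. pos w a \<noteq> pos w v)) \<and> pos w a \<noteq> pos w v)"
      unfolding YW by (rule Sb_cong) auto
    let ?x1 = "push q (Cf V) (?S ?W) id x"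
    have x1: "push q (?S ?W) (?S ?Y) id ?x1 = \<one>\<^bsub>homology_group q (?S ?Y)\<^esub>"
    proof -
      have "push q (?S ?W) (?S ?Y) id ?x1 = push q (Cf V) (?S ?Y) (\<lambda>w. id (id w)) x"
        by (rule push_compose[OF inc inc2]) auto
      then show ?thesis using insert.prems(3) by (simp add: id_def)
    qed
    obtain y where y: "y \<in> carrier (homology_group (q-1) (Cf (V - {v})))"
      "?x1 = push q (Cf V) (?S ?W) id (L (q-1) V a v y)"
    proof (rule drop_kernel[OF V av(1,2), where Q = "\<lambda>w. Q w \<and> (\<forall>(a,v)\<in>?Y. pos w a \<noteq> pos w v)" and q = q and x = ?x1, folded SW])
      show "inj_on (pos w) V \<Longrightarrow> fst w \<in> topspace B \<Longrightarrow> Q w \<and> (\<forall>(a,v)\<in>?Y. pos w a \<noteq> pos w v)" for w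
        using Q by blast
      show "fst w \<in> topspace B \<Longrightarrow> Q w \<and> (\<forall>(a,v)\<in>?Y. pos w a \<noteq> pos w v) \<Longrightarrow> pos w a = pos w v \<Longrightarrow> inj_on (pos w) (V - {v})" for w
        using Q2[of a v w] insert.prems(1) e by blast
    qed (use x1 in \<open>simp_all add: push_closed\<close>)
    let ?z = "L (q-1) V a v y" and ?H = "homology_group q (Cf V)"
    interpret H: comm_group ?H by simp
    have z: "?z \<in> carrier ?H" using L_closed[of "q-1" V a v y] by simp
    have "l (x \<otimes>\<^bsub>?H\<^esub> inv\<^bsub>?H\<^esub> ?z) = 0"
    proof (rule insert.IH)
      show "push q (Cf V) (?S ?W) id (x \<otimes>\<^bsub>?H\<^esub> inv\<^bsub>?H\<^esub> ?z) = \<one>\<^bsub>homology_group q (?S ?W)\<^esub>"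
        by (rule hom_eq_imp_mult_inv[OF _ _ hom_push insert.prems(2) z y(2)]) simp_all
    qed (use insert.prems z in auto)
    moreover have "l (x \<otimes>\<^bsub>?H\<^esub> inv\<^bsub>?H\<^esub> ?z) = l x - l ?z"
      unfolding rhom_mult[OF l insert.prems(2) H.inv_closed[OF z]] rhom_inv[OF H.is_group l z] by simp
    moreover have "l ?z = 0" using av(3) y(1) by (simp add: kills_def)
    ultimately show ?case by simp
  qed
  from this[of X x] show ?thesis using x by simp
qed

lemma inj_on_swap:
  assumes "inj_on f (V - {c})" "f c = f u" "u \<in> V" "c \<in> V" "u \<noteq> c"
  shows "inj_on f (V - {u})"
proof -
  have "V - {u} = insert c (V - {c} - {u})" using assms by auto
  moreover have "f u \<notin> f ` (V - {c} - {u})" using assms(1,3,5) by (auto simp: inj_on_def)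
  then have "inj_on f (insert c (V - {c} - {u}))"
    using assms(1,2) by (auto simp: inj_on_insert inj_on_diff)
  ultimately show ?thesis by simp
qed

text \<open>Here \<open>c\<close> runs around the other vertices, while in
  \<open>star_anchor\<close> the others run around \<open>c\<close>. Which form applies depends on
  the residues that are known to vanish.\<close>

lemma star_moved:
  assumes V: "finite V" "c \<in> V - A" and l: "l \<in> hfun q (Cf V)"
    and k: "\<And>a. a \<in> V - {c} \<Longrightarrow> kills q V l a c"
    and x: "x \<in> carrier (homology_group q (Cf V))"
      "push q (Cf V) (Cf (V - {c})) id x = \<one>\<^bsub>homology_group q (Cf (V - {c}))\<^esub>"
  shows "l x = 0"
proof (rule star_kernel[OF V(1) l _ _ _ _ x, where X = "(\<lambda>a. (a,c)) ` (V - {c})"])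
  have Vc: "V = insert c (V - {c})" using V by auto
  show "inj_on (pos w) V \<longleftrightarrow> inj_on (pos w) (V - {c}) \<and> (\<forall>(a, v)\<in>(\<lambda>a. (a, c)) ` (V - {c}). pos w a \<noteq> pos w v)" for w
  proof -
    have "inj_on (pos w) V \<longleftrightarrow> inj_on (pos w) (V - {c}) \<and> (\<forall>u\<in>V - {c}. pos w c \<noteq> pos w u)"
      by (subst Vc, subst inj_on_insert) auto
    then show ?thesis by (auto simp: eq_commute[of "pos w c"])
  qed
qed (use V k in auto)

text \<open>Where \<open>c\<close> meets \<open>v\<close>, removing \<open>v\<close> instead of
  \<open>c\<close> leaves an injective configuration as well, so the tubes may be taken with
  \<open>c\<close> as centre. Two holes never meet, hence only free vertices \<open>v\<close> have
  to be considered.\<close>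

lemma star_anchor:
  assumes V: "finite V" "c \<in> V" "c \<in> A \<or> V \<inter> A = {}" and l: "l \<in> hfun q (Cf V)"
    and k: "\<And>v. v \<in> V - {c} - A \<Longrightarrow> kills q V l c v"
    and x: "x \<in> carrier (homology_group q (Cf V))"
      "push q (Cf V) (Cf (V - {c})) id x = \<one>\<^bsub>homology_group q (Cf (V - {c}))\<^esub>"
  shows "l x = 0"
proof (rule star_kernel[OF V(1) l _ _ _ _ x, where X = "(\<lambda>v. (c,v)) ` (V - {c} - A)"])
  have Vc: "V = insert c (V - {c})" using V by auto
  have hd: "pos w c \<noteq> pos w u" if "fst w \<in> topspace B" "c \<in> A" "u \<in> A" "u \<noteq> c" for w u
    using hole_distinct[of c u "fst w"] that by (auto simp: pos_def)
  show "inj_on (pos w) V \<longleftrightarrow> inj_on (pos w) (V - {c}) \<and> (\<forall>(a, v)\<in>(\<lambda>v. (c, v)) ` (V - {c} - A). pos w a \<noteq> pos w v)"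
    if "fst w \<in> topspace B" for w
  proof -
    have "inj_on (pos w) V \<longleftrightarrow> inj_on (pos w) (V - {c}) \<and> (\<forall>u\<in>V - {c}. pos w c \<noteq> pos w u)"
      by (subst Vc, subst inj_on_insert) auto
    moreover have "(\<forall>u\<in>V - {c}. pos w c \<noteq> pos w u) \<longleftrightarrow> (\<forall>u\<in>V - {c} - A. pos w c \<noteq> pos w u)"
      using hd[OF that] V(3) by blast
    ultimately show ?thesis by auto
  qed
  show "inj_on (pos w) (V - {v})" if "(a, v) \<in> (\<lambda>v. (c, v)) ` (V - {c} - A)" "inj_on (pos w) (V - {c})" "pos w a = pos w v" for w a v
    by (rule inj_on_swap[of _ _ c]) (use that V in auto)
qed (use V k in auto)

section \<open>The action of the permutations of free vertices\<close>

definition act :: "(nat \<Rightarrow> nat) \<Rightarrow> 'b \<times> (nat \<Rightarrow> complex) \<Rightarrow> 'b \<times> (nat \<Rightarrow> complex)" where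
  "act \<pi> w = (fst w, \<lambda>i. snd w (\<pi> i))"

lemma pos_act:
  assumes "\<pi> permutes (V - A)" shows "pos (act \<pi> w) v = pos w (\<pi> v)"
proof -
  have "\<pi> v \<in> A \<longleftrightarrow> v \<in> A" using permutes_in_image[OF assms, of v] permutes_not_in[OF assms, of v]
    by (cases "v \<in> V - A") auto
  moreover have "\<pi> v = v" if "v \<in> A" using permutes_not_in[OF assms, of v] that by simp
  ultimately show ?thesis by (auto simp: pos_def act_def)
qed

lemma perm_image:
  assumes "\<pi> permutes (V - A)" shows "\<pi> ` V = V" "v \<in> V \<Longrightarrow> \<pi> ` (V - {v}) = V - {\<pi> v}"
proof -
  have "\<pi> permutes V" using assms by (rule permutes_subset) auto
  then show 1: "\<pi> ` V = V" by (rule permutes_image)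
  show "\<pi> ` (V - {v}) = V - {\<pi> v}"
    using image_set_diff[OF permutes_inj[OF assms], of V "{v}"] 1 by simp
qed

lemma inj_on_act:
  assumes "\<pi> permutes (V - A)" shows "inj_on (pos (act \<pi> w)) U \<longleftrightarrow> inj_on (pos w) (\<pi> ` U)"
proof -
  have "pos (act \<pi> w) = pos w \<circ> \<pi>" using pos_act[OF assms] by (auto simp: fun_eq_iff)
  then show ?thesis using comp_inj_on_iff[OF inj_on_subset[OF permutes_inj[OF assms]], of U "pos w"] by simp
qed

lemma cm_act:
  assumes "\<pi> permutes (V - A)" shows "continuous_map (Cf (\<pi> ` U)) (Cf U) (act \<pi>)"
  unfolding continuous_map_Sb
  using inj_on_act[OF assms] cm_Sb_coord[OF cm_id_Sb] cm_Sb_base[OF cm_id_Sb] by (auto simp: act_def)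

lemma eps_act:
  assumes "\<pi> permutes (V - A)" shows "eps U a (act \<pi> w) = eps (\<pi> ` U) (\<pi> a) w"
proof -
  have inj: "inj \<pi>" by (rule permutes_inj[OF assms])
  have "\<pi> ` U - {\<pi> a} = \<pi> ` (U - {a})" using image_set_diff[OF inj, of U "{a}"] by simp
  then show ?thesis
    unfolding eps_def pos_act[OF assms] by (simp add: prod.reindex inj_on_subset[OF inj])
qed

text \<open>Permutations carry tubes to tubes without any homotopy, since the radius
  \<open>eps\<close> is a symmetric function of the vertices other than the centre.\<close>

lemma L_act_image:
  assumes pi: "\<pi> permutes (V - A)" and U: "finite U" "v \<in> U - A" "a \<in> U - {v}"
    and y: "y \<in> carrier (homology_group q (Cf (\<pi> ` U - {\<pi> v})))"
  shows "push (q+1) (Cf (\<pi> ` U)) (Cf U) (act \<pi>) (L q (\<pi> ` U) (\<pi> a) (\<pi> v) y) =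
    L q U a v (push q (Cf (\<pi> ` U - {\<pi> v})) (Cf (U - {v})) (act \<pi>) y)"
proof -
  have inj: "inj \<pi>" by (rule permutes_inj[OF pi])
  have im: "\<pi> ` (U - {v}) = \<pi> ` U - {\<pi> v}" using image_set_diff[OF inj, of U "{v}"] by simp
  have nA: "\<pi> v \<notin> A"
    using permutes_in_image[OF pi, of v] permutes_not_in[OF pi, of v] U(2) by (cases "v \<in> V - A") auto
  have pv: "\<pi> v \<in> \<pi> ` U - A" "\<pi> a \<in> \<pi> ` U - {\<pi> v}"
    using U nA inj by (auto dest: injD)
  have c1: "continuous_map (Cf (\<pi> ` U - {\<pi> v})) (Cf (U - {v})) (act \<pi>)" "continuous_map (Cf (\<pi> ` U)) (Cf U) (act \<pi>)"
    using cm_act[OF pi, of "U - {v}"] cm_act[OF pi, of U] unfolding im by simp_all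
  have r: "rad (U - {v}) a (eps (U - {v}) a)" "rad (\<pi> ` U - {\<pi> v}) (\<pi> a) (eps (\<pi> ` U - {\<pi> v}) (\<pi> a))"
    by (rule rad_eps, use U pv in auto)+
  have o: "continuous_map (SX (Cf (U - {v}))) (Cf U) (orb a v (eps (U - {v}) a))"
    "continuous_map (SX (Cf (\<pi> ` U - {\<pi> v}))) (Cf (\<pi> ` U)) (orb (\<pi> a) (\<pi> v) (eps (\<pi> ` U - {\<pi> v}) (\<pi> a)))"
    using cm_orb[OF U(2,3) r(1)] cm_orb[OF pv r(2)] by auto
  have e: "act \<pi> (orb (\<pi> a) (\<pi> v) (eps (\<pi> ` U - {\<pi> v}) (\<pi> a)) u) = orb a v (eps (U - {v}) a) (case u of (\<theta>,w) \<Rightarrow> (\<theta>, act \<pi> w))" for u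
  proof -
    have "eps (U - {v}) a (act \<pi> w) = eps (\<pi> ` U - {\<pi> v}) (\<pi> a) w" for w using eps_act[OF pi, of "U - {v}"] unfolding im .
    moreover have "\<pi> i = \<pi> v \<longleftrightarrow> i = v" for i using inj by (auto dest: injD)
    moreover obtain \<theta> w where u: "u = (\<theta>,w)" by (cases u)
    moreover have "orb a v (eps (U - {v}) a) (\<theta>, act \<pi> w) =
      (fst (act \<pi> w), (snd (act \<pi> w))(v := pos (act \<pi> w) a + of_real (eps (U - {v}) a (act \<pi> w)) * \<theta>))"
      by (simp add: orb_def)
    ultimately show ?thesis
      unfolding pos_act[OF pi] by (auto simp: act_def orb_def fun_eq_iff)
  qed
  show ?thesis
    unfolding L_def tau_natural[OF c1(1) y, symmetric] push_compose[OF o(2) c1(2)] push_compose[OF cm_SX_map[OF c1(1)] o(1)]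
    by (simp only: e)
qed

lemma L_act:
  assumes pi: "\<pi> permutes (V - A)" and V: "finite V" "v \<in> V - A" "a \<in> V - {v}"
    and y: "y \<in> carrier (homology_group q (Cf (V - {\<pi> v})))"
  shows "push (q+1) (Cf V) (Cf V) (act \<pi>) (L q V (\<pi> a) (\<pi> v) y) =
    L q V a v (push q (Cf (V - {\<pi> v})) (Cf (V - {v})) (act \<pi>) y)"
  using L_act_image[OF pi V, of y q] y unfolding perm_image(1)[OF pi] by blast

definition hinv :: "int \<Rightarrow> nat set \<Rightarrow> (('b \<times> (nat \<Rightarrow> complex)) chain set \<Rightarrow> rat) set" where
  "hinv q V = {l \<in> hfun q (Cf V). \<forall>\<pi>. \<pi> permutes (V - A) \<longrightarrow>
     (\<forall>x\<in>carrier (homology_group q (Cf V)). l (push q (Cf V) (Cf V) (act \<pi>) x) = l x)}"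

lemma kills_perm:
  assumes l: "l \<in> hinv q V" and pi: "\<pi> permutes (V - A)" and V: "finite V" "v \<in> V - A" "a \<in> V - {v}"
    and k: "kills q V l a v"
  shows "kills q V l (\<pi> a) (\<pi> v)"
  unfolding kills_def
proof
  fix y assume y: "y \<in> carrier (homology_group (q-1) (Cf (V - {\<pi> v})))"
  have "L (q-1) V (\<pi> a) (\<pi> v) y \<in> carrier (homology_group q (Cf V))" using L_closed[of "q-1"] by simp
  then have "l (L (q-1) V (\<pi> a) (\<pi> v) y) = l (push q (Cf V) (Cf V) (act \<pi>) (L (q-1) V (\<pi> a) (\<pi> v) y))"
    using l pi unfolding hinv_def by simp
  also have "\<dots> = l (L (q-1) V a v (push (q-1) (Cf (V - {\<pi> v})) (Cf (V - {v})) (act \<pi>) y))"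
    using L_act[OF pi V y] by simp
  also have "\<dots> = 0" using k push_closed unfolding kills_def by blast
  finally show "l (L (q-1) V (\<pi> a) (\<pi> v) y) = 0" .
qed

lemma perm_pair:
  assumes "a \<in> S" "v \<in> S" "a' \<in> S" "v' \<in> S" "a \<noteq> v" "a' \<noteq> v'"
  obtains \<pi> where "\<pi> permutes S" "\<pi> a = a'" "\<pi> v = v'"
proof -
  let ?t = "Transposition.transpose a a'"
  let ?\<pi> = "Transposition.transpose (?t v) v' \<circ> ?t"
  have t: "?t permutes S" using assms by (intro permutes_swap_id)
  then have "?t v \<in> S" using assms by (simp add: permutes_in_image)
  then have "?\<pi> permutes S" using assms by (intro permutes_compose[OF t] permutes_swap_id)
  moreover have "?t v \<noteq> a'" using assms(5) by (metis transpose_apply_first transpose_eq_iff)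
  then have "?\<pi> a = a'" using assms by (simp add: Transposition.transpose_def)
  moreover have "?\<pi> v = v'" by simp
  ultimately show thesis by (rule that)
qed

lemma hinv_hfun: "l \<in> hinv q V \<Longrightarrow> l \<in> hfun q (Cf V)"
  by (simp add: hinv_def)

lemma hinv_lincomb: "l \<in> hinv q V \<Longrightarrow> m \<in> hinv q V \<Longrightarrow> (\<lambda>x. l x - c * m x) \<in> hinv q V"
  unfolding hinv_def using rhom_lincomb by auto

lemma hinv_average:
  assumes V: "finite V" and m: "m \<in> hfun q (Cf V)"
  defines "N \<equiv> card {\<pi>. \<pi> permutes (V - A)}"
  shows "(\<lambda>x. if x \<in> carrier (homology_group q (Cf V)) then
     (\<Sum>\<pi> | \<pi> permutes (V - A). m (push q (Cf V) (Cf V) (act \<pi>) x)) / of_nat N else 0) \<in> hinv q V" (is "?m \<in> _")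
proof -
  let ?H = "homology_group q (Cf V)"
  have c: "continuous_map (Cf V) (Cf V) (act \<pi>)" if "\<pi> permutes (V - A)" for \<pi>
    using cm_act[OF that, of V] perm_image(1)[OF that] by simp
  interpret H: comm_group ?H by simp
  have act_act: "(\<lambda>x. act \<pi> (act \<rho> x)) = act (\<rho> \<circ> \<pi>)" for \<pi> \<rho>
    by (auto simp: act_def fun_eq_iff)
  have "?m \<in> rhom ?H"
    unfolding rhom_def
    by (auto simp: push_mult rhom_mult[OF m] push_closed sum.distrib add_divide_distrib)
  moreover have "?m (push q (Cf V) (Cf V) (act \<rho>) x) = ?m x" if r: "\<rho> permutes (V - A)" and x: "x \<in> carrier ?H" for \<rho> x
  proof -
    have "(\<Sum>\<pi> | \<pi> permutes (V - A). m (push q (Cf V) (Cf V) (act \<pi>) (push q (Cf V) (Cf V) (act \<rho>) x))) =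
      (\<Sum>\<pi> | \<pi> permutes (V - A). m (push q (Cf V) (Cf V) (act (\<rho> \<circ> \<pi>)) x))"
    proof (rule sum.cong[OF refl])
      fix \<pi> assume "\<pi> \<in> {\<pi>. \<pi> permutes (V - A)}"
      then show "m (push q (Cf V) (Cf V) (act \<pi>) (push q (Cf V) (Cf V) (act \<rho>) x)) = m (push q (Cf V) (Cf V) (act (\<rho> \<circ> \<pi>)) x)"
        by (subst push_compose[OF c[OF r] c]) (simp_all add: act_act)
    qed
    also have "\<dots> = (\<Sum>\<pi> | \<pi> permutes (V - A). m (push q (Cf V) (Cf V) (act \<pi>) x))"
      by (rule setum_permutations_compose_left[OF r, symmetric])
    finally show ?thesis using x by (simp add: push_closed)
  qed
  ultimately show ?thesis unfolding hinv_def by blast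
qed

text \<open>Among the invariant functionals, those whose residue at the hole \<open>c\<close> vanishes extend over it.\<close>

lemma sep_hole:
  assumes V: "finite V" "c \<in> V \<inter> A" "v \<in> V - A"
    and n: "sep (hinv q (V - {c})) n" and m: "sep (hinv (q-1) (V - {v})) m"
  shows "sep (hinv q V) (m + n)"
proof (rule sep_rhom_extend[OF m, where g = "L (q-1) V c v" and G = "homology_group (q-1) (Cf (V - {v}))" and H = "homology_group q (Cf V)"])
  have LH: "L (q-1) V c v \<in> hom (homology_group (q-1) (Cf (V - {v}))) (homology_group q (Cf V))"
    using L_hom[of "q-1" V c v] by simp
  then show "L (q-1) V c v \<in> hom (homology_group (q-1) (Cf (V - {v}))) (homology_group q (Cf V))" .
  have cv: "c \<in> V - {v}" using V by auto
  let ?r = "rpull (homology_group (q-1) (Cf (V - {v}))) (L (q-1) V c v)"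
  fix l assume l: "l \<in> hinv q V"
  have "?r l \<in> hfun (q-1) (Cf (V - {v}))" by (rule rpull_rhom[OF LH hinv_hfun[OF l]]) simp
  moreover have "?r l (push (q-1) (Cf (V - {v})) (Cf (V - {v})) (act \<pi>) y) = ?r l y"
    if pi: "\<pi> permutes (V - {v} - A)" and y: "y \<in> carrier (homology_group (q-1) (Cf (V - {v})))" for \<pi> y
  proof -
    \<comment> \<open>A permutation of the remaining free vertices fixes \<open>v\<close> and
      \<open>c\<close>, so the residue of an invariant functional is again invariant.\<close>
    have pi': "\<pi> permutes (V - A)" by (rule permutes_subset[OF pi]) auto
    have fx: "\<pi> v = v" "\<pi> c = c" using permutes_not_in[OF pi] V by auto
    have "l (L (q-1) V c v (push (q-1) (Cf (V - {v})) (Cf (V - {v})) (act \<pi>) y)) = l (push q (Cf V) (Cf V) (act \<pi>) (L (q-1) V c v y))"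
      using L_act[OF pi' V(1,3) cv, of y "q-1"] y by (simp add: fx)
    also have "\<dots> = l (L (q-1) V c v y)"
      using l pi' L_closed[of "q-1" V c v y] by (simp add: hinv_def)
    finally show ?thesis using y by (simp add: rpull_def push_closed)
  qed
  ultimately show "?r l \<in> hinv (q-1) (V - {v})" unfolding hinv_def by blast
next
  have inc: "continuous_map (Cf V) (Cf (V - {c})) id" by (rule cm_Sb_mono) (auto intro: inj_on_subset)
  let ?i = "push q (Cf V) (Cf (V - {c})) id" and ?H = "homology_group q (Cf V)"
  have PA: "V - {c} - A = V - A" using V by auto
  show "sep {l \<in> hinv q V. \<forall>x\<in>carrier (homology_group (q-1) (Cf (V - {v}))). l (L (q-1) V c v x) = 0} n"
  proof (rule sep_mono[OF sep_image[OF n hinv_lincomb, where g = ?i and A = "carrier ?H"] _ order_refl], safe)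
    fix l assume l: "l \<in> hinv q V" and "\<forall>x\<in>carrier (homology_group (q-1) (Cf (V - {v}))). l (L (q-1) V c v x) = 0"
    then have k: "kills q V l c v" by (simp add: kills_def)
    \<comment> \<open>One vanishing residue at the hole gives all of them, because exchanging
      \<open>u\<close> and \<open>v\<close> fixes \<open>c\<close>.\<close>
    have k': "kills q V l c u" if "u \<in> V - {c} - A" for u
    proof -
      have t: "Transposition.transpose u v permutes (V - A)" using that V by (intro permutes_swap_id) auto
      have "kills q V l (Transposition.transpose u v c) (Transposition.transpose u v v)"
        by (rule kills_perm[OF l t V(1,3) _ k]) (use V in auto)
      moreover have "Transposition.transpose u v c = c" using that V by (auto simp: Transposition.transpose_def)
      ultimately show ?thesis by simp
    qed
    have lf: "l \<in> hfun q (Cf V)" by (rule hinv_hfun[OF l])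
    have "l x = 0" if "x \<in> carrier ?H" "?i x = \<one>\<^bsub>homology_group q (Cf (V - {c}))\<^esub>" for x
      by (rule star_anchor[OF V(1) _ _ lf k' that]) (use V in auto)
    then have "\<exists>m\<in>hfun q (Cf (V - {c})). \<forall>x\<in>carrier ?H. l x = m (?i x)"
      by (intro rhom_factor[OF _ _ hom_push lf]) auto
    then obtain m where m: "m \<in> hfun q (Cf (V - {c}))" "\<forall>x\<in>carrier ?H. l x = m (?i x)" ..
    \<comment> \<open>The extension \<open>m\<close> need not be invariant. Its average is, and has
      the same values on the image of \<open>?i\<close>, because \<open>l\<close> is invariant and
      the inclusion commutes with the permutations.\<close>
    let ?P = "{\<pi>. \<pi> permutes (V - A)}"
    let ?m = "\<lambda>x. if x \<in> carrier (homology_group q (Cf (V - {c}))) then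
     (\<Sum>\<pi>\<in>?P. m (push q (Cf (V - {c})) (Cf (V - {c})) (act \<pi>) x)) / of_nat (card ?P) else 0"
    have mi: "?m \<in> hinv q (V - {c})"
      using hinv_average[OF _ m(1)] V(1) unfolding PA by simp
    have "l x = ?m (?i x)" if x: "x \<in> carrier ?H" for x
    proof -
      have "m (push q (Cf (V - {c})) (Cf (V - {c})) (act \<pi>) (?i x)) = l x" if pi: "\<pi> permutes (V - A)" for \<pi>
      proof -
        have ca: "continuous_map (Cf V) (Cf V) (act \<pi>)" using cm_act[OF pi, of V] perm_image(1)[OF pi] by simp
        have "\<pi> c = c" using permutes_not_in[OF pi, of c] V by simp
        then have ca': "continuous_map (Cf (V - {c})) (Cf (V - {c})) (act \<pi>)"
          using cm_act[OF pi, of "V - {c}"] perm_image(2)[OF pi, of c] V by simp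
        have "push q (Cf (V - {c})) (Cf (V - {c})) (act \<pi>) (?i x) = ?i (push q (Cf V) (Cf V) (act \<pi>) x)"
          unfolding push_compose[OF inc ca'] push_compose[OF ca inc] by simp
        moreover have "l (push q (Cf V) (Cf V) (act \<pi>) x) = m (?i (push q (Cf V) (Cf V) (act \<pi>) x))"
          using m(2) push_closed[of q "Cf V" "Cf V" "act \<pi>" x] by blast
        moreover have "l (push q (Cf V) (Cf V) (act \<pi>) x) = l x" using l pi x unfolding hinv_def by blast
        ultimately show ?thesis by simp
      qed
      then have "(\<Sum>\<pi>\<in>?P. m (push q (Cf (V - {c})) (Cf (V - {c})) (act \<pi>) (?i x))) = of_nat (card ?P) * l x"
        by simp
      moreover have "card ?P \<noteq> 0"
      proof -
        have "finite ?P" using V(1) by (intro finite_permutations) auto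
        moreover have "id \<in> ?P" by (simp add: permutes_id)
        ultimately show ?thesis by (metis card_eq_0_iff empty_iff)
      qed
      ultimately show ?thesis by (simp add: push_closed)
    qed
    then have "l = (\<lambda>x. if x \<in> carrier ?H then ?m (?i x) else 0)"
      using rhom_outside[OF lf] by auto
    then show "l \<in> (\<lambda>l x. if x \<in> carrier ?H then l (?i x) else 0) ` hinv q (V - {c})" by (rule image_eqI[OF _ mi])
  qed
qed simp

section \<open>Unconstrained coordinates and the passage to the base\<close>

definition origin :: "'b \<Rightarrow> 'b \<times> (nat \<Rightarrow> complex)" where
  "origin b = (b, \<lambda>_. 0)"

lemma cm_origin: "continuous_map B (Sb (\<lambda>_. True)) origin"
  by (simp add: origin_def continuous_map_Sb cmi_misc)

lemma cm_fst_Sb: "continuous_map (Sb Q) B fst"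
  using cm_Sb_base[OF cm_id_Sb] .

lemma contract_fibre:
  assumes "x \<in> carrier (homology_group q (Sb (\<lambda>_. True)))"
  shows "push q B (Sb (\<lambda>_. True)) origin (push q (Sb (\<lambda>_. True)) B fst x) = x"
proof -
  let ?T = "Sb (\<lambda>_. True)"
  have "push q ?T ?T (\<lambda>w. origin (fst w)) = push q ?T ?T (\<lambda>w. w)"
    by (rule linear_homotopy)
      (use continuous_map_compose[OF cm_fst_Sb cm_origin] in \<open>auto simp: comp_def origin_def\<close>)
  then show ?thesis
    unfolding push_compose[OF cm_fst_Sb cm_origin] using push_id[OF assms] by simp
qed

lemma sep_base:
  assumes "sep (hfun q B) n" shows "sep (hfun q (Sb (\<lambda>_. True))) n"
proof (rule sep_mono[OF sep_rpull[OF assms, where g = "push q (Sb (\<lambda>_. True)) B fst" and G = "homology_group q (Sb (\<lambda>_. True))"]])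
  let ?T = "Sb (\<lambda>_. True)"
  show "hfun q ?T \<subseteq> {rpull (homology_group q ?T) (push q ?T B fst) l |l. l \<in> hfun q B}"
  proof
    fix l assume l: "l \<in> hfun q ?T"
    have "rpull (homology_group q B) (push q B ?T origin) l \<in> hfun q B" by (rule rpull_rhom[OF hom_push l]) simp
    moreover have "l = rpull (homology_group q ?T) (push q ?T B fst) (rpull (homology_group q B) (push q B ?T origin) l)"
    proof
      fix x show "l x = rpull (homology_group q ?T) (push q ?T B fst) (rpull (homology_group q B) (push q B ?T origin) l) x"
        by (cases "x \<in> carrier (homology_group q ?T)")
          (simp_all add: rpull_def push_closed contract_fibre rhom_outside[OF l])
    qed
    ultimately show "l \<in> {rpull (homology_group q ?T) (push q ?T B fst) l |l. l \<in> hfun q B}" by blast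
  qed
qed simp

text \<open>The new position of \<open>v\<close> is a real number that exceeds the modulus of every
  other coordinate with index in \<open>V\<close> and depends continuously on them, so no other free
  vertex of \<open>V\<close> can collide with it.\<close>

definition far :: "nat set \<Rightarrow> nat \<Rightarrow> 'b \<times> (nat \<Rightarrow> complex) \<Rightarrow> 'b \<times> (nat \<Rightarrow> complex)" where
  "far V v w = (fst w, (snd w)(v := of_real (1 + (\<Sum>u\<in>V - {v}. cmod (snd w u)))))"

lemma cm_far_coord: "continuous_map X (Sb Q) f \<Longrightarrow> continuous_map X euclidean (\<lambda>x. snd (far V v (f x)) i)"
  unfolding far_def by (cases "i = v") (auto intro!: cmi cm_Sb_coord)

lemma fst_far [simp]: "fst (far V v w) = fst w"
  by (simp add: far_def)

lemma snd_far: "snd (far V v w) i = (if i = v then of_real (1 + (\<Sum>u\<in>V - {v}. cmod (snd w u))) else snd w i)"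
  by (simp add: far_def)

lemma far_bound:
  assumes "finite V" "u \<in> V - {v}" shows "cmod (snd w u) < cmod (snd (far V v w) v)"
proof -
  have "cmod (snd w u) \<le> (\<Sum>u\<in>V - {v}. cmod (snd w u))"
    using assms by (intro member_le_sum) auto
  moreover have "0 \<le> (\<Sum>u\<in>V - {v}. cmod (snd w u))" by (simp add: sum_nonneg)
  then have "cmod (snd (far V v w) v) = 1 + (\<Sum>u\<in>V - {v}. cmod (snd w u))"
    unfolding snd_far by (simp add: cmod_eq_Re)
  ultimately show ?thesis by linarith
qed

lemma inj_on_far:
  assumes V: "finite V" "V \<inter> A = {}" and S: "S \<subseteq> V" "v \<in> V" "inj_on (pos w) (S - {v})"
  shows "inj_on (pos (far V v w)) (insert v S)"
proof -
  have p: "pos (far V v w) u = (if u = v then snd (far V v w) v else pos w u)" if "u \<in> V" for u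
    using that V(2) by (auto simp: pos_def snd_far)
  have e: "pos w u = snd w u" if "u \<in> V" for u using that V(2) by (auto simp: pos_def)
  have "pos w u \<noteq> snd (far V v w) v" if "u \<in> S - {v}" for u
    using far_bound[OF V(1), of u v w] that S e by (metis Diff_iff less_irrefl subsetD)
  then have "inj_on (\<lambda>u. if u = v then snd (far V v w) v else pos w u) (insert v S)"
    using S(3) unfolding inj_on_def by (metis DiffI insertE singletonD)
  then show ?thesis using p S by (subst inj_on_cong[OF p]) auto
qed

lemma cm_far:
  assumes "finite V" "V \<inter> A = {}" "v \<in> V"
  shows "continuous_map (Cf V) (Cf V) (far V v)"
  unfolding continuous_map_Sb
proof (intro conjI ballI allI)
  show "continuous_map (Cf V) euclidean (\<lambda>x. snd (far V v x) i)" for i by (rule cm_far_coord[OF cm_id_Sb])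
  show "inj_on (pos (far V v x)) V" if "x \<in> topspace (Cf V)" for x
    using inj_on_far[OF assms(1,2) subset_refl assms(3), of x] that assms(3) by (auto simp: insert_absorb inj_on_diff)
qed (simp add: cm_fst_Sb)

text \<open>Moving \<open>v\<close> away is invisible once \<open>v\<close> is forgotten. A class
  and its image therefore differ by an element of the kernel on which \<open>l\<close> vanishes by
  \<open>star_moved\<close> or \<open>star_anchor\<close>.\<close>

lemma far_invariant:
  assumes V: "finite V" "V \<inter> A = {}" "v \<in> V" and l: "l \<in> hfun q (Cf V)"
    and k: "(\<forall>a\<in>V - {v}. kills q V l a v) \<or> (\<forall>u\<in>V - {v}. kills q V l v u)"
    and x: "x \<in> carrier (homology_group q (Cf V))"
  shows "l (push q (Cf V) (Cf V) (far V v) x) = l x"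
proof -
  let ?H = "homology_group q (Cf V)"
  interpret H: comm_group ?H by simp
  let ?y = "push q (Cf V) (Cf V) (far V v) x"
  have inc: "continuous_map (Cf V) (Cf (V - {v})) id" by (rule cm_Sb_mono) (auto intro: inj_on_subset)
  have "push q (Cf V) (Cf (V - {v})) (\<lambda>w. id (far V v w)) = push q (Cf V) (Cf (V - {v})) id"
  proof (rule linear_homotopy)
    show "continuous_map (Cf V) (Cf (V - {v})) (\<lambda>w. id (far V v w))"
      using continuous_map_compose[OF cm_far[OF V] inc] by (simp add: comp_def)
    fix w t assume w: "w \<in> topspace (Cf V)"
    have "(1 - of_real t) * snd (id (far V v w)) i + of_real t * snd (id w) i = snd w i" if "i \<noteq> v" for i
      using that by (simp add: snd_far algebra_simps)
    then have "pos (fst (id (far V v w)), \<lambda>i. (1 - of_real t) * snd (id (far V v w)) i + of_real t * snd (id w) i) i = pos w i" if "i \<in> V - {v}" for i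
      using that V by (auto simp: pos_def)
    then show "inj_on (pos (fst (id (far V v w)), \<lambda>i. (1 - of_real t) * snd (id (far V v w)) i + of_real t * snd (id w) i)) (V - {v})"
      using w by (subst inj_on_cong) (auto intro: inj_on_subset)
  qed (use inc in auto)
  then have eq: "push q (Cf V) (Cf (V - {v})) id ?y = push q (Cf V) (Cf (V - {v})) id x"
    unfolding push_compose[OF cm_far[OF V] inc] by simp
  let ?d = "?y \<otimes>\<^bsub>?H\<^esub> inv\<^bsub>?H\<^esub> x"
  have d: "?d \<in> carrier ?H" "push q (Cf V) (Cf (V - {v})) id ?d = \<one>\<^bsub>homology_group q (Cf (V - {v}))\<^esub>"
    by (rule H.m_closed[OF push_closed H.inv_closed[OF x]], rule hom_eq_imp_mult_inv[OF _ _ hom_push push_closed x eq]) simp_all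
  have "l ?d = 0"
    using k
  proof
    assume k: "\<forall>a\<in>V - {v}. kills q V l a v"
    show ?thesis by (rule star_moved[OF V(1) _ l _ d]) (use V k in auto)
  next
    assume k: "\<forall>u\<in>V - {v}. kills q V l v u"
    show ?thesis by (rule star_anchor[OF V(1) _ _ l _ d]) (use V k in auto)
  qed
  moreover have "l ?d = l ?y - l x"
    unfolding rhom_mult[OF l push_closed H.inv_closed[OF x]] rhom_inv[OF H.is_group l x] by simp
  ultimately show ?thesis by simp
qed

text \<open>After every vertex but \<open>o'\<close> has been moved away, one after the other, their
  former positions no longer matter for injectivity. So the composed move is defined on the space
  without constraints, which retracts to the base, while the values of \<open>l\<close> have not
  changed.\<close>

lemma factor_through_base:
  assumes V: "finite V" "V \<inter> A = {}" "o' \<in> V" and l: "l \<in> hfun q (Cf V)"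
    and k: "\<And>a v. v \<in> V - {o'} \<Longrightarrow> a \<in> V - {v} \<Longrightarrow> kills q V l a v"
  shows "\<exists>m\<in>hfun q B. l = rpull (homology_group q (Cf V)) (push q (Cf V) B fst) m"
proof -
  let ?T = "Sb (\<lambda>_. True)" and ?H = "homology_group q (Cf V)"
  \<comment> \<open>Starting from the single vertex \<open>o'\<close>, each \<open>far\<close> adds
    one vertex to the set on which the image of an unconstrained point is injective.\<close>
  have key: "continuous_map ?T (Cf (insert o' (set vs))) (foldr (far V) vs)
     \<and> continuous_map (Cf V) (Cf V) (foldr (far V) vs)
     \<and> (\<forall>x\<in>carrier ?H. l (push q (Cf V) (Cf V) (foldr (far V) vs) x) = l x)"
    if "distinct vs" "set vs \<subseteq> V - {o'}" for vs
    using that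
  proof (induction vs)
    case Nil
    have "continuous_map ?T (Cf {o'}) id" by (rule cm_Sb_mono) auto
    then show ?case using push_id[of _ q "Cf V" "\<lambda>a. a"] by (simp add: id_def)
  next
    case (Cons v vs)
    then have v: "v \<in> V" "v \<noteq> o'" "v \<notin> set vs" and IH: "continuous_map ?T (Cf (insert o' (set vs))) (foldr (far V) vs)"
      "continuous_map (Cf V) (Cf V) (foldr (far V) vs)"
      "\<forall>x\<in>carrier ?H. l (push q (Cf V) (Cf V) (foldr (far V) vs) x) = l x" by auto
    have f: "foldr (far V) (v # vs) = (\<lambda>w. far V v (foldr (far V) vs w))" by auto
    have "continuous_map ?T (Cf (insert v (insert o' (set vs)))) (\<lambda>w. far V v (foldr (far V) vs w))"
      unfolding continuous_map_Sb
    proof (intro conjI allI ballI)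
      fix w assume "w \<in> topspace ?T"
      then have "inj_on (pos (foldr (far V) vs w)) (insert o' (set vs))" using IH(1)[unfolded continuous_map_Sb] by blast
      then show "inj_on (pos (far V v (foldr (far V) vs w))) (insert v (insert o' (set vs)))"
        using v Cons.prems V(3) by (intro inj_on_far[OF V(1,2)]) (auto intro: inj_on_diff)
    qed (use cm_far_coord[OF IH(1)] cm_Sb_base[OF IH(1)] in auto)
    then have 1: "continuous_map ?T (Cf (insert o' (set (v # vs)))) (foldr (far V) (v # vs))"
      unfolding f by (simp add: insert_commute)
    have 2: "continuous_map (Cf V) (Cf V) (foldr (far V) (v # vs))"
      unfolding f using continuous_map_compose[OF IH(2) cm_far[OF V(1,2) v(1)]] by (simp add: comp_def)
    have "l (push q (Cf V) (Cf V) (foldr (far V) (v # vs)) x) = l x" if "x \<in> carrier ?H" for x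
    proof -
      have "l (push q (Cf V) (Cf V) (far V v) (push q (Cf V) (Cf V) (foldr (far V) vs) x)) = l (push q (Cf V) (Cf V) (foldr (far V) vs) x)"
        using k v by (intro far_invariant[OF V(1,2) v(1) l _ push_closed]) auto
      then show ?thesis using IH(3) that unfolding f push_compose[OF IH(2) cm_far[OF V(1,2) v(1)]] by simp
    qed
    with 1 2 show ?case by blast
  qed
  obtain vs where vs: "set vs = V - {o'}" "distinct vs"
    using finite_distinct_list[of "V - {o'}"] V(1) by auto
  let ?T' = "foldr (far V) vs"
  have VV: "insert o' (set vs) = V" using vs V(3) by auto
  have T: "continuous_map ?T (Cf V) ?T'" "\<And>x. x \<in> carrier ?H \<Longrightarrow> l (push q (Cf V) (Cf V) ?T' x) = l x"
    using key[OF vs(2)] vs(1) unfolding VV by auto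
  have inc: "continuous_map (Cf V) ?T id" by (rule cm_Sb_mono) auto
  let ?s = "push q B (Cf V) (\<lambda>b. ?T' (origin b))"
  let ?m = "rpull (homology_group q B) ?s l"
  have "?m \<in> hfun q B" by (rule rpull_rhom[OF hom_push l]) simp
  moreover have key2: "l (?s (push q (Cf V) B fst x)) = l x" if x: "x \<in> carrier ?H" for x
  proof -
    have "push q (Cf V) (Cf V) ?T' x = push q ?T (Cf V) ?T' (push q (Cf V) ?T id x)"
      unfolding push_compose[OF inc T(1)] by simp
    also have "\<dots> = push q ?T (Cf V) ?T' (push q B ?T origin (push q ?T B fst (push q (Cf V) ?T id x)))"
      by (simp add: contract_fibre push_closed)
    also have "push q ?T B fst (push q (Cf V) ?T id x) = push q (Cf V) B fst x"
      unfolding push_compose[OF inc cm_fst_Sb] by simp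
    finally show ?thesis using T(2)[OF x] unfolding push_compose[OF cm_origin T(1)] by simp
  qed
  have "l = rpull ?H (push q (Cf V) B fst) ?m"
  proof
    fix x show "l x = rpull ?H (push q (Cf V) B fst) ?m x"
      by (cases "x \<in> carrier ?H") (simp_all add: rpull_def push_closed key2 rhom_outside[OF l])
  qed
  ultimately show ?thesis by blast
qed

end

section \<open>The Jacobi identity for residues\<close>

lemma convex_multiples_nonzero:
  fixes d :: complex
  assumes "d \<noteq> 0" "0 < r" "0 < s" "0 \<le> t" "t \<le> (1::real)"
  shows "(1 - of_real t) * (of_real r * d) + of_real t * (of_real s * d) \<noteq> 0"
proof -
  have "(1 - of_real t) * (of_real r * d) + of_real t * (of_real s * d) = of_real ((1 - t) * r + t * s) * d"
    by (simp add: algebra_simps)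
  moreover have "0 < (1 - t) * r + t * s"
    using assms convex_bound_lt[of "- r" 0 "- s" "1 - t" t] by simp
  ultimately show ?thesis using assms(1) by (metis mult_eq_0_iff less_irrefl of_real_eq_0_iff)
qed

lemma half_plus_notin:
  fixes w :: complex
  assumes "norm w > 1/2" shows "1/2 + \<i> * w \<notin> {0,1}"
proof -
  have n: "norm (\<i> * w) > 1/2" using assms by (simp add: norm_mult)
  have "1/2 + \<i> * w \<noteq> 0"
  proof
    assume "1/2 + \<i> * w = 0"
    then have "\<i> * w = - (1/2)" by (simp only: eq_neg_iff_add_eq_0 add.commute)
    then have "norm (\<i> * w) = 1/2" by (simp only: norm_minus_cancel norm_divide norm_one norm_numeral)
    then show False using n by simp
  qed
  moreover have "1/2 + \<i> * w \<noteq> 1"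
  proof
    assume "1/2 + \<i> * w = 1"
    then have "\<i> * w = 1 - 1/2" by (simp only: eq_diff_eq add.commute)
    then have "\<i> * w = 1/2" by (simp only: field_sum_of_halves eq_diff_eq[symmetric]) simp
    then have "norm (\<i> * w) = norm (1/2 :: complex)" by (rule arg_cong)
    then show False using n by (simp only: norm_divide norm_one norm_numeral)
  qed
  ultimately show ?thesis by simp
qed

lemma convex_same: "(1 - of_real t) * z + of_real t * z = (z :: complex)"
  by (simp add: algebra_simps)

text \<open>The origin of the figure eight below: half of the right side, with
  \<open>Im \<zeta>\<close> replaced by its absolute value, is \<open>\<zeta>\<^sup>2 / 2\<close> on
  the upper half circle, a loop around 0, and \<open>1 - \<zeta>\<^sup>2 / 2\<close> on the lower
  one, a loop around 1.\<close>

lemma unit_square: "norm \<zeta> = 1 \<Longrightarrow> \<zeta>\<^sup>2 = 1 + 2 * \<i> * of_real (Im \<zeta>) * \<zeta>"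
proof -
  assume "norm \<zeta> = 1"
  then have "(norm \<zeta>)\<^sup>2 = 1" by simp
  then have "(Re \<zeta>)\<^sup>2 + (Im \<zeta>)\<^sup>2 = 1" unfolding cmod_power2 .
  then show ?thesis by (simp add: complex_eq_iff power2_eq_square)
qed

text \<open>The figure eight is inflated to the circle of radius 2 about the midpoint 1/2. All
  intermediate points are \<open>1/2 + \<i> * m * \<zeta>\<close> with \<open>m\<close> at least
  \<open>\<bar>Im \<zeta>\<bar>\<close>. Such a point is real only if \<open>m = 0\<close>, when it
  is 1/2, or if \<zeta> is \<i> or -\<i>, when \<open>m\<close> is at least 1.\<close>

lemma pencil:
  assumes z: "norm \<zeta> = 1" "0 \<le> t" "t \<le> (1::real)"
  shows "(1 - of_real t) * (1/2 + \<i> * of_real \<bar>Im \<zeta>\<bar> * \<zeta>) + of_real t * (1/2 + 2 * \<i> * \<zeta>) \<notin> {0,1}"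
proof -
  have e: "(1 - c) * (h + \<i> * b * z) + c * (h + 2 * \<i> * z) = h + \<i> * (((1 - c) * b + c * 2) * z)" for b c h z :: complex
    by (simp add: algebra_simps)
  define m where "m = (1 - t) * \<bar>Im \<zeta>\<bar> + t * 2"
  have "(1 - of_real t) * (1/2 + \<i> * of_real \<bar>Im \<zeta>\<bar> * \<zeta>) + of_real t * (1/2 + 2 * \<i> * \<zeta>) = 1/2 + \<i> * (of_real m * \<zeta>)"
    unfolding m_def of_real_add of_real_mult of_real_diff of_real_1 of_real_numeral by (rule e)
  moreover have "1/2 + \<i> * (of_real m * \<zeta>) \<notin> {0,1}"
  proof (cases "Re \<zeta> = 0")
    case True
    then have "\<bar>Im \<zeta>\<bar> = 1" using z(1) by (simp add: cmod_def)
    then have "m > 1/2" using z by (simp add: m_def)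
    then show ?thesis by (intro half_plus_notin) (use z in \<open>simp add: norm_mult\<close>)
  next
    case False
    show ?thesis
    proof (cases "m = 0")
      case False
      have "Im (1/2 + \<i> * (of_real m * \<zeta>)) = m * Re \<zeta>" by simp
      then have "Im (1/2 + \<i> * (of_real m * \<zeta>)) \<noteq> 0" using False \<open>Re \<zeta> \<noteq> 0\<close> by simp
      then show ?thesis by fastforce
    qed simp
  qed
  ultimately show ?thesis by simp
qed

lemma circle_misses_real:
  assumes "norm \<zeta> = 1" "\<bar>c\<bar> < m" shows "of_real c + \<i> * of_real m * \<zeta> \<noteq> 0"
proof
  assume "of_real c + \<i> * of_real m * \<zeta> = 0"
  then have "\<i> * of_real m * \<zeta> = of_real (- c)" by (simp add: eq_neg_iff_add_eq_0 add.commute)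
  then have "norm (\<i> * of_real m * \<zeta>) = norm (of_real (- c) :: complex)" by (rule arg_cong)
  then show False using assms by (simp add: norm_mult)
qed

lemma continuous_map_if_const:
  "continuous_map X Y f \<Longrightarrow> continuous_map X Y g \<Longrightarrow> continuous_map X Y (\<lambda>x. if P then f x else g x)"
  by (cases P) simp_all

lemma tau2_inner_rotate:
  assumes y: "y \<in> carrier (homology_group p W)" and f: "continuous_map (SX (SX W)) M f"
  shows "push (p+1+1) (SX (SX W)) M (\<lambda>(\<zeta>,(\<theta>,w)). f (\<zeta>,(cis r * \<theta>,w))) (tau2 p W y) = push (p+1+1) (SX (SX W)) M f (tau2 p W y)"
proof -
  let ?r = "\<lambda>(\<theta>,w). (cis r * \<theta>, w)"
  have r: "continuous_map (SX W) (SX W) ?r"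
    by (auto simp: continuous_map_SX case_prod_unfold norm_mult intro!: cmi)
  have ty: "tau p W y \<in> carrier (homology_group (p+1) (SX W))" by (rule tau_closed[OF y])
  have "push (p+1) (SX W) (SX W) ?r (tau p W y) = tau p W y"
    unfolding tau_rotate by (rule push_id[OF ty]) auto
  then have "tau2 p W y = push (p+1+1) (SX (SX W)) (SX (SX W)) (\<lambda>(\<theta>,v). (\<theta>, ?r v)) (tau2 p W y)"
    unfolding tau2_def tau_natural[OF r ty] by simp
  then have "push (p+1+1) (SX (SX W)) M f (tau2 p W y) =
    push (p+1+1) (SX (SX W)) M f (push (p+1+1) (SX (SX W)) (SX (SX W)) (\<lambda>(\<theta>,v). (\<theta>, ?r v)) (tau2 p W y))" by (rule arg_cong)
  then show ?thesis
    unfolding push_compose[OF cm_SX_map[OF r] f] by (simp add: case_prod_unfold)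
qed

lemma tau_outer_rotate:
  assumes y: "y \<in> carrier (homology_group q V)" and f: "continuous_map (SX V) M f"
  shows "push (q+1) (SX V) M (\<lambda>(\<zeta>,w). f (cis r * \<zeta>,w)) (tau q V y) = push (q+1) (SX V) M f (tau q V y)"
proof -
  let ?r = "\<lambda>(\<theta>,w). (cis r * \<theta>, w)"
  have r: "continuous_map (SX V) (SX V) ?r"
    by (auto simp: continuous_map_SX case_prod_unfold norm_mult intro!: cmi)
  have "push (q+1) (SX V) (SX V) ?r (tau q V y) = tau q V y"
    unfolding tau_rotate by (rule push_id[OF tau_closed[OF y]]) auto
  then have "push (q+1) (SX V) M f (tau q V y) = push (q+1) (SX V) M f (push (q+1) (SX V) (SX V) ?r (tau q V y))" by simp
  then show ?thesis unfolding push_compose[OF r f] by (simp add: case_prod_unfold)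
qed

context config
begin

text \<open>Naturality of \<open>tau\<close> moves the inner tube under the outer circle, so an
  iterated tube becomes a single family of two-tori to which the sign rules apply.\<close>

lemma L_compose:
  assumes V: "finite V" "u \<in> V - A" "v \<in> V - {u} - A" "a \<in> V - {u}" "a' \<in> V - {u} - {v}"
    and y: "y \<in> carrier (homology_group q (Cf (V - {u} - {v})))"
  defines "W \<equiv> Cf (V - {u} - {v})"
  shows "L (q+1) V a u (L q (V - {u}) a' v y) = push (q+1+1) (SX (SX W)) (Cf V)
    (\<lambda>(\<zeta>,x). orb a u (eps (V - {u}) a) (\<zeta>, orb a' v (eps (V - {u} - {v}) a') x)) (tau2 q W y)"
    "continuous_map (SX (SX W)) (Cf V)
    (\<lambda>(\<zeta>,x). orb a u (eps (V - {u}) a) (\<zeta>, orb a' v (eps (V - {u} - {v}) a') x))"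
proof -
  have c1: "continuous_map (SX W) (Cf (V - {u})) (orb a' v (eps (V - {u} - {v}) a'))"
    unfolding W_def by (rule cm_orb[OF V(3,5) rad_eps]) (use V in auto)
  have c2: "continuous_map (SX (Cf (V - {u}))) (Cf V) (orb a u (eps (V - {u}) a))"
    by (rule cm_orb[OF V(2,4) rad_eps]) (use V in auto)
  have ty: "tau q W y \<in> carrier (homology_group (q+1) (SX W))" by (rule tau_closed) (use y in \<open>simp add: W_def\<close>)
  show "L (q+1) V a u (L q (V - {u}) a' v y) = push (q+1+1) (SX (SX W)) (Cf V)
    (\<lambda>(\<zeta>,x). orb a u (eps (V - {u}) a) (\<zeta>, orb a' v (eps (V - {u} - {v}) a') x)) (tau2 q W y)"
    unfolding L_def W_def[symmetric] tau_natural[OF c1 ty, symmetric] push_compose[OF cm_SX_map[OF c1] c2] tau2_def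
    by (simp add: case_prod_unfold)
  show "continuous_map (SX (SX W)) (Cf V)
    (\<lambda>(\<zeta>,x). orb a u (eps (V - {u}) a) (\<zeta>, orb a' v (eps (V - {u} - {v}) a') x))"
    using continuous_map_compose[OF cm_SX_map[OF c1] c2] by (simp add: comp_def case_prod_unfold)
qed

end

section \<open>Clusters of three free points\<close>

locale config_triple = config +
  fixes V :: "nat set" and a u v :: nat
  assumes finV: "finite V" and free: "V \<inter> A = {}" and mem: "a \<in> V" "u \<in> V" "v \<in> V"
    and distinct: "a \<noteq> u" "a \<noteq> v" "u \<noteq> v"
begin

abbreviation rest :: "('a \<times> (nat \<Rightarrow> complex)) topology" where
  "rest \<equiv> Cf (V - {u} - {v})"

abbreviation ra :: "'a \<times> (nat \<Rightarrow> complex) \<Rightarrow> real" where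
  "ra \<equiv> eps (V - {u} - {v}) a"

type_synonym 'x offset = "complex \<times> complex \<times> 'x \<times> (nat \<Rightarrow> complex) \<Rightarrow> complex"

text \<open>Positions are measured from the old position of \<open>a\<close> in units of the radius
  \<open>ra\<close>. As long as the offsets have norm at most 1, the cluster stays away from the
  other vertices, and only the offsets have to be kept apart.\<close>

definition triple :: "'a offset \<Rightarrow> 'a offset \<Rightarrow> 'a offset \<Rightarrow> complex \<times> complex \<times> 'a \<times> (nat \<Rightarrow> complex) \<Rightarrow> 'a \<times> (nat \<Rightarrow> complex)" where
  "triple \<alpha> \<beta> \<gamma> x = (let w = snd (snd x) in (fst w, (snd w)(a := snd w a + of_real (ra w) * \<alpha> x,
     u := snd w a + of_real (ra w) * \<beta> x, v := snd w a + of_real (ra w) * \<gamma> x)))"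

definition offset :: "'a offset \<Rightarrow> bool" where
  "offset \<alpha> \<longleftrightarrow> continuous_map (SX (SX rest)) euclidean \<alpha> \<and> (\<forall>x\<in>topspace (SX (SX rest)). norm (\<alpha> x) \<le> 1)"

definition apart :: "'a offset \<Rightarrow> 'a offset \<Rightarrow> bool" where
  "apart \<alpha> \<beta> \<longleftrightarrow> (\<forall>x\<in>topspace (SX (SX rest)). \<alpha> x \<noteq> \<beta> x)"

lemma inj_on_triple:
  assumes x: "snd (snd x) \<in> topspace rest" and n: "norm (\<alpha> x) \<le> 1" "norm (\<beta> x) \<le> 1" "norm (\<gamma> x) \<le> 1"
    and d: "\<alpha> x \<noteq> \<beta> x" "\<alpha> x \<noteq> \<gamma> x" "\<beta> x \<noteq> \<gamma> x"
  shows "inj_on (pos (triple \<alpha> \<beta> \<gamma> x)) V"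
proof -
  let ?w = "snd (snd x)"
  let ?f = "\<lambda>i. if i = a then \<alpha> x else if i = u then \<beta> x else \<gamma> x"
  have e: "0 < ra ?w" by (rule eps_pos) (use x mem distinct in auto)
  have p: "pos (triple \<alpha> \<beta> \<gamma> x) i = (if i \<in> {a,u,v} then pos ?w a + of_real (ra ?w) * ?f i else pos ?w i)" if "i \<in> V" for i
    using that free mem distinct by (auto simp: pos_def triple_def Let_def)
  have far: "pos ?w a + of_real (ra ?w) * ?f i \<noteq> pos ?w j" if "j \<in> V - {a,u,v}" for i j
  proof
    assume eq: "pos ?w a + of_real (ra ?w) * ?f i = pos ?w j"
    have "norm (of_real (ra ?w) * ?f i) \<le> ra ?w"
      using e n by (auto simp: norm_mult mult_left_le)
    then have "norm (pos ?w a - pos ?w j) \<le> ra ?w"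
      unfolding eq[symmetric] by simp
    moreover have "ra ?w < norm (pos ?w a - pos ?w j)"
    proof -
      have "rad (V - {u} - {v}) a ra" by (rule rad_eps) (use finV mem distinct in auto)
      then have "\<forall>i\<in>V - {u} - {v} - {a}. ra ?w < norm (pos ?w a - pos ?w i)"
        using x unfolding rad_def by blast
      then show ?thesis using that by blast
    qed
    ultimately show False by simp
  qed
  have i1: "inj_on (\<lambda>i. pos ?w a + of_real (ra ?w) * ?f i) {a,u,v}"
    using e d distinct by (auto simp: inj_on_def)
  have i2: "inj_on (pos ?w) (V - {a,u,v})"
    using x by (auto intro: inj_on_subset)
  have "inj_on (\<lambda>i. if i \<in> {a,u,v} then pos ?w a + of_real (ra ?w) * ?f i else pos ?w i) V"
  proof (rule inj_onI)
    fix i j assume ij: "i \<in> V" "j \<in> V"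
      and eq: "(if i \<in> {a,u,v} then pos ?w a + of_real (ra ?w) * ?f i else pos ?w i) = (if j \<in> {a,u,v} then pos ?w a + of_real (ra ?w) * ?f j else pos ?w j)"
    show "i = j"
    proof (cases "i \<in> {a,u,v}"; cases "j \<in> {a,u,v}")
      assume c: "i \<in> {a,u,v}" "j \<in> {a,u,v}"
      show ?thesis by (rule inj_onD[OF i1 _ c]) (use eq c in \<open>simp only: if_True\<close>)
    next
      assume c: "i \<in> {a,u,v}" "j \<notin> {a,u,v}"
      have "pos ?w a + of_real (ra ?w) * ?f i = pos ?w j" using eq c by (simp only: if_True if_False)
      then show ?thesis using far[of j i] c ij by blast
    next
      assume c: "i \<notin> {a,u,v}" "j \<in> {a,u,v}"
      have "pos ?w a + of_real (ra ?w) * ?f j = pos ?w i" using eq c by (simp only: if_True if_False)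
      then show ?thesis using far[of i j] c ij by blast
    next
      assume c: "i \<notin> {a,u,v}" "j \<notin> {a,u,v}"
      have "pos ?w i = pos ?w j" using eq c by (simp only: if_False)
      then show ?thesis using inj_onD[OF i2] c ij by blast
    qed
  qed
  then show ?thesis using p by (subst inj_on_cong[OF p]) auto
qed

lemma cm_rest: "continuous_map (SX (SX rest)) rest (\<lambda>x. snd (snd x))"
  by (rule cm_SX2)

lemma snd_triple: "snd (triple \<alpha> \<beta> \<gamma> x) i = (if i = v then snd (snd (snd x)) a + of_real (ra (snd (snd x))) * \<gamma> x
    else if i = u then snd (snd (snd x)) a + of_real (ra (snd (snd x))) * \<beta> x
    else if i = a then snd (snd (snd x)) a + of_real (ra (snd (snd x))) * \<alpha> x else snd (snd (snd x)) i)"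
  by (simp add: triple_def Let_def)

lemma cm_triple:
  assumes "offset \<alpha>" "offset \<beta>" "offset \<gamma>" "apart \<alpha> \<beta>" "apart \<alpha> \<gamma>" "apart \<beta> \<gamma>"
  shows "continuous_map (SX (SX rest)) (Cf V) (triple \<alpha> \<beta> \<gamma>)"
  unfolding continuous_map_Sb
proof (intro conjI allI ballI)
  note c = assms(1-3)[unfolded offset_def, THEN conjunct1]
  show "continuous_map (SX (SX rest)) euclidean (\<lambda>x. snd (triple \<alpha> \<beta> \<gamma> x) i)" for i
    using cm_Sb_coord[OF cm_rest] cm_eps[OF cm_rest] c
    unfolding snd_triple by (intro continuous_map_if_const cmi)
  show "continuous_map (SX (SX rest)) B (\<lambda>x. fst (triple \<alpha> \<beta> \<gamma> x))"
    using cm_Sb_base[OF cm_rest] by (simp add: triple_def Let_def)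
  fix x assume x: "x \<in> topspace (SX (SX rest))"
  then have "snd (snd x) \<in> topspace rest" by (auto simp: mem_Times_iff)
  then show "inj_on (pos (triple \<alpha> \<beta> \<gamma> x)) V"
    using assms x by (intro inj_on_triple) (auto simp: offset_def apart_def)
qed

text \<open>Along a segment the offsets stay in the unit disc by convexity, so only the three
  differences have to avoid 0.\<close>

lemma triple_homotopy:
  assumes o: "offset \<alpha>" "offset \<beta>" "offset \<gamma>" "offset \<alpha>'" "offset \<beta>'" "offset \<gamma>'"
    and d: "\<And>\<zeta> \<theta> w t. \<lbrakk>norm \<zeta> = 1; norm \<theta> = 1; w \<in> topspace rest; 0 \<le> t; t \<le> 1\<rbrakk> \<Longrightarrow>
      (1 - of_real t) * (\<beta> (\<zeta>,\<theta>,w) - \<alpha> (\<zeta>,\<theta>,w)) + of_real t * (\<beta>' (\<zeta>,\<theta>,w) - \<alpha>' (\<zeta>,\<theta>,w)) \<noteq> 0 \<and>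
      (1 - of_real t) * (\<gamma> (\<zeta>,\<theta>,w) - \<alpha> (\<zeta>,\<theta>,w)) + of_real t * (\<gamma>' (\<zeta>,\<theta>,w) - \<alpha>' (\<zeta>,\<theta>,w)) \<noteq> 0 \<and>
      (1 - of_real t) * (\<gamma> (\<zeta>,\<theta>,w) - \<beta> (\<zeta>,\<theta>,w)) + of_real t * (\<gamma>' (\<zeta>,\<theta>,w) - \<beta>' (\<zeta>,\<theta>,w)) \<noteq> 0"
  shows "push q (SX (SX rest)) (Cf V) (triple \<alpha> \<beta> \<gamma>) = push q (SX (SX rest)) (Cf V) (triple \<alpha>' \<beta>' \<gamma>')" (is ?h)
    "continuous_map (SX (SX rest)) (Cf V) (triple \<alpha> \<beta> \<gamma>)" (is ?c) "continuous_map (SX (SX rest)) (Cf V) (triple \<alpha>' \<beta>' \<gamma>')" (is ?c')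
proof -
  have dx: "(1 - of_real t) * (\<beta> x - \<alpha> x) + of_real t * (\<beta>' x - \<alpha>' x) \<noteq> 0 \<and>
      (1 - of_real t) * (\<gamma> x - \<alpha> x) + of_real t * (\<gamma>' x - \<alpha>' x) \<noteq> 0 \<and>
      (1 - of_real t) * (\<gamma> x - \<beta> x) + of_real t * (\<gamma>' x - \<beta>' x) \<noteq> 0"
    if "x \<in> topspace (SX (SX rest))" "0 \<le> t" "t \<le> 1" for x t
  proof -
    have "norm (fst x) = 1" "norm (fst (snd x)) = 1" "snd (snd x) \<in> topspace rest" using that(1) by (auto simp: mem_Times_iff)
    from d[OF this that(2,3)] show ?thesis by simp
  qed
  have "apart \<alpha> \<beta>" "apart \<alpha> \<gamma>" "apart \<beta> \<gamma>" "apart \<alpha>' \<beta>'" "apart \<alpha>' \<gamma>'" "apart \<beta>' \<gamma>'"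
    unfolding apart_def using dx[of _ 0] dx[of _ 1] by (metis diff_self mult_zero_left mult_zero_right add_0 of_real_0 of_real_1 diff_zero mult_1 order_refl zero_le_one add_0_right)+
  then show c: ?c ?c' using o by (auto intro!: cm_triple)
  show ?h
  proof (rule linear_homotopy[OF c])
    fix x t assume x: "x \<in> topspace (SX (SX rest))" and t: "0 \<le> t" "t \<le> (1::real)"
    define m where "m \<delta> \<delta>' y = (1 - of_real t) * \<delta> y + of_real t * \<delta>' y" for \<delta> \<delta>' :: "'a offset" and y
    have eq: "(fst (triple \<alpha> \<beta> \<gamma> x), \<lambda>i. (1 - of_real t) * snd (triple \<alpha> \<beta> \<gamma> x) i + of_real t * snd (triple \<alpha>' \<beta>' \<gamma>' x) i)
      = triple (m \<alpha> \<alpha>') (m \<beta> \<beta>') (m \<gamma> \<gamma>') x"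
      by (auto simp: triple_def Let_def m_def algebra_simps)
    have nb: "norm (m \<delta> \<delta>' x) \<le> 1" if "offset \<delta>" "offset \<delta>'" for \<delta> \<delta>'
    proof -
      have "norm (m \<delta> \<delta>' x) \<le> (1 - t) * norm (\<delta> x) + t * norm (\<delta>' x)"
        unfolding m_def using norm_triangle_ineq[of "(1 - of_real t) * \<delta> x" "of_real t * \<delta>' x"] t
        by (simp add: norm_mult) (metis abs_of_nonneg diff_ge_0_iff_ge norm_of_real of_real_1 of_real_diff)
      also have "\<dots> \<le> 1" using that x t by (intro convex_bound_le) (auto simp: offset_def)
      finally show ?thesis .
    qed
    have s: "snd (snd x) \<in> topspace rest" using x by (auto simp: mem_Times_iff)
    have "inj_on (pos (triple (m \<alpha> \<alpha>') (m \<beta> \<beta>') (m \<gamma> \<gamma>') x)) V"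
    proof (rule inj_on_triple[where x = x])
      show "m \<alpha> \<alpha>' x \<noteq> m \<beta> \<beta>' x" "m \<alpha> \<alpha>' x \<noteq> m \<gamma> \<gamma>' x" "m \<beta> \<beta>' x \<noteq> m \<gamma> \<gamma>' x"
        using dx[OF x t] by (auto simp: m_def algebra_simps)
    qed (use s nb o in auto)
    then show "inj_on (pos (fst (triple \<alpha> \<beta> \<gamma> x), \<lambda>i. (1 - of_real t) * snd (triple \<alpha> \<beta> \<gamma> x) i + of_real t * snd (triple \<alpha>' \<beta>' \<gamma>' x) i)) V"
      unfolding eq .
  qed (simp add: triple_def Let_def)
qed


lemma act_triple:
  "act (Transposition.transpose u v) (triple \<alpha> \<beta> \<gamma> x) = triple \<alpha> \<gamma> \<beta> x"
  "\<pi> a = u \<Longrightarrow> \<pi> u = v \<Longrightarrow> \<pi> v = a \<Longrightarrow> (\<And>i. i \<noteq> a \<Longrightarrow> i \<noteq> u \<Longrightarrow> i \<noteq> v \<Longrightarrow> \<pi> i = i) \<Longrightarrow>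
     act \<pi> (triple \<alpha> \<beta> \<gamma> x) = triple \<beta> \<gamma> \<alpha> x"
proof -
  show "act (Transposition.transpose u v) (triple \<alpha> \<beta> \<gamma> x) = triple \<alpha> \<gamma> \<beta> x"
    using distinct by (auto simp: act_def triple_def Let_def Transposition.transpose_def)
  assume pi: "\<pi> a = u" "\<pi> u = v" "\<pi> v = a" "\<And>i. i \<noteq> a \<Longrightarrow> i \<noteq> u \<Longrightarrow> i \<noteq> v \<Longrightarrow> \<pi> i = i"
  have "snd (triple \<alpha> \<beta> \<gamma> x) (\<pi> i) = snd (triple \<beta> \<gamma> \<alpha> x) i" for i
    using pi(4)[of i] distinct unfolding snd_triple
    by (cases "i = a"; cases "i = u"; cases "i = v") (simp_all add: pi(1-3))
  then show "act \<pi> (triple \<alpha> \<beta> \<gamma> x) = triple \<beta> \<gamma> \<alpha> x"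
    by (simp add: act_def triple_def Let_def fun_eq_iff)
qed

lemma offset_intro:
  assumes "continuous_map (SX (SX rest)) euclidean \<alpha>"
    "\<And>\<zeta> \<theta> w. \<lbrakk>norm \<zeta> = 1; norm \<theta> = 1; w \<in> topspace rest\<rbrakk> \<Longrightarrow> norm (\<alpha> (\<zeta>,\<theta>,w)) \<le> 1"
  shows "offset \<alpha>"
  using assms by (auto simp: offset_def)

lemmas cm_angles = cm_SX_fst cm_SX2(1)

lemma
  shows offset_zero: "offset (\<lambda>x. 0)" and offset_inner: "offset (\<lambda>x. fst (snd x))"
  and offset_outer_half: "offset (\<lambda>x. fst x / 2)"
  and offset_outer_eps: "offset (\<lambda>x. of_real (ra (snd (snd x))) * fst x)"
proof -
  show "offset (\<lambda>x. of_real (ra (snd (snd x))) * fst x)"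
  proof (intro offset_intro cmi cm_angles cm_eps[OF cm_rest])
    show "norm (of_real (ra (snd (snd (\<zeta>,\<theta>,w)))) * fst (\<zeta>,\<theta>,w)) \<le> 1" if "norm \<zeta> = 1" for \<zeta> \<theta> :: complex and w
      using eps_le_quarter[of "V - {u} - {v}" a w] eps_nonneg[of "V - {u} - {v}" a w] that by (simp add: norm_mult)
  qed
qed (intro offset_intro cmi cm_angles; simp add: norm_divide)+

text \<open>The inner tube puts \<open>v\<close> at distance \<open>ra\<close> from
  \<open>a\<close>. This gives the product defining \<open>eps\<close> one more factor
  \<open>ra\<close> and leaves the others unchanged, so the outer radius is the square of
  \<open>ra\<close>, which is \<open>ra\<close> in units of \<open>ra\<close>.\<close>

lemma residue_homotopy:
  assumes "x \<in> topspace (SX (SX rest))"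
  shows "(case x of (\<zeta>,y) \<Rightarrow> orb a u (eps (V - {u}) a) (\<zeta>, orb a v ra y)) = 
    triple (\<lambda>x. 0) (\<lambda>x. of_real (ra (snd (snd x))) * fst x) (\<lambda>x. fst (snd x)) x"
proof -
  obtain \<zeta> \<theta> w where x: "x = (\<zeta>,\<theta>,w)" by (cases x)
  have w: "norm \<theta> = 1" "w \<in> topspace rest" using assms by (auto simp: x)
  let ?w' = "orb a v ra (\<theta>,w)"
  have vA: "v \<notin> A" "u \<notin> A" "a \<notin> A" using free mem by auto
  have V: "V - {u} - {a} = insert v (V - {u} - {v} - {a})" using mem distinct by auto
  have p: "pos ?w' i = (if i = v then pos w a + of_real (ra w) * \<theta> else pos w i)" for i by (rule pos_orb[OF vA(1)])
  have "eps (V - {u}) a ?w' = min 1 (ra w) * ra w"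
    using finV w distinct eps_nonneg[of "V - {u} - {v}" a w] unfolding eps_def[of "V - {u}"] V p
    by (simp add: norm_mult) (simp add: eps_def)
  also have "\<dots> = ra w * ra w" using eps_le_quarter[of "V - {u} - {v}" a w] by simp
  finally show ?thesis
    using vA distinct by (auto simp: x triple_def Let_def orb_def p pos_def fun_eq_iff)
qed


text \<open>Along the segment between a cluster and a translated copy shrunk to a third, every
  difference is a positive multiple of its original value.\<close>

lemma triple_scale:
  assumes o: "offset \<alpha>" "offset \<beta>" "offset \<gamma>" "offset \<alpha>'" "offset \<beta>'" "offset \<gamma>'"
    and d: "\<And>\<zeta> \<theta> w. \<lbrakk>norm \<zeta> = 1; norm \<theta> = 1; w \<in> topspace rest\<rbrakk> \<Longrightarrow>
      \<beta>' (\<zeta>,\<theta>,w) - \<alpha>' (\<zeta>,\<theta>,w) \<noteq> 0 \<and> \<gamma>' (\<zeta>,\<theta>,w) - \<alpha>' (\<zeta>,\<theta>,w) \<noteq> 0 \<and> \<gamma>' (\<zeta>,\<theta>,w) - \<beta>' (\<zeta>,\<theta>,w) \<noteq> 0"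
    and s: "\<And>\<zeta> \<theta> w. \<beta> (\<zeta>,\<theta>,w) - \<alpha> (\<zeta>,\<theta>,w) = (\<beta>' (\<zeta>,\<theta>,w) - \<alpha>' (\<zeta>,\<theta>,w)) / 3 \<and>
      \<gamma> (\<zeta>,\<theta>,w) - \<alpha> (\<zeta>,\<theta>,w) = (\<gamma>' (\<zeta>,\<theta>,w) - \<alpha>' (\<zeta>,\<theta>,w)) / 3"
  shows "push q (SX (SX rest)) (Cf V) (triple \<alpha> \<beta> \<gamma>) = push q (SX (SX rest)) (Cf V) (triple \<alpha>' \<beta>' \<gamma>')" (is ?h)
    "continuous_map (SX (SX rest)) (Cf V) (triple \<alpha>' \<beta>' \<gamma>')" (is ?c)
proof -
  have k: "(1 - of_real t) * (\<beta> (\<zeta>,\<theta>,w) - \<alpha> (\<zeta>,\<theta>,w)) + of_real t * (\<beta>' (\<zeta>,\<theta>,w) - \<alpha>' (\<zeta>,\<theta>,w)) \<noteq> 0 \<and>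
      (1 - of_real t) * (\<gamma> (\<zeta>,\<theta>,w) - \<alpha> (\<zeta>,\<theta>,w)) + of_real t * (\<gamma>' (\<zeta>,\<theta>,w) - \<alpha>' (\<zeta>,\<theta>,w)) \<noteq> 0 \<and>
      (1 - of_real t) * (\<gamma> (\<zeta>,\<theta>,w) - \<beta> (\<zeta>,\<theta>,w)) + of_real t * (\<gamma>' (\<zeta>,\<theta>,w) - \<beta>' (\<zeta>,\<theta>,w)) \<noteq> 0"
    if x: "norm \<zeta> = 1" "norm \<theta> = 1" "w \<in> topspace rest" and t: "0 \<le> t" "t \<le> 1" for \<zeta> \<theta> w t
  proof -
    have n: "(1 - of_real t) * (d / 3) + of_real t * d \<noteq> 0" if "d \<noteq> 0" for d :: complex
      using convex_multiples_nonzero[OF that, of "1/3" 1 t] t by simp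
    have sb: "\<gamma> (\<zeta>,\<theta>,w) - \<beta> (\<zeta>,\<theta>,w) = (\<gamma>' (\<zeta>,\<theta>,w) - \<beta>' (\<zeta>,\<theta>,w)) / 3"
    proof -
      have "\<gamma> (\<zeta>,\<theta>,w) - \<beta> (\<zeta>,\<theta>,w) = (\<gamma> (\<zeta>,\<theta>,w) - \<alpha> (\<zeta>,\<theta>,w)) - (\<beta> (\<zeta>,\<theta>,w) - \<alpha> (\<zeta>,\<theta>,w))" by simp
      then show ?thesis unfolding s[THEN conjunct1] s[THEN conjunct2] by (simp add: diff_divide_distrib)
    qed
    show ?thesis unfolding sb s[THEN conjunct1] s[THEN conjunct2] using d[OF x] n by blast
  qed
  show ?h by (rule triple_homotopy(1)[OF o k])
  show ?c by (rule triple_homotopy(3)[OF o k])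
qed

text \<open>Up to the rotation by \<theta> and the scale 1/3, the first point is 0, the second is 1
  and the third runs along \<open>z\<close>. The scale admits every \<open>z\<close> of modulus at
  most 3.\<close>

definition loop :: "(complex \<Rightarrow> complex) \<Rightarrow> complex \<times> complex \<times> 'a \<times> (nat \<Rightarrow> complex) \<Rightarrow> 'a \<times> (nat \<Rightarrow> complex)" where
  "loop z = triple (\<lambda>x. 0) (\<lambda>x. fst (snd x) / 3) (\<lambda>x. fst (snd x) * z (fst x) / 3)"

lemma loop_cong: "z \<zeta> = z' \<zeta>' \<Longrightarrow> loop z (\<zeta>,x) = loop z' (\<zeta>',x)"
  by (simp add: loop_def triple_def)

lemma offset_loop:
  assumes "continuous_map (SX (SX rest)) euclidean (\<lambda>x. z (fst x))" "\<And>\<zeta>. norm \<zeta> = 1 \<Longrightarrow> norm (z \<zeta>) \<le> 3"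
  shows "offset (\<lambda>x. fst (snd x) * z (fst x) / 3)"
  using assms(2) by (intro offset_intro cmi cm_angles assms(1)) (auto simp: norm_mult norm_divide)

lemma offset_inner_third: "offset (\<lambda>x. fst (snd x) / 3)"
  by (intro offset_intro cmi cm_angles) (simp_all add: norm_divide)

lemma offset_prod_half: "offset (\<lambda>x. fst (snd x) * fst x / 2)"
  by (intro offset_intro cmi cm_angles) (simp_all add: norm_divide norm_mult)

lemma offset_inner_half: "offset (\<lambda>x. fst (snd x) / 2)"
  by (intro offset_intro cmi cm_angles) (simp_all add: norm_divide norm_mult)

lemma offset_neg_prod_half: "offset (\<lambda>x. - fst (snd x) * fst x / 2)"
  by (intro offset_intro cmi cm_angles) (simp_all add: norm_divide norm_mult)

lemma offset_neg_inner: "offset (\<lambda>x. - fst (snd x))"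
  by (intro offset_intro cmi cm_angles) (simp_all add: norm_divide norm_mult)

lemma offset_rotated_prod: "offset (\<lambda>x. fst (snd x) * (\<i> * fst x))"
  by (intro offset_intro cmi cm_angles) (simp_all add: norm_divide norm_mult)

lemma loop_homotopy:
  assumes z: "continuous_map (SX (SX rest)) euclidean (\<lambda>x. z (fst x))" "\<And>\<zeta>. norm \<zeta> = 1 \<Longrightarrow> norm (z \<zeta>) \<le> 3"
    and z': "continuous_map (SX (SX rest)) euclidean (\<lambda>x. z' (fst x))" "\<And>\<zeta>. norm \<zeta> = 1 \<Longrightarrow> norm (z' \<zeta>) \<le> 3"
    and d: "\<And>\<zeta> t. \<lbrakk>norm \<zeta> = 1; 0 \<le> t; t \<le> 1\<rbrakk> \<Longrightarrow> (1 - of_real t) * z \<zeta> + of_real t * z' \<zeta> \<notin> {0,1}"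
  shows "push q (SX (SX rest)) (Cf V) (loop z) = push q (SX (SX rest)) (Cf V) (loop z')"
    "continuous_map (SX (SX rest)) (Cf V) (loop z)"
proof -
  have "(1 - of_real t) * (\<theta> / 3 - 0) + of_real t * (\<theta> / 3 - 0) \<noteq> 0 \<and>
      (1 - of_real t) * (\<theta> * z \<zeta> / 3 - 0) + of_real t * (\<theta> * z' \<zeta> / 3 - 0) \<noteq> 0 \<and>
      (1 - of_real t) * (\<theta> * z \<zeta> / 3 - \<theta> / 3) + of_real t * (\<theta> * z' \<zeta> / 3 - \<theta> / 3) \<noteq> 0"
    if "norm \<zeta> = 1" "norm \<theta> = 1" "0 \<le> t" "t \<le> 1" for \<zeta> \<theta> :: complex and t :: real
  proof -
    let ?m = "(1 - of_real t) * z \<zeta> + of_real t * z' \<zeta>"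
    have e: "(1 - of_real t) * (\<theta> / 3 - 0) + of_real t * (\<theta> / 3 - 0) = \<theta> / 3"
      "(1 - of_real t) * (\<theta> * z \<zeta> / 3 - 0) + of_real t * (\<theta> * z' \<zeta> / 3 - 0) = \<theta> * ?m / 3"
      "(1 - of_real t) * (\<theta> * z \<zeta> / 3 - \<theta> / 3) + of_real t * (\<theta> * z' \<zeta> / 3 - \<theta> / 3) = \<theta> * (?m - 1) / 3"
      by (simp_all add: algebra_simps diff_divide_distrib add_divide_distrib)
    have "\<theta> \<noteq> 0" using that by auto
    then show ?thesis unfolding e using d[OF that(1,3,4)] by simp
  qed
  then show "push q (SX (SX rest)) (Cf V) (loop z) = push q (SX (SX rest)) (Cf V) (loop z')"
    "continuous_map (SX (SX rest)) (Cf V) (loop z)"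
    unfolding loop_def using triple_homotopy[OF offset_zero offset_inner_third offset_loop[OF z] offset_zero offset_inner_third offset_loop[OF z']] by simp_all
qed

text \<open>Three points on a common scale: the loop in which the third point encircles both others is the
  product of the two loops encircling one of them, and the symmetric group identifies the three loops up to sign.\<close>

lemma Jacobi:
  assumes l: "l \<in> hinv (q+1+1) V" and y: "y \<in> carrier (homology_group q rest)"
  shows "l (L (q+1) V a u (L q (V - {u}) a v y)) = 0"
proof -
  let ?T = "SX (SX rest)" and ?q = "q+1+1"
  define D where "D g = l (push ?q ?T (Cf V) g (tau2 q rest y))" for g
  have lf: "l \<in> hfun ?q (Cf V)" by (rule hinv_hfun[OF l])
  have ty: "tau q rest y \<in> carrier (homology_group (q+1) (SX rest))" by (rule tau_closed[OF y])
  have VA: "V - A = V" using free by auto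
  have D_cong: "D g = D h" if "push ?q ?T (Cf V) g = push ?q ?T (Cf V) h" for g h using that by (simp add: D_def)
  have D_eq: "D g = D h" if "\<And>\<zeta> \<theta> w. norm \<zeta> = 1 \<Longrightarrow> norm \<theta> = 1 \<Longrightarrow> w \<in> topspace rest \<Longrightarrow> g (\<zeta>,\<theta>,w) = h (\<zeta>,\<theta>,w)" for g h
  proof (rule D_cong, rule push_cong)
    fix x assume "x \<in> topspace ?T"
    then have "norm (fst x) = 1" "norm (fst (snd x)) = 1" "snd (snd x) \<in> topspace rest" by (auto simp: mem_Times_iff)
    from that[OF this] show "g x = h x" by simp
  qed
  have D_act: "D (\<lambda>x. act \<pi> (g x)) = D g" if pi: "\<pi> permutes V" and g: "continuous_map ?T (Cf V) g" for \<pi> g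
  proof -
    have ca: "continuous_map (Cf V) (Cf V) (act \<pi>)" using cm_act[of \<pi> V V] perm_image(1)[of \<pi> V] pi unfolding VA by simp
    have "D (\<lambda>x. act \<pi> (g x)) = l (push ?q (Cf V) (Cf V) (act \<pi>) (push ?q ?T (Cf V) g (tau2 q rest y)))"
      unfolding D_def push_compose[OF g ca] ..
    also have "\<dots> = D g" using l pi push_closed unfolding D_def hinv_def VA by blast
    finally show ?thesis .
  qed
  \<comment> \<open>The normal form of the iterated residue: \<open>u\<close> on a circle of radius
    1/2 inside the unit circle of \<open>v\<close>, both around \<open>a\<close>.\<close>
  define f where "f = triple (\<lambda>x. 0) (\<lambda>x. fst x / 2) (\<lambda>x. fst (snd x))"
  have nz: "\<theta> \<noteq> 0" if "norm \<theta> = 1" for \<theta> :: complex using that by auto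
  have h0: "(1 - of_real t) * (of_real r * \<zeta> - 0) + of_real t * (\<zeta> / 2 - 0) \<noteq> 0 \<and>
      (1 - of_real t) * (\<theta> - 0) + of_real t * (\<theta> - 0) \<noteq> 0 \<and>
      (1 - of_real t) * (\<theta> - of_real r * \<zeta>) + of_real t * (\<theta> - \<zeta> / 2) \<noteq> 0"
    if z: "norm \<zeta> = 1" "norm \<theta> = 1" "0 \<le> t" "t \<le> 1" and r: "0 < r" "r \<le> 1/4" for \<zeta> \<theta> :: complex and r t :: real
  proof -
    have "(1 - of_real t) * (of_real r * \<zeta>) + of_real t * (of_real (1/2) * \<zeta>) \<noteq> 0"
      using z r by (intro convex_multiples_nonzero nz) auto
    moreover have "(1 - of_real t) * (\<theta> - of_real r * \<zeta>) + of_real t * (\<theta> - \<zeta> / 2) = \<theta> - of_real ((1 - t) * r + t * (1/2)) * \<zeta>"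
      by (simp add: algebra_simps)
    moreover have "\<theta> - of_real ((1 - t) * r + t * (1/2)) * \<zeta> \<noteq> 0"
    proof
      assume "\<theta> - of_real ((1 - t) * r + t * (1/2)) * \<zeta> = 0"
      then have "norm \<theta> = norm (of_real ((1 - t) * r + t * (1/2)) * \<zeta>)" by simp
      then have "\<bar>(1 - t) * r + t * (1/2)\<bar> = 1" unfolding norm_mult norm_of_real z by simp
      moreover have "(1 - t) * r + t * (1/2) \<le> 1/2" using z r by (intro convex_bound_le) auto
      moreover have "0 \<le> (1 - t) * r + t * (1/2)" using z r by simp
      ultimately show False by simp
    qed
    ultimately show ?thesis using nz[OF z(2)] by (simp add: algebra_simps)
  qed
  have rr: "0 < ra w" "ra w \<le> 1/4" if "w \<in> topspace rest" for w
    using eps_pos[of w "V - {u} - {v}" a] eps_le_quarter[of "V - {u} - {v}" a w] that mem distinct by auto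
  have dd: "(1 - of_real t) * (of_real (ra w) * \<zeta> - 0) + of_real t * (\<zeta> / 2 - 0) \<noteq> 0 \<and>
      (1 - of_real t) * (\<theta> - 0) + of_real t * (\<theta> - 0) \<noteq> 0 \<and>
      (1 - of_real t) * (\<theta> - of_real (ra w) * \<zeta>) + of_real t * (\<theta> - \<zeta> / 2) \<noteq> 0"
    if "norm \<zeta> = 1" "norm \<theta> = 1" "w \<in> topspace rest" "0 \<le> t" "t \<le> (1::real)" for \<zeta> \<theta> :: complex and w t
    by (rule h0[OF that(1,2,4,5) rr[OF that(3)]])
  have H0: "push ?q ?T (Cf V) (triple (\<lambda>x. 0) (\<lambda>x. of_real (ra (snd (snd x))) * fst x) (\<lambda>x. fst (snd x))) = push ?q ?T (Cf V) f"
    unfolding f_def by (rule triple_homotopy(1)[OF offset_zero offset_outer_eps offset_inner offset_zero offset_outer_half offset_inner]) (unfold fst_conv snd_conv, rule dd)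
  have f: "continuous_map ?T (Cf V) f"
    unfolding f_def by (rule triple_homotopy(3)[OF offset_zero offset_outer_eps offset_inner offset_zero offset_outer_half offset_inner]) (unfold fst_conv snd_conv, rule dd)
  have VV: "u \<in> V - A" "v \<in> V - {u} - A" "a \<in> V - {u}" "a \<in> V - {u} - {v}" using free mem distinct by auto
  have start: "l (L (q+1) V a u (L q (V - {u}) a v y)) = D f"
  proof -
    have "push ?q ?T (Cf V) (\<lambda>(\<zeta>,x). orb a u (eps (V - {u}) a) (\<zeta>, orb a v ra x)) = push ?q ?T (Cf V) f"
      unfolding H0[symmetric] by (rule push_cong) (rule residue_homotopy)
    then show ?thesis unfolding L_compose(1)[OF finV VV y] D_def by (rule arg_cong)
  qed
  \<comment> \<open>Loops around 0, around 1 and around both, and the figure eight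
    \<open>?\<gamma>\<close> composed of the first two.\<close>
  let ?z1 = "\<lambda>\<zeta>. \<zeta> / 2" and ?z2 = "\<lambda>\<zeta>. 1 - \<zeta> / 2" and ?\<omega> = "\<lambda>\<zeta>. 1/2 + 2 * \<i> * \<zeta>"
    and ?\<gamma> = "\<lambda>\<zeta>. 1/2 + \<i> * of_real \<bar>Im \<zeta>\<bar> * \<zeta>"

  have cz: "continuous_map ?T euclidean (\<lambda>x. ?z1 (fst x))" "continuous_map ?T euclidean (\<lambda>x. ?z2 (fst x))"
    "continuous_map ?T euclidean (\<lambda>x. ?\<omega> (fst x))" "continuous_map ?T euclidean (\<lambda>x. ?\<gamma> (fst x))"
    by (intro cmi cm_angles; simp)+
  have im: "\<bar>Im \<zeta>\<bar> \<le> 1" if "norm \<zeta> = 1" for \<zeta> using abs_Im_le_cmod[of \<zeta>] that by simp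
  have nz: "norm (?z1 \<zeta>) \<le> 3" "norm (?z2 \<zeta>) \<le> 3" "norm (?\<omega> \<zeta>) \<le> 3" "norm (?\<gamma> \<zeta>) \<le> 3" if n: "norm \<zeta> = 1" for \<zeta>
    using norm_triangle_ineq4[of 1 "\<zeta>/2"] norm_triangle_ineq[of "1/2" "2 * \<i> * \<zeta>"]
      norm_triangle_ineq[of "1/2" "\<i> * of_real \<bar>Im \<zeta>\<bar> * \<zeta>"] n im[OF n]
    by (auto simp: norm_mult norm_divide)

  have lh: "D (loop z) = D (loop z')" "continuous_map ?T (Cf V) (loop z)"
    if "continuous_map ?T euclidean (\<lambda>x. z (fst x))" "\<And>\<zeta>. norm \<zeta> = 1 \<Longrightarrow> norm (z \<zeta>) \<le> 3"
      "continuous_map ?T euclidean (\<lambda>x. z' (fst x))" "\<And>\<zeta>. norm \<zeta> = 1 \<Longrightarrow> norm (z' \<zeta>) \<le> 3"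
      "\<And>\<zeta> t. \<lbrakk>norm \<zeta> = 1; 0 \<le> t; t \<le> 1\<rbrakk> \<Longrightarrow> (1 - of_real t) * z \<zeta> + of_real t * z' \<zeta> \<notin> {0,1}" for z z'
    using D_cong[OF loop_homotopy(1)[OF that]] loop_homotopy(2)[OF that] by blast+
  have c1: "continuous_map ?T (Cf V) (loop ?\<gamma>)" by (rule lh(2)[OF cz(4) nz(4) cz(3) nz(3) pencil])
  have c2: "continuous_map ?T (Cf V) (loop ?z1)"
  proof (rule lh(2)[OF cz(1) nz(1) cz(1) nz(1)])
    fix \<zeta> :: complex and t :: real assume n: "norm \<zeta> = 1"
    show "(1 - of_real t) * (\<zeta> / 2) + of_real t * (\<zeta> / 2) \<notin> {0,1}" unfolding convex_same using n by auto
  qed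
  have c3: "continuous_map ?T (Cf V) (loop ?z2)"
  proof (rule lh(2)[OF cz(2) nz(2) cz(2) nz(2)])
    fix \<zeta> :: complex and t :: real assume n: "norm \<zeta> = 1"
    have "1 - \<zeta> / 2 \<noteq> 0" using n by auto
    then show "(1 - of_real t) * (1 - \<zeta> / 2) + of_real t * (1 - \<zeta> / 2) \<notin> {0,1}" unfolding convex_same using n by auto
  qed
  note cl = c2 c3
  have sum: "D (loop ?\<gamma>) = D (loop ?z1) + D (loop ?z2)"
  proof -
    have "push ?q ?T (Cf V) (loop ?\<gamma>) (tau2 q rest y) = push ?q ?T (Cf V) (loop ?z1) (tau2 q rest y)
      \<otimes>\<^bsub>homology_group ?q (Cf V)\<^esub> push ?q ?T (Cf V) (loop ?z2) (tau2 q rest y)"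
      unfolding tau2_def
    proof (rule tau_concat[OF ty c1 c2 c3])
      fix \<zeta> :: complex and v :: "complex \<times> 'a \<times> (nat \<Rightarrow> complex)" assume n: "norm \<zeta> = 1"
      show "loop ?\<gamma> (\<zeta>,v) = loop ?z1 (\<zeta>\<^sup>2,v)" if "0 \<le> Im \<zeta>"
        using that by (intro loop_cong) (simp add: unit_square[OF n] algebra_simps add_divide_distrib)
      show "loop ?\<gamma> (\<zeta>,v) = loop ?z2 (\<zeta>\<^sup>2,v)" if "Im \<zeta> \<le> 0"
        using that by (intro loop_cong) (simp add: unit_square[OF n] diff_divide_distrib add_divide_distrib)
    qed
    then show ?thesis unfolding D_def by (simp only: rhom_mult[OF lf push_closed push_closed])
  qed
  have outer: "D (loop ?\<gamma>) = D (loop ?\<omega>)"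
    by (rule lh(1)[OF cz(4) nz(4) cz(3) nz(3) pencil])

  have d1: "\<theta> * \<zeta> / 2 - 0 \<noteq> 0 \<and> \<theta> - 0 \<noteq> 0 \<and> \<theta> - \<theta> * \<zeta> / 2 \<noteq> 0" "- \<theta> * \<zeta> / 2 - 0 \<noteq> 0 \<and> - \<theta> - 0 \<noteq> 0 \<and> - \<theta> - (- \<theta> * \<zeta> / 2) \<noteq> 0"
    if "norm \<zeta> = 1" "norm \<theta> = 1" for \<zeta> \<theta> :: complex
  proof -
    have "\<theta> \<noteq> 0" "\<zeta> \<noteq> 0" "\<zeta> \<noteq> 2" using that by auto
    moreover have "\<theta> - \<theta> * \<zeta> / 2 = \<theta> * (2 - \<zeta>) / 2" "- \<theta> - (- \<theta> * \<zeta> / 2) = - (\<theta> * (2 - \<zeta>) / 2)" by (simp_all add: algebra_simps diff_divide_distrib)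
    ultimately show "\<theta> * \<zeta> / 2 - 0 \<noteq> 0 \<and> \<theta> - 0 \<noteq> 0 \<and> \<theta> - \<theta> * \<zeta> / 2 \<noteq> 0" "- \<theta> * \<zeta> / 2 - 0 \<noteq> 0 \<and> - \<theta> - 0 \<noteq> 0 \<and> - \<theta> - (- \<theta> * \<zeta> / 2) \<noteq> 0"
      by simp_all
  qed
  let ?g = "triple (\<lambda>x. 0) (\<lambda>x. fst (snd x) * fst x / 2) (\<lambda>x. fst (snd x))"
  have T1: "push ?q ?T (Cf V) (triple (\<lambda>x. 0) (\<lambda>x. fst (snd x) * ?z1 (fst x) / 3) (\<lambda>x. fst (snd x) / 3)) = push ?q ?T (Cf V) ?g"
    by (rule triple_scale(1)[OF offset_zero offset_loop[OF cz(1) nz(1)] offset_inner_third offset_zero offset_prod_half offset_inner]) (assumption, unfold fst_conv snd_conv, rule d1, simp_all)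
  have cg: "continuous_map ?T (Cf V) ?g"
    by (rule triple_scale(2)[OF offset_zero offset_loop[OF cz(1) nz(1)] offset_inner_third offset_zero offset_prod_half offset_inner]) (assumption, unfold fst_conv snd_conv, rule d1, simp_all)
  \<comment> \<open>A common rotation by \<theta> is a shear of the torus and does not change the
    value.\<close>
  have Dg: "D ?g = D f"
  proof -
    have "D (\<lambda>(\<zeta>,(\<theta>,v)). f (\<zeta> * \<theta>,(\<theta>,v))) = D f" using tau2_torus(1)[OF y lf f] unfolding D_def .
    moreover have "D (\<lambda>(\<zeta>,(\<theta>,v)). f (\<zeta> * \<theta>,(\<theta>,v))) = D ?g"
      unfolding f_def by (rule D_eq) (simp add: triple_def Let_def mult.commute)
    ultimately show ?thesis by simp
  qed

  \<comment> \<open>Exchanging \<open>u\<close> and \<open>v\<close> puts the circling point inside,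
    as in \<open>f\<close>, up to the shear.\<close>
  have l1: "D (loop ?z1) = D f"
  proof -
    have t: "Transposition.transpose u v permutes V" using mem by (intro permutes_swap_id)
    have "D (loop ?z1) = D (\<lambda>x. act (Transposition.transpose u v) (loop ?z1 x))"
      by (rule D_act[OF t cl(1), symmetric])
    also have "\<dots> = D ?g" unfolding loop_def act_triple(1) by (rule D_cong[OF T1])
    finally show ?thesis using Dg by simp
  qed
  \<comment> \<open>The cyclic permutation makes the second point the anchor. Seen from there all
    directions are reversed, which is a half turn of \<theta>.\<close>
  have l2: "D (loop ?z2) = D f"
  proof -
    define \<pi> where "\<pi> = (\<lambda>i. if i = a then u else if i = u then v else if i = v then a else i)"
    have pi: "\<pi> permutes V"
    proof (rule bij_imp_permutes)
      show "bij_betw \<pi> V V"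
        by (rule bij_betw_byWitness[where f' = "\<lambda>i. if i = u then a else if i = v then u else if i = a then v else i"])
          (use mem distinct in \<open>auto simp: \<pi>_def\<close>)
    qed (use mem in \<open>auto simp: \<pi>_def\<close>)
    let ?h = "triple (\<lambda>x. 0) (\<lambda>x. - fst (snd x) * fst x / 2) (\<lambda>x. - fst (snd x))"
    have "D (loop ?z2) = D (\<lambda>x. act \<pi> (loop ?z2 x))"
      by (rule D_act[OF pi cl(2), symmetric])
    also have "\<dots> = D (triple (\<lambda>x. fst (snd x) / 3) (\<lambda>x. fst (snd x) * ?z2 (fst x) / 3) (\<lambda>x. 0))"
      unfolding loop_def by (subst act_triple(2)) (use distinct in \<open>auto simp: \<pi>_def\<close>)
    also have "\<dots> = D ?h"
      by (rule D_cong, rule triple_scale(1)[OF offset_inner_third offset_loop[OF cz(2) nz(2)] offset_zero offset_zero offset_neg_prod_half offset_neg_inner])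
        (assumption, unfold fst_conv snd_conv, rule d1, simp_all add: algebra_simps diff_divide_distrib)
    also have "\<dots> = D (\<lambda>(\<zeta>,(\<theta>,w)). ?g (\<zeta>,(cis pi * \<theta>,w)))"
      by (rule D_eq) (simp add: triple_def Let_def)
    also have "\<dots> = D ?g" unfolding D_def tau2_inner_rotate[OF y cg] ..
    finally show ?thesis using Dg by simp
  qed
  \<comment> \<open>When the third point encircles both others, these form the inner pair, whose
    circle is driven by \<theta>. The two circles thus change roles, and the sign changes.\<close>
  have l3: "D (loop ?\<omega>) = - D f"
  proof -
    let ?k = "triple (\<lambda>x. 0) (\<lambda>x. fst (snd x) / 2) (\<lambda>x. fst (snd x) * (\<i> * fst x))"
    let ?f' = "\<lambda>(\<zeta>,(\<theta>,w)). f (\<theta>,(\<zeta> * \<theta>,w))"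
    have n: "(1 - of_real t) * (\<theta> / 3 - 0) + of_real t * (\<theta> / 2 - 0) \<noteq> 0 \<and>
       (1 - of_real t) * (\<theta> * ?\<omega> \<zeta> / 3 - 0) + of_real t * (\<theta> * (\<i> * \<zeta>) - 0) \<noteq> 0 \<and>
       (1 - of_real t) * (\<theta> * ?\<omega> \<zeta> / 3 - \<theta> / 3) + of_real t * (\<theta> * (\<i> * \<zeta>) - \<theta> / 2) \<noteq> 0"
      if z: "norm \<zeta> = 1" "norm \<theta> = 1" and t: "0 \<le> t" "t \<le> (1::real)" for \<zeta> \<theta> :: complex and t
    proof -
      have th: "\<theta> \<noteq> 0" using z by auto
      have "(1 - of_real t) * (of_real (1/3) * \<theta>) + of_real t * (of_real (1/2) * \<theta>) \<noteq> 0"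
        by (rule convex_multiples_nonzero[OF th _ _ t]) auto
      moreover have "(1 - of_real t) * (\<theta> * ?\<omega> \<zeta> / 3 - 0) + of_real t * (\<theta> * (\<i> * \<zeta>) - 0) =
        \<theta> * (of_real ((1 - t) / 6) + \<i> * of_real (2/3 + t/3) * \<zeta>)"
        by (simp add: algebra_simps add_divide_distrib diff_divide_distrib)
      moreover have "(1 - of_real t) * (\<theta> * ?\<omega> \<zeta> / 3 - \<theta> / 3) + of_real t * (\<theta> * (\<i> * \<zeta>) - \<theta> / 2) =
        \<theta> * (of_real (- (1 - t) / 6 - t / 2) + \<i> * of_real (2/3 + t/3) * \<zeta>)"
        by (simp add: algebra_simps add_divide_distrib diff_divide_distrib)
      moreover have "of_real ((1 - t) / 6) + \<i> * of_real (2/3 + t/3) * \<zeta> \<noteq> 0"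
        "of_real (- (1 - t) / 6 - t / 2) + \<i> * of_real (2/3 + t/3) * \<zeta> \<noteq> 0"
        by (rule circle_misses_real[OF z(1)], use t in \<open>simp add: abs_if field_simps\<close>)+
      ultimately show ?thesis using th by simp
    qed
    have "D (loop ?\<omega>) = D ?k"
      unfolding loop_def
      by (rule D_cong, rule triple_homotopy(1)[OF offset_zero offset_inner_third offset_loop[OF cz(3) nz(3)] offset_zero offset_inner_half offset_rotated_prod])
        (assumption, unfold fst_conv snd_conv, rule n)
    also have "\<dots> = D (\<lambda>(\<zeta>,w). ?f' (cis (pi/2) * \<zeta>,w))"
      unfolding f_def by (rule D_eq) (simp add: triple_def Let_def mult_ac)
    also have "\<dots> = D ?f'"
    proof -
      have "continuous_map ?T ?T (\<lambda>(\<zeta>,(\<theta>,w)). (\<theta>,(\<zeta> * \<theta>,w)))"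
        by (auto simp: continuous_map_SX case_prod_unfold norm_mult intro!: cmi cm_SXs)
      then have c: "continuous_map ?T (Cf V) ?f'"
        using continuous_map_compose[OF _ f] by (simp add: comp_def case_prod_unfold)
      show ?thesis unfolding D_def tau2_def by (rule arg_cong[OF tau_outer_rotate[OF ty c]])
    qed
    also have "\<dots> = - D f" using tau2_torus(3)[OF y lf f] unfolding D_def .
    finally show ?thesis .
  qed
  \<comment> \<open>The relation reads \<open>- D f = D f + D f\<close>, that is
    \<open>3 * D f = 0\<close>.\<close>
  show ?thesis using sum outer start l1 l2 l3 by simp
qed

end

section \<open>Residues along two disjoint pairs\<close>

context config
begin

lemma eps_mono:
  assumes "finite V" "U \<subseteq> V" shows "eps V a w \<le> eps U a w"
proof -
  have "(\<Prod>u\<in>V - {a}. min 1 (cmod (pos w a - pos w u))) =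
     (\<Prod>u\<in>U - {a}. min 1 (cmod (pos w a - pos w u))) * (\<Prod>u\<in>V - {a} - (U - {a}). min 1 (cmod (pos w a - pos w u)))"
    using assms by (subst prod.subset_diff[of "U - {a}"]) (auto simp: mult.commute)
  also have "\<dots> \<le> (\<Prod>u\<in>U - {a}. min 1 (cmod (pos w a - pos w u))) * 1"
    by (intro mult_left_mono prod_le_1 prod_nonneg) auto
  finally show ?thesis by (simp add: eps_def)
qed

end

section \<open>Two disjoint pairs of free points\<close>

locale config_pairs = config +
  fixes V :: "nat set" and a u c v :: nat
  assumes finV: "finite V" and free: "V \<inter> A = {}" and mem: "a \<in> V" "u \<in> V" "c \<in> V" "v \<in> V"
    and distinct: "a \<noteq> u" "a \<noteq> c" "a \<noteq> v" "u \<noteq> c" "u \<noteq> v" "c \<noteq> v"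
begin

abbreviation W :: "nat set" where
  "W \<equiv> V - {u} - {v}"

definition quad where
  "quad r s x = (fst (snd (snd x)), (snd (snd (snd x)))(u := snd (snd (snd x)) a + of_real (r x) * fst x,
     v := snd (snd (snd x)) c + of_real (s x) * fst (snd x)))"
  for r :: "complex \<times> complex \<times> 'a \<times> (nat \<Rightarrow> complex) \<Rightarrow> real" and s

definition radius where
  "radius b r \<longleftrightarrow> continuous_map (SX (SX (Cf W))) euclidean r \<and> (\<forall>x\<in>topspace (SX (SX (Cf W))). 0 < r x \<and> r x \<le> eps W b (snd (snd x)))"
  for r :: "complex \<times> complex \<times> 'a \<times> (nat \<Rightarrow> complex) \<Rightarrow> real"

text \<open>Both radii are at most a quarter of the distance between \<open>a\<close> and
  \<open>c\<close>, so the two circles are disjoint; the other vertices lie outside both.\<close>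

lemma inj_on_quad:
  assumes x: "x \<in> topspace (SX (SX (Cf W)))" and r: "0 < r x" "r x \<le> eps W a (snd (snd x))" and s: "0 < s x" "s x \<le> eps W c (snd (snd x))"
  shows "inj_on (pos (quad r s x)) V"
proof -
  obtain \<zeta> \<theta> w where X: "x = (\<zeta>,\<theta>,w)" by (cases x)
  have w: "norm \<zeta> = 1" "norm \<theta> = 1" "fst w \<in> topspace B" "inj_on (pos w) W" using x by (auto simp: X)
  have aW: "a \<in> W" "c \<in> W" "finite W" using mem distinct finV by auto
  have p: "pos (quad r s x) i = (if i = u then pos w a + of_real (r x) * \<zeta> else if i = v then pos w c + of_real (s x) * \<theta> else pos w i)" if "i \<in> V" for i
    using that free mem distinct by (auto simp: pos_def quad_def X)
  have lt: "r x < cmod (pos w a - pos w i)" "r x \<le> cmod (pos w a - pos w i) / 4" if "i \<in> W - {a}" for i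
  proof -
    have "pos w a \<noteq> pos w i" using inj_onD[OF w(4), of a i] that aW by blast
    then have "0 < cmod (pos w a - pos w i)" by simp
    moreover have "r x \<le> min 1 (cmod (pos w a - pos w i)) / 4" using eps_le[OF aW(3) that, of w] r(2) by (simp add: X)
    ultimately show "r x < cmod (pos w a - pos w i)" "r x \<le> cmod (pos w a - pos w i) / 4" by linarith+
  qed
  have lt': "s x < cmod (pos w c - pos w i)" "s x \<le> cmod (pos w c - pos w i) / 4" if "i \<in> W - {c}" for i
  proof -
    have "pos w c \<noteq> pos w i" using inj_onD[OF w(4), of c i] that aW by blast
    then have "0 < cmod (pos w c - pos w i)" by simp
    moreover have "s x \<le> min 1 (cmod (pos w c - pos w i)) / 4" using eps_le[OF aW(3) that, of w] s(2) by (simp add: X)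
    ultimately show "s x < cmod (pos w c - pos w i)" "s x \<le> cmod (pos w c - pos w i) / 4" by linarith+
  qed
  have nr: "norm (of_real (r x) * \<zeta>) = r x" "norm (of_real (s x) * \<theta>) = s x" using r(1) s(1) w by (simp_all add: norm_mult)
  have un: "pos w a + of_real (r x) * \<zeta> \<noteq> pos w i" if "i \<in> W" for i
  proof
    assume "pos w a + of_real (r x) * \<zeta> = pos w i"
    then have "cmod (pos w a - pos w i) = norm (of_real (r x) * \<zeta>)" by (metis add_diff_cancel_left' norm_minus_commute)
    then show False using lt(1)[of i] that r(1) unfolding nr by (cases "i = a") auto
  qed
  have vn: "pos w c + of_real (s x) * \<theta> \<noteq> pos w i" if "i \<in> W" for i
  proof
    assume "pos w c + of_real (s x) * \<theta> = pos w i"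
    then have "cmod (pos w c - pos w i) = norm (of_real (s x) * \<theta>)" by (metis add_diff_cancel_left' norm_minus_commute)
    then show False using lt'(1)[of i] that s(1) unfolding nr by (cases "i = c") auto
  qed
  have uv: "pos w a + of_real (r x) * \<zeta> \<noteq> pos w c + of_real (s x) * \<theta>"
  proof
    assume "pos w a + of_real (r x) * \<zeta> = pos w c + of_real (s x) * \<theta>"
    then have "pos w a - pos w c = of_real (s x) * \<theta> - of_real (r x) * \<zeta>" by (simp add: algebra_simps)
    then have "cmod (pos w a - pos w c) \<le> s x + r x" using norm_triangle_ineq4[of "of_real (s x) * \<theta>" "of_real (r x) * \<zeta>"] nr by simp
    moreover have "r x \<le> cmod (pos w a - pos w c) / 4" "s x \<le> cmod (pos w c - pos w a) / 4"
      by (rule lt(2) lt'(2), use aW distinct in simp)+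
    ultimately show False using r(1) s(1) norm_minus_commute[of "pos w a" "pos w c"] by simp
  qed
  have "inj_on (\<lambda>i. if i = u then pos w a + of_real (r x) * \<zeta> else if i = v then pos w c + of_real (s x) * \<theta> else pos w i) V"
  proof (rule inj_onI)
    fix i j assume ij: "i \<in> V" "j \<in> V" and eq: "(if i = u then pos w a + of_real (r x) * \<zeta> else if i = v then pos w c + of_real (s x) * \<theta> else pos w i)
      = (if j = u then pos w a + of_real (r x) * \<zeta> else if j = v then pos w c + of_real (s x) * \<theta> else pos w j)"
    consider "i = u \<or> i = v" "j = u \<or> j = v" | "i = u \<or> i = v" "j \<in> W" | "i \<in> W" "j = u \<or> j = v" | "i \<in> W" "j \<in> W"
      using ij by blast
    then show "i = j"
    proof cases
      case 1
      then show ?thesis using eq uv uv[symmetric] distinct(5) by (elim disjE) simp_all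
    next
      case 2
      have ne: "j \<noteq> u" "j \<noteq> v" using 2 by auto
      show ?thesis using 2(1) eq un[OF 2(2)] vn[OF 2(2)] distinct(5) unfolding if_not_P[OF ne(1)] if_not_P[OF ne(2)] by (elim disjE) simp_all
    next
      case 3
      have ne: "i \<noteq> u" "i \<noteq> v" using 3 by auto
      show ?thesis using 3(2) eq[symmetric] un[OF 3(1)] vn[OF 3(1)] distinct(5) unfolding if_not_P[OF ne(1)] if_not_P[OF ne(2)] by (elim disjE) simp_all
    next
      case 4
      then have "pos w i = pos w j" using eq by (auto split: if_splits)
      then show ?thesis by (rule inj_onD[OF w(4) _ 4])
    qed
  qed
  then show ?thesis using p by (subst inj_on_cong[OF p]) auto
qed

lemma cm_quad:
  assumes "radius a r" "radius c s" shows "continuous_map (SX (SX (Cf W))) (Cf V) (quad r s)"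
  unfolding continuous_map_Sb
proof (intro conjI allI ballI)
  have cW: "continuous_map (SX (SX (Cf W))) (Cf W) (\<lambda>x. snd (snd x))" by (rule cm_SX2)
  note rs = assms[unfolded radius_def, THEN conjunct1]
  have e: "snd (quad r s x) i = (if i = v then snd (snd (snd x)) c + of_real (s x) * fst (snd x)
     else if i = u then snd (snd (snd x)) a + of_real (r x) * fst x else snd (snd (snd x)) i)" for x i by (simp add: quad_def)
  show "continuous_map (SX (SX (Cf W))) euclidean (\<lambda>x. snd (quad r s x) i)" for i
    unfolding e by (intro continuous_map_if_const cmi cm_Sb_coord[OF cW] rs cm_SX2(1))
  show "continuous_map (SX (SX (Cf W))) B (\<lambda>x. fst (quad r s x))"
    using cm_Sb_base[OF cW] by (simp add: quad_def)
  show "inj_on (pos (quad r s x)) V" if "x \<in> topspace (SX (SX (Cf W)))" for x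
    using assms that unfolding radius_def by (intro inj_on_quad) blast+
qed

lemma quad_homotopy:
  assumes o: "radius a r" "radius c s" "radius a r'" "radius c s'"
  shows "push q (SX (SX (Cf W))) (Cf V) (quad r s) = push q (SX (SX (Cf W))) (Cf V) (quad r' s')"
proof (rule linear_homotopy[OF cm_quad cm_quad])
  fix x t assume x: "x \<in> topspace (SX (SX (Cf W)))" and t: "0 \<le> t" "t \<le> (1::real)"
  let ?m = "\<lambda>r r' y. (1 - t) * r y + t * r' y"
  have eq: "(fst (quad r s x), \<lambda>i. (1 - of_real t) * snd (quad r s x) i + of_real t * snd (quad r' s' x) i) = quad (?m r r') (?m s s') x"
    by (auto simp: quad_def algebra_simps)
  have b: "0 < ?m r r' x \<and> ?m r r' x \<le> eps W b (snd (snd x))" if "radius b r" "radius b r'" for b r r'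
  proof
    have "0 < r x" "0 < r' x" "r x \<le> eps W b (snd (snd x))" "r' x \<le> eps W b (snd (snd x))"
      using that x unfolding radius_def by blast+
    then show "0 < ?m r r' x" "?m r r' x \<le> eps W b (snd (snd x))"
      using convex_bound_lt[of "- r x" 0 "- r' x" "1 - t" t] t by (auto intro: convex_bound_le)
  qed
  show "inj_on (pos (fst (quad r s x), \<lambda>i. (1 - of_real t) * snd (quad r s x) i + of_real t * snd (quad r' s' x) i)) V"
    unfolding eq by (rule inj_on_quad[OF x]) (use b[OF o(1,3)] b[OF o(2,4)] in auto)
qed (use o in \<open>auto simp: quad_def\<close>)


lemma radius_eps: "b \<in> W \<Longrightarrow> radius b (\<lambda>x. eps W b (snd (snd x)))"
  unfolding radius_def using cm_eps[OF cm_SX2(2)[of "Cf W"]] eps_pos by auto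

text \<open>All admissible radii give homotopic maps. In the iterated tube the outer radius depends
  on the position of \<open>v\<close>, but it stays below the radius computed without
  \<open>v\<close>, since an additional vertex can only shrink \<open>eps\<close>.\<close>

lemma residue_quad:
  assumes y: "y \<in> carrier (homology_group q (Cf W))" and r: "radius a r" "radius c s"
  shows "L (q+1) V a u (L q (V - {u}) c v y) = push (q+1+1) (SX (SX (Cf W))) (Cf V) (quad r s) (tau2 q (Cf W) y)"
proof -
  let ?r = "\<lambda>x. eps (V - {u}) a (orb c v (eps W c) (snd x))" and ?s = "\<lambda>x. eps W c (snd (snd x))"
  have VV: "u \<in> V - A" "v \<in> V - {u} - A" "a \<in> V - {u}" "c \<in> W" "a \<in> W" "finite (V - {u})" "finite W"
    using free mem distinct finV by auto
  have vA: "v \<notin> A" "a \<notin> A" "c \<notin> A" using free mem by auto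
  have o: "continuous_map (SX (Cf W)) (Cf (V - {u})) (orb c v (eps W c))"
    by (rule cm_orb[OF VV(2,4) rad_eps[OF VV(7,4)]])
  have o': "continuous_map (SX (SX (Cf W))) (Cf (V - {u})) (\<lambda>x. orb c v (eps W c) (snd x))"
    using continuous_map_compose[OF cm_SX_snd o] by (simp add: comp_def)
  have R: "radius a ?r"
    unfolding radius_def
  proof (intro conjI ballI cm_eps[OF o'])
    fix x assume x: "x \<in> topspace (SX (SX (Cf W)))"
    have "orb c v (eps W c) (snd x) \<in> topspace (Cf (V - {u}))"
      using continuous_map_image_subset_topspace[OF o'] x by blast
    then show "0 < ?r x" using VV(3) by (intro eps_pos) auto
    have "pos (orb c v (eps W c) (snd x)) i = pos (snd (snd x)) i" if "i \<in> W" for i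
      using pos_orb[OF vA(1), of c "eps W c" "fst (snd x)" "snd (snd x)" i] that by simp
    then have "eps W a (orb c v (eps W c) (snd x)) = eps W a (snd (snd x))"
      unfolding eps_def by (intro arg_cong2[where f = "(/)"] prod.cong refl) (use VV(5) in simp)
    moreover have "?r x \<le> eps W a (orb c v (eps W c) (snd x))" by (rule eps_mono[OF VV(6)]) auto
    ultimately show "?r x \<le> eps W a (snd (snd x))" by simp
  qed
  have "push (q+1+1) (SX (SX (Cf W))) (Cf V) (\<lambda>(\<zeta>,x). orb a u (eps (V - {u}) a) (\<zeta>, orb c v (eps W c) x)) = push (q+1+1) (SX (SX (Cf W))) (Cf V) (quad ?r ?s)"
    by (rule push_cong) (use distinct vA in \<open>auto simp: quad_def orb_def pos_def fun_eq_iff\<close>)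
  also have "\<dots> = push (q+1+1) (SX (SX (Cf W))) (Cf V) (quad r s)"
    by (rule quad_homotopy[OF R radius_eps[OF VV(4)] r])
  finally show ?thesis unfolding L_compose(1)[OF finV VV(1-4) y] by simp
qed

text \<open>With independent radii both orders describe the same torus of configurations; only its
  two circles are interchanged.\<close>

lemma residues_antisym:
  assumes y: "y \<in> carrier (homology_group q (Cf W))" and l: "l \<in> hfun (q+1+1) (Cf V)"
  shows "l (L (q+1) V c v (L q (V - {v}) a u y)) = - l (L (q+1) V a u (L q (V - {u}) c v y))"
proof -
  interpret sw: config_pairs B p A V c v a u
    by unfold_locales (use finV free mem distinct in auto)
  have W: "V - {v} - {u} = W" by auto
  have m: "a \<in> W" "c \<in> W" using mem distinct by auto
  let ?r = "\<lambda>x. eps W a (snd (snd x))" and ?s = "\<lambda>x. eps W c (snd (snd x))"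
  note R = radius_eps[OF m(1)] radius_eps[OF m(2)]
  have "(\<lambda>(\<zeta>,(\<theta>,w)). quad ?r ?s (\<theta>,(\<zeta>,w))) = sw.quad ?s ?r"
    by (rule ext) (simp add: quad_def sw.quad_def case_prod_unfold fun_upd_twist[OF distinct(5)])
  then have "l (push (q+1+1) (SX (SX (Cf W))) (Cf V) (sw.quad ?s ?r) (tau2 q (Cf W) y)) =
    - l (push (q+1+1) (SX (SX (Cf W))) (Cf V) (quad ?r ?s) (tau2 q (Cf W) y))"
    using tau2_torus(2)[OF y l cm_quad[OF R]] by simp
  moreover have "L (q+1) V c v (L q (V - {v}) a u y) = push (q+1+1) (SX (SX (Cf W))) (Cf V) (sw.quad ?s ?r) (tau2 q (Cf W) y)"
    using sw.residue_quad[of y q ?s ?r, unfolded W, OF y] sw.radius_eps[of a] sw.radius_eps[of c] m unfolding W by simp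
  ultimately show ?thesis unfolding residue_quad[OF y R] by simp
qed

end

context config
begin

section \<open>Moving the anchors of residues far away\<close>

lemma inj_on_two_far:
  assumes i: "inj_on (pos w) (V - {a} - {c})"
    and a: "pos w a = of_real D" and c: "pos w c = of_real C" and C: "C < D" "0 \<le> C"
    and le: "\<And>i. i \<in> V - {a} - {c} \<Longrightarrow> cmod (pos w i) < C"
  shows "inj_on (pos w) V"
proof -
  have ac: "pos w a \<noteq> pos w c" unfolding a c using C by simp
  have ai: "pos w a \<noteq> pos w i" "pos w c \<noteq> pos w i" if "i \<in> V - {a} - {c}" for i
  proof -
    have "cmod (pos w i) < cmod (pos w a)" "cmod (pos w i) < cmod (pos w c)"
      unfolding a c using le[OF that] C by simp_all
    then show "pos w a \<noteq> pos w i" "pos w c \<noteq> pos w i" by auto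
  qed
  show ?thesis
  proof (rule inj_onI)
    fix i j assume ij: "i \<in> V" "j \<in> V" and e: "pos w i = pos w j"
    consider "i = j" | "i \<in> V - {a} - {c}" "j \<in> V - {a} - {c}" | "i \<in> V - {a} - {c}" "j = a \<or> j = c"
      | "j \<in> V - {a} - {c}" "i = a \<or> i = c" | "i = a" "j = c" | "i = c" "j = a" using ij by blast
    then show "i = j"
    proof cases
      case 2 then show ?thesis by (rule inj_onD[OF i e])
    next
      case 3 then show ?thesis using e ai[OF 3(1)] by metis
    next
      case 4 then show ?thesis using e ai[OF 4(1)] by metis
    qed (use e ac in auto)
  qed
qed


lemma inj_on_one_far:
  assumes i: "inj_on (pos w) (V - {a})" and a: "pos w a = of_real D"
    and le: "\<And>i. i \<in> V - {a} \<Longrightarrow> cmod (pos w i) < D"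
  shows "inj_on (pos w) V"
proof -
  have "pos w a \<notin> pos w ` (V - {a})"
  proof
    assume "pos w a \<in> pos w ` (V - {a})"
    then obtain i where "i \<in> V - {a}" "pos w a = pos w i" by blast
    then show False using le[of i] unfolding a by (metis abs_ge_self norm_of_real not_le)
  qed
  then have "inj_on (pos w) (insert a (V - {a}))" using i unfolding inj_on_insert by simp
  then show ?thesis by (rule inj_on_subset) auto
qed

lemma far_real:
  assumes "finite V"
  obtains D where "snd (far V v w) v = of_real D" "\<And>i. i \<in> V - {v} \<Longrightarrow> 1 + cmod (snd w i) \<le> D" "1 \<le> D"
proof (rule that[of "1 + (\<Sum>u\<in>V - {v}. cmod (snd w u))"])
  show "1 + cmod (snd w i) \<le> 1 + (\<Sum>u\<in>V - {v}. cmod (snd w u))" if "i \<in> V - {v}" for i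
    using member_le_sum[OF that, of "\<lambda>u. cmod (snd w u)"] assms by simp
qed (simp_all add: snd_far sum_nonneg)

text \<open>Compatibility of moving \<open>a\<close> with the tube of \<open>v\<close> around
  \<open>c\<close>. The far position of \<open>a\<close> and the radius differ on the two sides, but
  along the segment \<open>a\<close> stays far out and the radius stays admissible.\<close>

lemma far_orb:
  assumes U: "finite U" "U \<inter> A = {}" and m: "a \<in> U" "c \<in> U" "v \<in> U" "a \<noteq> c" "a \<noteq> v" "c \<noteq> v"
  defines "W \<equiv> U - {v}"
  shows "push q (SX (Cf W)) (Cf U) (\<lambda>x. far U a (orb c v (eps W c) x)) =
    push q (SX (Cf W)) (Cf U) (\<lambda>x. orb c v (eps W c) (case x of (\<theta>,w) \<Rightarrow> (\<theta>, far W a w)))"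
proof (rule linear_homotopy)
  have W: "finite W" "W \<inter> A = {}" "a \<in> W" "c \<in> W" using U m by (auto simp: W_def)
  have o: "continuous_map (SX (Cf W)) (Cf U) (orb c v (eps W c))"
    unfolding W_def by (rule cm_orb[OF _ _ rad_eps]) (use U m in auto)
  show "continuous_map (SX (Cf W)) (Cf U) (\<lambda>x. far U a (orb c v (eps W c) x))"
    using continuous_map_compose[OF o cm_far[OF U m(1)]] by (simp add: comp_def)
  show "continuous_map (SX (Cf W)) (Cf U) (\<lambda>x. orb c v (eps W c) (case x of (\<theta>,w) \<Rightarrow> (\<theta>, far W a w)))"
    using continuous_map_compose[OF cm_SX_map[OF cm_far[OF W(1-3)]] o] by (simp add: comp_def)
  show "fst (far U a (orb c v (eps W c) x)) = fst (orb c v (eps W c) (case x of (\<theta>,w) \<Rightarrow> (\<theta>, far W a w)))" for x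
    by (simp add: orb_def case_prod_unfold)
  fix x t assume x: "x \<in> topspace (SX (Cf W))" and t: "0 \<le> t" "t \<le> (1::real)"
  obtain \<theta> w where X: "x = (\<theta>,w)" "norm \<theta> = 1" "w \<in> topspace (Cf W)" using x by (rule SX_cases)
  let ?w1 = "orb c v (eps W c) (\<theta>,w)" and ?w2 = "far W a w"
  obtain D1 where D1: "snd (far U a ?w1) a = of_real D1" "\<And>i. i \<in> U - {a} \<Longrightarrow> 1 + cmod (snd ?w1 i) \<le> D1" "1 \<le> D1"
    using far_real[OF U(1)] by blast
  obtain D2 where D2: "snd ?w2 a = of_real D2" "\<And>i. i \<in> W - {a} \<Longrightarrow> 1 + cmod (snd w i) \<le> D2" "1 \<le> D2"
    using far_real[OF W(1)] by blast
  define D where "D = (1 - t) * D1 + t * D2"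
  define e where "e = (1 - t) * eps W c w + t * eps W c ?w2"
  define w' where "w' = (fst w, (snd w)(a := of_real D))"
  have s1: "snd ?w1 i = snd w i" if "i \<in> W" for i using that by (simp add: orb_def W_def)
  have pc: "pos w c = snd w c" "pos ?w2 c = snd w c" using W m by (auto simp: pos_def snd_far)
  have eq: "(fst (far U a ?w1), \<lambda>i. (1 - of_real t) * snd (far U a ?w1) i + of_real t * snd (orb c v (eps W c) (\<theta>, ?w2)) i) = orb c v (\<lambda>_. e) (\<theta>, w')"
  proof -
    have "(1 - of_real t) * snd (far U a ?w1) i + of_real t * snd (orb c v (eps W c) (\<theta>, ?w2)) i = snd (orb c v (\<lambda>_. e) (\<theta>, w')) i" for i
    proof -
      consider "i = v" | "i = a" | "i \<noteq> v" "i \<noteq> a" by blast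
      then show ?thesis
      proof cases
        case 1
        have "pos w' c = snd w c" using W m by (auto simp: pos_def w'_def)
        then show ?thesis using 1 m pc by (simp add: snd_far orb_def e_def algebra_simps)
      next
        case 2
        have "snd (orb c v (eps W c) (\<theta>, ?w2)) a = of_real D2" using m D2(1) by (simp add: orb_def)
        then show ?thesis using 2 m D1(1) by (simp add: D_def w'_def orb_def)
      next
        case 3
        then show ?thesis by (simp add: snd_far orb_def w'_def algebra_simps)
      qed
    qed
    then show ?thesis by (simp add: orb_def w'_def fun_eq_iff)
  qed
  have p': "pos w' i = (if i = a then of_real D else pos w i)" if "i \<in> U" for i
    using that U by (auto simp: pos_def w'_def)
  have pw: "pos w i = snd w i" if "i \<in> W" for i using that W by (auto simp: pos_def)
  have Dge: "1 + cmod (pos w i) \<le> D" if "i \<in> W - {a}" for i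
    using convex_bound_le[of "- D1" "- (1 + cmod (pos w i))" "- D2" "1 - t" t] D1(2)[of i] D2(2)[OF that] s1[of i] pw[of i] that t
    by (simp add: D_def W_def)
  have e: "0 < e" "e \<le> 1/4" "\<And>i. i \<in> W - {c} - {a} \<Longrightarrow> e < cmod (pos w c - pos w i)"
  proof -
    have i2: "?w2 \<in> topspace (Cf W)" using continuous_map_image_subset_topspace[OF cm_far[OF W(1-3)]] X(3) by blast
    have r: "rad W c (eps W c)" by (rule rad_eps[OF W(1,4)])
    have e0: "0 < eps W c w" "0 < eps W c ?w2" using X(3) i2 W(4) by (auto intro!: eps_pos)
    then show "0 < e" using convex_bound_lt[of "- eps W c w" 0 "- eps W c ?w2" "1 - t" t] t by (simp add: e_def)
    show "e \<le> 1/4" unfolding e_def using eps_le_quarter t by (intro convex_bound_le) auto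
    fix i assume i: "i \<in> W - {c} - {a}"
    have "pos ?w2 i = pos w i" using i W by (auto simp: pos_def snd_far)
    moreover have "eps W c ?w2 < cmod (pos ?w2 c - pos ?w2 i)" "eps W c w < cmod (pos w c - pos w i)"
      using r i2 X(3) i unfolding rad_def by blast+
    ultimately show "e < cmod (pos w c - pos w i)" unfolding e_def pc using t by (intro convex_bound_lt) auto
  qed
  have "inj_on (pos w') W"
  proof (rule inj_on_one_far)
    have "inj_on (pos w) (W - {a})" using X(3) by (auto intro: inj_on_subset)
    then show "inj_on (pos w') (W - {a})" using p' by (subst inj_on_cong) (auto simp: W_def)
    show "pos w' a = of_real D" using p' m by simp
    show "cmod (pos w' i) < D" if "i \<in> W - {a}" for i using Dge[OF that] p'[of i] that by (auto simp: W_def)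
  qed
  moreover have "e < cmod (pos w' c - pos w' i)" if "i \<in> U - {v} - {c}" for i
  proof (cases "i = a")
    case True
    have "1 + cmod (pos w c) \<le> D" using W m by (intro Dge) auto
    moreover have "D \<le> cmod (of_real D :: complex)" by simp
    ultimately have "1 \<le> cmod (pos w c - of_real D)"
      using norm_triangle_ineq2[of "of_real D" "pos w c"] unfolding norm_minus_commute[of "pos w c"] by linarith
    then show ?thesis using e(2) True p' m by simp
  next
    case False
    then show ?thesis using e(3)[of i] that p' m by (auto simp: W_def)
  qed
  ultimately have "inj_on (\<lambda>i. if i = v then pos w' c + of_real e * \<theta> else pos w' i) U"
    using U m e(1) X(2) unfolding W_def by (intro inj_on_orb) auto
  moreover have "v \<notin> A" using U m by auto
  ultimately have "inj_on (pos (orb c v (\<lambda>_. e) (\<theta>, w'))) U" by (subst inj_on_cong[OF pos_orb]) auto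
  then show "inj_on (pos (fst (far U a (orb c v (eps W c) x)), \<lambda>i. (1 - of_real t) * snd (far U a (orb c v (eps W c) x)) i
    + of_real t * snd (orb c v (eps W c) (case x of (\<theta>,w) \<Rightarrow> (\<theta>, far W a w))) i)) U"
    unfolding X(1) prod.case eq .
qed

text \<open>After \<open>c\<close> and then \<open>a\<close> have been moved away, their former
  positions enter only through two real numbers, whose order is preserved along a segment. Hence
  maps that agree on the other vertices become homotopic.\<close>

lemma far_far:
  assumes W: "finite W" "W \<inter> A = {}" and m: "a \<in> W" "c \<in> W" "a \<noteq> c"
    and f: "continuous_map X (Cf W) f" and g: "continuous_map X (Cf W) g"
    and fst: "\<And>x. x \<in> topspace X \<Longrightarrow> fst (f x) = fst (g x)"
    and fg: "\<And>x i. x \<in> topspace X \<Longrightarrow> i \<in> W - {a} - {c} \<Longrightarrow> snd (f x) i = snd (g x) i"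
  shows "push q X (Cf W) (\<lambda>x. far W a (far W c (f x))) = push q X (Cf W) (\<lambda>x. far W a (far W c (g x)))"
proof (rule linear_homotopy)
  show "continuous_map X (Cf W) (\<lambda>x. far W a (far W c (f x)))" "continuous_map X (Cf W) (\<lambda>x. far W a (far W c (g x)))"
    using continuous_map_compose[OF continuous_map_compose[OF f cm_far[OF W m(2)]] cm_far[OF W m(1)]]
      continuous_map_compose[OF continuous_map_compose[OF g cm_far[OF W m(2)]] cm_far[OF W m(1)]] by (simp_all add: comp_def)
  fix x t assume x: "x \<in> topspace X" and t: "0 \<le> t" "t \<le> (1::real)"
  have two: "\<exists>C D. snd (far W a (far W c w)) a = of_real D \<and> snd (far W a (far W c w)) c = of_real C \<and> C < D \<and> 0 \<le> C \<and>
    (\<forall>i\<in>W - {a} - {c}. cmod (snd w i) < C)" for w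
  proof -
    obtain C where C: "snd (far W c w) c = of_real C" "\<And>i. i \<in> W - {c} \<Longrightarrow> 1 + cmod (snd w i) \<le> C" "1 \<le> C"
      using far_real[OF W(1)] by blast
    obtain D where D: "snd (far W a (far W c w)) a = of_real D" "\<And>i. i \<in> W - {a} \<Longrightarrow> 1 + cmod (snd (far W c w) i) \<le> D"
      using far_real[OF W(1)] by blast
    have "snd (far W a (far W c w)) c = of_real C" using C(1) m by (simp add: snd_far[of W a])
    moreover have "C < D" using D(2)[of c] m C(1,3) by simp
    moreover have "cmod (snd w i) < C" if "i \<in> W - {a} - {c}" for i using C(2)[of i] that by auto
    ultimately show ?thesis using D(1) C(3) by (intro exI[of _ C] exI[of _ D]) auto
  qed
  obtain C D where 1: "snd (far W a (far W c (f x))) a = of_real D" "snd (far W a (far W c (f x))) c = of_real C" "C < D" "0 \<le> C"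
    "\<And>i. i \<in> W - {a} - {c} \<Longrightarrow> cmod (snd (f x) i) < C" using two[of "f x"] by blast
  obtain C' D' where 2: "snd (far W a (far W c (g x))) a = of_real D'" "snd (far W a (far W c (g x))) c = of_real C'" "C' < D'" "0 \<le> C'"
    "\<And>i. i \<in> W - {a} - {c} \<Longrightarrow> cmod (snd (g x) i) < C'" using two[of "g x"] by blast
  let ?w = "(fst (far W a (far W c (f x))), \<lambda>i. (1 - of_real t) * snd (far W a (far W c (f x))) i + of_real t * snd (far W a (far W c (g x))) i)"
  have nA: "i \<notin> A" if "i \<in> W" for i using that W by auto
  have p: "pos ?w i = snd (f x) i" if "i \<in> W - {a} - {c}" for i
    using fg[OF x that] nA[of i] that by (simp add: pos_def snd_far algebra_simps)
  show "inj_on (pos ?w) W"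
  proof (rule inj_on_two_far)
    show "pos ?w a = of_real ((1 - t) * D + t * D')" "pos ?w c = of_real ((1 - t) * C + t * C')"
      using 1(1,2) 2(1,2) nA m by (simp_all add: pos_def)
    show "(1 - t) * C + t * C' < (1 - t) * D + t * D'"
      using convex_bound_lt[of "C - D" 0 "C' - D'" "1 - t" t] 1(3) 2(3) t by (simp add: algebra_simps)
    show "0 \<le> (1 - t) * C + t * C'" using 1(4) 2(4) t by simp
    have "f x \<in> topspace (Cf W)" using continuous_map_image_subset_topspace[OF f] x by blast
    then have "inj_on (pos (f x)) (W - {a} - {c})" by (auto intro: inj_on_subset)
    moreover have "pos (f x) i = snd (f x) i" if "i \<in> W - {a} - {c}" for i using nA that by (simp add: pos_def)
    ultimately have "inj_on (snd (f x)) (W - {a} - {c})" by (metis (no_types, lifting) inj_on_cong)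
    then show "inj_on (pos ?w) (W - {a} - {c})" using p by (metis (no_types, lifting) inj_on_cong)
    fix i assume i: "i \<in> W - {a} - {c}"
    show "cmod (pos ?w i) < (1 - t) * C + t * C'"
      unfolding p[OF i] using convex_bound_lt[of "- C" "- cmod (snd (f x) i)" "- C'" "1 - t" t] 1(5)[OF i] 2(5)[OF i] fg[OF x i] t by simp
  qed
qed (use fst in simp)

text \<open>Exchanging the two pairs changes the sign of the iterated residue, since it exchanges the two circles.
  On the other hand the iterated residue does not change when its anchors \<open>a\<close> and \<open>c\<close> are moved far
  away (by the Jacobi identity), and after that the exchange is homotopic to the identity.\<close>

lemma two_pairs:
  assumes l: "l \<in> hinv (q+1+1) V" and V: "finite V" "V \<inter> A = {}" and m: "a \<in> V" "u \<in> V" "c \<in> V" "v \<in> V"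
    and d: "a \<noteq> u" "a \<noteq> c" "a \<noteq> v" "u \<noteq> c" "u \<noteq> v" "c \<noteq> v"
    and y: "y \<in> carrier (homology_group q (Cf (V - {u} - {v})))"
  shows "l (L (q+1) V a u (L q (V - {u}) c v y)) = 0"
proof -
  interpret config_pairs B p A V a u c v by unfold_locales (use V m d in auto)
  have lf: "l \<in> hfun (q+1+1) (Cf V)" by (rule hinv_hfun[OF l])
  have VA: "V - A = V" and nA: "u \<notin> A" "v \<notin> A" using V m by auto
  let ?W = "V - {u} - {v}" and ?U = "V - {u}"
  let ?H = "homology_group q (Cf ?W)"
  define N where "N y = l (L (q+1) V a u (L q ?U c v y))" for y
  define \<pi> where "\<pi> = Transposition.transpose a c \<circ> Transposition.transpose u v"
  have pi: "\<pi> permutes V" unfolding \<pi>_def using m by (intro permutes_compose permutes_swap_id)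
  have pv: "\<pi> a = c" "\<pi> c = a" "\<pi> u = v" "\<pi> v = u" and po: "\<And>i. i \<noteq> a \<Longrightarrow> i \<noteq> c \<Longrightarrow> i \<noteq> u \<Longrightarrow> i \<noteq> v \<Longrightarrow> \<pi> i = i"
    using d by (auto simp: \<pi>_def Transposition.transpose_def)
  have pi': "\<pi> permutes (V - A)" using pi VA by simp
  have Wc: "V - {v} - {u} = ?W" by auto
  have piW: "\<pi> ` ?W = ?W" "\<pi> ` ?U = V - {v}"
    using image_set_diff[OF permutes_inj[OF pi], of V "{u}"] image_set_diff[OF permutes_inj[OF pi], of "V - {u}" "{v}"]
      permutes_image[OF pi] pv Wc by simp_all
  let ?p = "push q (Cf ?W) (Cf ?W) (act \<pi>)"
  have ca: "continuous_map (Cf ?W) (Cf ?W) (act \<pi>)" using cm_act[OF pi', of ?W] unfolding piW .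
  have W: "finite ?W" "?W \<inter> A = {}" "a \<in> ?W" "c \<in> ?W" using V m d by auto
  note cf = cm_far[OF W(1,2)]
  \<comment> \<open>By equivariance and invariance of \<open>l\<close> this is the iterated residue
    in the other order, hence the sign.\<close>
  have pi_N: "N (?p y) = - N y" if y: "y \<in> carrier ?H" for y
  proof -
    let ?z = "L q (V - {v}) a u y"
    have "push (q+1) (Cf (V - {v})) (Cf ?U) (act \<pi>) ?z = L q ?U c v (?p y)"
      by (rule L_act_image[OF pi', of ?U v c y q, unfolded piW pv Wc]) (use y V(1) m d nA in simp_all)
    moreover have "push (q+1+1) (Cf V) (Cf V) (act \<pi>) (L (q+1) V c v ?z) = L (q+1) V a u (push (q+1) (Cf (V - {v})) (Cf ?U) (act \<pi>) ?z)"
      by (rule L_act[OF pi', of u a ?z "q+1", unfolded pv, OF V(1) _ _ L_closed]) (use m d nA in simp_all)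
    moreover have "l (push (q+1+1) (Cf V) (Cf V) (act \<pi>) (L (q+1) V c v ?z)) = l (L (q+1) V c v ?z)"
      using l pi' L_closed[of "q+1" V c v ?z] unfolding hinv_def by blast
    ultimately have "N (?p y) = l (L (q+1) V c v ?z)" by (simp add: N_def)
    then show ?thesis using residues_antisym[OF y lf] by (simp add: N_def)
  qed
  \<comment> \<open>By the Jacobi identity the residue \<mu> of \<open>l\<close> has no residues
    with centre \<open>a\<close>, so \<open>far_invariant\<close> applies to \<mu>;
    \<open>far_orb\<close> then carries the move through the inner tube.\<close>
  have far_N: "N (push q (Cf ?W) (Cf ?W) (far ?W a) y) = N y" if y: "y \<in> carrier ?H" for y
  proof -
    define \<mu> where "\<mu> = rpull (homology_group (q+1) (Cf ?U)) (L (q+1) V a u) l"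
    have U: "finite ?U" "?U \<inter> A = {}" "a \<in> ?U" using V m d by auto
    have mu: "\<mu> \<in> hfun (q+1) (Cf ?U)" unfolding \<mu>_def by (rule rpull_rhom[OF L_hom lf]) simp
    have muL: "\<mu> (L q ?U b w z) = l (L (q+1) V a u (L q ?U b w z))" for b w z
      unfolding \<mu>_def rpull_def by (simp add: L_closed)
    have k: "kills (q+1) ?U \<mu> a i" if i: "i \<in> ?U - {a}" for i
      unfolding kills_def
    proof
      fix z assume "z \<in> carrier (homology_group (q + 1 - 1) (Cf (?U - {i})))"
      then have z: "z \<in> carrier (homology_group q (Cf (?U - {i})))" by simp
      interpret t: config_triple B p A V a u i by unfold_locales (use V m d i in auto)
      have "l (L (q+1) V a u (L q ?U a i z)) = 0" by (rule t.Jacobi[OF l z])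
      then show "\<mu> (L (q + 1 - 1) ?U a i z) = 0" by (simp add: muL)
    qed
    have o: "continuous_map (SX (Cf ?W)) (Cf ?U) (orb c v (eps ?W c))"
      by (rule cm_orb[OF _ _ rad_eps]) (use V m d in auto)
    have ty: "tau q (Cf ?W) y \<in> carrier (homology_group (q+1) (SX (Cf ?W)))" by (rule tau_closed[OF y])
    have "N y = \<mu> (L q ?U c v y)" by (simp add: N_def muL)
    also have "\<dots> = \<mu> (push (q+1) (Cf ?U) (Cf ?U) (far ?U a) (L q ?U c v y))"
      by (rule far_invariant[OF U mu _ L_closed, symmetric]) (use k in blast)
    also have "push (q+1) (Cf ?U) (Cf ?U) (far ?U a) (L q ?U c v y) = L q ?U c v (push q (Cf ?W) (Cf ?W) (far ?W a) y)"
      unfolding L_def push_compose[OF o cm_far[OF U]] tau_natural[OF cf[OF W(3)] y, symmetric]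
        push_compose[OF cm_SX_map[OF cf[OF W(3)]] o]
      by (subst far_orb[OF U(1,2)]) (use m d in auto)
    also have "\<mu> \<dots> = N (push q (Cf ?W) (Cf ?W) (far ?W a) y)" by (simp add: N_def muL)
    finally show ?thesis by simp
  qed
  let ?a = "push q (Cf ?W) (Cf ?W) (far ?W a)" and ?c = "push q (Cf ?W) (Cf ?W) (far ?W c)"
  have swap: "far ?W a (act \<pi> w) = act \<pi> (far ?W c w)" for w
  proof -
    have "(\<Sum>i\<in>?W - {a}. cmod (snd w (\<pi> i))) = (\<Sum>i\<in>?W - {c}. cmod (snd w i))"
    proof (rule sum.reindex_cong[OF inj_on_subset[OF permutes_inj[OF pi] subset_UNIV], symmetric])
      show "?W - {c} = \<pi> ` (?W - {a})" using image_set_diff[OF permutes_inj[OF pi], of ?W "{a}"] piW pv by simp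
    qed simp
    moreover have "\<pi> i = c \<longleftrightarrow> i = a" for i using permutes_inj[OF pi] pv(1) by (metis injD)
    ultimately show ?thesis by (auto simp: far_def act_def fun_eq_iff)
  qed
  \<comment> \<open>Conjugation by \<pi> transfers the invariance from \<open>a\<close> to
    \<open>c\<close>; the two signs cancel.\<close>
  have c_N: "N (?c y) = N y" if y: "y \<in> carrier ?H" for y
  proof -
    have "?p (?c y) = ?a (?p y)"
      unfolding push_compose[OF cf[OF W(4)] ca] push_compose[OF ca cf[OF W(3)]] swap ..
    then have "- N (?c y) = N (?a (?p y))" using pi_N[OF push_closed, of "Cf ?W" "far ?W c" y] by simp
    also have "\<dots> = - N y" using far_N[OF push_closed, of "Cf ?W" "act \<pi>" y] pi_N[OF y] by simp
    finally show ?thesis by simp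
  qed
  have "?a (?c (?p y)) = ?a (?c y)"
  proof -
    have cc: "continuous_map (Cf ?W) (Cf ?W) (\<lambda>w. far ?W c (act \<pi> w))" using continuous_map_compose[OF ca cf[OF W(4)]] by (simp add: comp_def)
    have "push q (Cf ?W) (Cf ?W) (\<lambda>w. far ?W a (far ?W c (act \<pi> w))) = push q (Cf ?W) (Cf ?W) (\<lambda>w. far ?W a (far ?W c w))"
    proof (rule far_far[OF W d(2) ca])
      show "snd (act \<pi> w) i = snd w i" if "i \<in> ?W - {a} - {c}" for w i using po[of i] that by (simp add: act_def)
    qed (simp_all add: act_def)
    then show ?thesis
      unfolding push_compose[OF ca cf[OF W(4)]] push_compose[OF cc cf[OF W(3)]] push_compose[OF cf[OF W(4)] cf[OF W(3)]] by simp
  qed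
  then have "N (?a (?c (?p y))) = N (?a (?c y))" by simp
  then have "N (?p y) = N y" unfolding far_N[OF push_closed] c_N[OF push_closed] c_N[OF y] .
  then have "N y = 0" using pi_N[OF y] by simp
  then show ?thesis by (simp add: N_def)
qed


lemma sep_negative_degree: "q < 0 \<Longrightarrow> sep (hfun q X) n"
proof (rule sep_zero)
  fix l assume q: "q < 0" and l: "l \<in> hfun q X"
  show "l = (\<lambda>x. 0)"
  proof
    fix x show "l x = 0"
      using neg_carrier[OF q, of x X] rhom_outside[OF l, of x] rhom_one[OF _ l] by (cases "x \<in> carrier (homology_group q X)") auto
  qed
qed

text \<open>Without holes, an invariant functional is determined by one residue, which in turn factors through the
  base by the Jacobi identity, and by its restriction to the base.\<close>

lemma sep_free:
  assumes V: "finite V" "V \<inter> A = {}" and C: "sep (hfun q B) C" "sep (hfun (q-1) B) C"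
  shows "sep (hinv q V) (C + C)"
proof (cases "\<exists>a\<in>V. \<exists>u\<in>V. a \<noteq> u")
  case False
  then have "Cf V = Sb (\<lambda>_. True)" by (intro Sb_cong) (auto simp: inj_on_def)
  then have "hinv q V \<subseteq> hfun q (Sb (\<lambda>_. True))" by (auto simp: hinv_def)
  then show ?thesis by (rule sep_mono[OF sep_base[OF C(1)]]) simp
next
  case True
  then obtain a u where au: "a \<in> V" "u \<in> V" "a \<noteq> u" by blast
  have VA: "V - A = V" using V by auto
  let ?U = "V - {u}"
  let ?W = "{rpull (homology_group (q-1) (Cf ?U)) (push (q-1) (Cf ?U) B fst) m |m. m \<in> hfun (q-1) B}"
  have LH: "L (q-1) V a u \<in> hom (homology_group (q-1) (Cf ?U)) (homology_group q (Cf V))"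
    using L_hom[of "q-1" V a u] by simp
  show ?thesis
  proof (rule sep_rhom_extend[OF sep_rpull[OF C(2)] LH])
    fix l assume l: "l \<in> hinv q V"
    let ?l = "rpull (homology_group (q-1) (Cf ?U)) (L (q-1) V a u) l"
    have lf: "?l \<in> hfun (q-1) (Cf ?U)" by (rule rpull_rhom[OF LH hinv_hfun[OF l]]) simp
    have "kills (q-1) ?U ?l c v" if v: "v \<in> ?U - {a}" and c: "c \<in> ?U - {v}" for c v
      unfolding kills_def
    proof
      fix y assume y: "y \<in> carrier (homology_group (q-1-1) (Cf (?U - {v})))"
      have l': "l \<in> hinv (q-1-1+1+1) V" using l by simp
      have "l (L (q-1-1+1) V a u (L (q-1-1) ?U c v y)) = 0"
      \<comment> \<open>Either the second collision has the anchor \<open>a\<close> of the first as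
        its centre, which gives a cluster of three, or the two pairs are disjoint.\<close>
      proof (cases "c = a")
        case True
        interpret t: config_triple B p A V a u v by unfold_locales (use V au v in auto)
        show ?thesis unfolding True by (rule t.Jacobi[OF l' y])
      next
        case False
        show ?thesis by (rule two_pairs[OF l' V _ _ _ _ _ _ _ _ _ _ y]) (use au v c False in auto)
      qed
      then show "?l (L (q-1-1) ?U c v y) = 0"
        using L_closed[of "q-1-1" ?U c v y] by (simp add: rpull_def)
    qed
    then have "\<exists>m\<in>hfun (q-1) B. ?l = rpull (homology_group (q-1) (Cf ?U)) (push (q-1) (Cf ?U) B fst) m"
      by (intro factor_through_base[OF _ _ _ lf, of a]) (use V au in auto)
    then show "?l \<in> ?W" by blast
  next
    show "sep {l \<in> hinv q V. \<forall>x\<in>carrier (homology_group (q-1) (Cf ?U)). l (L (q-1) V a u x) = 0} C"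
    proof (rule sep_mono[OF sep_rpull[OF C(1), of "homology_group q (Cf V)" "push q (Cf V) B fst"]])
      show "{l \<in> hinv q V. \<forall>x\<in>carrier (homology_group (q-1) (Cf ?U)). l (L (q-1) V a u x) = 0}
        \<subseteq> {rpull (homology_group q (Cf V)) (push q (Cf V) B fst) m |m. m \<in> hfun q B}"
      proof
        fix l assume "l \<in> {l \<in> hinv q V. \<forall>x\<in>carrier (homology_group (q-1) (Cf ?U)). l (L (q-1) V a u x) = 0}"
        then have l: "l \<in> hinv q V" "kills q V l a u" by (auto simp: kills_def)
        have "kills q V l c v" if cv: "v \<in> V - {a}" "c \<in> V - {v}" for c v
        proof -
          \<comment> \<open>Permutations are transitive on ordered pairs of distinct vertices, so
            one vanishing residue gives all of them.\<close>
          obtain \<pi> where pi: "\<pi> permutes V" "\<pi> a = c" "\<pi> u = v" using perm_pair[of a V u c v] au cv by blast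
          have "kills q V l (\<pi> a) (\<pi> u)" by (rule kills_perm[OF l(1) _ V(1) _ _ l(2)]) (use pi VA au in auto)
          then show ?thesis unfolding pi .
        qed
        then have "\<exists>m\<in>hfun q B. l = rpull (homology_group q (Cf V)) (push q (Cf V) B fst) m"
          by (intro factor_through_base[OF V au(1) hinv_hfun[OF l(1)]]) auto
        then show "l \<in> {rpull (homology_group q (Cf V)) (push q (Cf V) B fst) m |m. m \<in> hfun q B}" by blast
      qed
    qed simp
  qed simp
qed

text \<open>Filling in a hole leaves degree \<open>i\<close> and one hole fewer; the residue at the
  hole has degree \<open>i - 1\<close>, the same holes and one free point fewer. The claimed bound
  satisfies this recursion because \<open>i * i^h + (i+1)^h\<close> is at most
  \<open>(i+1)^(h+1)\<close>. The factor 2 comes from \<open>sep_free\<close>, and the number of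
  free points never enters.\<close>

theorem sep_hinv:
  assumes C: "\<And>q. sep (hfun q B) C" and V: "finite V" "card (V \<inter> A) = h"
  shows "sep (hinv (int i) V) (2 * C * (i + 1) ^ h)"
  using V
proof (induction h arbitrary: V i)
  case 0
  then have "V \<inter> A = {}" by simp
  then have "sep (hinv (int i) V) (C + C)" using 0 by (intro sep_free C)
  then show ?case by (simp add: mult_2)
next
  case (Suc h)
  have le: "2 * C * i ^ Suc h + 2 * C * (i + 1) ^ h \<le> 2 * C * (i + 1) ^ Suc h" for i
  proof -
    have "i ^ h \<le> (i + 1) ^ h" by (intro power_mono) auto
    then have "i * i ^ h \<le> i * (i + 1) ^ h" by (rule mult_le_mono2)
    then have "2 * C * (i * i ^ h + (i + 1) ^ h) \<le> 2 * C * (i * (i + 1) ^ h + (i + 1) ^ h)" by (intro mult_le_mono2) simp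
    then show ?thesis by (simp add: algebra_simps)
  qed
  have le0: "C \<le> 2 * C * (i + 1) ^ Suc h" for i
  proof -
    have "1 \<le> 2 * (i + 1) ^ Suc h" by (simp add: Suc_le_eq)
    then have "C * 1 \<le> C * (2 * (i + 1) ^ Suc h)" by (rule mult_le_mono2)
    then show ?thesis by (simp only: mult_1_right mult_ac)
  qed
  note IH = Suc.IH
  show ?case using Suc.prems
  proof (induction i arbitrary: V)
    case (0 V)
    show ?case
    proof (cases "V - A = {}")
      case True
      \<comment> \<open>All vertices are holes, which never collide, so no condition is
        left.\<close>
      then have "Cf V = Sb (\<lambda>_. True)" by (intro Sb_cong) (auto simp: inj_on_def pos_def dest: hole_distinct)
      then have "hinv (int 0) V \<subseteq> hfun (int 0) (Sb (\<lambda>_. True))" by (auto simp: hinv_def)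
      then show ?thesis by (rule sep_mono[OF sep_base[OF C] _ le0])
    next
      case False
      then obtain v where v: "v \<in> V - A" by blast
      obtain c where c: "c \<in> V \<inter> A" using 0(2) by (metis card.empty ex_in_conv nat.distinct(1))
      have "card ((V - {c}) \<inter> A) = h" using 0 c by (simp add: Int_Diff[symmetric] Diff_Int_distrib2 card_Diff_singleton)
      then have "sep (hinv (int 0) (V - {c})) (2 * C * (0 + 1) ^ h)" using 0 by (intro IH) auto
      \<comment> \<open>In degree 0 the residue lives in degree -1, where homology is trivial;
        integer degrees make this an ordinary case of the recursion.\<close>
      moreover have "sep (hinv (int 0 - 1) (V - {v})) 0"
        by (rule sep_mono[OF sep_negative_degree[of "int 0 - 1" "Cf (V - {v})"]]) (auto simp: hinv_def)
      ultimately have "sep (hinv (int 0) V) (0 + 2 * C * (0 + 1) ^ h)" by (intro sep_hole[OF 0(1) c v])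
      then show ?thesis by simp
    qed
  next
    case (Suc j V)
    show ?case
    proof (cases "V - A = {}")
      case True
      then have "Cf V = Sb (\<lambda>_. True)" by (intro Sb_cong) (auto simp: inj_on_def pos_def dest: hole_distinct)
      then have "hinv (int (Suc j)) V \<subseteq> hfun (int (Suc j)) (Sb (\<lambda>_. True))" by (auto simp: hinv_def)
      then show ?thesis by (rule sep_mono[OF sep_base[OF C] _ le0])
    next
      case False
      then obtain v where v: "v \<in> V - A" by blast
      obtain c where c: "c \<in> V \<inter> A" using Suc.prems(2) by (metis card.empty ex_in_conv nat.distinct(1))
      have "card ((V - {c}) \<inter> A) = h" using Suc.prems c by (simp add: Int_Diff[symmetric] Diff_Int_distrib2 card_Diff_singleton)
      then have 1: "sep (hinv (int (Suc j)) (V - {c})) (2 * C * (Suc j + 1) ^ h)" using Suc.prems by (intro IH) auto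
      have "(V - {v}) \<inter> A = V \<inter> A" using v by auto
      then have "sep (hinv (int j) (V - {v})) (2 * C * (j + 1) ^ Suc h)" using Suc.prems by (intro Suc.IH) auto
      then have 2: "sep (hinv (int (Suc j) - 1) (V - {v})) (2 * C * Suc j ^ Suc h)" by simp
      have "sep (hinv (int (Suc j)) V) (2 * C * Suc j ^ Suc h + 2 * C * (Suc j + 1) ^ h)"
        by (rule sep_hole[OF Suc.prems(1) c v 1 2])
      then show ?thesis by (rule sep_mono[OF _ subset_refl le])
    qed
  qed
qed

end

section \<open>Spaces covered by contractible pieces\<close>

lemma sep_trivial_group:
  assumes "trivial_group (homology_group q X)" shows "sep (hfun q X) 0"
proof (rule sep_zero)
  fix l assume l: "l \<in> hfun q X"
  show "l = (\<lambda>x. 0)"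
  proof
    fix x show "l x = 0"
      using assms rhom_outside[OF l, of x] rhom_one[OF _ l] by (cases "x \<in> carrier (homology_group q X)") (auto simp: trivial_group_def)
  qed
qed

lemma sep_point:
  assumes X: "topspace X = {a}" shows "sep (hfun q X) 1"
proof (cases "q = 0")
  case False
  then show ?thesis by (intro sep_mono[OF sep_trivial_group[OF homology_dimension_axiom[OF X]]]) auto
next
  case True
  obtain f where f: "f \<in> iso integer_group (homology_group 0 X)"
    using group.iso_sym[OF group_relative_homology_group homology_coefficients[OF X]] by (auto simp: is_iso_def)
  show ?thesis unfolding sep_def
  proof (intro exI[of _ "{f 1}"] conjI ballI impI)
    fix l assume l: "l \<in> hfun q X" and l1: "\<forall>s\<in>{f 1}. l s = 0"
    have fh: "f \<in> hom integer_group (homology_group 0 X)" using f by (simp add: iso_def)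
    have m: "l (f (x + y)) = l (f x) + l (f y)" for x y
    proof -
      have "f (x + y) = f x \<otimes>\<^bsub>homology_group 0 X\<^esub> f y" "f x \<in> carrier (homology_group 0 X)" "f y \<in> carrier (homology_group 0 X)"
        using fh by (auto simp: hom_def)
      then show ?thesis using rhom_mult[OF l[unfolded True]] by simp
    qed
    have z: "l (f 0) = 0" using m[of 0 0] by simp
    have nn: "l (f (int n)) = 0" for n
    proof (induction n)
      case (Suc n) then show ?case using m[of 1 "int n"] l1 by simp
    qed (use z in simp)
    have "l (f k) = 0" for k
    proof (cases "0 \<le> k")
      case True then show ?thesis using nn[of "nat k"] by simp
    next
      case False
      then have "l (f (- k)) = 0" using nn[of "nat (- k)"] by simp
      then show ?thesis using m[of k "- k"] z by simp
    qed
    moreover have "carrier (homology_group 0 X) = range f" using f by (auto simp: iso_def bij_betw_def)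
    ultimately have "l x = 0" for x using rhom_outside[OF l, of x] unfolding True by (cases "x \<in> range f") auto
    then show "l = (\<lambda>x. 0)" by (rule ext)
  qed simp_all
qed

lemma sep_finite:
  assumes X: "Hausdorff_space X" and F: "finite F" "F \<subseteq> topspace X"
  shows "sep (hfun q (subtopology X F)) (card F)"
  using F
proof (induction F arbitrary: q rule: finite_induct)
  case empty
  show ?case by (rule sep_mono[OF sep_trivial_group[OF trivial_homology_group_empty]]) auto
next
  case (insert x F)
  let ?T = "subtopology X (insert x F)"
  have T: "topspace ?T = insert x F" using insert by auto
  have o: "openin ?T S" if "S \<subseteq> insert x F" for S
  proof -
    have "closedin ?T (topspace ?T - S)"
      using closedin_Hausdorff_finite[OF Hausdorff_space_subtopology[OF X]] insert T by (metis Diff_subset finite.insertI finite_Diff)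
    then show ?thesis using that unfolding T by (metis T double_diff openin_closedin_eq subset_refl openin_closedin)
  qed
  have "sep (hfun q ?T) (1 + (card F + 0))"
  proof (rule sep_Mayer_Vietoris[where A = "{x}" and B = F])
    have "subtopology ?T {x} = subtopology X {x}" "subtopology ?T F = subtopology X F"
      by (simp_all add: subtopology_subtopology Int_absorb1 subset_insertI)
    then show "sep (hfun q (subtopology ?T {x})) 1" "sep (hfun q (subtopology ?T F)) (card F)"
      using insert sep_point[of "subtopology X {x}" x q] by simp_all
    show "sep (hfun (q-1) (subtopology ?T ({x} \<inter> F))) 0"
      using insert(2) by (intro sep_trivial_group trivial_homology_group_empty) auto
  qed (use o T in auto)
  then show ?case using insert by simp
qed

text \<open>Iterated Mayer--Vietoris.\<close>

lemma sep_cover: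
  assumes U: "finite I" "\<And>i. i \<in> I \<Longrightarrow> openin X (U i)"
    and C: "\<And>J q. J \<subseteq> I \<Longrightarrow> J \<noteq> {} \<Longrightarrow> sep (hfun q (subtopology X (\<Inter>i\<in>J. U i))) C"
  shows "sep (hfun q (subtopology X (\<Union>i\<in>I. U i))) (C * 3 ^ card I)"
  using assms
proof (induction I arbitrary: U q rule: finite_induct)
  case empty
  show ?case by (rule sep_mono[OF sep_trivial_group[OF trivial_homology_group_empty]]) auto
next
  case (insert k I)
  let ?A = "U k" and ?B = "\<Union>i\<in>I. U i"
  let ?T = "subtopology X (?A \<union> ?B)"
  have oA: "openin X ?A" "openin X ?B" using insert by auto
  have TA: "subtopology ?T ?A = subtopology X ?A" "subtopology ?T ?B = subtopology X ?B"
    by (simp_all add: subtopology_subtopology Int_absorb1)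
  have T: "topspace ?T = ?A \<union> ?B" using openin_subset[OF oA(1)] openin_subset[OF oA(2)] by auto
  \<comment> \<open>The part inside \<open>U k\<close> is again a union of \<open>card I\<close>
    sets whose intersections belong to the given family, so one more set at most triples the
    bound.\<close>
  have "sep (hfun q ?T) (C * 3 ^ card I + (C * 3 ^ card I + C * 3 ^ card I))"
  proof (rule sep_Mayer_Vietoris[where A = "?A" and B = "?B"])
    have "openin X (?A \<union> ?B)" using oA by (rule openin_Un)
    then show "openin ?T ?A" "openin ?T ?B" using oA by (simp_all add: openin_open_subtopology)
    show "?A \<union> ?B = topspace ?T" using T by simp
    show "sep (hfun q (subtopology ?T ?A)) (C * 3 ^ card I)"
      unfolding TA by (rule sep_mono[OF insert.prems(2)[of "{k}", simplified]]) auto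
    show "sep (hfun q (subtopology ?T ?B)) (C * 3 ^ card I)"
      unfolding TA
    proof (rule insert.IH)
      show "sep (hfun q (subtopology X (\<Inter>i\<in>J. U i))) C" if "J \<subseteq> I" "J \<noteq> {}" for J q
        by (rule insert.prems(2)) (use that in auto)
    qed (use insert.prems in auto)
    have "subtopology ?T (?A \<inter> ?B) = subtopology X (\<Union>i\<in>I. U k \<inter> U i)"
      unfolding subtopology_subtopology by (rule arg_cong[where f = "subtopology X"]) auto
    moreover have "sep (hfun (q-1) (subtopology X (\<Union>i\<in>I. U k \<inter> U i))) (C * 3 ^ card I)"
    proof (rule insert.IH)
      fix J and q :: int assume J: "J \<subseteq> I" "J \<noteq> {}"
      have "(\<Inter>i\<in>J. U k \<inter> U i) = (\<Inter>i\<in>insert k J. U i)" using J by auto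
      moreover have "sep (hfun q (subtopology X (\<Inter>i\<in>insert k J. U i))) C" by (rule insert.prems(2)) (use J in auto)
      ultimately show "sep (hfun q (subtopology X (\<Inter>i\<in>J. U k \<inter> U i))) C" by simp
    qed (use insert.prems in auto)
    ultimately show "sep (hfun (q-1) (subtopology ?T (?A \<inter> ?B))) (C * 3 ^ card I)" by simp
  qed
  moreover have "C * 3 ^ card I + (C * 3 ^ card I + C * 3 ^ card I) = C * 3 ^ card (insert k I)" using insert(1,2) by simp
  ultimately show ?case by simp
qed


lemma convex_pos: "0 < x \<Longrightarrow> 0 < y \<Longrightarrow> 0 \<le> t \<Longrightarrow> t \<le> 1 \<Longrightarrow> 0 < (1 - t) * x + t * (y::real)"
  using convex_bound_lt[of "- x" 0 "- y" "1 - t" t] by simp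

lemma sep_retract:
  assumes r: "continuous_map X Y r" and s: "continuous_map Y X s"
    and sr: "push q X X (\<lambda>x. s (r x)) = push q X X (\<lambda>x. x)" and n: "sep (hfun q Y) n"
  shows "sep (hfun q X) n"
proof (rule sep_mono[OF sep_rpull[OF n, where g = "push q X Y r" and G = "homology_group q X"]])
  show "hfun q X \<subseteq> {rpull (homology_group q X) (push q X Y r) l |l. l \<in> hfun q Y}"
  proof
    fix l assume l: "l \<in> hfun q X"
    have "rpull (homology_group q Y) (push q Y X s) l \<in> hfun q Y" by (rule rpull_rhom[OF hom_push l]) simp
    moreover have "l = rpull (homology_group q X) (push q X Y r) (rpull (homology_group q Y) (push q Y X s) l)"
    proof
      fix x
      have "push q X X (\<lambda>x. x) x = x" if "x \<in> carrier (homology_group q X)" by (rule push_id[OF that]) auto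
      then show "l x = rpull (homology_group q X) (push q X Y r) (rpull (homology_group q Y) (push q Y X s) l) x"
        by (cases "x \<in> carrier (homology_group q X)") (simp_all add: rpull_def push_closed push_compose[OF r s] sr rhom_outside[OF l])
    qed
    ultimately show "l \<in> {rpull (homology_group q X) (push q X Y r) l |l. l \<in> hfun q Y}" by blast
  qed
qed simp

section \<open>Lifting through a free quotient\<close>

text \<open>That \<kappa> is a covering is not assumed: evenly covered pieces are produced from
  freeness, finiteness of the group and the Hausdorff property.\<close>

locale free_quotient =
  fixes G :: "('g, 'm) monoid_scheme" and X :: "'a topology" and \<phi> :: "'g \<Rightarrow> 'a \<Rightarrow> 'a"
    and \<kappa> :: "'a \<Rightarrow> complex" and P :: "complex set"
  assumes fin: "finite (carrier G)" and act: "free_topological_action G X \<phi>" and Hausdorff: "Hausdorff_space X"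
    and quotient: "quotient_map X (top_of_set (- P)) \<kappa>"
    and fibre: "\<And>x y. \<lbrakk>x \<in> topspace X; y \<in> topspace X\<rbrakk> \<Longrightarrow> \<kappa> x = \<kappa> y \<longleftrightarrow> (\<exists>g\<in>carrier G. y = \<phi> g x)"
begin

sublocale group_action G "topspace X" \<phi>
  using act by (simp add: free_topological_action_def)

sublocale group G
  using group_hom by (simp add: group_hom_def)

lemma cm_phi: "g \<in> carrier G \<Longrightarrow> continuous_map X X (\<phi> g)"
  using act by (simp add: free_topological_action_def)

lemma phi_in: "g \<in> carrier G \<Longrightarrow> x \<in> topspace X \<Longrightarrow> \<phi> g x \<in> topspace X"
  by (rule element_image) auto

lemma phi_one: "x \<in> topspace X \<Longrightarrow> \<phi> \<one>\<^bsub>G\<^esub> x = x"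
  using id_eq_one by (metis restrict_apply')

lemma phi_free: "g \<in> carrier G \<Longrightarrow> x \<in> topspace X \<Longrightarrow> \<phi> g x = x \<Longrightarrow> g = \<one>\<^bsub>G\<^esub>"
  using act unfolding free_topological_action_def stabilizer_def by blast

lemma phi_inv: "g \<in> carrier G \<Longrightarrow> x \<in> topspace X \<Longrightarrow> \<phi> (inv\<^bsub>G\<^esub> g) (\<phi> g x) = x"
  by (rule orbit_sym_aux) auto

lemma phi_inv': "g \<in> carrier G \<Longrightarrow> x \<in> topspace X \<Longrightarrow> \<phi> g (\<phi> (inv\<^bsub>G\<^esub> g) x) = x"
  using phi_inv[of "inv\<^bsub>G\<^esub> g" x] by simp

lemma kappa_phi: "g \<in> carrier G \<Longrightarrow> x \<in> topspace X \<Longrightarrow> \<kappa> (\<phi> g x) = \<kappa> x"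
  using fibre[of x "\<phi> g x"] phi_in by metis

lemma cm_kappa: "continuous_map X euclidean \<kappa>"
  using quotient_imp_continuous_map[OF quotient] by (rule continuous_map_into_fulltopology)

lemma kappa_image: "\<kappa> ` topspace X = - P"
  using quotient_imp_surjective_map[OF quotient] by simp

lemma openin_phi_image:
  assumes "g \<in> carrier G" "openin X U" shows "openin X (\<phi> g ` U)"
proof -
  have "U \<subseteq> topspace X" using assms(2) by (rule openin_subset)
  then have "\<phi> g ` U = {x \<in> topspace X. \<phi> (inv\<^bsub>G\<^esub> g) x \<in> U}"
    using assms(1) phi_inv[OF assms(1)] phi_inv'[OF assms(1)] phi_in by (auto simp: image_iff subset_iff) metis
  then show ?thesis using openin_continuous_map_preimage[OF cm_phi[of "inv\<^bsub>G\<^esub> g"] assms(2)] assms(1) by simp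
qed

text \<open>The saturation of an open set is the union of its translates, hence open.\<close>

lemma open_kappa_image:
  assumes "openin X U" shows "openin (top_of_set (- P)) (\<kappa> ` U)"
proof -
  have U: "U \<subseteq> topspace X" using assms by (rule openin_subset)
  have "{x \<in> topspace X. \<kappa> x \<in> \<kappa> ` U} = (\<Union>g\<in>carrier G. \<phi> g ` U)"
  proof
    show "{x \<in> topspace X. \<kappa> x \<in> \<kappa> ` U} \<subseteq> (\<Union>g\<in>carrier G. \<phi> g ` U)"
    proof
      fix x assume "x \<in> {x \<in> topspace X. \<kappa> x \<in> \<kappa> ` U}"
      then obtain u where u: "u \<in> U" "\<kappa> u = \<kappa> x" "x \<in> topspace X" by auto
      then show "x \<in> (\<Union>g\<in>carrier G. \<phi> g ` U)" using fibre[of u x] U by auto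
    qed
    show "(\<Union>g\<in>carrier G. \<phi> g ` U) \<subseteq> {x \<in> topspace X. \<kappa> x \<in> \<kappa> ` U}"
      using U phi_in kappa_phi by (auto simp: subset_iff)
  qed
  moreover have "openin X (\<Union>g\<in>carrier G. \<phi> g ` U)" using openin_phi_image[OF _ assms] by blast
  ultimately have "openin X {x \<in> topspace X. \<kappa> x \<in> \<kappa> ` U}" by simp
  moreover have "\<kappa> ` U \<subseteq> topspace (top_of_set (- P))" using U kappa_image by auto
  ultimately show ?thesis using quotient unfolding quotient_map_def by blast
qed

lemma kappa_notin: "x \<in> topspace X \<Longrightarrow> \<kappa> x \<notin> P"
  using kappa_image by blast

section \<open>Sheets, local sections and lifts of homotopies\<close>

definition sheet :: "'a set \<Rightarrow> bool" where
  "sheet U \<longleftrightarrow> openin X U \<and> inj_on \<kappa> U"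

text \<open>The finitely many other translates of \<open>x\<close> can be separated from
  \<open>x\<close>; a neighbourhood disjoint from its nontrivial translates contains at most one
  point of each orbit.\<close>

lemma sheet_exists:
  assumes x: "x \<in> topspace X" obtains U where "sheet U" "x \<in> U"
proof -
  have "\<forall>g\<in>carrier G - {\<one>\<^bsub>G\<^esub>}. \<exists>A B. openin X A \<and> openin X B \<and> x \<in> A \<and> \<phi> g x \<in> B \<and> disjnt A B"
  proof
    fix g assume g: "g \<in> carrier G - {\<one>\<^bsub>G\<^esub>}"
    then have "x \<noteq> \<phi> g x" using phi_free[of g x] x by auto
    then show "\<exists>A B. openin X A \<and> openin X B \<and> x \<in> A \<and> \<phi> g x \<in> B \<and> disjnt A B"
      using Hausdorff x phi_in[of g x] g unfolding Hausdorff_space_def by blast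
  qed
  then obtain A B where AB: "\<And>g. g \<in> carrier G - {\<one>\<^bsub>G\<^esub>} \<Longrightarrow> openin X (A g) \<and> openin X (B g) \<and> x \<in> A g \<and> \<phi> g x \<in> B g \<and> disjnt (A g) (B g)"
    by metis
  define U where "U = topspace X \<inter> (\<Inter>g\<in>carrier G - {\<one>\<^bsub>G\<^esub>}. A g \<inter> {z \<in> topspace X. \<phi> g z \<in> B g})"
  have "openin X (A g \<inter> {z \<in> topspace X. \<phi> g z \<in> B g})" if "g \<in> carrier G - {\<one>\<^bsub>G\<^esub>}" for g
    using AB[OF that] openin_continuous_map_preimage[OF cm_phi] that by (intro openin_Int) auto
  then have "openin X U" unfolding U_def by (intro openin_Int_Inter) (use fin in auto)
  moreover have "x \<in> U" using x AB by (auto simp: U_def)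
  moreover have "inj_on \<kappa> U"
  proof (rule inj_onI)
    fix y z assume yz: "y \<in> U" "z \<in> U" "\<kappa> y = \<kappa> z"
    then have t: "y \<in> topspace X" "z \<in> topspace X" by (auto simp: U_def)
    then obtain g where g: "g \<in> carrier G" "z = \<phi> g y" using fibre[of y z] yz(3) by blast
    show "y = z"
    proof (cases "g = \<one>\<^bsub>G\<^esub>")
      case True then show ?thesis using g phi_one t by simp
    next
      case False
      then have "\<phi> g y \<in> B g" "z \<in> A g" using yz g by (auto simp: U_def)
      then show ?thesis using AB[of g] g False unfolding disjnt_def by blast
    qed
  qed
  ultimately show thesis using that[of U] unfolding sheet_def by blast
qed

lemma sheet_phi:
  assumes g: "g \<in> carrier G" and U: "sheet U" shows "sheet (\<phi> g ` U)" "\<kappa> ` \<phi> g ` U = \<kappa> ` U"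
proof -
  have UX: "U \<subseteq> topspace X" using U openin_subset unfolding sheet_def by blast
  have k: "\<kappa> (\<phi> g u) = \<kappa> u" if "u \<in> U" for u using kappa_phi[OF g] UX that by blast
  have "inj_on \<kappa> (\<phi> g ` U)"
  proof (rule inj_onI)
    fix y z assume yz: "y \<in> \<phi> g ` U" "z \<in> \<phi> g ` U" "\<kappa> y = \<kappa> z"
    then obtain u w where "u \<in> U" "w \<in> U" "y = \<phi> g u" "z = \<phi> g w" by blast
    moreover from this have "u = w" using yz(3) k U unfolding sheet_def inj_on_def by simp
    ultimately show "y = z" by simp
  qed
  then show "sheet (\<phi> g ` U)" using U openin_phi_image[OF g] unfolding sheet_def by blast
  show "\<kappa> ` \<phi> g ` U = \<kappa> ` U" using k by (auto simp: image_iff)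
qed

text \<open>The quotient map is open, so its inverse on a sheet is continuous.\<close>

lemma sheet_lift:
  assumes U: "sheet U" and F: "continuous_map Z euclidean F" "\<And>z. z \<in> topspace Z \<Longrightarrow> F z \<in> \<kappa> ` U"
  shows "continuous_map Z X (\<lambda>z. inv_into U \<kappa> (F z))"
proof -
  have UX: "openin X U" "U \<subseteq> topspace X" "inj_on \<kappa> U" using U openin_subset unfolding sheet_def by blast+
  have FP: "continuous_map Z (top_of_set (- P)) F"
    using F UX(2) kappa_image by (auto simp: continuous_map_in_subtopology)
  have "openin Z {z \<in> topspace Z. inv_into U \<kappa> (F z) \<in> W}" if W: "openin X W" for W
  proof -
    have "{z \<in> topspace Z. inv_into U \<kappa> (F z) \<in> W} = {z \<in> topspace Z. F z \<in> \<kappa> ` (U \<inter> W)}"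
    proof (rule Collect_cong, rule conj_cong[OF refl])
      fix z assume z: "z \<in> topspace Z"
      obtain u where u: "u \<in> U" "F z = \<kappa> u" using F(2)[OF z] by blast
      then have "inv_into U \<kappa> (F z) = u" using UX(3) by simp
      then show "inv_into U \<kappa> (F z) \<in> W \<longleftrightarrow> F z \<in> \<kappa> ` (U \<inter> W)"
        using u UX(3) by (auto simp: inj_on_def)
    qed
    moreover have "openin Z {z \<in> topspace Z. F z \<in> \<kappa> ` (U \<inter> W)}"
      by (rule openin_continuous_map_preimage[OF FP open_kappa_image]) (use UX W in auto)
    ultimately show ?thesis by simp
  qed
  moreover have "inv_into U \<kappa> (F z) \<in> topspace X" if "z \<in> topspace Z" for z
    using inv_into_into[OF F(2)[OF that]] UX(2) by blast
  ultimately show ?thesis unfolding continuous_map by blast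
qed

text \<open>The set of agreement is closed by the Hausdorff property, and open because near a common
  value both maps lie in one sheet.\<close>

lemma unique_lift:
  assumes Z: "connected_space Z" and f: "continuous_map Z X f" and g: "continuous_map Z X g"
    and fg: "\<And>z. z \<in> topspace Z \<Longrightarrow> \<kappa> (f z) = \<kappa> (g z)" and z: "z0 \<in> topspace Z" "f z0 = g z0" "z \<in> topspace Z"
  shows "f z = g z"
proof -
  let ?E = "{z \<in> topspace Z. f z = g z}"
  have "closedin Z ?E" by (rule closedin_continuous_maps_eq[OF Hausdorff f g])
  moreover have "openin Z ?E"
    unfolding openin_subopen[of Z ?E]
  proof
    fix z assume z: "z \<in> ?E"
    then have "f z \<in> topspace X" using continuous_map_image_subset_topspace[OF f] by blast
    then obtain U where U: "sheet U" "f z \<in> U" using sheet_exists by blast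
    then have UX: "openin X U" "inj_on \<kappa> U" by (auto simp: sheet_def)
    let ?T = "{z \<in> topspace Z. f z \<in> U} \<inter> {z \<in> topspace Z. g z \<in> U}"
    have "openin Z ?T" using openin_continuous_map_preimage[OF f UX(1)] openin_continuous_map_preimage[OF g UX(1)] by blast
    moreover have "z \<in> ?T" using z U by auto
    moreover have "?T \<subseteq> ?E" using fg UX(2) unfolding inj_on_def by blast
    ultimately show "\<exists>T. openin Z T \<and> z \<in> T \<and> T \<subseteq> ?E" by blast
  qed
  ultimately have "?E = {} \<or> ?E = topspace Z" using Z unfolding connected_space_clopen_in by blast
  then show ?thesis using z by blast
qed

text \<open>The group element is chosen at one point; by uniqueness of lifts it works
  everywhere.\<close>

lemma lifts_differ:
  assumes Z: "connected_space Z" "topspace Z \<noteq> {}" and f: "continuous_map Z X f" and g: "continuous_map Z X g"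
    and fg: "\<And>z. z \<in> topspace Z \<Longrightarrow> \<kappa> (f z) = \<kappa> (g z)"
  obtains \<gamma> where "\<gamma> \<in> carrier G" "\<And>z. z \<in> topspace Z \<Longrightarrow> g z = \<phi> \<gamma> (f z)"
proof -
  obtain z0 where z0: "z0 \<in> topspace Z" using Z(2) by blast
  have X: "f z \<in> topspace X" "g z \<in> topspace X" if "z \<in> topspace Z" for z using f g that by (auto simp: continuous_map_def)
  obtain \<gamma> where g0: "\<gamma> \<in> carrier G" "g z0 = \<phi> \<gamma> (f z0)" using fibre[OF X[OF z0]] fg[OF z0] by blast
  have "g z = \<phi> \<gamma> (f z)" if z: "z \<in> topspace Z" for z
  proof (rule unique_lift[where f = g and g = "\<lambda>z. \<phi> \<gamma> (f z)", OF Z(1) g _ _ z0 g0(2) z])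
    show "continuous_map Z X (\<lambda>z. \<phi> \<gamma> (f z))" using continuous_map_compose[OF f cm_phi[OF g0(1)]] by (simp add: comp_def)
    show "\<kappa> (g z) = \<kappa> (\<phi> \<gamma> (f z))" if "z \<in> topspace Z" for z using fg[OF that] kappa_phi[OF g0(1) X(1)[OF that]] by simp
  qed
  with g0(1) show thesis by (rule that)
qed


text \<open>Bisection of the parameter interval: short intervals lift into one sheet, and joining
  two intervals only shrinks the neighbourhood of \<open>v0\<close>.\<close>

lemma lift_strip:
  fixes F :: "real \<times> 'v \<Rightarrow> complex"
  defines "T V \<equiv> prod_topology euclideanreal V"
  assumes F: "continuous_map (T V) (top_of_set (- P)) F" and v0: "v0 \<in> topspace V" and st: "s \<le> t"
    and f: "openin V N" "v0 \<in> N" "continuous_map (subtopology V N) X f" "\<And>v. v \<in> N \<Longrightarrow> \<kappa> (f v) = F (s,v)"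
  obtains N' h where "openin V N'" "v0 \<in> N'" "N' \<subseteq> N" "continuous_map (subtopology (T V) ({s..t} \<times> N')) X h"
    "\<And>r v. r \<in> {s..t} \<Longrightarrow> v \<in> N' \<Longrightarrow> \<kappa> (h (r,v)) = F (r,v)" "\<And>v. v \<in> N' \<Longrightarrow> h (s,v) = f v"
proof -
  \<comment> \<open>Quantifying over all initial lifts and all neighbourhoods is what lets
    consecutive intervals be joined.\<close>
  define Q where "Q s t \<longleftrightarrow> (\<forall>N f. openin V N \<longrightarrow> v0 \<in> N \<longrightarrow> continuous_map (subtopology V N) X f \<longrightarrow> (\<forall>v\<in>N. \<kappa> (f v) = F (s,v)) \<longrightarrow>
    (\<exists>N' h. openin V N' \<and> v0 \<in> N' \<and> N' \<subseteq> N \<and> continuous_map (subtopology (T V) ({s..t} \<times> N')) X h \<and>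
      (\<forall>r\<in>{s..t}. \<forall>v\<in>N'. \<kappa> (h (r,v)) = F (r,v)) \<and> (\<forall>v\<in>N'. h (s,v) = f v)))" for s t
  have cm_slice: "continuous_map (subtopology V N) (subtopology (T V) ({a..b} \<times> N)) (\<lambda>v. (r,v))" if "r \<in> {a..b}" for N a b r
    unfolding T_def using that by (auto simp: continuous_map_in_subtopology continuous_map_pairwise comp_def intro: continuous_map_from_subtopology)
  have "Q s t" using st
  proof (induction rule: Bolzano)
    case (trans a b c)
    show "Q a c" unfolding Q_def
    proof (intro allI impI)
      fix N f assume f: "openin V N" "v0 \<in> N" "continuous_map (subtopology V N) X f" "\<forall>v\<in>N. \<kappa> (f v) = F (a,v)"
      obtain N1 h where h: "openin V N1" "v0 \<in> N1" "N1 \<subseteq> N" "continuous_map (subtopology (T V) ({a..b} \<times> N1)) X h"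
        "\<forall>r\<in>{a..b}. \<forall>v\<in>N1. \<kappa> (h (r,v)) = F (r,v)" "\<forall>v\<in>N1. h (a,v) = f v"
        using trans(1)[unfolded Q_def, THEN spec, THEN spec, THEN mp, OF f(1), THEN mp, OF f(2), THEN mp, OF f(3), THEN mp, OF f(4)]
        by (elim exE conjE) (rule that)
      have hb: "continuous_map (subtopology V N1) X (\<lambda>v. h (b,v))"
        using continuous_map_compose[OF cm_slice h(4), of b] trans(3) by (simp add: comp_def)
      have hF: "\<forall>v\<in>N1. \<kappa> (h (b,v)) = F (b,v)" using h(5) trans(3) by simp
      obtain N2 k where k: "openin V N2" "v0 \<in> N2" "N2 \<subseteq> N1" "continuous_map (subtopology (T V) ({b..c} \<times> N2)) X k"
        "\<forall>r\<in>{b..c}. \<forall>v\<in>N2. \<kappa> (k (r,v)) = F (r,v)" "\<forall>v\<in>N2. k (b,v) = h (b,v)"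
        using trans(2)[unfolded Q_def, THEN spec, THEN spec, THEN mp, OF h(1), THEN mp, OF h(2), THEN mp, OF hb, THEN mp, OF hF]
        by (elim exE conjE) (rule that)
      let ?Z = "subtopology (T V) ({a..c} \<times> N2)"
      let ?h = "\<lambda>x. if fst x \<le> b then h x else k x"
      have "continuous_map ?Z X ?h"
      proof (rule continuous_map_cases_le)
        show "continuous_map ?Z euclideanreal fst"
          unfolding T_def by (intro continuous_map_from_subtopology continuous_map_fst)
        show "continuous_map (subtopology ?Z {x \<in> topspace ?Z. fst x \<le> b}) X h"
          unfolding subtopology_subtopology by (rule continuous_map_from_subtopology_mono[OF h(4)]) (use k(3) in auto)
        show "continuous_map (subtopology ?Z {x \<in> topspace ?Z. b \<le> fst x}) X k"
          unfolding subtopology_subtopology by (rule continuous_map_from_subtopology_mono[OF k(4)]) auto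
        show "h x = k x" if "x \<in> topspace ?Z" "fst x = b" for x using that k(6) by (cases x) auto
      qed simp
      moreover have "\<kappa> (?h (r,v)) = F (r,v)" if "r \<in> {a..c}" "v \<in> N2" for r v
        using that h(5) k(3,5) by (cases "r \<le> b") auto
      moreover have "?h (a,v) = f v" if "v \<in> N2" for v using that h(6) k(3) trans(3) by auto
      ultimately show "\<exists>N' h. openin V N' \<and> v0 \<in> N' \<and> N' \<subseteq> N \<and> continuous_map (subtopology (T V) ({a..c} \<times> N')) X h \<and>
        (\<forall>r\<in>{a..c}. \<forall>v\<in>N'. \<kappa> (h (r,v)) = F (r,v)) \<and> (\<forall>v\<in>N'. h (a,v) = f v)"
        using k(1-3) h(3) by (intro exI[of _ N2] exI[of _ ?h]) blast
    qed
  next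
    case (local x)
    have "F (x,v0) \<in> - P" using F v0 unfolding T_def continuous_map_def by auto
    then obtain x0 where x0: "x0 \<in> topspace X" "\<kappa> x0 = F (x,v0)" using kappa_image by (metis imageE)
    obtain U where U: "sheet U" "x0 \<in> U" using sheet_exists[OF x0(1)] .
    have UX: "openin X U" "U \<subseteq> topspace X" using U openin_subset unfolding sheet_def by blast+
    have oU: "openin (T V) {z \<in> topspace (T V). F z \<in> \<kappa> ` U}"
      by (rule openin_continuous_map_preimage[OF F open_kappa_image[OF UX(1)]])
    have xU: "(x,v0) \<in> {z \<in> topspace (T V). F z \<in> \<kappa> ` U}" using v0 x0 U unfolding T_def by (simp flip: x0(2))
    obtain I N1 where IN: "openin euclideanreal I" "openin V N1" "x \<in> I" "v0 \<in> N1" "I \<times> N1 \<subseteq> {z \<in> topspace (T V). F z \<in> \<kappa> ` U}"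
      using oU[unfolded T_def openin_prod_topology_alt, THEN spec, THEN spec, THEN mp, OF xU[unfolded T_def]]
      by (elim exE conjE) (rule that, (assumption | (unfold T_def, assumption))+)
    obtain d where d: "d > 0" "ball x d \<subseteq> I" using IN(1,3) open_contains_ball[of I] by auto
    have "Q a b" if ab: "a \<le> x" "x \<le> b" "b - a < d" for a b
      unfolding Q_def
    proof (intro allI impI)
      fix N f assume f: "openin V N" "v0 \<in> N" "continuous_map (subtopology V N) X f" "\<forall>v\<in>N. \<kappa> (f v) = F (a,v)"
      have abI: "{a..b} \<subseteq> I" using ab d by (auto simp: dist_real_def subset_iff ball_def)
      have NV: "N \<subseteq> topspace V" using f(1) by (rule openin_subset)
      have fX: "f v \<in> topspace X" if "v \<in> N" for v
        using continuous_map_image_subset_topspace[OF f(3)] that NV by auto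
      have "F (a,v0) \<in> \<kappa> ` U" using IN(4,5) abI ab(1,2) by (auto simp: subset_iff)
      then obtain u where u: "u \<in> U" "\<kappa> u = \<kappa> (f v0)" using f(2,4) by auto
      then obtain g where g: "g \<in> carrier G" "f v0 = \<phi> g u" using fibre[of u "f v0"] UX fX[OF f(2)] by blast
      \<comment> \<open>The sheet is translated so that it contains the initial value; its image in
        the plane stays the same.\<close>
      define U' where "U' = \<phi> g ` U"
      have U': "sheet U'" "\<kappa> ` U' = \<kappa> ` U" unfolding U'_def by (rule sheet_phi[OF g(1) U(1)])+
      define N' where "N' = N1 \<inter> {v \<in> topspace (subtopology V N). f v \<in> U'}"
      have "openin (subtopology V N) {v \<in> topspace (subtopology V N). f v \<in> U'}"
        using openin_continuous_map_preimage[OF f(3)] U'(1) unfolding sheet_def by blast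
      then have "openin V {v \<in> topspace (subtopology V N). f v \<in> U'}" using f(1) by (metis openin_trans_full)
      then have N': "openin V N'" "v0 \<in> N'" "N' \<subseteq> N" "N' \<subseteq> N1"
        unfolding N'_def using IN(2,4) f(2) v0 g u unfolding U'_def by auto
      have FU: "F (r,v) \<in> \<kappa> ` U'" if "r \<in> {a..b}" "v \<in> N'" for r v
        unfolding U'(2) using IN(5) abI that N'(4) by (auto simp: subset_iff)
      let ?h = "\<lambda>z. inv_into U' \<kappa> (F z)"
      have "continuous_map (subtopology (T V) ({a..b} \<times> N')) X ?h"
        by (rule sheet_lift[OF U'(1)]) (use F FU in \<open>auto intro: continuous_map_from_subtopology simp: continuous_map_in_subtopology\<close>)
      moreover have "\<kappa> (?h (r,v)) = F (r,v)" if "r \<in> {a..b}" "v \<in> N'" for r v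
        by (rule f_inv_into_f[OF FU[OF that]])
      moreover have "?h (a,v) = f v" if v: "v \<in> N'" for v
      proof (rule inv_into_f_eq)
        show "inj_on \<kappa> U'" using U'(1) by (simp add: sheet_def)
        show "f v \<in> U'" using v by (simp add: N'_def)
        show "\<kappa> (f v) = F (a,v)" using v f(4) N'(3) by blast
      qed
      ultimately show "\<exists>N' h. openin V N' \<and> v0 \<in> N' \<and> N' \<subseteq> N \<and> continuous_map (subtopology (T V) ({a..b} \<times> N')) X h \<and>
        (\<forall>r\<in>{a..b}. \<forall>v\<in>N'. \<kappa> (h (r,v)) = F (r,v)) \<and> (\<forall>v\<in>N'. h (a,v) = f v)"
        using N' by (intro exI[of _ N'] exI[of _ ?h]) blast
    qed
    then show ?case using d(1) by blast
  qed
  then have "\<exists>N' h. openin V N' \<and> v0 \<in> N' \<and> N' \<subseteq> N \<and> continuous_map (subtopology (T V) ({s..t} \<times> N')) X h \<and>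
      (\<forall>r\<in>{s..t}. \<forall>v\<in>N'. \<kappa> (h (r,v)) = F (r,v)) \<and> (\<forall>v\<in>N'. h (s,v) = f v)"
    using f unfolding Q_def by simp
  then show thesis using that by blast
qed

text \<open>Over a fixed point of \<open>V\<close>, two lifts of a path with the same start
  coincide, so the strips around the points of \<open>V\<close> agree on overlaps and can be pasted.
  Clamping the parameter extends \<open>F\<close> to the whole line, where the strips were
  constructed.\<close>

lemma homotopy_lift:
  fixes F :: "real \<times> 'v \<Rightarrow> complex"
  assumes F: "continuous_map (IX V) (top_of_set (- P)) F" and f: "continuous_map V X f" "\<And>v. v \<in> topspace V \<Longrightarrow> \<kappa> (f v) = F (0,v)"
  obtains h where "continuous_map (IX V) X h" "\<And>x. x \<in> topspace (IX V) \<Longrightarrow> \<kappa> (h x) = F x" "\<And>v. v \<in> topspace V \<Longrightarrow> h (0,v) = f v"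
proof -
  let ?T = "prod_topology euclideanreal V"
  let ?F = "\<lambda>(r,v). F (max 0 (min 1 r), v)"
  have FT: "continuous_map ?T (top_of_set (- P)) ?F"
  proof -
    have "continuous_map euclideanreal (top_of_set {0..1}) (\<lambda>r. max 0 (min 1 r) :: real)"
      by (auto simp: continuous_map_top_of_set intro!: continuous_intros)
    then have "continuous_map ?T (IX V) (\<lambda>x. (max 0 (min 1 (fst x)), snd x))"
      using continuous_map_compose[OF continuous_map_fst[of euclideanreal V]]
      by (auto simp: continuous_map_pairwise comp_def intro: continuous_map_snd)
    then show ?thesis using continuous_map_compose[OF _ F] by (simp add: comp_def case_prod_unfold)
  qed
  have "\<forall>v0\<in>topspace V. \<exists>N h. openin V N \<and> v0 \<in> N \<and> continuous_map (subtopology ?T ({0..1} \<times> N)) X h \<and>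
     (\<forall>r\<in>{0..1}. \<forall>v\<in>N. \<kappa> (h (r,v)) = ?F (r,v)) \<and> (\<forall>v\<in>N. h (0,v) = f v)"
  proof
    fix v0 assume v0: "v0 \<in> topspace V"
    have "continuous_map (subtopology V (topspace V)) X f" "\<And>v. v \<in> topspace V \<Longrightarrow> \<kappa> (f v) = ?F (0,v)" using f by auto
    from lift_strip[OF FT v0 zero_le_one openin_topspace v0 this]
    show "\<exists>N h. openin V N \<and> v0 \<in> N \<and> continuous_map (subtopology ?T ({0..1} \<times> N)) X h \<and>
     (\<forall>r\<in>{0..1}. \<forall>v\<in>N. \<kappa> (h (r,v)) = ?F (r,v)) \<and> (\<forall>v\<in>N. h (0,v) = f v)" by metis
  qed
  then obtain N h where Nh: "\<And>v0. v0 \<in> topspace V \<Longrightarrow> openin V (N v0) \<and> v0 \<in> N v0 \<and> continuous_map (subtopology ?T ({0..1} \<times> N v0)) X (h v0) \<and>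
     (\<forall>r\<in>{0..1}. \<forall>v\<in>N v0. \<kappa> (h v0 (r,v)) = ?F (r,v)) \<and> (\<forall>v\<in>N v0. h v0 (0,v) = f v)"
    by metis
  have IXT: "IX V = subtopology ?T ({0..1} \<times> topspace V)" by (simp add: prod_topology_subtopology)
  have agree: "h u (r,v) = h w (r,v)" if uw: "u \<in> topspace V" "w \<in> topspace V" "v \<in> N u" "v \<in> N w" "r \<in> {0..1}" for u w v r
  proof -
    have c: "continuous_map (top_of_set {0..1}) X (\<lambda>r. h x (r,v))" if x: "x \<in> topspace V" "v \<in> N x" for x
    proof -
      have vV: "v \<in> topspace V" using Nh[OF x(1)] x(2) openin_subset by blast
      have "continuous_map (top_of_set {0..1}) (subtopology ?T ({0..1} \<times> N x)) (\<lambda>r. (r,v))"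
        using x vV by (auto simp: continuous_map_in_subtopology continuous_map_pairwise comp_def)
      moreover have "continuous_map (subtopology ?T ({0..1} \<times> N x)) X (h x)" using Nh[OF x(1)] by blast
      ultimately show ?thesis using continuous_map_compose by (fastforce simp: comp_def)
    qed
    show ?thesis
    proof (rule unique_lift[where f = "\<lambda>r. h u (r,v)" and g = "\<lambda>r. h w (r,v)" and ?z0.0 = 0, OF _ c[OF uw(1,3)] c[OF uw(2,4)]])
      show "connected_space (top_of_set {0..1::real})" by (simp add: connected_space_subtopology is_interval_def)
      show "\<kappa> (h u (z,v)) = \<kappa> (h w (z,v))" if "z \<in> topspace (top_of_set {0..1})" for z
        using Nh[OF uw(1)] Nh[OF uw(2)] uw(3,4) that by simp
      show "h u (0,v) = h w (0,v)" using Nh[OF uw(1)] Nh[OF uw(2)] uw(3,4) by simp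
    qed (use uw in auto)
  qed
  let ?h = "\<lambda>x. h (snd x) x"
  have NV: "N v \<subseteq> topspace V" if "v \<in> topspace V" for v using Nh[OF that] openin_subset by blast
  have "continuous_map (IX V) X ?h"
  proof (rule pasting_lemma[where I = "topspace V" and T = "\<lambda>v. {0..1} \<times> N v" and f = h])
    fix i assume i: "i \<in> topspace V"
    have "topspace (top_of_set {0..1::real}) = {0..1}" by simp
    then have "openin (top_of_set {0..1::real}) {0..1}" by (metis openin_topspace)
    then show "openin (IX V) ({0..1} \<times> N i)" using Nh[OF i] by (simp add: openin_prod_Times_iff)
    show "continuous_map (subtopology (IX V) ({0..1} \<times> N i)) X (h i)"
      unfolding IXT subtopology_subtopology
      by (rule continuous_map_from_subtopology_mono[of ?T "{0..1} \<times> N i"]) (use Nh[OF i] in auto)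
  next
    fix i j x assume ij: "i \<in> topspace V" "j \<in> topspace V" "x \<in> topspace (IX V) \<inter> ({0..1} \<times> N i) \<inter> ({0..1} \<times> N j)"
    then show "h i x = h j x" using agree[OF ij(1,2), of "snd x" "fst x"] by (auto simp: mem_Times_iff)
  next
    fix x assume "x \<in> topspace (IX V)"
    then show "\<exists>j. j \<in> topspace V \<and> x \<in> {0..1} \<times> N j \<and> h (snd x) x = h j x"
      using Nh[of "snd x"] by (intro exI[of _ "snd x"]) (auto simp: mem_Times_iff)
  qed
  moreover have "\<kappa> (?h x) = F x" if x: "x \<in> topspace (IX V)" for x
  proof -
    obtain r v where rv: "x = (r,v)" "r \<in> {0..1}" "v \<in> topspace V" using x by (cases x) auto
    then have "\<kappa> (h v (r,v)) = ?F (r,v)" using Nh[OF rv(3)] by blast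
    then show ?thesis using rv by simp
  qed
  moreover have "?h (0,v) = f v" if "v \<in> topspace V" for v using Nh[OF that] by simp
  ultimately show thesis by (rule that)
qed


section \<open>Orbit configurations and the homology of the base\<close>

abbreviation Conf :: "nat \<Rightarrow> (nat \<Rightarrow> 'a) topology" where
  "Conf n \<equiv> orbit_conf G X \<phi> n"

text \<open>Points lie in different orbits exactly if their images under \<kappa> differ, which
  turns the orbit condition into injectivity.\<close>

lemma topspace_Conf: "topspace (Conf n) = {x \<in> {1..n} \<rightarrow>\<^sub>E topspace X. inj_on (\<lambda>i. \<kappa> (x i)) {1..n}}"
proof -
  have "(\<forall>i\<in>{1..n}. \<forall>j\<in>{1..n}. i \<noteq> j \<longrightarrow> (\<forall>g\<in>carrier G. x i \<noteq> \<phi> g (x j))) \<longleftrightarrow> inj_on (\<lambda>i. \<kappa> (x i)) {1..n}"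
    if x: "x \<in> {1..n} \<rightarrow>\<^sub>E topspace X" for x
  proof -
    have "(\<forall>g\<in>carrier G. x i \<noteq> \<phi> g (x j)) \<longleftrightarrow> \<kappa> (x i) \<noteq> \<kappa> (x j)" if "i \<in> {1..n}" "j \<in> {1..n}" for i j
    proof -
      have "x j \<in> topspace X" "x i \<in> topspace X" using x that by (auto simp: PiE_iff)
      then show ?thesis unfolding eq_commute[of "\<kappa> (x i)"] using fibre[of "x j" "x i"] by blast
    qed
    then show ?thesis unfolding inj_on_def by blast
  qed
  then show ?thesis unfolding orbit_conf_def by auto
qed

lemma continuous_map_Conf:
  "continuous_map Z (Conf n) f \<longleftrightarrow> f \<in> topspace Z \<rightarrow> topspace (Conf n) \<and> (\<forall>i\<in>{1..n}. continuous_map Z X (\<lambda>z. f z i))"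
proof -
  have "continuous_map Z (subtopology Y S) f \<longleftrightarrow> continuous_map Z Y f \<and> f \<in> topspace Z \<rightarrow> topspace (subtopology Y S)" for Y S
    using continuous_map_funspace[of Z Y f] by (auto simp: continuous_map_in_subtopology)
  then have "continuous_map Z (Conf n) f \<longleftrightarrow> continuous_map Z (product_topology (\<lambda>_. X) {1..n}) f \<and> f \<in> topspace Z \<rightarrow> topspace (Conf n)"
    unfolding orbit_conf_def .
  then show ?thesis
    unfolding continuous_map_componentwise by (auto simp: topspace_Conf PiE_def)
qed

lemma cm_Conf_coord: "continuous_map Z (Conf n) f \<Longrightarrow> i \<in> {1..n} \<Longrightarrow> continuous_map Z X (\<lambda>z. f z i)"
  unfolding continuous_map_Conf by blast

lemma Hausdorff_Conf: "Hausdorff_space (Conf n)"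
  unfolding orbit_conf_def by (intro Hausdorff_space_subtopology) (simp add: Hausdorff_space_product_topology Hausdorff)

text \<open>The straight-line contraction of \<open>K\<close> lifts to a retraction of the piece onto a finite fibre.\<close>

lemma sep_convex_piece:
  assumes convex: "\<And>z z' t. \<lbrakk>z \<in> K; z' \<in> K; 0 \<le> t; t \<le> 1\<rbrakk> \<Longrightarrow> (\<lambda>i. (1 - of_real t) * z i + of_real t * z' i) \<in> K"
    and conf: "\<And>z. z \<in> K \<Longrightarrow> inj_on z {1..a}" "\<And>z i. z \<in> K \<Longrightarrow> i \<in> {1..a} \<Longrightarrow> z i \<notin> P"
  shows "sep (hfun q (subtopology (Conf a) {x. (\<lambda>i. \<kappa> (x i)) \<in> K})) (card (carrier G) ^ a)"
proof -
  define E where "E = subtopology (Conf a) {x. (\<lambda>i. \<kappa> (x i)) \<in> K}"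
  have tE: "topspace E = {x \<in> {1..a} \<rightarrow>\<^sub>E topspace X. (\<lambda>i. \<kappa> (x i)) \<in> K}"
    unfolding E_def using conf(1) by (auto simp: topspace_Conf)
  have cE: "continuous_map Z E f \<longleftrightarrow> f \<in> topspace Z \<rightarrow> topspace E \<and> (\<forall>i\<in>{1..a}. continuous_map Z X (\<lambda>z. f z i))" for Z :: "'z topology" and f
    unfolding E_def continuous_map_in_subtopology continuous_map_Conf by auto
  have cc: "continuous_map E X (\<lambda>x. x i)" if "i \<in> {1..a}" for i
    unfolding E_def using cm_Conf_coord[of "Conf a" a "\<lambda>x. x" i] that by (auto intro: continuous_map_from_subtopology)
  show ?thesis
  proof (cases "topspace E = {}")
    case True
    then show ?thesis unfolding E_def[symmetric] by (intro sep_mono[OF sep_trivial_group[OF trivial_homology_group_empty]]) auto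
  next
    case False
    then obtain x0 where x0: "x0 \<in> topspace E" by blast
    define F where "F i y = (1 - of_real (fst y)) * \<kappa> (snd y i) + of_real (fst y) * \<kappa> (x0 i)" for i and y :: "real \<times> (nat \<Rightarrow> 'a)"
    have FK: "(\<lambda>i. F i y) \<in> K" if "y \<in> topspace (IX E)" for y
      unfolding F_def using that x0 by (intro convex) (auto simp: tE)
    have "\<exists>h. continuous_map (IX E) X h \<and> (\<forall>y\<in>topspace (IX E). \<kappa> (h y) = F i y) \<and> (\<forall>x\<in>topspace E. h (0,x) = x i)" if i: "i \<in> {1..a}" for i
    proof -
      have c: "continuous_map (IX E) euclidean (\<lambda>y. \<kappa> (snd y i))"
        using continuous_map_compose[OF continuous_map_compose[OF continuous_map_snd cc[OF i]] cm_kappa] by (simp add: comp_def)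
      have "continuous_map (IX E) euclidean (F i)" unfolding F_def by (intro cmi c)
      then have Fc: "continuous_map (IX E) (top_of_set (- P)) (F i)"
        unfolding continuous_map_top_of_set using conf(2)[OF FK i] by simp
      show ?thesis
        by (rule homotopy_lift[OF Fc cc[OF i]]) (auto simp: F_def)
    qed
    then obtain h where h: "\<And>i. i \<in> {1..a} \<Longrightarrow> continuous_map (IX E) X (h i)"
      "\<And>i y. i \<in> {1..a} \<Longrightarrow> y \<in> topspace (IX E) \<Longrightarrow> \<kappa> (h i y) = F i y" "\<And>i x. i \<in> {1..a} \<Longrightarrow> x \<in> topspace E \<Longrightarrow> h i (0,x) = x i"
      by metis
    define H where "H y = (\<lambda>i\<in>{1..a}. h i y)" for y
    have kH: "(\<lambda>i. \<kappa> (H y i)) = (\<lambda>i. F i y)" if y: "y \<in> topspace (IX E)" for y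
    proof
      fix i
      have "snd y \<in> topspace E" using y by auto
      \<comment> \<open>Outside the index set both tuples have the value \<open>undefined\<close>,
        so the segment is constant there. This matters because \<open>K\<close> is a set of full
        sequences.\<close>
      then have "i \<notin> {1..a} \<Longrightarrow> snd y i = undefined \<and> x0 i = undefined" using x0 unfolding tE by (auto simp: PiE_def extensional_def)
      then show "\<kappa> (H y i) = F i y" using h(2)[OF _ y, of i] by (cases "i \<in> {1..a}") (auto simp: H_def F_def convex_same)
    qed
    have HE: "H y \<in> topspace E" if y: "y \<in> topspace (IX E)" for y
    proof -
      have "h i y \<in> topspace X" if "i \<in> {1..a}" for i using continuous_map_image_subset_topspace[OF h(1)[OF that]] y by blast
      then show ?thesis unfolding tE using kH[OF y] FK[OF y] by (auto simp: H_def)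
    qed
    have Hc: "continuous_map (IX E) E H"
      unfolding cE using HE h(1) by (auto simp: H_def)
    \<comment> \<open>The fibre over the end configuration: each coordinate ranges over one orbit,
      so there are at most \<open>card (carrier G) ^ a\<close> points.\<close>
    define D where "D = {x \<in> topspace E. \<forall>i\<in>{1..a}. \<kappa> (x i) = \<kappa> (x0 i)}"
    have rc: "continuous_map E (subtopology E D) (\<lambda>x. H (1,x))"
    proof -
      have "continuous_map E (IX E) (Pair 1)" by (simp add: continuous_map_IX cmi_misc)
      then have "continuous_map E E (\<lambda>x. H (1,x))" using continuous_map_compose[OF _ Hc] by (simp add: comp_def)
      moreover have "H (1,x) \<in> D" if "x \<in> topspace E" for x
        unfolding D_def using HE[of "(1,x)"] kH[of "(1,x)"] that by (auto simp: F_def fun_eq_iff)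
      ultimately show ?thesis by (auto simp: continuous_map_in_subtopology)
    qed
    have ic: "continuous_map (subtopology E D) E (\<lambda>x. x)" by (simp add: continuous_map_from_subtopology)
    have hom: "push q E E (\<lambda>x. H (1,x)) = push q E E (\<lambda>x. x)"
    proof (rule push_homotopic[symmetric, OF Hc])
      fix x assume x: "x \<in> topspace E"
      then have "x \<in> {1..a} \<rightarrow>\<^sub>E topspace X" unfolding tE by blast
      then show "H (0,x) = x" using h(3)[OF _ x] by (auto simp: H_def PiE_def extensional_def fun_eq_iff)
    qed simp
    have Dsub: "D \<subseteq> (\<Pi>\<^sub>E i\<in>{1..a}. (\<lambda>g. \<phi> g (x0 i)) ` carrier G)"
    proof
      fix x assume x: "x \<in> D"
      have "x i \<in> (\<lambda>g. \<phi> g (x0 i)) ` carrier G" if i: "i \<in> {1..a}" for i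
      proof -
        have "x0 i \<in> topspace X" "x i \<in> topspace X" using x x0 i unfolding D_def tE by auto
        moreover have "\<kappa> (x0 i) = \<kappa> (x i)" using x i unfolding D_def by auto
        ultimately show ?thesis using fibre[of "x0 i" "x i"] by blast
      qed
      then show "x \<in> (\<Pi>\<^sub>E i\<in>{1..a}. (\<lambda>g. \<phi> g (x0 i)) ` carrier G)" using x unfolding D_def tE by auto
    qed
    have fP: "finite (\<Pi>\<^sub>E i\<in>{1..a}. (\<lambda>g. \<phi> g (x0 i)) ` carrier G)" using fin by (intro finite_PiE) auto
    have "card (\<Pi>\<^sub>E i\<in>{1..a}. (\<lambda>g. \<phi> g (x0 i)) ` carrier G) = (\<Prod>i\<in>{1..a}. card ((\<lambda>g. \<phi> g (x0 i)) ` carrier G))"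
      by (rule card_PiE) simp
    also have "\<dots> \<le> (\<Prod>i\<in>{1..a}. card (carrier G))" using card_image_le[OF fin] by (intro prod_mono) auto
    finally have Dcard: "card D \<le> card (carrier G) ^ a" using card_mono[OF fP Dsub] by simp
    have "sep (hfun q (subtopology E D)) (card D)"
      using Hausdorff_Conf finite_subset[OF Dsub fP] unfolding E_def
      by (intro sep_finite Hausdorff_space_subtopology) (auto simp: D_def E_def)
    then have "sep (hfun q E) (card D)" by (intro sep_retract[OF rc ic]) (simp_all only: hom)
    then show ?thesis unfolding E_def[symmetric] by (rule sep_mono[OF _ subset_refl Dcard])
  qed
qed

text \<open>For each difference that must not vanish, between two points or between a point and a
  puncture, one of four open half planes is prescribed. These cover the nonzero numbers and are
  convex, so finitely many open pieces, with all their intersections, fall under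
  \<open>sep_convex_piece\<close>. The resulting bound is the same in every degree.\<close>

lemma sep_Conf:
  assumes P: "finite P" obtains C where "\<And>q. sep (hfun q (Conf a)) C"
proof -
  \<comment> \<open>The label \<open>(i, Inl j)\<close> stands for a pair of points,
    \<open>(i, Inr p)\<close> for a point and a puncture.\<close>
  define d where "d e z = (case e of (i, Inl j) \<Rightarrow> z i - z j | (i, Inr p) \<Rightarrow> z i - p)" for e :: "nat \<times> (nat + complex)" and z :: "nat \<Rightarrow> complex"
  define Ed where "Ed = {e. \<exists>i\<in>{1..a}. (\<exists>j\<in>{1..a}. i \<noteq> j \<and> e = (i, Inl j)) \<or> (\<exists>p\<in>P. e = (i, Inr p))}"
  define I where "I = (\<Pi>\<^sub>E e\<in>Ed. {1, -1, \<i>, -\<i>})"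
  \<comment> \<open>With sets \<open>J\<close> of choices as index, intersections of pieces have the
    same form as the pieces.\<close>
  define K where "K J = {z. \<forall>s\<in>J. \<forall>e\<in>Ed. 0 < Re (s e * d e z)}" for J :: "(nat \<times> (nat + complex) \<Rightarrow> complex) set"
  define U where "U s = {x \<in> topspace (Conf a). (\<lambda>i. \<kappa> (x i)) \<in> K {s}}" for s
  have "Ed \<subseteq> {1..a} \<times> (Inl ` {1..a} \<union> Inr ` P)" by (auto simp: Ed_def)
  then have fE: "finite Ed" by (rule finite_subset) (use P in auto)
  then have fI: "finite I" unfolding I_def by (intro finite_PiE) auto
  have dc: "d e (\<lambda>i. (1 - of_real t) * z i + of_real t * z' i) = (1 - of_real t) * d e z + of_real t * d e z'" for e t z z'
    by (auto simp: d_def algebra_simps split: prod.split sum.split)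
  have Re: "Re (c * ((1 - of_real t) * x + of_real t * y)) = (1 - t) * Re (c * x) + t * Re (c * y)" for c x y t
    by (simp add: algebra_simps)
  have piece: "sep (hfun q (subtopology (Conf a) {x. (\<lambda>i. \<kappa> (x i)) \<in> K J})) (card (carrier G) ^ a)" if J: "J \<noteq> {}" for J q
  proof (rule sep_convex_piece)
    obtain s where s: "s \<in> J" using J by blast
    show "(\<lambda>i. (1 - of_real t) * z i + of_real t * z' i) \<in> K J" if z: "z \<in> K J" "z' \<in> K J" "0 \<le> t" "t \<le> 1" for z z' t
      unfolding K_def mem_Collect_eq dc Re
    proof (intro ballI)
      fix s e assume "s \<in> J" "e \<in> Ed"
      then have "0 < Re (s e * d e z)" "0 < Re (s e * d e z')" using z unfolding K_def by blast+
      then show "0 < (1 - t) * Re (s e * d e z) + t * Re (s e * d e z')"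
        by (rule convex_pos[OF _ _ z(3,4)])
    qed
    have nz: "d e z \<noteq> 0" if "z \<in> K J" "e \<in> Ed" for e z
    proof
      assume "d e z = 0"
      moreover have "0 < Re (s e * d e z)" using that s unfolding K_def by blast
      ultimately show False by simp
    qed
    show "inj_on z {1..a}" if z: "z \<in> K J" for z
    proof (rule inj_onI, rule ccontr)
      fix i j assume ij: "i \<in> {1..a}" "j \<in> {1..a}" "z i = z j" "i \<noteq> j"
      then have "(i, Inl j) \<in> Ed" by (auto simp: Ed_def)
      from nz[OF z this] show False using ij(3) by (simp add: d_def)
    qed
    show "z i \<notin> P" if z: "z \<in> K J" and i: "i \<in> {1..a}" for z i
    proof
      assume "z i \<in> P"
      then have "(i, Inr (z i)) \<in> Ed" using i by (auto simp: Ed_def)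
      from nz[OF z this] show False by (simp add: d_def)
    qed
  qed
  have oU: "openin (Conf a) (U s)" for s
  proof -
    have c: "continuous_map (Conf a) euclidean (\<lambda>x. \<kappa> (x i))" if "i \<in> {1..a}" for i
      using continuous_map_compose[OF cm_Conf_coord[of "Conf a" a "\<lambda>x. x", OF _ that] cm_kappa] by (simp add: comp_def)
    have o: "openin (Conf a) {x \<in> topspace (Conf a). 0 < Re (s e * d e (\<lambda>i. \<kappa> (x i)))}" if e: "e \<in> Ed" for e
    proof -
      have "continuous_map (Conf a) euclidean (\<lambda>x. Re (s e * d e (\<lambda>i. \<kappa> (x i))))"
        using e unfolding Ed_def by (auto simp: d_def intro!: cmi c)
      from openin_continuous_map_preimage[OF this, of "{0<..}"] show ?thesis by simp
    qed
    have "U s = topspace (Conf a) \<inter> (\<Inter>e\<in>Ed. {x \<in> topspace (Conf a). 0 < Re (s e * d e (\<lambda>i. \<kappa> (x i)))})"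
      by (auto simp: U_def K_def)
    then show ?thesis using o fE by (simp only:) (intro openin_Int_Inter; auto)
  qed
  have un: "(\<Union>s\<in>I. U s) = topspace (Conf a)"
  proof
    show "topspace (Conf a) \<subseteq> (\<Union>s\<in>I. U s)"
    proof
      fix x assume x: "x \<in> topspace (Conf a)"
      have nz: "d e (\<lambda>i. \<kappa> (x i)) \<noteq> 0" if e: "e \<in> Ed" for e
      proof -
        have n: "inj_on (\<lambda>i. \<kappa> (x i)) {1..a}" "\<And>i. i \<in> {1..a} \<Longrightarrow> \<kappa> (x i) \<notin> P"
          using x kappa_notin unfolding topspace_Conf by (auto dest: PiE_mem)
        obtain i where i: "i \<in> {1..a}" "(\<exists>j\<in>{1..a}. i \<noteq> j \<and> e = (i, Inl j)) \<or> (\<exists>p\<in>P. e = (i, Inr p))"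
          using e unfolding Ed_def by blast
        from i(2) show ?thesis
        proof
          assume "\<exists>j\<in>{1..a}. i \<noteq> j \<and> e = (i, Inl j)"
          then show ?thesis using inj_onD[OF n(1), of i] i(1) by (auto simp: d_def)
        next
          assume "\<exists>p\<in>P. e = (i, Inr p)"
          then show ?thesis using n(2)[OF i(1)] by (auto simp: d_def)
        qed
      qed
      have "\<exists>c\<in>{1, -1, \<i>, -\<i>}. 0 < Re (c * w)" if "w \<noteq> 0" for w :: complex
      proof -
        have "Re w \<noteq> 0 \<or> Im w \<noteq> 0" using that by (auto simp: complex_eq_iff)
        then show ?thesis by (auto simp: neq_iff)
      qed
      then have "\<forall>e\<in>Ed. \<exists>c\<in>{1, -1, \<i>, -\<i>}. 0 < Re (c * d e (\<lambda>i. \<kappa> (x i)))" using nz by blast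
      then obtain s where s: "\<forall>e\<in>Ed. s e \<in> {1, -1, \<i>, -\<i>} \<and> 0 < Re (s e * d e (\<lambda>i. \<kappa> (x i)))" by metis
      then have "restrict s Ed \<in> I" "x \<in> U (restrict s Ed)" using x by (auto simp: I_def U_def K_def)
      then show "x \<in> (\<Union>s\<in>I. U s)" by blast
    qed
  qed (auto simp: U_def)
  show thesis
  proof (rule that)
    fix q
    have "sep (hfun q (subtopology (Conf a) (\<Union>s\<in>I. U s))) (card (carrier G) ^ a * 3 ^ card I)"
    proof (rule sep_cover[OF fI oU])
      fix J and q :: int assume J: "J \<subseteq> I" "J \<noteq> {}"
      have "(\<Inter>s\<in>J. U s) = topspace (Conf a) \<inter> {x. (\<lambda>i. \<kappa> (x i)) \<in> K J}" using J(2) by (auto simp: U_def K_def)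
      then have "subtopology (Conf a) (\<Inter>s\<in>J. U s) = subtopology (Conf a) {x. (\<lambda>i. \<kappa> (x i)) \<in> K J}"
        by (simp only: subtopology_restrict)
      then show "sep (hfun q (subtopology (Conf a) (\<Inter>s\<in>J. U s))) (card (carrier G) ^ a)" using piece[OF J(2)] by simp
    qed
    then show "sep (hfun q (Conf a)) (card (carrier G) ^ a * 3 ^ card I)" unfolding un by simp
  qed
qed

end

section \<open>Descent of invariant cochains\<close>

abbreviation simplex_top :: "nat \<Rightarrow> (nat \<Rightarrow> real) topology" where
  "simplex_top m \<equiv> subtopology (powertop_real UNIV) (standard_simplex m)"

lemma singular_chain_induct [consumes 1, case_names zero one diff]:
  assumes c: "singular_chain m X c" and P: "P 0" "\<And>\<sigma>. singular_simplex m X \<sigma> \<Longrightarrow> P (frag_of \<sigma>)"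
    "\<And>c d. singular_chain m X c \<Longrightarrow> singular_chain m X d \<Longrightarrow> P c \<Longrightarrow> P d \<Longrightarrow> P (c - d)"
  shows "P c"
proof -
  have "singular_chain m X c \<and> P c"
    using c unfolding singular_chain_def[of m X c]
  proof (induction c rule: frag_induction)
    case (diff a b)
    then show ?case using P(3)[of a b] singular_chain_diff[of m X a b] by (simp add: singular_chain_def)
  qed (use P(1,2) in \<open>simp_all add: singular_chain_of\<close>)
  then show ?thesis ..
qed

context free_quotient
begin

text \<open>The simplex is star-shaped about \<open>c\<close>, so \<open>f\<close> is the end of a
  homotopy that starts at a constant map, and constant maps lift.\<close>

lemma simplex_lift:
  assumes f: "continuous_map (simplex_top m) (top_of_set (- P)) f"
  obtains h where "continuous_map (simplex_top m) X h" "\<And>t. t \<in> standard_simplex m \<Longrightarrow> \<kappa> (h t) = f t"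
proof -
  let ?D = "simplex_top m"
  have tD: "topspace ?D = standard_simplex m" by simp
  obtain c where c: "c \<in> standard_simplex m" using nonempty_standard_simplex by blast
  have "f c \<in> - P" using f c by (auto simp: continuous_map_def)
  then obtain x0 where x0: "x0 \<in> topspace X" "\<kappa> x0 = f c" using kappa_image by (metis imageE)
  define g where "g y = (\<lambda>i. (1 - fst y) * c i + fst y * snd y i)" for y :: "real \<times> (nat \<Rightarrow> real)"
  have cg: "continuous_map (IX ?D) ?D g"
  proof -
    have s: "continuous_map (IX ?D) euclideanreal (\<lambda>y. snd y i)" for i
    proof -
      have "continuous_map (IX ?D) (powertop_real UNIV) snd"
        using continuous_map_into_fulltopology[OF continuous_map_snd] by blast
      then show ?thesis by (simp only: continuous_map_componentwise_UNIV)
    qed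
    have "continuous_map (IX ?D) (powertop_real UNIV) g"
      unfolding continuous_map_componentwise_UNIV g_def by (intro allI cmi s)
    moreover have "g y \<in> standard_simplex m" if "y \<in> topspace (IX ?D)" for y
      unfolding g_def using that c by (intro convex_standard_simplex) auto
    ultimately show ?thesis by (auto simp: continuous_map_in_subtopology)
  qed
  have F: "continuous_map (IX ?D) (top_of_set (- P)) (\<lambda>y. f (g y))"
    using continuous_map_compose[OF cg f] by (simp add: comp_def)
  obtain h where h: "continuous_map (IX ?D) X h" "\<And>y. y \<in> topspace (IX ?D) \<Longrightarrow> \<kappa> (h y) = f (g y)"
  proof -
    have p: "continuous_map ?D X (\<lambda>_. x0)" "\<kappa> x0 = f (g (0,v))" for v using x0 by (simp_all add: g_def)
    show ?thesis by (rule homotopy_lift[OF F p]) (rule that)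
  qed
  have "continuous_map ?D (IX ?D) (Pair 1)" by (simp add: continuous_map_IX cmi_misc)
  then have "continuous_map ?D X (\<lambda>t. h (1,t))" using continuous_map_compose[OF _ h(1)] by (simp add: comp_def)
  moreover have "\<kappa> (h (1,t)) = f t" if "t \<in> standard_simplex m" for t
    using h(2)[of "(1,t)"] that by (simp add: g_def)
  ultimately show thesis by (rule that)
qed

end

text \<open>The vertices \<open>1..a\<close> are the points kept in \<open>X\<close>, which form the
  base; \<open>a+1..n\<close> are the points divided by the group; \<open>n+1..N\<close> number the
  punctures, which are holes of constant position.\<close>

locale orbit_transfer = free_quotient G X \<phi> \<kappa> P
    for G :: "('g, 'm) monoid_scheme" and X :: "'a topology" and \<phi> \<kappa> P +
  fixes a n N :: nat and e :: "nat \<Rightarrow> complex"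
  assumes an: "a \<le> n" and nN: "n \<le> N" and e: "bij_betw e {n+1..N} P"
begin

definition holes :: "nat set" where
  "holes = {1..a} \<union> {n+1..N}"

definition hole_pos :: "nat \<Rightarrow> (nat \<Rightarrow> 'a) \<Rightarrow> complex" where
  "hole_pos v b = (if v \<le> a then \<kappa> (b v) else e v)"

lemma e_in: "v \<in> {n+1..N} \<Longrightarrow> e v \<in> P"
  using e by (auto simp: bij_betw_def)

sublocale config "Conf a" hole_pos holes
proof
  fix v assume v: "v \<in> holes"
  show "continuous_map (Conf a) euclidean (hole_pos v)"
  proof (cases "v \<le> a")
    case True
    then have "v \<in> {1..a}" using v an by (auto simp: holes_def)
    then have "continuous_map (Conf a) X (\<lambda>b. b v)" by (intro cm_Conf_coord) auto
    from continuous_map_compose[OF this cm_kappa] show ?thesis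
      using True by (simp add: hole_pos_def[abs_def] comp_def)
  qed (simp add: hole_pos_def[abs_def])
next
  fix u v b assume uv: "u \<in> holes" "v \<in> holes" "u \<noteq> v" and b: "b \<in> topspace (Conf a)"
  have k: "\<kappa> (b i) \<noteq> \<kappa> (b j)" if "i \<in> {1..a}" "j \<in> {1..a}" "i \<noteq> j" for i j
    using b that unfolding topspace_Conf inj_on_def by blast
  have kp: "\<kappa> (b i) \<notin> P" if "i \<in> {1..a}" for i
    using b that kappa_notin unfolding topspace_Conf by (auto dest: PiE_mem)
  have ee: "e i \<noteq> e j" if "i \<in> {n+1..N}" "j \<in> {n+1..N}" "i \<noteq> j" for i j
    using e that unfolding bij_betw_def inj_on_def by blast
  consider "u \<in> {1..a}" "v \<in> {1..a}" | "u \<in> {1..a}" "v \<in> {n+1..N}" | "u \<in> {n+1..N}" "v \<in> {1..a}" | "u \<in> {n+1..N}" "v \<in> {n+1..N}"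
    using uv unfolding holes_def by blast
  then show "hole_pos u b \<noteq> hole_pos v b"
  proof cases
    case 1 then show ?thesis using k[OF 1] uv(3) by (simp add: hole_pos_def)
  next
    case 2 then show ?thesis using kp[OF 2(1)] e_in[OF 2(2)] an by (auto simp: hole_pos_def)
  next
    case 3 then show ?thesis using kp[OF 3(2)] e_in[OF 3(1)] an by (auto simp: hole_pos_def)
  next
    case 4 then show ?thesis using ee[OF 4] uv(3) an by (auto simp: hole_pos_def)
  qed
qed

abbreviation moving :: "nat set" where
  "moving \<equiv> {a+1..n}"

lemma moving: "{1..N} - holes = moving"
  using an nN by (auto simp: holes_def)

lemma card_holes: "card ({1..N} \<inter> holes) = a + (N - n)"
proof -
  have "{1..N} \<inter> holes = {1..a} \<union> {n+1..N}" using an nN by (auto simp: holes_def)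
  then show ?thesis using an by (simp add: card_Un_disjoint)
qed

lemma pos_moving: "i \<in> moving \<Longrightarrow> pos w i = snd w i"
  and pos_far: "i \<in> {n+1..N} \<Longrightarrow> pos w i = e i"
  and pos_base: "i \<in> {1..a} \<Longrightarrow> pos w i = \<kappa> (fst w i)"
proof -
  show "pos w i = snd w i" if i: "i \<in> moving"
  proof -
    have "i \<notin> holes" using i by (auto simp: holes_def)
    then show ?thesis by (simp add: pos_def)
  qed
  show "pos w i = e i" if i: "i \<in> {n+1..N}"
  proof -
    have "i \<in> holes" "\<not> i \<le> a" using i an by (auto simp: holes_def)
    then show ?thesis by (simp add: pos_def hole_pos_def)
  qed
  show "pos w i = \<kappa> (fst w i)" if i: "i \<in> {1..a}"
  proof -
    have "i \<in> holes" using i by (auto simp: holes_def)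
    then show ?thesis using i by (simp add: pos_def hole_pos_def)
  qed
qed

section \<open>Projection of configurations and lifts of simplices\<close>

definition proj :: "(nat \<Rightarrow> 'a) \<Rightarrow> (nat \<Rightarrow> 'a) \<times> (nat \<Rightarrow> complex)" where
  "proj x = (restrict x {1..a}, \<lambda>i. if i \<in> moving then \<kappa> (x i) else 0)"

text \<open>The second component is compared at the indices in \<open>moving\<close> alone; its
  other coordinates are free parameters that do not describe points of the configuration.\<close>

definition is_lift :: "nat \<Rightarrow> ((nat \<Rightarrow> real) \<Rightarrow> nat \<Rightarrow> 'a) \<Rightarrow> ((nat \<Rightarrow> real) \<Rightarrow> (nat \<Rightarrow> 'a) \<times> (nat \<Rightarrow> complex)) \<Rightarrow> bool" where
  "is_lift m \<sigma>' \<sigma> \<longleftrightarrow> singular_simplex m (Conf n) \<sigma>' \<and> (\<forall>t\<in>standard_simplex m.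
     (\<forall>i\<in>{1..a}. \<sigma>' t i = fst (\<sigma> t) i) \<and> (\<forall>i\<in>moving. \<kappa> (\<sigma>' t i) = snd (\<sigma> t) i))"

text \<open>Punctures are vertices too, so the moving coordinates avoid them and lift through
  \<kappa> one by one; distinct images then give a point of the orbit configuration space.\<close>

lemma lift_exists:
  assumes \<sigma>: "singular_simplex m (Cf {1..N}) \<sigma>" shows "\<exists>\<sigma>'. is_lift m \<sigma>' \<sigma>"
proof -
  have c: "continuous_map (simplex_top m) (Cf {1..N}) \<sigma>" using \<sigma> by (simp add: singular_simplex_def)
  have st: "\<sigma> t \<in> topspace (Cf {1..N})" if "t \<in> standard_simplex m" for t
    using continuous_map_image_subset_topspace[OF c] that by auto
  have ps: "pos (\<sigma> t) i = snd (\<sigma> t) i" if "i \<in> moving" for t i by (rule pos_moving[OF that])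
  have inj: "inj_on (pos (\<sigma> t)) {1..N}" "fst (\<sigma> t) \<in> topspace (Conf a)" if "t \<in> standard_simplex m" for t
    using st[OF that] by auto
  have "\<exists>h. continuous_map (simplex_top m) X h \<and> (\<forall>t\<in>standard_simplex m. \<kappa> (h t) = snd (\<sigma> t) i)" if i: "i \<in> moving" for i
  proof -
    have "snd (\<sigma> t) i \<notin> P" if t: "t \<in> standard_simplex m" for t
    proof
      assume "snd (\<sigma> t) i \<in> P"
      then obtain v where v: "v \<in> {n+1..N}" "e v = snd (\<sigma> t) i" using e unfolding bij_betw_def by (metis imageE)
      then have "pos (\<sigma> t) v = pos (\<sigma> t) i" unfolding ps[OF i] using an pos_far[OF v(1)] by simp
      then have "v = i" using v(1) i an nN by (intro inj_onD[OF inj(1)[OF t]]) auto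
      then show False using v(1) i by auto
    qed
    then have "continuous_map (simplex_top m) (top_of_set (- P)) (\<lambda>t. snd (\<sigma> t) i)"
      using cm_Sb_coord[OF c] by (auto simp: continuous_map_top_of_set)
    then show ?thesis by (rule simplex_lift) blast
  qed
  then obtain h where h: "\<And>i. i \<in> moving \<Longrightarrow> continuous_map (simplex_top m) X (h i)"
    "\<And>i t. i \<in> moving \<Longrightarrow> t \<in> standard_simplex m \<Longrightarrow> \<kappa> (h i t) = snd (\<sigma> t) i" by metis
  define \<sigma>' where "\<sigma>' = (\<lambda>t\<in>standard_simplex m. \<lambda>i\<in>{1..n}. if i \<le> a then fst (\<sigma> t) i else h i t)"
  have s': "\<sigma>' t i = (if i \<le> a then fst (\<sigma> t) i else h i t)" if "t \<in> standard_simplex m" "i \<in> {1..n}" for t i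
    using that by (simp add: \<sigma>'_def)
  have mv: "i \<in> moving" if "i \<in> {1..n}" "\<not> i \<le> a" for i using that by auto
  have k: "\<kappa> (\<sigma>' t i) = pos (\<sigma> t) i" if t: "t \<in> standard_simplex m" and i: "i \<in> {1..n}" for t i
  proof (cases "i \<le> a")
    case True
    then have "i \<in> holes" using i by (auto simp: holes_def)
    then show ?thesis using True s'[OF t i] by (simp add: pos_def hole_pos_def)
  next
    case False
    then show ?thesis using s'[OF t i] h(2)[OF mv[OF i False] t] ps[OF mv[OF i False]] by simp
  qed
  have cc: "continuous_map (simplex_top m) X (\<lambda>t. \<sigma>' t i)" if i: "i \<in> {1..n}" for i
  proof -
    have "continuous_map (simplex_top m) X (\<lambda>t. if i \<le> a then fst (\<sigma> t) i else h i t)"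
    proof (cases "i \<le> a")
      case True
      then have "i \<in> {1..a}" using i by auto
      then show ?thesis using True cm_Conf_coord[OF cm_Sb_base[OF c]] by simp
    qed (use h(1)[OF mv[OF i]] in simp)
    then show ?thesis by (rule continuous_map_eq) (use s' i in simp)
  qed
  have "\<sigma>' t \<in> topspace (Conf n)" if t: "t \<in> standard_simplex m" for t
  proof -
    have "\<sigma>' t i \<in> topspace X" if "i \<in> {1..n}" for i
      using continuous_map_image_subset_topspace[OF cc[OF that]] t by auto
    moreover have "inj_on (\<lambda>i. \<kappa> (\<sigma>' t i)) {1..n}"
    proof -
      have "inj_on (pos (\<sigma> t)) {1..n}" using inj(1)[OF t] by (rule inj_on_subset) (use nN in auto)
      then show ?thesis using k[OF t] by (subst inj_on_cong) auto
    qed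
    moreover have "\<sigma>' t \<in> extensional {1..n}" using t by (simp add: \<sigma>'_def)
    ultimately show ?thesis unfolding topspace_Conf by (auto simp: PiE_def)
  qed
  then have "continuous_map (simplex_top m) (Conf n) \<sigma>'" using cc unfolding continuous_map_Conf by auto
  then have "singular_simplex m (Conf n) \<sigma>'" by (simp add: singular_simplex_def \<sigma>'_def)
  moreover have "\<sigma>' t i = fst (\<sigma> t) i" if "t \<in> standard_simplex m" "i \<in> {1..a}" for t i
    using s'[OF that(1), of i] that(2) an by simp
  moreover have "\<kappa> (\<sigma>' t i) = snd (\<sigma> t) i" if "t \<in> standard_simplex m" "i \<in> moving" for t i
    using k[OF that(1), of i] ps[OF that(2)] that(2) by simp
  ultimately show ?thesis unfolding is_lift_def by blast
qed

abbreviation Wr where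
  "Wr \<equiv> wreath_subgroup G n a"

text \<open>A simplex is connected, so each moving coordinate of two lifts differs by one constant
  group element. Together these form an element of the wreath subgroup with trivial
  permutation.\<close>

lemma lift_unique:
  assumes s: "is_lift m \<sigma>' \<sigma>" and t: "is_lift m \<tau>' \<sigma>"
  shows "\<exists>w\<in>Wr. \<tau>' = simplex_map m (wreath_action \<phi> n w) \<sigma>'"
proof -
  have c: "continuous_map (simplex_top m) (Conf n) \<sigma>'" "continuous_map (simplex_top m) (Conf n) \<tau>'"
    "\<tau>' \<in> extensional (standard_simplex m)"
    using s t by (auto simp: is_lift_def singular_simplex_def)
  have con: "connected_space (simplex_top m)"
    using connectedin_standard_simplex by (simp add: connectedin_def)
  have ne: "topspace (simplex_top m) \<noteq> {}" by (simp add: nonempty_standard_simplex)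
  have "\<exists>\<gamma>\<in>carrier G. \<forall>t\<in>standard_simplex m. \<tau>' t i = \<phi> \<gamma> (\<sigma>' t i)" if i: "i \<in> moving" for i
  proof -
    have i': "i \<in> {1..n}" using i by auto
    have "\<kappa> (\<sigma>' z i) = \<kappa> (\<tau>' z i)" if "z \<in> topspace (simplex_top m)" for z
      using s t i that by (auto simp: is_lift_def)
    from lifts_differ[OF con ne cm_Conf_coord[OF c(1) i'] cm_Conf_coord[OF c(2) i'] this]
    show ?thesis by (metis topspace_standard_simplex)
  qed
  then obtain \<gamma> where g: "\<And>i. i \<in> moving \<Longrightarrow> \<gamma> i \<in> carrier G" "\<And>i t. i \<in> moving \<Longrightarrow> t \<in> standard_simplex m \<Longrightarrow> \<tau>' t i = \<phi> (\<gamma> i) (\<sigma>' t i)"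
    by metis
  define w where "w = (\<lambda>i\<in>{1..n}. if i \<le> a then \<one>\<^bsub>G\<^esub> else \<gamma> i, id :: nat \<Rightarrow> nat)"
  have "w \<in> Wr"
    using g(1) by (auto simp: w_def wreath_subgroup_def wreath_group_def sym_group_def permutes_id)
  moreover have "\<tau>' = simplex_map m (wreath_action \<phi> n w) \<sigma>'"
  proof
    fix z
    show "\<tau>' z = simplex_map m (wreath_action \<phi> n w) \<sigma>' z"
    proof (cases "z \<in> standard_simplex m")
      case False
      then show ?thesis using c(3) by (simp add: simplex_map_def extensional_def)
    next
      case True
      have X: "\<sigma>' z \<in> {1..n} \<rightarrow>\<^sub>E topspace X" "\<tau>' z \<in> {1..n} \<rightarrow>\<^sub>E topspace X"
        using continuous_map_image_subset_topspace[OF c(1)] continuous_map_image_subset_topspace[OF c(2)] True unfolding topspace_Conf by auto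
      have "\<tau>' z i = wreath_action \<phi> n w (\<sigma>' z) i" for i
      proof (cases "i \<in> {1..n}")
        case False
        then show ?thesis using X(2) by (simp add: wreath_action_def w_def PiE_def extensional_def del: atLeastAtMost_iff)
      next
        case i: True
        have sx: "\<sigma>' z i \<in> topspace X" using X(1) i by (rule PiE_mem)
        show ?thesis
        proof (cases "i \<le> a")
          case True
          then have "\<tau>' z i = \<sigma>' z i" using s t \<open>z \<in> standard_simplex m\<close> i unfolding is_lift_def by simp
          then show ?thesis using True i phi_one[OF sx] by (simp add: wreath_action_def w_def)
        next
          case False
          then show ?thesis using g(2)[of i z] i \<open>z \<in> standard_simplex m\<close> by (simp add: wreath_action_def w_def)
        qed
      qed
      then show ?thesis using True by (auto simp: simplex_map_def)
    qed
  qed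
  ultimately show ?thesis by blast
qed


lemma cm_proj: "continuous_map (Conf n) (Cf {1..N}) proj"
  unfolding continuous_map_Sb
proof (intro conjI allI ballI)
  have c: "continuous_map (Conf n) X (\<lambda>x. x i)" if "i \<in> {1..n}" for i
    using cm_Conf_coord[of "Conf n" n "\<lambda>x. x", OF _ that] by simp
  have an': "i \<in> {1..n}" if "i \<in> {1..a}" for i using that an by auto
  have "restrict x {1..a} \<in> topspace (Conf a)" if "x \<in> topspace (Conf n)" for x
  proof -
    have "inj_on (\<lambda>i. \<kappa> (x i)) {1..a}" using that an unfolding topspace_Conf by (auto intro: inj_on_subset)
    then have "inj_on (\<lambda>i. \<kappa> (restrict x {1..a} i)) {1..a}" by (subst inj_on_cong[where g = "\<lambda>i. \<kappa> (x i)"]) simp_all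
    then show ?thesis using that an' unfolding topspace_Conf by auto
  qed
  then show "continuous_map (Conf n) (Conf a) (\<lambda>x. fst (proj x))"
    unfolding continuous_map_Conf using c an' by (auto simp: proj_def)
  show "continuous_map (Conf n) euclidean (\<lambda>x. snd (proj x) i)" for i
  proof (cases "i \<in> moving")
    case True
    then have "i \<in> {1..n}" by auto
    from continuous_map_compose[OF c[OF this] cm_kappa] show ?thesis using True by (simp add: proj_def comp_def)
  qed (simp add: proj_def del: atLeastAtMost_iff)
  fix x assume x: "x \<in> topspace (Conf n)"
  have xs: "x \<in> {1..n} \<rightarrow>\<^sub>E topspace X" and inj: "inj_on (\<lambda>i. \<kappa> (x i)) {1..n}"
    using x unfolding topspace_Conf by blast+
  have X: "x i \<in> topspace X" if "i \<in> {1..n}" for i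
    by (rule PiE_mem[OF xs that])
  have p: "pos (proj x) i = \<kappa> (x i)" if i: "i \<in> {1..n}" for i
  proof (cases "i \<le> a")
    case True
    then have "i \<in> {1..a}" using i by auto
    then show ?thesis using pos_base[of i] by (simp add: proj_def)
  next
    case False
    then have "i \<in> moving" using i by auto
    then show ?thesis unfolding pos_moving[OF \<open>i \<in> moving\<close>] by (simp add: proj_def)
  qed
  show "inj_on (pos (proj x)) {1..N}"
  proof (rule inj_onI)
    fix i j assume ij: "i \<in> {1..N}" "j \<in> {1..N}" "pos (proj x) i = pos (proj x) j"
    consider "i \<in> {1..n}" "j \<in> {1..n}" | "i \<in> {1..n}" "j \<in> {n+1..N}" | "i \<in> {n+1..N}" "j \<in> {1..n}" | "i \<in> {n+1..N}" "j \<in> {n+1..N}"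
      using ij by fastforce
    then show "i = j"
    proof cases
      case 1 then show ?thesis using ij(3) inj_onD[OF inj _ 1] p[OF 1(1)] p[OF 1(2)] by simp
    next
      case 2 then show ?thesis using ij(3) p[OF 2(1)] pos_far[OF 2(2)] kappa_notin[OF X[OF 2(1)]] e_in[OF 2(2)] by simp
    next
      case 3 then show ?thesis using ij(3) p[OF 3(2)] pos_far[OF 3(1)] kappa_notin[OF X[OF 3(2)]] e_in[OF 3(1)] by simp
    next
      case 4
      then have "e i = e j" using ij(3) pos_far[OF 4(1)] pos_far[OF 4(2)] by simp
      then show ?thesis by (rule inj_onD[OF bij_betw_imp_inj_on[OF e] _ 4])
    qed
  qed
qed

text \<open>The chosen lifts need not be compatible with faces, so this need not be a chain map. It
  behaves like one after evaluation of an invariant cochain, whose values do not depend on the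
  choice.\<close>

definition lift :: "nat \<Rightarrow> ((nat \<Rightarrow> 'a) \<times> (nat \<Rightarrow> complex)) chain \<Rightarrow> (nat \<Rightarrow> 'a) chain" where
  "lift m = frag_extend (\<lambda>\<sigma>. frag_of (SOME \<sigma>'. is_lift m \<sigma>' \<sigma>))"

lemma some_lift: "singular_simplex m (Cf {1..N}) \<sigma> \<Longrightarrow> is_lift m (SOME \<sigma>'. is_lift m \<sigma>' \<sigma>) \<sigma>"
  using lift_exists by (rule someI_ex)

lemma lift_chain: "singular_chain m (Cf {1..N}) c \<Longrightarrow> singular_chain m (Conf n) (lift m c)"
  unfolding lift_def
  by (rule singular_chain_extend) (use some_lift in \<open>auto simp: singular_chain_of is_lift_def singular_chain_def\<close>)

lemma lift_add: "lift m (c + d) = lift m c + lift m d"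
  and lift_diff: "lift m (c - d) = lift m c - lift m d"
  and lift_0: "lift m 0 = 0"
  and lift_of: "lift m (frag_of \<sigma>) = frag_of (SOME \<sigma>'. is_lift m \<sigma>' \<sigma>)"
  and lift_cmul: "lift m (frag_cmul k c) = frag_cmul k (lift m c)"
  by (simp_all add: lift_def frag_extend_add frag_extend_diff frag_extend_cmul)

lemma lift_sum: "finite I \<Longrightarrow> lift m (\<Sum>i\<in>I. f i) = (\<Sum>i\<in>I. lift m (f i))"
  by (induction I rule: finite_induct) (simp_all add: lift_add lift_0)

definition inv_cochains :: "nat \<Rightarrow> ((nat \<Rightarrow> 'a) chain \<Rightarrow> rat) set" where
  "inv_cochains m = {u \<in> cochains m (Conf n). \<forall>w\<in>Wr. \<forall>c. singular_chain m (Conf n) c \<longrightarrow> u (chain_map m (wreath_action \<phi> n w) c) = u c}"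

lemma cochain_add: "u \<in> cochains m Y \<Longrightarrow> singular_chain m Y c \<Longrightarrow> singular_chain m Y d \<Longrightarrow> u (c + d) = u c + u d"
  by (simp add: cochains_iff)

lemma cochain_minus: "u \<in> cochains m Y \<Longrightarrow> singular_chain m Y c \<Longrightarrow> u (- c) = - u c"
  using cochain_add[of u m Y c "- c"] cochain_zero[of u m Y] by (simp add: singular_chain_minus)

lemma cochain_diff: "u \<in> cochains m Y \<Longrightarrow> singular_chain m Y c \<Longrightarrow> singular_chain m Y d \<Longrightarrow> u (c - d) = u c - u d"
  using cochain_add[of u m Y c "- d"] cochain_minus[of u m Y d] by (simp add: singular_chain_minus)

lemma inv_cochain_lift:
  assumes u: "u \<in> inv_cochains m" and s: "is_lift m \<sigma>' \<sigma>" "is_lift m \<tau>' \<sigma>"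
  shows "u (frag_of \<tau>') = u (frag_of \<sigma>')"
proof -
  obtain w where w: "w \<in> Wr" "\<tau>' = simplex_map m (wreath_action \<phi> n w) \<sigma>'" using lift_unique[OF s] by blast
  have "singular_chain m (Conf n) (frag_of \<sigma>')" using s(1) by (simp add: is_lift_def singular_chain_of)
  then have "u (chain_map m (wreath_action \<phi> n w) (frag_of \<sigma>')) = u (frag_of \<sigma>')"
    using u w(1) unfolding inv_cochains_def by blast
  then show ?thesis by (simp add: w(2))
qed

text \<open>A simplex of configurations is one of the lifts of its own projection.\<close>

lemma lift_proj:
  assumes u: "u \<in> inv_cochains m" and c: "singular_chain m (Conf n) c"
  shows "u (lift m (chain_map m proj c)) = u c"
  using c
proof (induction c rule: singular_chain_induct)
  case zero
  then show ?case by (simp add: lift_0)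
next
  case (one \<sigma>')
  note s = one
  have "singular_simplex m (Cf {1..N}) (simplex_map m proj \<sigma>')" by (rule singular_simplex_simplex_map[OF s cm_proj])
  then have "is_lift m (SOME \<tau>. is_lift m \<tau> (simplex_map m proj \<sigma>')) (simplex_map m proj \<sigma>')" by (rule some_lift)
  moreover have "is_lift m \<sigma>' (simplex_map m proj \<sigma>')"
    using s by (simp add: is_lift_def simplex_map_def proj_def del: atLeastAtMost_iff)
  ultimately have "u (frag_of (SOME \<tau>. is_lift m \<tau> (simplex_map m proj \<sigma>'))) = u (frag_of \<sigma>')" by (intro inv_cochain_lift[OF u])
  then show ?case by (simp add: lift_of)
next
  case (diff c d)
  have uc: "u \<in> cochains m (Conf n)" using u by (simp add: inv_cochains_def)
  note cc = diff(1,2)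
  have l: "singular_chain m (Conf n) (lift m (chain_map m proj c))" "singular_chain m (Conf n) (lift m (chain_map m proj d))"
    using cc by (auto intro!: lift_chain singular_chain_chain_map[OF _ cm_proj])
  show ?case using diff cochain_diff[OF uc cc] cochain_diff[OF uc l] by (simp add: chain_map_diff lift_diff)
qed

text \<open>A permutation \<pi> of the moving vertices is realized upstairs by the wreath element
  with trivial group part and permutation inverse to \<pi>, the inverse because
  \<open>wreath_action\<close> itself inverts the permutation.\<close>

lemma lift_perm:
  assumes u: "u \<in> inv_cochains m" and pi: "\<pi> permutes moving" and c: "singular_chain m (Cf {1..N}) c"
  shows "u (lift m (chain_map m (act \<pi>) c)) = u (lift m c)"
  using c
proof (induction c rule: singular_chain_induct)
  case zero
  then show ?case by (simp add: lift_0)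
next
  case (one \<sigma>)
  note s = one
  define \<sigma>' where "\<sigma>' = (SOME \<tau>. is_lift m \<tau> \<sigma>)"
  have l: "is_lift m \<sigma>' \<sigma>" unfolding \<sigma>'_def by (rule some_lift[OF s])
  then have s': "singular_simplex m (Conf n) \<sigma>'" by (simp add: is_lift_def)
  define w where "w = (\<lambda>i\<in>{1..n}. \<one>\<^bsub>G\<^esub>, Hilbert_Choice.inv \<pi>)"
  have pn: "\<pi> permutes {1..n}" by (rule permutes_subset[OF pi]) auto
  have fx: "\<pi> i = i" if "i \<le> a" for i using permutes_not_in[OF pi, of i] that by auto
  have ii: "Hilbert_Choice.inv \<pi> i = i" if "i \<le> a" for i using permutes_not_in[OF permutes_inv[OF pi], of i] that by auto
  have inv2: "Hilbert_Choice.inv (Hilbert_Choice.inv \<pi>) = \<pi>" by (rule permutes_inv_inv[OF pi])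
  have w: "w \<in> Wr"
    using permutes_inv[OF pn] ii by (auto simp: w_def wreath_subgroup_def wreath_group_def sym_group_def)
  then have wc: "w \<in> carrier (wreath_group G n)" by (simp add: wreath_subgroup_def case_prod_unfold)
  let ?\<tau>' = "simplex_map m (wreath_action \<phi> n w) \<sigma>'"
  have t: "singular_simplex m (Conf n) ?\<tau>'" by (rule singular_simplex_simplex_map[OF s' wreath_action_conf[OF act wc]])
  have wa: "?\<tau>' t i = \<sigma>' t (\<pi> i)" if t: "t \<in> standard_simplex m" and i: "i \<in> {1..n}" for t i
  proof -
    have "continuous_map (simplex_top m) (Conf n) \<sigma>'" using s' by (simp add: singular_simplex_def)
    from continuous_map_image_subset_topspace[OF this] have "\<sigma>' t \<in> topspace (Conf n)" using t by auto
    then have st: "\<sigma>' t \<in> {1..n} \<rightarrow>\<^sub>E topspace X" unfolding topspace_Conf by blast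
    have "\<pi> i \<in> {1..n}" using permutes_in_image[OF pn, of i] i by blast
    then have "\<sigma>' t (\<pi> i) \<in> topspace X" by (rule PiE_mem[OF st])
    then show ?thesis using phi_one i t by (simp add: simplex_map_def wreath_action_def w_def inv2 del: atLeastAtMost_iff)
  qed
  have ca: "continuous_map (Cf {1..N}) (Cf {1..N}) (act \<pi>)"
    using cm_act[of \<pi> "{1..N}" "{1..N}"] perm_image(1)[of \<pi> "{1..N}"] pi unfolding moving by simp
  have "singular_simplex m (Cf {1..N}) (simplex_map m (act \<pi>) \<sigma>)" by (rule singular_simplex_simplex_map[OF s ca])
  then have 1: "is_lift m (SOME \<tau>. is_lift m \<tau> (simplex_map m (act \<pi>) \<sigma>)) (simplex_map m (act \<pi>) \<sigma>)" by (rule some_lift)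
  have 2: "is_lift m ?\<tau>' (simplex_map m (act \<pi>) \<sigma>)"
    unfolding is_lift_def
  proof (intro conjI ballI t)
    fix z i assume z: "z \<in> standard_simplex m"
    show "?\<tau>' z i = fst (simplex_map m (act \<pi>) \<sigma> z) i" if i: "i \<in> {1..a}"
      using wa[OF z, of i] l z i fx[of i] an by (simp add: is_lift_def simplex_map_def act_def)
    show "\<kappa> (?\<tau>' z i) = snd (simplex_map m (act \<pi>) \<sigma> z) i" if i: "i \<in> moving"
    proof -
      have "\<pi> i \<in> moving" using permutes_in_image[OF pi, of i] i by blast
      then have "\<kappa> (\<sigma>' z (\<pi> i)) = snd (\<sigma> z) (\<pi> i)" using l z unfolding is_lift_def by blast
      then show ?thesis using wa[OF z, of i] i z by (simp add: simplex_map_def act_def)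
    qed
  qed
  have "u (frag_of (SOME \<tau>. is_lift m \<tau> (simplex_map m (act \<pi>) \<sigma>))) = u (frag_of ?\<tau>')" by (rule inv_cochain_lift[OF u 2 1])
  also have "\<dots> = u (chain_map m (wreath_action \<phi> n w) (frag_of \<sigma>'))" by simp
  also have "\<dots> = u (frag_of \<sigma>')"
  proof -
    have "singular_chain m (Conf n) (frag_of \<sigma>')" using s' by (simp add: singular_chain_of)
    then show ?thesis using u w unfolding inv_cochains_def by blast
  qed
  finally show ?case by (simp add: lift_of \<sigma>'_def)
next
  case (diff c d)
  have uc: "u \<in> cochains m (Conf n)" using u by (simp add: inv_cochains_def)
  have ca: "continuous_map (Cf {1..N}) (Cf {1..N}) (act \<pi>)"
    using cm_act[of \<pi> "{1..N}" "{1..N}"] perm_image(1)[of \<pi> "{1..N}"] pi unfolding moving by simp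
  note cc = diff(1,2)
  note l = lift_chain[OF cc(1)] lift_chain[OF cc(2)] lift_chain[OF singular_chain_chain_map[OF cc(1) ca]] lift_chain[OF singular_chain_chain_map[OF cc(2) ca]]
  show ?case using diff cochain_diff[OF uc l(1,2)] cochain_diff[OF uc l(3,4)] by (simp add: chain_map_diff lift_diff)
qed

lemma is_lift_face:
  assumes "is_lift (Suc m) \<sigma>' \<sigma>" "k \<le> Suc m"
  shows "is_lift m (singular_face (Suc m) k \<sigma>') (singular_face (Suc m) k \<sigma>)"
proof -
  have "singular_simplex m (Conf n) (singular_face (Suc m) k \<sigma>')"
    using singular_simplex_singular_face[of "Suc m" "Conf n" \<sigma>' k] assms by (simp add: is_lift_def)
  moreover have "simplical_face k t \<in> standard_simplex (Suc m)" if "t \<in> standard_simplex m" for t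
    using simplical_face_in_standard_simplex[of "Suc m" k t] assms(2) that by simp
  ultimately show ?thesis using assms(1) by (simp add: is_lift_def singular_face_def)
qed

text \<open>Faces of a chosen lift are lifts of the faces, possibly not the chosen ones; an
  invariant cochain does not notice the difference.\<close>

lemma lift_boundary:
  assumes u: "u \<in> inv_cochains m" and c: "singular_chain (Suc m) (Cf {1..N}) c"
  shows "u (lift m (chain_boundary (Suc m) c)) = u (chain_boundary (Suc m) (lift (Suc m) c))"
  using c
proof (induction c rule: singular_chain_induct)
  case zero
  then show ?case by (simp add: lift_0)
next
  case (one \<sigma>)
  note s = one
  have uc: "u \<in> cochains m (Conf n)" using u by (simp add: inv_cochains_def)
  let ?\<sigma>' = "SOME \<tau>. is_lift (Suc m) \<tau> \<sigma>"
  have l: "is_lift (Suc m) ?\<sigma>' \<sigma>" by (rule some_lift[OF s])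
  let ?f = "\<lambda>k. frag_of (SOME \<tau>. is_lift m \<tau> (singular_face (Suc m) k \<sigma>))" and ?g = "\<lambda>k. frag_of (singular_face (Suc m) k ?\<sigma>')"
  have fc: "is_lift m (SOME \<tau>. is_lift m \<tau> (singular_face (Suc m) k \<sigma>)) (singular_face (Suc m) k \<sigma>)" if "k \<le> Suc m" for k
    by (rule some_lift) (use singular_simplex_singular_face[OF s, of k] that in simp)
  have f: "singular_chain m (Conf n) (?f k)" if "k \<le> Suc m" for k using fc[OF that] by (simp add: is_lift_def singular_chain_of)
  have g: "singular_chain m (Conf n) (?g k)" if "k \<le> Suc m" for k using is_lift_face[OF l that] by (simp add: is_lift_def singular_chain_of)
  have fg: "u (?f k) = u (?g k)" if "k \<le> Suc m" for k by (rule inv_cochain_lift[OF u is_lift_face[OF l that] fc[OF that]])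
  have su: "u (\<Sum>k\<in>I. frag_cmul ((-1) ^ k) (h k)) = (\<Sum>k\<in>I. (-1) ^ k * u (h k))" if "finite I" "\<And>k. k \<in> I \<Longrightarrow> singular_chain m (Conf n) (h k)"
    for I :: "nat set" and h
    using that
  proof (induction I rule: finite_induct)
    case empty then show ?case using cochain_zero[OF uc] by simp
  next
    case (insert k I)
    have "u (frag_cmul ((-1) ^ k) (h k)) = (-1) ^ k * u (h k)"
      using cochain_minus[OF uc, of "h k"] insert.prems[of k] by (cases "even k") auto
    moreover have "u (frag_cmul ((-1) ^ k) (h k) + (\<Sum>k\<in>I. frag_cmul ((-1) ^ k) (h k))) = u (frag_cmul ((-1) ^ k) (h k)) + u (\<Sum>k\<in>I. frag_cmul ((-1) ^ k) (h k))"
      using insert.prems by (intro cochain_add[OF uc] singular_chain_cmul singular_chain_sum) auto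
    ultimately show ?case using insert by simp
  qed
  have "lift m (chain_boundary (Suc m) (frag_of \<sigma>)) = (\<Sum>k\<le>Suc m. frag_cmul ((-1) ^ k) (?f k))"
    by (simp add: chain_boundary_of lift_sum lift_cmul lift_of lift_add)
  then have "u (lift m (chain_boundary (Suc m) (frag_of \<sigma>))) = (\<Sum>k\<le>Suc m. (-1) ^ k * u (?f k))"
    using su[of "{..Suc m}" ?f] f by simp
  also have "\<dots> = (\<Sum>k\<le>Suc m. (-1) ^ k * u (?g k))" using fg by (intro sum.cong) auto
  also have "\<dots> = u (\<Sum>k\<le>Suc m. frag_cmul ((-1) ^ k) (?g k))" using su[of "{..Suc m}" ?g] g by simp
  also have "(\<Sum>k\<le>Suc m. frag_cmul ((-1) ^ k) (?g k)) = chain_boundary (Suc m) (lift (Suc m) (frag_of \<sigma>))"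
    by (simp add: chain_boundary_of lift_of)
  finally show ?case .
next
  case (diff c d)
  have uc: "u \<in> cochains m (Conf n)" using u by (simp add: inv_cochains_def)
  note cc = diff(1,2)
  note l = lift_chain[OF singular_chain_boundary_alt[OF cc(1)]] lift_chain[OF singular_chain_boundary_alt[OF cc(2)]]
    singular_chain_boundary_alt[OF lift_chain[OF cc(1)]] singular_chain_boundary_alt[OF lift_chain[OF cc(2)]]
  show ?case using diff cochain_diff[OF uc l(1,2)] cochain_diff[OF uc l(3,4)] by (simp add: chain_boundary_diff lift_diff)
qed


section \<open>Invariant cocycles as symmetric functionals on homology\<close>

definition descend :: "nat \<Rightarrow> ((nat \<Rightarrow> 'a) chain \<Rightarrow> rat) \<Rightarrow> ((nat \<Rightarrow> 'a) \<times> (nat \<Rightarrow> complex)) chain set \<Rightarrow> rat" where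
  "descend m u x = (if x \<in> carrier (homology_group (int m) (Cf {1..N}))
     then u (lift m (SOME c. singular_relcycle m (Cf {1..N}) {} c \<and> x = hcl m (Cf {1..N}) c)) else 0)"

lemma cocycle_boundary:
  assumes "u \<in> cocycles m Y" "singular_chain (Suc m) Y c" shows "u (chain_boundary (Suc m) c) = 0"
proof -
  have "coboundary_map m Y u c = (\<lambda>c\<in>singular_chain_set (Suc m) Y. 0) c"
    using assms(1) by (simp add: cocycles_def cochain_module_def)
  then show ?thesis using assms(2) by (simp add: coboundary_map_def)
qed

text \<open>Homologous cycles differ by a boundary, on whose lift \<open>u\<close> vanishes by
  \<open>lift_boundary\<close> and the cocycle condition.\<close>

lemma descend_hcl:
  assumes u: "u \<in> inv_cochains m" "u \<in> cocycles m (Conf n)" and c: "singular_relcycle m (Cf {1..N}) {} c"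
  shows "descend m u (hcl m (Cf {1..N}) c) = u (lift m c)"
proof -
  let ?c = "SOME d. singular_relcycle m (Cf {1..N}) {} d \<and> hcl m (Cf {1..N}) c = hcl m (Cf {1..N}) d"
  have "singular_relcycle m (Cf {1..N}) {} ?c \<and> hcl m (Cf {1..N}) c = hcl m (Cf {1..N}) ?c"
    by (rule someI[of _ c]) (use c in simp)
  then have sc: "singular_relcycle m (Cf {1..N}) {} ?c" "singular_relboundary m (Cf {1..N}) {} (c - ?c)"
    using hcl_eq by blast+
  then obtain d where d: "singular_chain (Suc m) (Cf {1..N}) d" "chain_boundary (Suc m) d = c - ?c"
    unfolding singular_boundary by blast
  have uc: "u \<in> cochains m (Conf n)" using u(1) by (simp add: inv_cochains_def)
  have cc: "singular_chain m (Cf {1..N}) c" "singular_chain m (Cf {1..N}) ?c" using c sc(1) by (auto simp: singular_cycle)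
  have "u (lift m (c - ?c)) = u (chain_boundary (Suc m) (lift (Suc m) d))"
    unfolding d(2)[symmetric] by (rule lift_boundary[OF u(1) d(1)])
  also have "\<dots> = 0" by (rule cocycle_boundary[OF u(2) lift_chain[OF d(1)]])
  finally have "u (lift m c) = u (lift m ?c)"
    using cochain_diff[OF uc lift_chain[OF cc(1)] lift_chain[OF cc(2)]] by (simp add: lift_diff)
  then show ?thesis unfolding descend_def using hcl_carrier[OF c] by simp
qed

lemma descend_hinv:
  assumes u: "u \<in> inv_cochains m" "u \<in> cocycles m (Conf n)"
  shows "descend m u \<in> hinv (int m) {1..N}"
  unfolding hinv_def
proof (intro CollectI conjI allI impI ballI)
  let ?Y = "Cf {1..N}"
  have uc: "u \<in> cochains m (Conf n)" using u(1) by (simp add: inv_cochains_def)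
  show "descend m u \<in> hfun (int m) ?Y"
    unfolding rhom_def
  proof (intro CollectI conjI ballI allI impI)
    fix x y assume "x \<in> carrier (homology_group (int m) ?Y)" "y \<in> carrier (homology_group (int m) ?Y)"
    then obtain c d where cd: "singular_relcycle m ?Y {} c" "x = hcl m ?Y c" "singular_relcycle m ?Y {} d" "y = hcl m ?Y d"
      by (metis hcl_cases)
    have ch: "singular_chain m ?Y c" "singular_chain m ?Y d" using cd by (auto simp: singular_cycle)
    have "x \<otimes>\<^bsub>homology_group (int m) ?Y\<^esub> y = hcl m ?Y (c + d)" unfolding cd(2,4) by (rule hcl_add[OF cd(1,3)])
    then show "descend m u (x \<otimes>\<^bsub>homology_group (int m) ?Y\<^esub> y) = descend m u x + descend m u y"
      unfolding cd(2,4) using descend_hcl[OF u] cd(1,3) singular_relcycle_add[OF cd(1,3)]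
        cochain_add[OF uc lift_chain[OF ch(1)] lift_chain[OF ch(2)]] by (simp add: lift_add)
  qed (simp add: descend_def)
  fix \<pi> x assume pi: "\<pi> permutes {1..N} - holes" and "x \<in> carrier (homology_group (int m) ?Y)"
  then obtain c where c: "singular_relcycle m ?Y {} c" "x = hcl m ?Y c" by (metis hcl_cases)
  have ca: "continuous_map ?Y ?Y (act \<pi>)"
    using cm_act[OF pi, of "{1..N}"] perm_image(1)[OF pi] by simp
  have "push (int m) ?Y ?Y (act \<pi>) x = hcl m ?Y (chain_map m (act \<pi>) c)" unfolding c(2) by (rule push_hcl[OF ca c(1)])
  moreover have "singular_relcycle m ?Y {} (chain_map m (act \<pi>) c)" using c(1) ca by (intro singular_relcycle_chain_map) auto
  moreover have "u (lift m (chain_map m (act \<pi>) c)) = u (lift m c)"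
    using c(1) pi unfolding moving by (intro lift_perm[OF u(1)]) (simp_all add: singular_cycle)
  ultimately show "descend m u (push (int m) ?Y ?Y (act \<pi>) x) = descend m u x"
    using descend_hcl[OF u] c by simp
qed

text \<open>If the descended functional is zero, then \<open>u\<close> vanishes on all cycles by
  \<open>lift_proj\<close>. It therefore factors through the boundary map, and
  \<open>rhom_factor\<close> extends it from the boundaries to a functional on all chains.\<close>

lemma descend_eq_0:
  assumes u: "u \<in> inv_cochains m" "u \<in> cocycles m (Conf n)" and z: "descend m u = (\<lambda>x. 0)"
  shows "u \<in> coboundaries m (Conf n)"
proof -
  let ?E = "Conf n"
  have uc: "u \<in> cochains m ?E" using u(1) by (simp add: inv_cochains_def)
  have cyc: "u c = 0" if c: "singular_relcycle m ?E {} c" for c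
  proof -
    have "singular_relcycle m (Cf {1..N}) {} (chain_map m proj c)" using c cm_proj by (intro singular_relcycle_chain_map) auto
    then have "u (lift m (chain_map m proj c)) = 0" using descend_hcl[OF u] z by metis
    then show ?thesis using lift_proj[OF u(1)] c by (simp add: singular_cycle)
  qed
  show ?thesis
  proof (cases m)
    \<comment> \<open>In degree 0 every chain is a cycle and zero is the only coboundary.\<close>
    case 0
    have "u = (\<lambda>c\<in>singular_chain_set 0 ?E. 0)"
    proof
      fix c show "u c = (\<lambda>c\<in>singular_chain_set 0 ?E. 0) c"
      proof (cases "singular_chain 0 ?E c")
        case True
        then have "singular_relcycle m ?E {} c" by (simp add: 0 singular_cycle chain_boundary_def)
        then show ?thesis using cyc True by simp
      next
        case False
        then show ?thesis using uc by (simp add: 0 cochains_iff extensional_def)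
      qed
    qed
    then show ?thesis by (simp add: coboundaries_def 0 cochain_module_def)
  next
    case (Suc q)
    define l where "l c = (if singular_chain (Suc q) ?E c then u c else 0)" for c
    have l: "l \<in> rhom (chain_group (Suc q) ?E)"
      unfolding rhom_def l_def using cochain_add[OF uc[unfolded Suc]] by (auto simp: singular_chain_add)
    have g: "chain_boundary (Suc q) \<in> hom (chain_group (Suc q) ?E) (chain_group q ?E)"
      by (auto simp: hom_def singular_chain_boundary_alt chain_boundary_add)
    have "\<exists>v\<in>rhom (chain_group q ?E). \<forall>c\<in>carrier (chain_group (Suc q) ?E). l c = v (chain_boundary (Suc q) c)"
    proof (rule rhom_factor[OF _ _ g l])
      show "l c = 0" if "c \<in> carrier (chain_group (Suc q) ?E)" "chain_boundary (Suc q) c = \<one>\<^bsub>chain_group q ?E\<^esub>" for c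
        using that cyc[of c] by (simp add: l_def Suc singular_cycle)
    qed (simp_all add: abelian_chain_group)
    then obtain v where v: "v \<in> rhom (chain_group q ?E)" "\<And>c. singular_chain (Suc q) ?E c \<Longrightarrow> u c = v (chain_boundary (Suc q) c)"
      by (auto simp: l_def)
    let ?v = "restrict v (singular_chain_set q ?E)"
    have "?v \<in> cochains q ?E" using rhom_mult[OF v(1)] by (simp add: cochains_iff singular_chain_add)
    moreover have "u = coboundary_map q ?E ?v"
    proof
      fix c show "u c = coboundary_map q ?E ?v c"
      proof (cases "singular_chain (Suc q) ?E c")
        case True
        then show ?thesis using v(2)[OF True] singular_chain_boundary_alt[OF True] by (simp add: coboundary_map_def)
      next
        case False
        then show ?thesis using uc by (simp add: Suc cochains_iff extensional_def coboundary_map_def)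
      qed
    qed
    ultimately show ?thesis by (simp add: coboundaries_def Suc)
  qed
qed

end

section \<open>Dimension of the invariants\<close>

text \<open>Gaussian elimination over the test points \<open>S\<close>. \<open>T\<close> is a
  relation and not a function because functionals will be attached to representatives of a class; it
  suffices that a functional vanishing on \<open>S\<close> can only belong to the zero
  vector.\<close>

lemma spanned_by_functionals:
  fixes M :: "(rat, 'v, 'x) module_scheme" and T :: "('v \<times> ('s \<Rightarrow> rat)) set"
  assumes M: "vectorspace rat_field M" and S: "finite S" and T: "\<And>A f. (A,f) \<in> T \<Longrightarrow> A \<in> carrier M"
    and lin: "\<And>A f B g c. (A,f) \<in> T \<Longrightarrow> (B,g) \<in> T \<Longrightarrow> (A \<oplus>\<^bsub>M\<^esub> c \<odot>\<^bsub>M\<^esub> B, \<lambda>s. f s + c * g s) \<in> T"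
    and inj: "\<And>A f. (A,f) \<in> T \<Longrightarrow> \<forall>s\<in>S. f s = 0 \<Longrightarrow> A = \<zero>\<^bsub>M\<^esub>"
  shows "\<exists>Bs. finite Bs \<and> card Bs \<le> card S \<and> Bs \<subseteq> carrier M \<and> (\<forall>(A,f)\<in>T. A \<in> LinearCombinations.module.span rat_field M Bs)"
proof -
  interpret vectorspace rat_field M by (rule M)
  show ?thesis
    using S T lin inj
  proof (induction S arbitrary: T rule: finite_induct)
    case empty
    have "A = \<zero>\<^bsub>M\<^esub>" if "(A,f) \<in> T" for A f using empty(3)[OF that] by simp
    moreover have "\<zero>\<^bsub>M\<^esub> \<in> span {}" using span_is_submodule[of "{}"] by (simp add: LinearCombinations.submodule_def)
    ultimately show ?case by (intro exI[of _ "{}"]) auto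
  next
    case (insert s S)
    show ?case
    proof (cases "\<forall>(A,f)\<in>T. f s = 0")
      case True
      have "\<exists>Bs. finite Bs \<and> card Bs \<le> card S \<and> Bs \<subseteq> carrier M \<and> (\<forall>(A,f)\<in>T. A \<in> span Bs)"
      proof (rule insert.IH)
        show "A = \<zero>\<^bsub>M\<^esub>" if "(A,f) \<in> T" "\<forall>s\<in>S. f s = 0" for A f
          by (rule insert.prems(3)[OF that(1)]) (use True that in auto)
      qed (use insert.prems in blast)+
      then show ?thesis using insert(1,2) by (metis card_insert_disjoint le_SucI)
    next
      case False
      then obtain A0 f0 where A0: "(A0,f0) \<in> T" "f0 s \<noteq> 0" by blast
      let ?T = "{(A,f) \<in> T. f s = 0}"
      have "\<exists>Bs. finite Bs \<and> card Bs \<le> card S \<and> Bs \<subseteq> carrier M \<and> (\<forall>(A,f)\<in>?T. A \<in> span Bs)"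
      proof (rule insert.IH)
        show "(A \<oplus>\<^bsub>M\<^esub> c \<odot>\<^bsub>M\<^esub> B, \<lambda>s. f s + c * g s) \<in> ?T" if "(A,f) \<in> ?T" "(B,g) \<in> ?T" for A f B g c
          using insert.prems(2)[of A f B g c] that by auto
        show "A = \<zero>\<^bsub>M\<^esub>" if "(A,f) \<in> ?T" "\<forall>s\<in>S. f s = 0" for A f
          by (rule insert.prems(3)[of A f]) (use that in auto)
      qed (use insert.prems(1) in blast)
      then obtain Bs where Bs: "finite Bs" "card Bs \<le> card S" "Bs \<subseteq> carrier M" "\<forall>(A,f)\<in>?T. A \<in> span Bs" by blast
      have A0M: "A0 \<in> carrier M" by (rule insert.prems(1)[OF A0(1)])
      have sub: "insert A0 Bs \<subseteq> carrier M" using Bs(3) A0M by blast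
      have sm: "submodule rat_field (span (insert A0 Bs)) M" by (rule span_is_submodule[OF sub])
      have "A \<in> span (insert A0 Bs)" if Af: "(A,f) \<in> T" for A f
      proof -
        \<comment> \<open>Adding this multiple of \<open>A0\<close> makes the functional vanish at
          \<open>s\<close>, so the span of \<open>Bs\<close> applies.\<close>
        define c where "c = - f s / f0 s"
        have AM: "A \<in> carrier M" by (rule insert.prems(1)[OF Af])
        have "(A \<oplus>\<^bsub>M\<^esub> c \<odot>\<^bsub>M\<^esub> A0, \<lambda>s. f s + c * f0 s) \<in> ?T"
          using insert.prems(2)[OF Af A0(1), of c] A0(2) by (simp add: c_def)
        then have "A \<oplus>\<^bsub>M\<^esub> c \<odot>\<^bsub>M\<^esub> A0 \<in> span Bs" using Bs(4) by blast
        then have 1: "A \<oplus>\<^bsub>M\<^esub> c \<odot>\<^bsub>M\<^esub> A0 \<in> span (insert A0 Bs)" using span_is_monotone[of Bs "insert A0 Bs"] by blast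
        have "A0 \<in> span (insert A0 Bs)" using in_own_span[OF sub] by blast
        then have 2: "(- c) \<odot>\<^bsub>M\<^esub> A0 \<in> span (insert A0 Bs)" using sm by (simp add: LinearCombinations.submodule_def)
        have cM: "c \<odot>\<^bsub>M\<^esub> A0 \<in> carrier M" "(- c) \<odot>\<^bsub>M\<^esub> A0 \<in> carrier M" using A0M by simp_all
        have "c \<odot>\<^bsub>M\<^esub> A0 \<oplus>\<^bsub>M\<^esub> (- c) \<odot>\<^bsub>M\<^esub> A0 = (c \<oplus>\<^bsub>rat_field\<^esub> (- c)) \<odot>\<^bsub>M\<^esub> A0"
          using A0M by (subst smult_l_distr) simp_all
        also have "\<dots> = \<zero>\<^bsub>M\<^esub>" using lmult_0[OF A0M] by (simp add: class_ring_simps)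
        finally have "A = (A \<oplus>\<^bsub>M\<^esub> c \<odot>\<^bsub>M\<^esub> A0) \<oplus>\<^bsub>M\<^esub> (- c) \<odot>\<^bsub>M\<^esub> A0"
          using AM cM by (simp add: M.a_assoc)
        then show ?thesis using 1 2 sm unfolding LinearCombinations.submodule_def by metis
      qed
      moreover have "card (insert A0 Bs) \<le> card (insert s S)"
        using Bs(1,2) insert(1,2) by (metis card_insert_disjoint card_insert_le_m1 le_SucI Suc_le_mono card_insert_if)
      ultimately show ?thesis using Bs(1) sub by (intro exI[of _ "insert A0 Bs"]) auto
    qed
  qed
qed

lemma dim_le_functionals:
  fixes M :: "(rat, 'v, 'x) module_scheme" and T :: "('v \<times> ('s \<Rightarrow> rat)) set"
  assumes M: "vectorspace rat_field M" and S: "finite S" and T: "\<And>A f. (A,f) \<in> T \<Longrightarrow> A \<in> carrier M"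
    and lin: "\<And>A f B g c. (A,f) \<in> T \<Longrightarrow> (B,g) \<in> T \<Longrightarrow> (A \<oplus>\<^bsub>M\<^esub> c \<odot>\<^bsub>M\<^esub> B, \<lambda>s. f s + c * g s) \<in> T"
    and inj: "\<And>A f. (A,f) \<in> T \<Longrightarrow> \<forall>s\<in>S. f s = 0 \<Longrightarrow> A = \<zero>\<^bsub>M\<^esub>"
    and total: "\<And>A. A \<in> carrier M \<Longrightarrow> \<exists>f. (A,f) \<in> T"
  shows "vectorspace.fin_dim rat_field M \<and> vectorspace.dim rat_field M \<le> card S"
proof -
  interpret vectorspace rat_field M by (rule M)
  obtain Bs where Bs: "finite Bs" "card Bs \<le> card S" "Bs \<subseteq> carrier M" "\<forall>(A,f)\<in>T. A \<in> span Bs"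
  proof -
    have "\<exists>Bs. finite Bs \<and> card Bs \<le> card S \<and> Bs \<subseteq> carrier M \<and> (\<forall>(A,f)\<in>T. A \<in> span Bs)"
      by (rule spanned_by_functionals[OF M S]; (rule T | rule lin | rule inj); assumption)
    then show ?thesis by (elim exE conjE) (rule that)
  qed
  have "carrier M \<subseteq> span Bs"
  proof
    fix A assume "A \<in> carrier M"
    then obtain f where "(A,f) \<in> T" using total by blast
    then show "A \<in> span Bs" using Bs(4) by blast
  qed
  then have g: "gen_set Bs" using span_is_subset2[OF Bs(3)] by blast
  have "fin_dim" unfolding fin_dim_def using Bs(1,3) g by blast
  moreover have "dim \<le> card S" using gen_ge_dim[OF Bs(1,3) g] Bs(2) by linarith
  ultimately show ?thesis ..
qed


context orbit_transfer
begin

abbreviation wa where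
  "wa \<equiv> wreath_action \<phi> n"

lemma Wr_carrier: "w \<in> Wr \<Longrightarrow> w \<in> carrier (wreath_group G n)"
  by (auto simp: wreath_subgroup_def)

lemma cm_wa: "w \<in> Wr \<Longrightarrow> continuous_map (Conf n) (Conf n) (wa w)"
  using wreath_action_conf[OF act Wr_carrier] .

lemma finite_Wr: "finite Wr"
proof (rule finite_subset)
  show "Wr \<subseteq> (\<Pi>\<^sub>E i\<in>{1..n}. carrier G) \<times> {\<sigma>. \<sigma> permutes {1..n}}"
    by (auto simp: wreath_subgroup_def wreath_group_def sym_group_def)
  show "finite ((\<Pi>\<^sub>E i\<in>{1..n}. carrier G) \<times> {\<sigma>. \<sigma> permutes {1..n}})"
    using fin by (intro finite_cartesian_product finite_PiE finite_permutations) auto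
qed

lemma subgroup_Wr: "subgroup Wr (wreath_group G n)"
  by (rule wreath_subgroup_subgroup[OF is_group])

lemma chain_map_wa:
  assumes "v \<in> Wr" "w \<in> Wr" "singular_chain m (Conf n) c"
  shows "chain_map m (wa v) (chain_map m (wa w) c) = chain_map m (wa (v \<otimes>\<^bsub>wreath_group G n\<^esub> w)) c"
  unfolding chain_map_comp
  by (rule chain_map_eq[OF assms(3)]) (rule wreath_action_mult(1)[OF act Wr_carrier[OF assms(1)] Wr_carrier[OF assms(2)], symmetric])

text \<open>Averaging over the finite group makes a representative invariant on the level of cochains.\<close>

lemma invariant_representative:
  assumes A: "A \<in> carrier (invariant_cohomology m (Conf n) (wa ` Wr))"
  obtains u where "u \<in> inv_cochains m" "u \<in> cocycles m (Conf n)" "A = cohom_class m (Conf n) u"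
proof -
  let ?E = "Conf n" and ?W = "wreath_group G n"
  let ?M = "cochain_module m ?E"
  interpret W: group ?W by (rule wreath_group_group[OF is_group])
  interpret WS: subgroup Wr ?W by (rule subgroup_Wr)
  obtain u0 where u0: "u0 \<in> cocycles m ?E" "A = cohom_class m ?E u0"
    using A by (auto simp: invariant_cohomology_def carrier_cohomology)
  have uc: "u0 \<in> cochains m ?E" using u0(1) by (simp add: cocycles_def)
  interpret B: submodule rat_field "coboundaries m ?E" "?M\<lparr>carrier := cocycles m ?E\<rparr>" by (rule submodule_coboundaries)
  interpret Z: submodule rat_field "cocycles m ?E" ?M by (rule submodule_cocycles)
  have zB: "(\<lambda>c\<in>singular_chain_set m ?E. 0) \<in> coboundaries m ?E" using B.zero_closed by (simp add: cochain_module_def)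
  have diffB: "\<exists>b\<in>coboundaries m ?E. \<forall>c. singular_chain m ?E c \<longrightarrow> u0 (chain_map m (wa w) c) = b c + u0 c" if w: "w \<in> Wr" for w
  proof -
    have "cohom_class m ?E (cochain_map m ?E (wa w) u0) = cohom_class m ?E u0"
      using A w u0 cohomology_map_class[OF cm_wa[OF w] u0(1)] by (auto simp: invariant_cohomology_def)
    moreover have "cochain_map m ?E (wa w) u0 \<in> cohom_class m ?E (cochain_map m ?E (wa w) u0)"
    proof -
      have "cochain_map m ?E (wa w) u0 = (\<lambda>c\<in>singular_chain_set m ?E. 0) \<oplus>\<^bsub>?M\<^esub> cochain_map m ?E (wa w) u0"
        by (auto simp: cochain_module_def cochain_map_def)
      then show ?thesis using zB by (auto simp: a_r_coset_def r_coset_def)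
    qed
    ultimately obtain b where b: "b \<in> coboundaries m ?E" "cochain_map m ?E (wa w) u0 = b \<oplus>\<^bsub>?M\<^esub> u0"
      by (auto simp: a_r_coset_def r_coset_def)
    have "u0 (chain_map m (wa w) c) = b c + u0 c" if "singular_chain m ?E c" for c
      using fun_cong[OF b(2), of c] that by (simp add: cochain_map_def cochain_module_def)
    then show ?thesis using b(1) by blast
  qed
  \<comment> \<open>A sum of translates of \<open>u0\<close> is a multiple of \<open>u0\<close> up
    to a coboundary; the whole group, after division by its order, gives the average.\<close>
  have "\<exists>b\<in>coboundaries m ?E. \<forall>c. singular_chain m ?E c \<longrightarrow> (\<Sum>w\<in>S. u0 (chain_map m (wa w) c)) = b c + of_nat (card S) * u0 c"
    if "finite S" "S \<subseteq> Wr" for S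
    using that
  proof (induction S rule: finite_induct)
    case empty
    show ?case using zB by (intro bexI[of _ "\<lambda>c\<in>singular_chain_set m ?E. 0"]) auto
  next
    case (insert w S)
    obtain b where b: "b \<in> coboundaries m ?E" "\<And>c. singular_chain m ?E c \<Longrightarrow> (\<Sum>w\<in>S. u0 (chain_map m (wa w) c)) = b c + of_nat (card S) * u0 c"
      using insert by auto
    obtain b' where b': "b' \<in> coboundaries m ?E" "\<And>c. singular_chain m ?E c \<Longrightarrow> u0 (chain_map m (wa w) c) = b' c + u0 c"
      using diffB[of w] insert.prems by auto
    have "(\<lambda>c\<in>singular_chain_set m ?E. b c + b' c) \<in> coboundaries m ?E"
      using B.m_closed[OF b(1) b'(1)] by (simp add: cochain_module_def)
    then show ?case using b(2) b'(2) insert(1,2)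
      by (intro bexI[of _ "\<lambda>c\<in>singular_chain_set m ?E. b c + b' c"]) (auto simp: algebra_simps)
  qed
  then obtain b where b: "b \<in> coboundaries m ?E" "\<And>c. singular_chain m ?E c \<Longrightarrow> (\<Sum>w\<in>Wr. u0 (chain_map m (wa w) c)) = b c + of_nat (card Wr) * u0 c"
    using finite_Wr by blast
  define r :: rat where "r = 1 / of_nat (card Wr)"
  have "card Wr \<noteq> 0" using finite_Wr WS.one_closed by (metis card_eq_0_iff empty_iff)
  then have r: "r * of_nat (card Wr) = 1" by (simp add: r_def)
  define b' where "b' = (\<lambda>c\<in>singular_chain_set m ?E. r * b c)"
  have b': "b' \<in> coboundaries m ?E" unfolding b'_def using B.smult_closed[OF _ b(1), of r] by (simp add: cochain_module_def)
  define u where "u = b' \<oplus>\<^bsub>?M\<^esub> u0"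
  have ue: "u c = r * (\<Sum>w\<in>Wr. u0 (chain_map m (wa w) c))" if "singular_chain m ?E c" for c
  proof -
    have "u c = r * b c + (r * of_nat (card Wr)) * u0 c" using that by (simp add: u_def b'_def cochain_module_def r)
    then show ?thesis using b(2)[OF that] by (simp add: algebra_simps)
  qed
  have cls: "cohom_class m ?E u = A" unfolding u_def u0(2) by (rule cohom_class_eqI[OF u0(1) b'])
  have uz: "u \<in> cocycles m ?E"
    unfolding u_def using Z.m_closed[of b' u0] b' u0(1) coboundaries_subset by blast
  have "u (chain_map m (wa v) c) = u c" if v: "v \<in> Wr" and c: "singular_chain m ?E c" for v c
  proof -
    have "(\<Sum>w\<in>Wr. u0 (chain_map m (wa w) (chain_map m (wa v) c))) = (\<Sum>w\<in>Wr. u0 (chain_map m (wa (w \<otimes>\<^bsub>?W\<^esub> v)) c))"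
      by (rule sum.cong[OF refl]) (simp add: chain_map_wa[OF _ v c])
    also have "\<dots> = (\<Sum>w\<in>Wr. u0 (chain_map m (wa w) c))"
    proof (rule sum.reindex_bij_witness[where i = "\<lambda>w. w \<otimes>\<^bsub>?W\<^esub> inv\<^bsub>?W\<^esub> v" and j = "\<lambda>w. w \<otimes>\<^bsub>?W\<^esub> v"])
      note cl = WS.mem_carrier
      show "w \<otimes>\<^bsub>?W\<^esub> v \<otimes>\<^bsub>?W\<^esub> inv\<^bsub>?W\<^esub> v = w" if "w \<in> Wr" for w
        using cl[OF that] cl[OF v] by (simp add: W.m_assoc)
      show "w \<otimes>\<^bsub>?W\<^esub> inv\<^bsub>?W\<^esub> v \<otimes>\<^bsub>?W\<^esub> v = w" if "w \<in> Wr" for w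
        using cl[OF that] cl[OF v] by (simp add: W.m_assoc)
    qed (use v in auto)
    finally show ?thesis using ue[OF c] ue[OF singular_chain_chain_map[OF c cm_wa[OF v]]] by simp
  qed
  then have "u \<in> inv_cochains m" using uz by (simp add: inv_cochains_def cocycles_def)
  then show thesis using uz cls that by blast
qed

text \<open>Each invariant class is related to the descended functionals of its invariant
  representatives. The relation is linear, and by \<open>descend_eq_0\<close> a zero functional
  belongs only to the zero class, so the test points for \<open>hinv\<close> bound the
  dimension.\<close>

lemma dim_invariant_cohomology:
  assumes s: "sep (hinv (int m) {1..N}) k"
  defines "I \<equiv> invariant_cohomology m (Conf n) (wa ` Wr)"
  shows "vectorspace.fin_dim rat_field I \<and> vectorspace.dim rat_field I \<le> k"
proof -
  let ?E = "Conf n"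
  let ?M = "cochain_module m ?E"
  have vI: "vectorspace rat_field I" unfolding I_def by (rule vectorspace_wreath_invariants[OF act])
  interpret I: vectorspace rat_field I by (rule vI)
  interpret Z: submodule rat_field "cocycles m ?E" ?M by (rule submodule_cocycles)
  note qv = quotient_vectorspace[OF vectorspace_cocycles[of m ?E] submodule_coboundaries[of m ?E],
    folded cohomology_def, unfolded coset_carrier, simplified]
  obtain S where S: "finite S" "card S \<le> k" "\<And>l. l \<in> hinv (int m) {1..N} \<Longrightarrow> \<forall>s\<in>S. l s = 0 \<Longrightarrow> l = (\<lambda>x. 0)"
    using s unfolding sep_def by auto
  define T where "T = {(cohom_class m ?E u, descend m u) | u. u \<in> inv_cochains m \<and> u \<in> cocycles m ?E}"
  have "vectorspace.fin_dim rat_field I \<and> vectorspace.dim rat_field I \<le> card S"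
  proof (rule dim_le_functionals[OF vI S(1), where T = T])
    show "A \<in> carrier I" if Af: "(A,f) \<in> T" for A f
    proof -
      obtain u where u: "u \<in> inv_cochains m" "u \<in> cocycles m ?E" "A = cohom_class m ?E u" using Af unfolding T_def by blast
      have "cohomology_map m ?E (wa w) A = A" if w: "w \<in> Wr" for w
      proof -
        have "cochain_map m ?E (wa w) u = u"
        proof
          fix c
          have "u c = undefined" if "\<not> singular_chain m ?E c" using u(1) that by (simp add: inv_cochains_def cochains_iff extensional_def)
          then show "cochain_map m ?E (wa w) u c = u c" using u(1) w by (simp add: cochain_map_def inv_cochains_def)
        qed
        then show ?thesis unfolding u(3) cohomology_map_class[OF cm_wa[OF w] u(2)] by simp
      qed
      then show ?thesis using u(2,3) by (auto simp: I_def invariant_cohomology_def carrier_cohomology)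
    qed
    show "(A \<oplus>\<^bsub>I\<^esub> c \<odot>\<^bsub>I\<^esub> B, \<lambda>s. f s + c * g s) \<in> T" if Af: "(A,f) \<in> T" and Bg: "(B,g) \<in> T" for A f B g c
    proof -
      obtain u where u: "u \<in> inv_cochains m" "u \<in> cocycles m ?E" "A = cohom_class m ?E u" "f = descend m u" using Af unfolding T_def by blast
      obtain v where v: "v \<in> inv_cochains m" "v \<in> cocycles m ?E" "B = cohom_class m ?E v" "g = descend m v" using Bg unfolding T_def by blast
      define y where "y = u \<oplus>\<^bsub>?M\<^esub> c \<odot>\<^bsub>?M\<^esub> v"
      have cv: "c \<odot>\<^bsub>?M\<^esub> v \<in> cocycles m ?E" using Z.smult_closed[OF _ v(2), of c] by simp
      have yz: "y \<in> cocycles m ?E" unfolding y_def using Z.m_closed[OF u(2) cv] .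
      have ye: "y d = u d + c * v d" if "singular_chain m ?E d" for d using that by (simp add: y_def cochain_module_def)
      have "A \<oplus>\<^bsub>I\<^esub> c \<odot>\<^bsub>I\<^esub> B = cohom_class m ?E y"
        using u v cv by (simp add: I_def invariant_cohomology_def y_def qv)
      moreover have yi: "y \<in> inv_cochains m"
        using yz u(1) v(1) cm_wa by (auto simp: inv_cochains_def cocycles_def ye singular_chain_chain_map)
      moreover have "(\<lambda>s. f s + c * g s) = descend m y"
      proof
        fix x
        show "f x + c * g x = descend m y x"
        proof (cases "x \<in> carrier (homology_group (int m) (Cf {1..N}))")
          case True
          then obtain z where z: "singular_relcycle m (Cf {1..N}) {} z" "x = hcl m (Cf {1..N}) z" by (rule hcl_cases)
          have "singular_chain m ?E (lift m z)" by (rule lift_chain) (use z(1) in \<open>simp add: singular_cycle\<close>)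
          then show ?thesis
            unfolding u(4) v(4) z(2) descend_hcl[OF u(1,2) z(1)] descend_hcl[OF v(1,2) z(1)] descend_hcl[OF yi yz z(1)] by (simp add: ye)
        qed (simp add: u(4) v(4) descend_def)
      qed
      ultimately show ?thesis unfolding T_def using yz by blast
    qed
    show "A = \<zero>\<^bsub>I\<^esub>" if Af: "(A,f) \<in> T" and f0: "\<forall>s\<in>S. f s = 0" for A f
    proof -
      obtain u where u: "u \<in> inv_cochains m" "u \<in> cocycles m ?E" "A = cohom_class m ?E u" "f = descend m u" using Af unfolding T_def by blast
      have "descend m u = (\<lambda>x. 0)" using S(3)[OF descend_hinv[OF u(1,2)]] f0 u(4) by simp
      then have ub: "u \<in> coboundaries m ?E" by (rule descend_eq_0[OF u(1,2)])
      interpret B: submodule rat_field "coboundaries m ?E" "?M\<lparr>carrier := cocycles m ?E\<rparr>" by (rule submodule_coboundaries)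
      interpret C: vectorspace rat_field ?M by (rule vectorspace_cochain_module)
      have sg: "subgroup (coboundaries m ?E) (add_monoid (?M\<lparr>carrier := cocycles m ?E\<rparr>))"
        by (rule submodule_subgroup[OF submodule_coboundaries])
      have "u \<oplus>\<^bsub>?M\<^esub> \<zero>\<^bsub>?M\<^esub> = u" using u(2) Z.subset by (intro C.M.r_zero) blast
      then have "A = cohom_class m ?E \<zero>\<^bsub>?M\<^esub>"
        using cohom_class_eqI[OF Z.zero_closed ub] u(3) by simp
      also have "\<dots> = coboundaries m ?E"
      proof -
        have "coboundaries m ?E \<subseteq> carrier ?M" using coboundaries_subset Z.subset by blast
        then show ?thesis by simp
      qed
      also have "\<dots> = \<zero>\<^bsub>I\<^esub>" by (simp add: I_def invariant_cohomology_def cohomology_def quotient_module_def)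
      finally show ?thesis .
    qed
    show "\<exists>f. (A,f) \<in> T" if A: "A \<in> carrier I" for A
    proof -
      obtain u where "u \<in> inv_cochains m" "u \<in> cocycles m ?E" "A = cohom_class m ?E u"
        by (rule invariant_representative[OF A[unfolded I_def]])
      then show ?thesis unfolding T_def by blast
    qed
  qed
  then show ?thesis using S(2) by linarith
qed

end

section \<open>The punctured sphere\<close>

text \<open>Replaces the sphere of real sequences by one in a three-dimensional Euclidean space,
  where stereographic projection to the complex plane is available.\<close>

lemma nsphere_2: "(nsphere 2) homeomorphic_space (top_of_set (sphere (0::complex \<times> real) 1))"
proof -
  have B: "independent (Basis :: (complex \<times> real) set)" by (rule independent_Basis)
  have "card (Basis :: (complex \<times> real) set) = 3" by simp
  then obtain f :: "(nat \<Rightarrow> real) \<Rightarrow> complex \<times> real" and g where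
    "homeomorphic_maps (nsphere (3 - 1)) (top_of_set (sphere 0 1 \<inter> span Basis)) f g"
    using homeomorphic_maps_nsphere_euclidean_sphere[OF B orthogonal_Basis, of 3] norm_Basis by auto
  then show ?thesis unfolding homeomorphic_space_def span_Basis by auto
qed

text \<open>Stereographic projection from one of the removed points; the other removed points become
  \<open>P\<close>. The presence of at least one puncture enters here.\<close>

lemma punctured_sphere:
  assumes Q: "finite Q" "Q \<noteq> {}" "Q \<subseteq> topspace (nsphere 2)"
  obtains P :: "complex set" where "finite P" "subtopology (nsphere 2) (topspace (nsphere 2) - Q) homeomorphic_space top_of_set (- P)"
proof -
  obtain f g where fg: "homeomorphic_maps (nsphere 2) (top_of_set (sphere (0::complex \<times> real) 1)) f g"
    using nsphere_2 unfolding homeomorphic_space_def by blast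
  have f: "homeomorphic_map (nsphere 2) (top_of_set (sphere (0::complex \<times> real) 1)) f"
    using fg homeomorphic_maps_map by blast
  have fi: "inj_on f (topspace (nsphere 2))" "f ` topspace (nsphere 2) = sphere 0 1"
    using homeomorphic_imp_injective_map[OF f] homeomorphic_imp_surjective_map[OF f] by auto
  obtain q where q: "q \<in> Q" using Q(2) by blast
  then have fq: "f q \<in> sphere 0 1" using fi(2) Q(3) by blast
  have "sphere (0::complex \<times> real) 1 - {f q} homeomorphic (UNIV :: complex set)"
    by (rule homeomorphic_punctured_sphere_affine) (use fq in simp_all)
  then obtain h k where hk: "homeomorphism (sphere (0::complex \<times> real) 1 - {f q}) (UNIV :: complex set) h k"
    unfolding homeomorphic_def by blast
  let ?S = "sphere (0::complex \<times> real) 1 - {f q}"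
  have hi: "inj_on h ?S" "h ` ?S = UNIV" "continuous_on ?S h" using hk unfolding homeomorphism_def by (metis inj_on_inverseI)+
  define P where "P = h ` (f ` Q - {f q})"
  have "subtopology (nsphere 2) (topspace (nsphere 2) - Q) homeomorphic_space subtopology (top_of_set (sphere (0::complex \<times> real) 1)) (sphere 0 1 - f ` Q)"
  proof -
    have "f ` (topspace (nsphere 2) - Q) = sphere 0 1 - f ` Q"
      using inj_on_image_set_diff[OF fi(1), of "topspace (nsphere 2)" Q] Q(3) fi(2) by auto
    then show ?thesis
      using homeomorphic_map_subtopologies[OF f, of "topspace (nsphere 2) - Q" "sphere 0 1 - f ` Q"] homeomorphic_map_imp_homeomorphic_space
      by (metis Diff_subset Int_absorb1 fi(2) topspace_euclidean_subtopology)
  qed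
  also have "subtopology (top_of_set (sphere (0::complex \<times> real) 1)) (sphere 0 1 - f ` Q) = top_of_set (sphere 0 1 - f ` Q)"
    by (simp add: subtopology_subtopology Int_absorb1)
  also have "\<dots> homeomorphic_space top_of_set (- P)"
  proof -
    have sub: "sphere 0 1 - f ` Q \<subseteq> ?S" using q by auto
    have "sphere 0 1 - f ` Q = ?S - (f ` Q - {f q})" using q by auto
    then have "h ` (sphere 0 1 - f ` Q) = h ` ?S - h ` (f ` Q - {f q})"
      using inj_on_image_set_diff[OF hi(1), of ?S "f ` Q - {f q}"] fi(2) Q(3) by auto
    then have "h ` (sphere 0 1 - f ` Q) = - P" by (auto simp: hi(2) P_def)
    then have "homeomorphism (sphere 0 1 - f ` Q) (- P) h k"
      using homeomorphism_of_subsets[OF hk sub, of "- P"] by auto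
    then have "homeomorphic_maps (top_of_set (sphere 0 1 - f ` Q)) (top_of_set (- P)) h k"
      by (auto simp: homeomorphism_def homeomorphic_maps_def continuous_map_in_subtopology)
    then show ?thesis unfolding homeomorphic_space_def by blast
  qed
  finally have "subtopology (nsphere 2) (topspace (nsphere 2) - Q) homeomorphic_space top_of_set (- P)" .
  moreover have "finite P" using Q(1) by (simp add: P_def)
  ultimately show thesis using that by blast
qed

theorem theorem3p3:
  fixes S :: "'a topology" and P :: "'a set" and X :: "'a topology"
    and G :: "('g, 'm) monoid_scheme" and \<phi> :: "'g \<Rightarrow> 'a \<Rightarrow> 'a"
    and Q :: "(nat \<Rightarrow> real) set" and a :: nat
  assumes "closed_surface S" and "finite P" and "P \<subseteq> topspace S"
    and "X = subtopology S (topspace S - P)"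
    and "group G" and "finite (carrier G)" and "free_topological_action G X \<phi>"
    and "finite Q" and "Q \<noteq> {}" and "Q \<subseteq> topspace (nsphere 2)"
    and "orbit_space G X \<phi> homeomorphic_space
           subtopology (nsphere 2) (topspace (nsphere 2) - Q)"
  shows "\<exists>p :: real poly. \<forall>n\<ge>a. \<forall>i.
           vectorspace.fin_dim rat_field
             (invariant_cohomology i (orbit_conf G X \<phi> n)
                (wreath_action \<phi> n ` wreath_subgroup G n a)) \<and>
           real (vectorspace.dim rat_field
             (invariant_cohomology i (orbit_conf G X \<phi> n)
                (wreath_action \<phi> n ` wreath_subgroup G n a))) \<le> poly p (real i)"
proof -
  obtain P' :: "complex set" where P': "finite P'" "subtopology (nsphere 2) (topspace (nsphere 2) - Q) homeomorphic_space top_of_set (- P')"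
    using punctured_sphere[OF assms(8-10)] .
  then have "orbit_space G X \<phi> homeomorphic_space top_of_set (- P')"
    using homeomorphic_space_trans[OF assms(11)] by blast
  then obtain h where h: "homeomorphic_map (orbit_space G X \<phi>) (top_of_set (- P')) h"
    using homeomorphic_space by blast
  \<comment> \<open>Orbits are read as points of the plane, so \<kappa> is a quotient map whose
    fibres are the orbits.\<close>
  define \<kappa> where "\<kappa> = h \<circ> orbit G \<phi>"
  interpret ac: group_action G "topspace X" \<phi> using assms(7) by (simp add: free_topological_action_def)
  interpret free_quotient G X \<phi> \<kappa> P'
  proof
    show "Hausdorff_space X"
      using assms(1,4) by (simp add: closed_surface_def Hausdorff_space_subtopology)
    show "quotient_map X (top_of_set (- P')) \<kappa>"
      unfolding \<kappa>_def by (rule quotient_map_compose[OF quotient_map_orbit_space h[unfolded homeomorphic_map_def, THEN conjunct1]])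
    fix x y assume xy: "x \<in> topspace X" "y \<in> topspace X"
    have o: "orbit G \<phi> x \<in> topspace (orbit_space G X \<phi>)" "orbit G \<phi> y \<in> topspace (orbit_space G X \<phi>)"
      using xy by (auto simp: topspace_orbit_space orbits_def)
    have "\<kappa> x = \<kappa> y \<longleftrightarrow> orbit G \<phi> x = orbit G \<phi> y"
      using homeomorphic_imp_injective_map[OF h] o unfolding \<kappa>_def inj_on_def by auto
    also have "\<dots> \<longleftrightarrow> y \<in> orbit G \<phi> x"
    proof
      assume "orbit G \<phi> x = orbit G \<phi> y" then show "y \<in> orbit G \<phi> x" using ac.orbit_refl[OF xy(2)] by simp
    next
      assume y: "y \<in> orbit G \<phi> x"
      then have x: "x \<in> orbit G \<phi> y" by (rule ac.orbit_sym[OF xy])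
      have cl: "z \<in> topspace X" if "z \<in> orbit G \<phi> w" "w \<in> topspace X" for z w
        using that ac.element_image by (auto simp: orbit_def)
      show "orbit G \<phi> x = orbit G \<phi> y"
      proof
        show "orbit G \<phi> x \<subseteq> orbit G \<phi> y"
          using ac.orbit_trans[OF xy(2,1) _ x] cl xy(1) by blast
        show "orbit G \<phi> y \<subseteq> orbit G \<phi> x"
          using ac.orbit_trans[OF xy _ y] cl xy(2) by blast
      qed
    qed
    also have "\<dots> \<longleftrightarrow> (\<exists>g\<in>carrier G. y = \<phi> g x)" by (auto simp: orbit_def)
    finally show "\<kappa> x = \<kappa> y \<longleftrightarrow> (\<exists>g\<in>carrier G. y = \<phi> g x)" .
  qed (use assms in auto)
  obtain C where C: "\<And>q. sep (hfun q (Conf a)) C" using sep_Conf[OF P'(1), of a] by blast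
  \<comment> \<open>The holes are the \<open>a\<close> base points and the punctures of the plane.
    The polynomial is \<open>2 * C * (X + 1) ^ ?h\<close>, with \<open>C\<close> obtained before
    \<open>n\<close> is fixed.\<close>
  let ?h = "a + card P'"
  let ?p = "Polynomial.smult (real (2 * C)) ([:1,1:] ^ ?h) :: real poly"
  show ?thesis
  proof (intro exI[of _ ?p] allI impI)
    fix n i assume an: "a \<le> n"
    have "\<exists>e. bij_betw e {n+1..n + card P'} P'"
      by (rule finite_same_card_bij) (use P'(1) in simp_all)
    then obtain e where e: "bij_betw e {n+1..n + card P'} P'" ..
    \<comment> \<open>The labels above \<open>n\<close> are reserved for the punctures, one for each
      element of \<open>P'\<close>.\<close>
    interpret orbit_transfer G X \<phi> \<kappa> P' a n "n + card P'" e
      by unfold_locales (use an e in auto)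
    have "sep (hinv (int i) {1..n + card P'}) (2 * C * (i + 1) ^ ?h)"
      by (rule sep_hinv[OF C]) (simp_all only: card_holes finite_atLeastAtMost add_diff_cancel_left')
    from dim_invariant_cohomology[OF this]
    have d: "vectorspace.fin_dim rat_field (invariant_cohomology i (Conf n) (wa ` Wr))"
      "vectorspace.dim rat_field (invariant_cohomology i (Conf n) (wa ` Wr)) \<le> 2 * C * (i + 1) ^ ?h" by auto
    have "poly ?p (real i) = real (2 * C * (i + 1) ^ ?h)" by (simp add: poly_power algebra_simps)
    then show "vectorspace.fin_dim rat_field (invariant_cohomology i (Conf n) (wa ` Wr)) \<and>
      real (vectorspace.dim rat_field (invariant_cohomology i (Conf n) (wa ` Wr))) \<le> poly ?p (real i)"
      using d by (simp only: of_nat_le_iff simp_thms)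
  qed
qed

end
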